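(* Let $\{y_n\}_{n\in\mathbb{N}}$ be a positive nonincreasing sequence and let $B_1$ here denote the Blaschke product with zeros $z_n=n+iy_n$, $n\in\mathbb{N}$. 1. If $\sum_{n\in\mathbb{N}}n^{-3/2}\log(1/y_n)<\infty$, then every even majorant $w>0$ that is nonincreasing on $[0,\infty)$ and satisfies $\int_1^\infty t^{-3/2}\log(1/w(t))\,dt<\infty$ belongs to $\mathrm{Adm}(B_1)$. 2. Let $y:[0,\infty)\to(0,\infty)$ be nonincreasing with $y(n)=y_n$, $n\in\mathbb{N}$, and $Y=-\log y$. If $x\mapsto Y(e^x)$ is convex on $\mathbb{R}$ and $\sum_{n\in\mathbb{N}}n^{-3/2}\log(1/y_n)=\infty$, then no majorant $w$ with $w(t)=o(|t|^{-N})$ as $|t|\to\infty$ for every $N>0$ belongs to $\mathrm{Adm}(B_1)$.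
   Context: $H^2$ is the Hardy space of $\mathbb{C}^+$, $K_B=H^2\ominus BH^2$; $w\in\mathrm{Adm}(B)$ means there is a nonzero $f\in K_B$ with $|f(x)|\le w(x)$ for a.e. $x\in\mathbb{R}$. *)

theory Defs
  imports "HOL-Complex_Analysis.Complex_Analysis" "HOL-Library.Landau_Symbols"
begin

definition upper_half :: "complex set" where
  "upper_half = {z. Im z > 0}"

definition hardy2 :: "(complex \<Rightarrow> complex) set" where
  "hardy2 = {f. f holomorphic_on upper_half \<and>
     (\<exists>C::real. \<forall>y>0. (\<integral>\<^sup>+ x. ennreal ((cmod (f (Complex x y)))\<^sup>2) \<partial>lborel) \<le> ennreal C)}"

text \<open>Boundary values on the real line (vertical limit; exists a.e. for H^2 functions).\<close>
definition hardy_bv :: "(complex \<Rightarrow> complex) \<Rightarrow> real \<Rightarrow> complex" where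
  "hardy_bv f x = Lim (at_right 0) (\<lambda>y. f (Complex x y))"

definition l2_inner :: "(real \<Rightarrow> complex) \<Rightarrow> (real \<Rightarrow> complex) \<Rightarrow> complex" where
  "l2_inner f g = (\<integral> x. f x * cnj (g x) \<partial>lborel)"

definition model_space :: "(complex \<Rightarrow> complex) \<Rightarrow> (complex \<Rightarrow> complex) set" where
  "model_space B = {f \<in> hardy2. \<forall>h \<in> hardy2.
      l2_inner (hardy_bv f) (hardy_bv (\<lambda>z. B z * h z)) = 0}"

definition Adm :: "(complex \<Rightarrow> complex) \<Rightarrow> (real \<Rightarrow> real) set" where
  "Adm B = {w. \<exists>f \<in> model_space B. (\<exists>z \<in> upper_half. f z \<noteq> 0) \<and>
       (AE x in lborel. cmod (hardy_bv f x) \<le> w x)}"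

text \<open>Blaschke factor for the upper half-plane with zero a (normalized to be positive at i).\<close>
definition blaschke_factor :: "complex \<Rightarrow> complex \<Rightarrow> complex" where
  "blaschke_factor a z = (complex_of_real (cmod (a\<^sup>2 + 1)) / (a\<^sup>2 + 1)) * ((z - a) / (z - cnj a))"

definition blaschke :: "(nat \<Rightarrow> complex) \<Rightarrow> complex \<Rightarrow> complex" where
  "blaschke zs z = prodinf (\<lambda>n. blaschke_factor (zs n) z)"

definition B1 :: "(nat \<Rightarrow> real) \<Rightarrow> complex \<Rightarrow> complex" where
  "B1 y = blaschke (\<lambda>k. Complex (real (Suc k)) (y (Suc k)))"

end

theory Submission
  imports Defs
begin

text \<open>For the first part, a function \<open>1 / E\<close> with \<open>E z = (\<Prod>k. 1 - z / cnj (a (m k)))\<close> built on a sparse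
  subsequence of the zeros lies in the model space. The real parts \<open>l k = q\<^sub>k (k + 1)\<^sup>2\<close> of the chosen zeros
  resemble those of a cosine of a square root; letting the bounded integer \<open>q\<^sub>k\<close> grow slowly makes
  \<open>\<bar>E\<bar>\<close> dominate \<open>1 / w\<close> on the real line, at a total cost measured by the two convergent integrals.

  For the second part, every \<open>f\<close> in the model space is a series \<open>\<Sum>n. c n / (z - cnj (a n))\<close> with
  \<open>c n = O(sqrt (y n))\<close>. Fast decay on the negative half-axis makes all moments \<open>\<Sum>n. c n * cnj (a n) ^ k\<close>
  vanish, so \<open>f\<close> decays away from the poles like every \<open>\<bar>z\<bar> ^ (- k)\<close> with explicit constants, and
  optimising in \<open>k\<close> (Legendre duality for the convex weight) gives \<open>f z = O(yf \<bar>z\<bar> powr (1/4))\<close> up to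
  rescaling \<open>z\<close>. After the substitution \<open>z = - (b + \<zeta>)\<^sup>2\<close> the divergence of the series becomes divergence of
  the logarithmic integral in a half-plane, which forces \<open>f = 0\<close>.\<close>

section \<open>Line integrals in the half-plane\<close>

text \<open>Both statements turn on one change of scale. If the zeros have size \<open>k^2\<close>,
  the cost at the \<open>K\<close>-th of them is a value of \<open>L\<close> at about
  \<open>K^2\<close>. A relative shift of size \<open>L(K^2) / K^2\<close> in each of about
  \<open>K/2\<close> steps acts on about \<open>K/2\<close> earlier zeros and so pays for that cost;
  the shifts have a finite total because \<open>\<Sum> L(k^2) / k^2\<close> is controlled by
  \<open>\<Sum> n^(-3/2) L(n)\<close>. Conversely, a square substitution turns the half-plane test
  \<open>\<Sum> V(2^k) / 2^k\<close> with \<open>V(s) = Y(s^2)\<close> back into a series with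
  weight \<open>n^(-3/2)\<close>. The model space is given by orthogonality of vertical limits. Both
  halves therefore rest on the existence of these limits, almost everywhere and in L^2, and on one
  fact: the product of the boundary values of two Hardy functions has integral 0. It yields
  membership of \<open>1 / E\<close> because on the real line the Blaschke product of the chosen
  zeros is a constant times \<open>cnj E / E\<close>. The crude coefficient bound and the rounding
  of exponents only replace the weight by its fourth root, which multiplies its logarithm by a
  constant and so preserves divergence.\<close>

lemma continuous_on_Complex_line [continuous_intros]:
  "continuous_on A f \<Longrightarrow> continuous_on A g \<Longrightarrow> continuous_on A (\<lambda>x. Complex (f x) (g x))"
  unfolding Complex_eq by (intro continuous_intros)

lemma measurable_Complex [measurable (raw)]:
  assumes [measurable]: "f \<in> borel_measurable M" "g \<in> borel_measurable M"
  shows "(\<lambda>x. Complex (f x) (g x)) \<in> borel_measurable M"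
  unfolding Complex_eq by measurable

lemma norm_integral_le_nn_integral:
  fixes f :: "'a \<Rightarrow> complex"
  shows "ennreal (cmod (\<integral>x. f x \<partial>M)) \<le> (\<integral>\<^sup>+x. ennreal (cmod (f x)) \<partial>M)"
  by (cases "integrable M f") (auto intro: integral_norm_bound_ennreal simp: not_integrable_integral_eq)

lemma strip_vector_derivative:
  assumes "(\<Phi> has_field_derivative \<phi> (Complex x y)) (at (Complex x y))"
  shows "((\<lambda>t. \<Phi> (Complex t y)) has_vector_derivative \<phi> (Complex x y)) (at x within A)"
    and "((\<lambda>t. \<Phi> (Complex x t)) has_vector_derivative \<i> * \<phi> (Complex x y)) (at y within A)"
proof -
  have 1: "((\<lambda>t. Complex t y) has_vector_derivative 1) (at x within A)"
    unfolding Complex_eq by (auto intro!: derivative_eq_intros)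
  have 2: "((\<lambda>t. Complex x t) has_vector_derivative \<i>) (at y within A)"
    unfolding Complex_eq by (auto intro!: derivative_eq_intros)
  show "((\<lambda>t. \<Phi> (Complex t y)) has_vector_derivative \<phi> (Complex x y)) (at x within A)"
    using field_vector_diff_chain_within[OF 1, of \<Phi> "\<phi> (Complex x y)"] assms
    by (simp add: o_def DERIV_subset)
  show "((\<lambda>t. \<Phi> (Complex x t)) has_vector_derivative \<i> * \<phi> (Complex x y)) (at y within A)"
    using field_vector_diff_chain_within[OF 2, of \<Phi> "\<phi> (Complex x y)"] assms
    by (simp add: o_def DERIV_subset)
qed

text \<open>No pointwise decay of \<open>\<phi>\<close> towards infinity is available, so the
  vertical sides of the rectangle with abscissae \<open>-R\<close> and \<open>R\<close> are
  controlled only on average: by Fubini their contributions \<open>V R\<close> have a finite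
  integral over \<open>R\<close>, hence cannot stay above a positive constant for all large
  \<open>R\<close>. That contradicts two horizontal integrals at distance
  \<open>d > 0\<close>.\<close>

lemma strip_integral_const:
  assumes hol: "\<phi> holomorphic_on {z. a < Im z \<and> Im z < b}"
    and bd: "\<And>y. a < y \<Longrightarrow> y < b \<Longrightarrow> (\<integral>\<^sup>+x. ennreal (cmod (\<phi> (Complex x y))) \<partial>lborel) \<le> ennreal C"
    and y: "a < y1" "y1 \<le> y2" "y2 < b"
  shows "(\<integral>x. \<phi> (Complex x y1) \<partial>lborel) = (\<integral>x. \<phi> (Complex x y2) \<partial>lborel)"
proof (rule ccontr)
  define S where "S = {z. a < Im z \<and> Im z < b}"
  have S_eq: "S = {z. Im z > a} \<inter> {z. Im z < b}" by (auto simp: S_def)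
  have oS: "open S" unfolding S_eq by (intro open_Int open_halfspace_Im_gt open_halfspace_Im_lt)
  have cS: "convex S" unfolding S_eq by (intro convex_Int convex_halfspace_Im_gt convex_halfspace_Im_lt)
  obtain \<Phi> where \<Phi>0: "\<And>z. z \<in> S \<Longrightarrow> (\<Phi> has_field_derivative \<phi> z) (at z within S)"
    using holomorphic_convex_primitive'[OF cS oS hol[folded S_def]] by blast
  have \<Phi>: "(\<Phi> has_field_derivative \<phi> z) (at z)" if "z \<in> S" for z
    using \<Phi>0[OF that] at_within_open[OF that oS] by simp
  have cont: "continuous_on S \<phi>" using hol holomorphic_on_imp_continuous_on S_def by blast
  have inS: "Complex x y \<in> S" if "a < y" "y < b" for x y using that by (simp add: S_def)
  have contx: "continuous_on A (\<lambda>x. \<phi> (Complex x y))" if "a < y" "y < b" for y A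
    by (rule continuous_on_compose2[OF cont]) (auto intro!: continuous_intros inS that)
  have conty: "continuous_on {y1..y2} (\<lambda>y. \<phi> (Complex x y))" for x
    by (rule continuous_on_compose2[OF cont]) (use y in \<open>auto intro!: continuous_intros inS\<close>)
  have meas[measurable]: "(\<lambda>x. \<phi> (Complex x y)) \<in> borel_measurable borel" if "a < y" "y < b" for y
    using contx[OF that] by (rule borel_measurable_continuous_onI)
  have int: "integrable lborel (\<lambda>x. \<phi> (Complex x y))" if "a < y" "y < b" for y
    unfolding integrable_iff_bounded using bd[OF that] meas[OF that]
    by (auto simp: le_less_trans)
  have J: "(\<integral>x. indicator {-R..R} x *\<^sub>R \<phi> (Complex x y) \<partial>lborel) = \<Phi> (Complex R y) - \<Phi> (Complex (-R) y)"
    if "a < y" "y < b" "R \<ge> 0" for y R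
    by (rule integral_FTC_Icc[of "-R" R "\<lambda>x. \<Phi> (Complex x y)"])
      (use that in \<open>auto intro!: strip_vector_derivative \<Phi> inS contx\<close>)
  have Jlim: "((\<lambda>R. \<integral>x. indicator {-R..R} x *\<^sub>R \<phi> (Complex x y) \<partial>lborel) \<longlongrightarrow> (\<integral>x. \<phi> (Complex x y) \<partial>lborel)) at_top"
    if "a < y" "y < b" for y
  proof (rule integral_dominated_convergence_at_top[where w="\<lambda>x. norm (\<phi> (Complex x y))"])
    show "AE x in lborel. ((\<lambda>R. indicator {-R..R} x *\<^sub>R \<phi> (Complex x y)) \<longlongrightarrow> \<phi> (Complex x y)) at_top"
    proof (rule AE_I2)
      fix x :: real
      have "eventually (\<lambda>R. R \<ge> \<bar>x\<bar>) at_top" by (rule eventually_ge_at_top)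
      then have "eventually (\<lambda>R. indicator {-R..R} x *\<^sub>R \<phi> (Complex x y) = \<phi> (Complex x y)) at_top"
        by eventually_elim (auto simp: indicator_def)
      then show "((\<lambda>R. indicator {-R..R} x *\<^sub>R \<phi> (Complex x y)) \<longlongrightarrow> \<phi> (Complex x y)) at_top"
        by (rule tendsto_eventually)
    qed
  qed (use that in \<open>auto intro!: meas integrable_norm int always_eventually simp: indicator_def\<close>)
  \<comment> \<open>Extension by 0 outside the strip gives a Borel function on the whole plane, to
    which Fubini applies.\<close>
  define \<psi> where "\<psi> = (\<lambda>z. indicator S z *\<^sub>R \<phi> z)"
  have \<psi>m[measurable]: "\<psi> \<in> borel_measurable borel"
    unfolding \<psi>_def using oS cont by (intro borel_measurable_continuous_on_indicator) auto
  define V where "V = (\<lambda>R. \<integral>\<^sup>+y. indicator {y1..y2} y * ennreal (cmod (\<psi> (Complex R y))) \<partial>lborel)"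
  have vert: "ennreal (cmod (\<Phi> (Complex R y2) - \<Phi> (Complex R y1))) \<le> V R" for R
  proof -
    have "(\<integral>y. indicator {y1..y2} y *\<^sub>R (\<i> * \<phi> (Complex R y)) \<partial>lborel) = \<Phi> (Complex R y2) - \<Phi> (Complex R y1)"
      by (rule integral_FTC_Icc[of y1 y2 "\<lambda>y. \<Phi> (Complex R y)"])
        (use y in \<open>auto intro!: strip_vector_derivative \<Phi> inS continuous_intros conty\<close>)
    then have "ennreal (cmod (\<Phi> (Complex R y2) - \<Phi> (Complex R y1)))
       \<le> (\<integral>\<^sup>+y. ennreal (norm (indicator {y1..y2} y *\<^sub>R (\<i> * \<phi> (Complex R y)))) \<partial>lborel)"
      using norm_integral_le_nn_integral[of lborel "\<lambda>y. indicator {y1..y2} y *\<^sub>R (\<i> * \<phi> (Complex R y))"]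
      by simp
    also have "\<dots> = V R" unfolding V_def
      by (intro nn_integral_cong) (use y in \<open>auto simp: indicator_def \<psi>_def norm_mult intro!: inS\<close>)
    finally show ?thesis .
  qed
  have Vm[measurable]: "V \<in> borel_measurable borel" unfolding V_def by measurable
  have V_int: "(\<integral>\<^sup>+R. V R \<partial>lborel) < \<infinity>"
  proof -
    have "(\<integral>\<^sup>+R. V R \<partial>lborel) = (\<integral>\<^sup>+y. (\<integral>\<^sup>+R. indicator {y1..y2} y * ennreal (cmod (\<psi> (Complex R y))) \<partial>lborel) \<partial>lborel)"
      unfolding V_def by (rule lborel_pair.Fubini'[symmetric]) measurable
    also have "\<dots> = (\<integral>\<^sup>+y. indicator {y1..y2} y * (\<integral>\<^sup>+R. ennreal (cmod (\<psi> (Complex R y))) \<partial>lborel) \<partial>lborel)"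
      by (intro nn_integral_cong nn_integral_cmult) measurable
    also have "\<dots> \<le> (\<integral>\<^sup>+y. ennreal C * indicator {y1..y2} y \<partial>lborel)"
    proof (intro nn_integral_mono)
      fix t
      show "indicator {y1..y2} t * (\<integral>\<^sup>+R. ennreal (cmod (\<psi> (Complex R t))) \<partial>lborel) \<le> ennreal C * indicator {y1..y2} t"
      proof (cases "t \<in> {y1..y2}")
        case True
        then have "a < t" "t < b" using y by auto
        then show ?thesis using bd[of t] True by (auto simp: \<psi>_def S_def)
      qed auto
    qed
    also have "\<dots> < \<infinity>" using y by (simp add: nn_integral_cmult_indicator ennreal_mult_less_top)
    finally show ?thesis .
  qed
  have V_int': "(\<integral>\<^sup>+R. V (-R) \<partial>lborel) < \<infinity>"
    using nn_integral_real_affine[of V "-1" 0] V_int by simp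
  assume neq: "(\<integral>x. \<phi> (Complex x y1) \<partial>lborel) \<noteq> (\<integral>x. \<phi> (Complex x y2) \<partial>lborel)"
  define d where "d = cmod ((\<integral>x. \<phi> (Complex x y2) \<partial>lborel) - (\<integral>x. \<phi> (Complex x y1) \<partial>lborel))"
  have d: "d > 0" using neq by (simp add: d_def)
  have yy: "a < y1" "y1 < b" "a < y2" "y2 < b" using y by auto
  have "((\<lambda>R. cmod ((\<integral>x. indicator {-R..R} x *\<^sub>R \<phi> (Complex x y2) \<partial>lborel)
         - (\<integral>x. indicator {-R..R} x *\<^sub>R \<phi> (Complex x y1) \<partial>lborel))) \<longlongrightarrow> d) at_top"
    unfolding d_def by (intro tendsto_intros Jlim yy)
  then have "\<forall>\<^sub>F R in at_top. cmod ((\<integral>x. indicator {-R..R} x *\<^sub>R \<phi> (Complex x y2) \<partial>lborel)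
         - (\<integral>x. indicator {-R..R} x *\<^sub>R \<phi> (Complex x y1) \<partial>lborel)) > d/2"
    using d by (intro order_tendstoD) auto
  with eventually_ge_at_top[of 0]
  have "\<forall>\<^sub>F R in at_top. ennreal (d/2) \<le> V R + V (-R)"
  proof eventually_elim
    case (elim R)
    have "d/2 \<le> cmod ((\<Phi> (Complex R y2) - \<Phi> (Complex R y1)) - (\<Phi> (Complex (-R) y2) - \<Phi> (Complex (-R) y1)))"
      using elim J[OF yy(1,2), of R] J[OF yy(3,4), of R] by (simp add: algebra_simps)
    also have "\<dots> \<le> cmod (\<Phi> (Complex R y2) - \<Phi> (Complex R y1)) + cmod (\<Phi> (Complex (-R) y2) - \<Phi> (Complex (-R) y1))"
      by (rule norm_triangle_ineq4)
    finally have "ennreal (d/2) \<le> ennreal (cmod (\<Phi> (Complex R y2) - \<Phi> (Complex R y1))) + ennreal (cmod (\<Phi> (Complex (-R) y2) - \<Phi> (Complex (-R) y1)))"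
      by (metis ennreal_leI ennreal_plus norm_ge_zero)
    also have "\<dots> \<le> V R + V (-R)" by (intro add_mono vert)
    finally show ?case .
  qed
  then obtain R0 where R0: "\<And>R. R \<ge> R0 \<Longrightarrow> ennreal (d/2) \<le> V R + V (-R)"
    by (auto simp: eventually_at_top_linorder)
  have "(\<integral>\<^sup>+R. ennreal (d/2) * indicator {R0..} R \<partial>lborel) \<le> (\<integral>\<^sup>+R. V R + V (-R) \<partial>lborel)"
    by (intro nn_integral_mono) (auto simp: indicator_def R0)
  also have "\<dots> = (\<integral>\<^sup>+R. V R \<partial>lborel) + (\<integral>\<^sup>+R. V (-R) \<partial>lborel)"
    by (intro nn_integral_add) measurable
  also have "\<dots> < \<infinity>" using V_int V_int' by simp
  finally have fin: "(\<integral>\<^sup>+R. ennreal (d/2) * indicator {R0..} R \<partial>lborel) < \<infinity>" .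
  have "emeasure lborel {R0..} = (\<infinity>::ennreal)"
  proof -
    have "ennreal (real n) \<le> emeasure lborel {R0..}" for n :: nat
    proof -
      have "emeasure lborel {R0..R0 + real n} \<le> emeasure lborel {R0..}"
        by (intro emeasure_mono) auto
      then show ?thesis by simp
    qed
    then have "\<forall>n. ennreal (real n) \<le> emeasure lborel {R0..}" by simp
    then show ?thesis
      by (metis ennreal_of_nat_eq_real_of_nat infinity_ennreal_def ennreal_Ex_less_of_nat less_top not_less)
  qed
  then show False using fin d by (simp add: nn_integral_cmult_indicator ennreal_mult_eq_top_iff)
qed

text \<open>The factor \<open>exp (\<i> s z)\<close> with \<open>s > 0\<close> decays upwards, so
  lifting the line to infinity kills the damped integral; dominated convergence along
  \<open>s = 1 / (n + 1)\<close> then removes the damping.\<close>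

lemma halfplane_integral_zero:
  assumes hol: "\<phi> holomorphic_on {z. a < Im z}"
    and bd: "\<And>y. a < y \<Longrightarrow> (\<integral>\<^sup>+x. ennreal (cmod (\<phi> (Complex x y))) \<partial>lborel) \<le> ennreal C"
    and y: "a < y"
  shows "(\<integral>x. \<phi> (Complex x y) \<partial>lborel) = 0"
proof -
  have cont: "continuous_on {z. a < Im z} \<phi>" using hol holomorphic_on_imp_continuous_on by blast
  have contx: "continuous_on A (\<lambda>x. \<phi> (Complex x y))" if "a < y" for y A
    by (rule continuous_on_compose2[OF cont]) (auto intro!: continuous_intros that)
  have meas: "(\<lambda>x. \<phi> (Complex x y)) \<in> borel_measurable borel" if "a < y" for y
    using contx[OF that] by (rule borel_measurable_continuous_onI)
  have int: "integrable lborel (\<lambda>x. \<phi> (Complex x y))" if "a < y" for y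
    unfolding integrable_iff_bounded using bd[OF that] meas[OF that]
    by (auto simp: le_less_trans)
  define G where "G = (\<lambda>s z. \<phi> z * exp (\<i> * of_real s * z))"
  have nG: "cmod (G s (Complex x t)) = cmod (\<phi> (Complex x t)) * exp (- (s * t))" for s x t
    by (simp add: G_def norm_mult)
  have Gm: "(\<lambda>x. G s (Complex x t)) \<in> borel_measurable borel" if "a < t" for s t
    unfolding G_def using meas[OF that] by measurable
  have Gbd: "(\<integral>\<^sup>+x. ennreal (cmod (G s (Complex x t))) \<partial>lborel) \<le> ennreal (max C 0 * exp (-(s*t)))" if "a < t" for s t
  proof -
    have [measurable]: "(\<lambda>x. \<phi> (Complex x t)) \<in> borel_measurable borel"
      by (rule meas[OF that])
    have "(\<integral>\<^sup>+x. ennreal (cmod (G s (Complex x t))) \<partial>lborel)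
       = (\<integral>\<^sup>+x. ennreal (cmod (\<phi> (Complex x t))) * ennreal (exp (- (s * t))) \<partial>lborel)"
      by (simp add: nG ennreal_mult)
    also have "\<dots> = (\<integral>\<^sup>+x. ennreal (cmod (\<phi> (Complex x t))) \<partial>lborel) * ennreal (exp (- (s * t)))"
      by (rule nn_integral_multc) measurable
    also have "\<dots> \<le> ennreal (max C 0) * ennreal (exp (- (s * t)))"
      by (intro mult_right_mono order.trans[OF bd[OF that]] ennreal_leI) auto
    finally show ?thesis by (simp add: ennreal_mult)
  qed
  have G0: "(\<integral>x. G s (Complex x y) \<partial>lborel) = 0" if s: "s > 0" for s
  proof -
    have hG: "G s holomorphic_on {z. a < Im z}" unfolding G_def
      by (intro holomorphic_intros hol)
    have le: "cmod (\<integral>x. G s (Complex x y) \<partial>lborel) \<le> max C 0 * exp (-(s*t))" if t: "t > y" for t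
    proof -
      have eq: "(\<integral>x. G s (Complex x y) \<partial>lborel) = (\<integral>x. G s (Complex x t) \<partial>lborel)"
      proof (rule strip_integral_const[where a=a and b="t+1" and C="max C 0 * exp (-(s*a))"])
        fix u assume "a < u" "u < t + 1"
        show "(\<integral>\<^sup>+x. ennreal (cmod (G s (Complex x u))) \<partial>lborel) \<le> ennreal (max C 0 * exp (-(s*a)))"
          by (rule order.trans[OF Gbd[OF \<open>a < u\<close>]])
            (use \<open>a < u\<close> s in \<open>auto intro!: ennreal_leI mult_left_mono\<close>)
      qed (use y t in \<open>auto intro!: holomorphic_on_subset[OF hG]\<close>)
      have at: "a < t" using y t by simp
      have "ennreal (cmod (\<integral>x. G s (Complex x t) \<partial>lborel)) \<le> (\<integral>\<^sup>+x. ennreal (cmod (G s (Complex x t))) \<partial>lborel)"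
        by (rule norm_integral_le_nn_integral)
      also note Gbd[OF at]
      finally show ?thesis unfolding eq by (subst (asm) ennreal_le_iff) auto
    qed
    have "((\<lambda>t. max C 0 * exp (-(s*t))) \<longlongrightarrow> max C 0 * 0) at_top"
      by (intro tendsto_mult tendsto_const filterlim_compose[OF exp_at_bot])
        (auto intro!: filterlim_tendsto_pos_mult_at_top[OF tendsto_const] s filterlim_ident simp: filterlim_uminus_at_bot)
    moreover have "\<forall>\<^sub>F t in at_top. cmod (\<integral>x. G s (Complex x y) \<partial>lborel) \<le> max C 0 * exp (-(s*t))"
      using eventually_gt_at_top[of y] by eventually_elim (rule le)
    ultimately have "cmod (\<integral>x. G s (Complex x y) \<partial>lborel) \<le> max C 0 * 0"
      by (intro tendsto_lowerbound) auto
    then show ?thesis by simp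
  qed
  have "(\<lambda>n. \<integral>x. G (1 / Suc n) (Complex x y) \<partial>lborel) \<longlonglongrightarrow> (\<integral>x. \<phi> (Complex x y) \<partial>lborel)"
  proof (rule integral_dominated_convergence[where w="\<lambda>x. exp \<bar>y\<bar> * norm (\<phi> (Complex x y))"])
    show "AE x in lborel. (\<lambda>n. G (1 / Suc n) (Complex x y)) \<longlonglongrightarrow> \<phi> (Complex x y)"
    proof (rule AE_I2)
      fix x
      have "(\<lambda>n. \<phi> (Complex x y) * exp (\<i> * of_real (1 / Suc n) * Complex x y)) \<longlonglongrightarrow> \<phi> (Complex x y) * exp (\<i> * of_real 0 * Complex x y)"
        by (intro tendsto_intros LIMSEQ_Suc[OF lim_1_over_n])
      then show "(\<lambda>n. G (1 / Suc n) (Complex x y)) \<longlonglongrightarrow> \<phi> (Complex x y)" by (simp add: G_def)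
    qed
    show "AE x in lborel. cmod (G (1 / Suc n) (Complex x y)) \<le> exp \<bar>y\<bar> * norm (\<phi> (Complex x y))" for n
    proof (rule AE_I2)
      fix x
      have "\<bar>1 / Suc n * y\<bar> \<le> \<bar>y\<bar>" by (simp add: abs_mult field_simps)
      then have "exp (-(1 / Suc n * y)) \<le> exp \<bar>y\<bar>" unfolding exp_le_cancel_iff by linarith
      then show "cmod (G (1 / Suc n) (Complex x y)) \<le> exp \<bar>y\<bar> * norm (\<phi> (Complex x y))"
        unfolding nG by (subst mult.commute) (rule mult_right_mono, simp_all only: norm_ge_zero)
    qed
  qed (use y in \<open>auto intro!: meas Gm int integrable_norm\<close>)
  moreover have "(\<lambda>n. \<integral>x. G (1 / Suc n) (Complex x y) \<partial>lborel) = (\<lambda>n. 0)" by (intro ext G0) simp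
  ultimately show ?thesis by (metis LIMSEQ_unique tendsto_const)
qed

section \<open>The Poisson representation in the Hardy space\<close>

lemma upper_half_iff: "z \<in> upper_half \<longleftrightarrow> Im z > 0"
  by (simp add: upper_half_def)

lemma open_upper_half: "open upper_half"
  unfolding upper_half_def by (rule open_halfspace_Im_gt)

lemma convex_upper_half: "convex upper_half"
  unfolding upper_half_def by (rule convex_halfspace_Im_gt)

lemma hardy2_holomorphic: "h \<in> hardy2 \<Longrightarrow> h holomorphic_on upper_half"
  by (simp add: hardy2_def)

lemma hardy2_bound:
  assumes "h \<in> hardy2"
  obtains C where "C \<ge> 0"
    "\<And>y. y > 0 \<Longrightarrow> (\<integral>\<^sup>+ x. ennreal ((cmod (h (Complex x y)))\<^sup>2) \<partial>lborel) \<le> ennreal C"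
proof -
  obtain C where "\<forall>y>0. (\<integral>\<^sup>+ x. ennreal ((cmod (h (Complex x y)))\<^sup>2) \<partial>lborel) \<le> ennreal C"
    using assms by (auto simp: hardy2_def)
  then have "\<And>y. y > 0 \<Longrightarrow> (\<integral>\<^sup>+ x. ennreal ((cmod (h (Complex x y)))\<^sup>2) \<partial>lborel) \<le> ennreal (max C 0)"
    by (meson ennreal_leI max.cobounded1 order.trans)
  then show ?thesis by (intro that[of "max C 0"]) auto
qed

lemma hardy2_continuous_line:
  assumes "h holomorphic_on upper_half" "y > 0"
  shows "continuous_on A (\<lambda>x. h (Complex x y))"
  by (rule continuous_on_compose2[OF holomorphic_on_imp_continuous_on[OF assms(1)]])
    (auto intro!: continuous_intros simp: upper_half_iff assms)

lemma hardy2_measurable_line: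
  assumes "h holomorphic_on upper_half" "y > 0"
  shows "(\<lambda>x. h (Complex x y)) \<in> borel_measurable borel"
  using hardy2_continuous_line[OF assms] by (rule borel_measurable_continuous_onI)

lemma hardy2_square_integrable:
  assumes "h \<in> hardy2" "y > 0"
  shows "integrable lborel (\<lambda>x. (cmod (h (Complex x y)))\<^sup>2)"
proof -
  have [measurable]: "(\<lambda>x. h (Complex x y)) \<in> borel_measurable borel"
    using assms by (intro hardy2_measurable_line hardy2_holomorphic)
  obtain C where "(\<integral>\<^sup>+ x. ennreal ((cmod (h (Complex x y)))\<^sup>2) \<partial>lborel) \<le> ennreal C"
    using hardy2_bound[OF assms(1)] assms(2) by metis
  then show ?thesis
    by (intro integrableI_bounded) (auto intro: le_less_trans)
qed

lemma integrable_mult_L2: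
  fixes u v :: "real \<Rightarrow> complex"
  assumes [measurable]: "u \<in> borel_measurable lborel" "v \<in> borel_measurable lborel"
    and "integrable lborel (\<lambda>x. (cmod (u x))\<^sup>2)" "integrable lborel (\<lambda>x. (cmod (v x))\<^sup>2)"
  shows "integrable lborel (\<lambda>x. u x * v x)"
proof (rule Bochner_Integration.integrable_bound)
  show "integrable lborel (\<lambda>x. (cmod (u x))\<^sup>2 + (cmod (v x))\<^sup>2)"
    using assms by auto
  show "AE x in lborel. norm (u x * v x) \<le> norm ((cmod (u x))\<^sup>2 + (cmod (v x))\<^sup>2)"
  proof (rule AE_I2)
    fix x
    have "2 * cmod (u x) * cmod (v x) \<le> (cmod (u x))\<^sup>2 + (cmod (v x))\<^sup>2"
      by (rule sum_squares_bound)
    moreover have "0 \<le> cmod (u x) * cmod (v x)" by simp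
    ultimately show "norm (u x * v x) \<le> norm ((cmod (u x))\<^sup>2 + (cmod (v x))\<^sup>2)"
      unfolding norm_mult real_norm_def by linarith
  qed
qed measurable

lemma nn_integral_inverse_square:
  assumes c: "c > (0::real)"
  shows "(\<integral>\<^sup>+x. ennreal (1 / ((x - a)\<^sup>2 + c\<^sup>2)) \<partial>lborel) = ennreal (pi / c)"
proof -
  have half: "(\<integral>\<^sup>+x. ennreal (1 / ((x - a)\<^sup>2 + c\<^sup>2)) * indicator {a..} x \<partial>lborel) = ennreal (pi / (2 * c))" for a
  proof -
    have "(\<integral>\<^sup>+x. ennreal (1 / ((x - a)\<^sup>2 + c\<^sup>2)) * indicator {a..} x \<partial>lborel)
      = ennreal (pi / (2 * c)) - ennreal (arctan ((a - a) / c) / c)"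
    proof (subst ennreal_minus, simp, rule nn_integral_FTC_atLeast[where F="\<lambda>x. arctan ((x - a) / c) / c"])
      show "((\<lambda>x. arctan ((x - a) / c) / c) \<longlongrightarrow> pi / (2 * c)) at_top"
      proof -
        have "filterlim (\<lambda>x. (x - a) * (1/c)) at_top at_top"
          using c filterlim_at_top_mult_tendsto_pos[of "\<lambda>_. 1/c" "1/c" at_top "\<lambda>x. x - a"]
            filterlim_tendsto_add_at_top[OF tendsto_const[of "-a"] filterlim_ident]
          by simp
        then have "((\<lambda>x. arctan ((x - a) / c)) \<longlongrightarrow> pi / 2) at_top"
          using filterlim_compose[OF tendsto_arctan_at_top] by simp
        from tendsto_divide[OF this tendsto_const[of c]] c show ?thesis by simp
      qed
      fix x
      show "DERIV (\<lambda>x. arctan ((x - a) / c) / c) x :> 1 / ((x - a)\<^sup>2 + c\<^sup>2)"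
      proof -
        have 1: "1 + ((x - a) / c)\<^sup>2 = ((x - a)\<^sup>2 + c\<^sup>2) / c\<^sup>2"
          using c by (simp add: power_divide add_divide_distrib)
        have "DERIV (\<lambda>x. arctan ((x - a) / c) / c) x :> inverse (1 + ((x - a) / c)\<^sup>2) * (1 / c) / c"
          using c by (auto intro!: derivative_eq_intros)
        also have "inverse (1 + ((x - a) / c)\<^sup>2) * (1 / c) / c = 1 / ((x - a)\<^sup>2 + c\<^sup>2)"
          unfolding 1 using c by (simp add: power2_eq_square)
        finally show ?thesis .
      qed
    qed (auto intro!: borel_measurable_divide)
    then show ?thesis by simp
  qed
  have "(\<integral>\<^sup>+x. ennreal (1 / ((x - a)\<^sup>2 + c\<^sup>2)) \<partial>lborel)
      = (\<integral>\<^sup>+x. ennreal (1 / ((x - a)\<^sup>2 + c\<^sup>2)) * indicator {a..} x + ennreal (1 / ((x - a)\<^sup>2 + c\<^sup>2)) * indicator {..<a} x \<partial>lborel)"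
    by (intro nn_integral_cong) (auto simp: indicator_def)
  also have "\<dots> = (\<integral>\<^sup>+x. ennreal (1 / ((x - a)\<^sup>2 + c\<^sup>2)) * indicator {a..} x \<partial>lborel)
      + (\<integral>\<^sup>+x. ennreal (1 / ((x - a)\<^sup>2 + c\<^sup>2)) * indicator {..<a} x \<partial>lborel)"
    by (intro nn_integral_add) measurable
  also have "(\<integral>\<^sup>+x. ennreal (1 / ((x - a)\<^sup>2 + c\<^sup>2)) * indicator {..<a} x \<partial>lborel)
     = (\<integral>\<^sup>+x. ennreal (1 / ((x - a)\<^sup>2 + c\<^sup>2)) * indicator {..a} x \<partial>lborel)"
  proof (rule nn_integral_cong_AE)
    have "AE x in lborel. x \<noteq> a" by (rule AE_lborel_singleton)
    then show "AE x in lborel. ennreal (1 / ((x - a)\<^sup>2 + c\<^sup>2)) * indicator {..<a} x = ennreal (1 / ((x - a)\<^sup>2 + c\<^sup>2)) * indicator {..a} x"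
      by eventually_elim (auto simp: indicator_def)
  qed
  also have "\<dots> = (\<integral>\<^sup>+x. ennreal (1 / ((x + a)\<^sup>2 + c\<^sup>2)) * indicator {-a..} x \<partial>lborel)"
  proof -
    have [measurable]: "(\<lambda>x. ennreal (1 / ((x - a)\<^sup>2 + c\<^sup>2)) * indicator {..a} x) \<in> borel_measurable borel"
      by measurable
    show ?thesis
    apply (subst nn_integral_real_affine[where c="-1" and t=0])
    apply simp
    apply simp
    apply (auto intro!: nn_integral_cong simp: indicator_def power2_eq_square algebra_simps)
    done
  qed
  also have "\<dots> = ennreal (pi / (2 * c))" using half[of "-a"] by simp
  finally show ?thesis using half[of a] c by (simp add: ennreal_plus[symmetric] del: ennreal_plus)
qed

lemma nn_integral_kernel_le:
  assumes "Im w < a" "a \<le> y"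
  shows "(\<integral>\<^sup>+x. ennreal (1 / (cmod (Complex x y - w))\<^sup>2) \<partial>lborel) \<le> ennreal (pi / (a - Im w))"
proof -
  have "(\<integral>\<^sup>+x. ennreal (1 / (cmod (Complex x y - w))\<^sup>2) \<partial>lborel)
      = (\<integral>\<^sup>+x. ennreal (1 / ((x - Re w)\<^sup>2 + (y - Im w)\<^sup>2)) \<partial>lborel)"
    by (simp add: cmod_power2)
  also have "\<dots> = ennreal (pi / (y - Im w))"
    using assms by (intro nn_integral_inverse_square) auto
  also have "\<dots> \<le> ennreal (pi / (a - Im w))"
    using assms by (intro ennreal_leI divide_left_mono) auto
  finally show ?thesis .
qed

lemma kernel_hardy2:
  assumes "Im w < 0"
  shows "(\<lambda>z. 1 / (z - w)) \<in> hardy2"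
proof -
  have "(\<lambda>z. 1 / (z - w)) holomorphic_on upper_half"
    using assms by (auto intro!: holomorphic_intros simp: upper_half_iff)
  moreover have "(\<integral>\<^sup>+ x. ennreal ((cmod (1 / (Complex x y - w)))\<^sup>2) \<partial>lborel) \<le> ennreal (pi / (0 - Im w))" if "y > 0" for y
    using nn_integral_kernel_le[of w 0 y] assms that by (simp add: norm_divide power_divide)
  ultimately show ?thesis unfolding hardy2_def by blast
qed

text \<open>By the arithmetic-geometric mean inequality the product has uniformly bounded integrals
  on all lines, so it falls under \<open>halfplane_integral_zero\<close>. The pairing is bilinear,
  without conjugation.\<close>

lemma hardy2_mult_integral_zero:
  assumes f: "f \<in> hardy2" and g: "g \<in> hardy2" and y: "y > 0"
  shows "(\<integral>x. f (Complex x y) * g (Complex x y) \<partial>lborel) = 0"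
proof -
  obtain A where A: "A \<ge> 0" "\<And>y. y > 0 \<Longrightarrow> (\<integral>\<^sup>+ x. ennreal ((cmod (f (Complex x y)))\<^sup>2) \<partial>lborel) \<le> ennreal A"
    using hardy2_bound[OF f] by metis
  obtain B where B: "B \<ge> 0" "\<And>y. y > 0 \<Longrightarrow> (\<integral>\<^sup>+ x. ennreal ((cmod (g (Complex x y)))\<^sup>2) \<partial>lborel) \<le> ennreal B"
    using hardy2_bound[OF g] by metis
  show ?thesis
  proof (rule halfplane_integral_zero[where a=0 and C="A+B" and \<phi>="\<lambda>z. f z * g z"])
    show "(\<lambda>z. f z * g z) holomorphic_on {z. 0 < Im z}"
      using hardy2_holomorphic[OF f] hardy2_holomorphic[OF g]
      unfolding upper_half_def by (intro holomorphic_intros) auto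
    fix y :: real assume y: "y > 0"
    have [measurable]: "(\<lambda>x. f (Complex x y)) \<in> borel_measurable borel" "(\<lambda>x. g (Complex x y)) \<in> borel_measurable borel"
      using f g y by (auto intro!: hardy2_measurable_line hardy2_holomorphic)
    have "(\<integral>\<^sup>+ x. ennreal (cmod (f (Complex x y) * g (Complex x y))) \<partial>lborel)
       \<le> (\<integral>\<^sup>+ x. ennreal ((cmod (f (Complex x y)))\<^sup>2) + ennreal ((cmod (g (Complex x y)))\<^sup>2) \<partial>lborel)"
    proof (intro nn_integral_mono)
      fix x
      have "2 * cmod (f (Complex x y)) * cmod (g (Complex x y)) \<le> (cmod (f (Complex x y)))\<^sup>2 + (cmod (g (Complex x y)))\<^sup>2"
        by (rule sum_squares_bound)
      moreover have "0 \<le> cmod (f (Complex x y)) * cmod (g (Complex x y))" by simp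
      ultimately have "cmod (f (Complex x y) * g (Complex x y)) \<le> (cmod (f (Complex x y)))\<^sup>2 + (cmod (g (Complex x y)))\<^sup>2"
        unfolding norm_mult by linarith
      then show "ennreal (cmod (f (Complex x y) * g (Complex x y))) \<le> ennreal ((cmod (f (Complex x y)))\<^sup>2) + ennreal ((cmod (g (Complex x y)))\<^sup>2)"
        by (metis ennreal_leI ennreal_plus zero_le_power2)
    qed
    also have "\<dots> = (\<integral>\<^sup>+ x. ennreal ((cmod (f (Complex x y)))\<^sup>2) \<partial>lborel) + (\<integral>\<^sup>+ x. ennreal ((cmod (g (Complex x y)))\<^sup>2) \<partial>lborel)"
      by (intro nn_integral_add) measurable
    also have "\<dots> \<le> ennreal A + ennreal B" by (intro add_mono A B y)
    also have "\<dots> = ennreal (A + B)" using A B by simp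
    finally show "(\<integral>\<^sup>+ x. ennreal (cmod (f (Complex x y) * g (Complex x y))) \<partial>lborel) \<le> ennreal (A + B)" .
  qed (use y in auto)
qed

definition poisson :: "real \<Rightarrow> real \<Rightarrow> real" where
  "poisson y t = y / (pi * (t\<^sup>2 + y\<^sup>2))"

lemma poisson_measurable [measurable]: "poisson y \<in> borel_measurable borel"
  unfolding poisson_def by measurable

lemma integral_inverse_square:
  assumes "c > (0::real)"
  shows "integrable lborel (\<lambda>x. 1 / ((x - a)\<^sup>2 + c\<^sup>2))"
    and "(\<integral>x. 1 / ((x - a)\<^sup>2 + c\<^sup>2) \<partial>lborel) = pi / c"
proof -
  have "has_bochner_integral lborel (\<lambda>x. 1 / ((x - a)\<^sup>2 + c\<^sup>2)) (pi / c)"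
    using nn_integral_inverse_square[OF assms, of a] assms
    by (intro has_bochner_integral_nn_integral) auto
  then show "integrable lborel (\<lambda>x. 1 / ((x - a)\<^sup>2 + c\<^sup>2))"
    "(\<integral>x. 1 / ((x - a)\<^sup>2 + c\<^sup>2) \<partial>lborel) = pi / c"
    by (auto simp: has_bochner_integral_iff)
qed

lemma inverse_square_le:
  assumes "c > (0::real)"
  shows "(1 / ((x - a)\<^sup>2 + c\<^sup>2))\<^sup>2 \<le> (1 / c\<^sup>2) * (1 / ((x - a)\<^sup>2 + c\<^sup>2))"
proof -
  have "1 / ((x - a)\<^sup>2 + c\<^sup>2) \<le> 1 / c\<^sup>2"
    using assms by (intro divide_left_mono) (auto simp: add_nonneg_pos)
  then show ?thesis unfolding power2_eq_square[of "1 / ((x - a)\<^sup>2 + c\<^sup>2)"]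
    by (intro mult_right_mono) auto
qed

lemma integrable_inverse_square_mult:
  assumes c: "c > (0::real)" and [measurable]: "u \<in> borel_measurable lborel"
    and u2: "integrable lborel (\<lambda>x. (cmod (u x))\<^sup>2)"
  shows "integrable lborel (\<lambda>x. complex_of_real (1 / ((x - a)\<^sup>2 + c\<^sup>2)) * u x)"
proof (rule integrable_mult_L2)
  show "integrable lborel (\<lambda>x. (cmod (complex_of_real (1 / ((x - a)\<^sup>2 + c\<^sup>2))))\<^sup>2)"
  proof (rule Bochner_Integration.integrable_bound[OF integrable_mult_right[OF integral_inverse_square(1)[OF c], of "1/c\<^sup>2"]])
    show "AE x in lborel. norm ((cmod (complex_of_real (1 / ((x - a)\<^sup>2 + c\<^sup>2))))\<^sup>2) \<le> norm (1 / c\<^sup>2 * (1 / ((x - a)\<^sup>2 + c\<^sup>2)))"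
      using inverse_square_le[OF c, of _ a] unfolding norm_of_real by (auto simp: abs_mult)
  qed measurable
qed (use u2 in auto)

lemma ennreal_linear_combination:
  "\<lbrakk>0 \<le> k; 0 \<le> a; 0 \<le> m; 0 \<le> b\<rbrakk> \<Longrightarrow> ennreal (k * a + m * b) = ennreal k * ennreal a + ennreal m * ennreal b"
  by (simp add: ennreal_plus ennreal_mult)

text \<open>The kernel comes from the quotient \<open>(h z - h w) / ((z - w) (z - w'))\<close>,
  where \<open>w'\<close> is the mirror image of \<open>w\<close> in the line at height
  \<open>\<epsilon>\<close>. It has no pole above \<open>w'\<close>, so its integral over that line
  vanishes, and on the line the denominator is the real number
  \<open>(t - x)^2 + y^2\<close>.\<close>

lemma hardy2_poisson:
  assumes h: "h \<in> hardy2" and e: "\<epsilon> > 0" and y: "y > 0"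
  shows "h (Complex x (\<epsilon> + y)) = (\<integral>t. complex_of_real (poisson y (t - x)) * h (Complex t \<epsilon>) \<partial>lborel)"
proof -
  obtain C where C: "C \<ge> 0" "\<And>y. y > 0 \<Longrightarrow> (\<integral>\<^sup>+ x. ennreal ((cmod (h (Complex x y)))\<^sup>2) \<partial>lborel) \<le> ennreal C"
    using hardy2_bound[OF h] by metis
  have hol: "h holomorphic_on upper_half" using h by (rule hardy2_holomorphic)
  define w where "w = Complex x (\<epsilon> + y)"
  define w' where "w' = Complex x (\<epsilon> - y)"
  \<comment> \<open>The midpoint between \<open>max 0 (\<epsilon> - y)\<close> and
    \<open>\<epsilon>\<close>: the half-plane above \<open>a\<close> contains the line of
    integration and stays away from both the real axis and the pole \<open>w'\<close>.\<close>
  define a where "a = (max 0 (\<epsilon> - y) + \<epsilon>) / 2"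
  have a: "0 < a" "\<epsilon> - y < a" "a < \<epsilon>" using e y by (auto simp: a_def max_def field_simps)
  define d where "d = a - (\<epsilon> - y)"
  have d: "d > 0" using a by (simp add: d_def)
  have wU: "w \<in> upper_half" using e y by (simp add: w_def upper_half_iff)
  define Q where "Q = (\<lambda>z. if z = w then deriv h w else (h z - h w) / (z - w))"
  have Q: "Q holomorphic_on upper_half" unfolding Q_def
    using wU open_upper_half by (intro pole_lemma hol) (simp add: interior_open)
  define \<phi> where "\<phi> = (\<lambda>z. Q z / (z - w'))"
  have ne: "z \<noteq> w'" if "Im z > a" for z using that a by (auto simp: w'_def)
  have sub: "{z. a < Im z} \<subseteq> upper_half" using a by (auto simp: upper_half_iff)
  have \<phi>hol: "\<phi> holomorphic_on {z. a < Im z}"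
    unfolding \<phi>_def using ne by (intro holomorphic_intros holomorphic_on_subset[OF Q sub]) auto
  define r where "r = Im w / 2"
  have r: "r > 0" using e y by (simp add: r_def w_def)
  have cb: "cball w r \<subseteq> upper_half"
  proof
    fix z assume "z \<in> cball w r"
    then have "\<bar>Im z - Im w\<bar> \<le> r" using abs_Im_le_cmod[of "z - w"]
      by (simp add: dist_norm norm_minus_commute)
    then have "Im z \<ge> Im w - r" by linarith
    then show "z \<in> upper_half" using r by (simp add: upper_half_iff r_def)
  qed
  have "continuous_on (cball w r) (\<lambda>z. norm (Q z))"
    by (intro continuous_intros holomorphic_on_imp_continuous_on holomorphic_on_subset[OF Q cb])
  then have "bounded ((\<lambda>z. norm (Q z)) ` cball w r)"
    by (intro compact_imp_bounded compact_continuous_image) auto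
  then obtain D0 where "\<forall>z\<in>cball w r. norm (Q z) \<le> D0"
    unfolding bounded_iff by auto
  then have D0: "\<And>z. z \<in> cball w r \<Longrightarrow> norm (Q z) \<le> D0" by blast
  define D where "D = max D0 0"
  have D: "D \<ge> 0" "\<And>z. z \<in> cball w r \<Longrightarrow> norm (Q z) \<le> D" using D0 by (auto simp: D_def intro: max.coboundedI1)
  define \<kappa> where "\<kappa> = 1 + 2 * y / r"
  have \<kappa>: "\<kappa> \<ge> 1" using r y by (simp add: \<kappa>_def)
  define K2 where "K2 = \<kappa> * (1 / d\<^sup>2 + cmod (h w)) + D * (r + 2 * y)"
  have K2: "K2 \<ge> 0" unfolding K2_def using \<kappa> D r y by auto
  have "w - w' = of_real (2 * y) * \<i>" by (simp add: w_def w'_def complex_eq_iff)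
  then have ww': "cmod (w - w') = 2 * y" using y by (simp only: norm_mult norm_of_real norm_ii)
  \<comment> \<open>Near \<open>w\<close> compactness bounds \<open>Q\<close>; elsewhere
    \<open>1 / |z - w|\<close> is at most \<open>\<kappa> / |z - w'|\<close>, and the cross term
    splits into squares. Both terms on the right have line integrals bounded uniformly in the
    height.\<close>
  have bound: "cmod (\<phi> z) \<le> \<kappa> * (cmod (h z))\<^sup>2 + K2 * (1 / (cmod (z - w'))\<^sup>2)" if z: "Im z > a" for z
  proof -
    define p where "p = 1 / cmod (z - w')"
    have zd: "cmod (z - w') \<ge> d" using abs_Im_le_cmod[of "z - w'"] z a by (simp add: d_def w'_def)
    then have zpos: "cmod (z - w') > 0" using d by linarith
    have p0: "p > 0" using zpos by (simp add: p_def)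
    have pd: "p \<le> 1 / d" unfolding p_def using zd d zpos by (intro divide_left_mono) auto
    have tri: "cmod (z - w') \<le> cmod (z - w) + 2 * y"
      using norm_triangle_ineq[of "z - w" "w - w'"] ww' by simp
    have n\<phi>: "cmod (\<phi> z) = cmod (Q z) * p" by (simp add: \<phi>_def p_def norm_divide)
    have p2: "1 / (cmod (z - w'))\<^sup>2 = p\<^sup>2" by (simp add: p_def power_divide)
    show ?thesis
    proof (cases "z \<in> cball w r")
      case True
      then have "cmod (z - w) \<le> r" by (simp add: dist_norm norm_minus_commute)
      then have "cmod (z - w') \<le> r + 2 * y" using tri by linarith
      then have "1 \<le> (r + 2 * y) * p" unfolding p_def using zpos by simp
      then have "cmod (Q z) * p * 1 \<le> (D * p) * ((r + 2 * y) * p)"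
        using D True p0 by (intro mult_mono) auto
      also have "\<dots> = D * (r + 2 * y) * p\<^sup>2" by (simp add: power2_eq_square)
      also have "\<dots> \<le> K2 * p\<^sup>2"
        unfolding K2_def using \<kappa> by (intro mult_right_mono) auto
      finally show ?thesis unfolding n\<phi> p2 using \<kappa> by (simp add: add_increasing)
    next
      case False
      then have zr: "cmod (z - w) > r" by (simp add: dist_norm norm_minus_commute)
      then have zw: "z \<noteq> w" using r by auto
      have "cmod (z - w') \<le> cmod (z - w) * \<kappa>"
      proof -
        have "2 * y \<le> cmod (z - w) * (2 * y / r)"
          using zr r y by (simp add: field_simps)
        then show ?thesis using tri by (simp add: \<kappa>_def algebra_simps)
      qed
      then have "1 \<le> cmod (z - w) * \<kappa> * p" unfolding p_def using zpos by simp
      moreover have "cmod (z - w) > 0" using zr r by linarith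
      ultimately have inv: "1 / cmod (z - w) \<le> \<kappa> * p" by (simp add: pos_divide_le_eq mult_ac)
      have "cmod (Q z) = cmod (h z - h w) * (1 / cmod (z - w))" using zw by (simp add: Q_def norm_divide)
      also have "\<dots> \<le> (cmod (h z) + cmod (h w)) * (\<kappa> * p)"
        using inv by (intro mult_mono norm_triangle_ineq4) auto
      finally have "cmod (\<phi> z) \<le> (cmod (h z) + cmod (h w)) * (\<kappa> * p) * p"
        unfolding n\<phi> using p0 by (intro mult_right_mono) auto
      also have "\<dots> = \<kappa> * (cmod (h z) * p\<^sup>2) + \<kappa> * cmod (h w) * p\<^sup>2"
        by (simp add: power2_eq_square algebra_simps)
      also have "cmod (h z) * p\<^sup>2 \<le> (cmod (h z))\<^sup>2 + (1 / d\<^sup>2) * p\<^sup>2"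
      proof -
        have "2 * cmod (h z) * p\<^sup>2 \<le> (cmod (h z))\<^sup>2 + (p\<^sup>2)\<^sup>2" by (rule sum_squares_bound)
        moreover have "(p\<^sup>2)\<^sup>2 \<le> (1 / d\<^sup>2) * p\<^sup>2"
          unfolding power2_eq_square[of "p\<^sup>2"] using power_mono[OF pd, of 2] p0
          by (intro mult_right_mono) (auto simp: power_divide)
        moreover have "0 \<le> cmod (h z) * p\<^sup>2" by simp
        moreover have "2 * cmod (h z) * p\<^sup>2 = 2 * (cmod (h z) * p\<^sup>2)" by simp
        ultimately show ?thesis by linarith
      qed
      finally have "cmod (\<phi> z) \<le> \<kappa> * ((cmod (h z))\<^sup>2 + 1 / d\<^sup>2 * p\<^sup>2) + \<kappa> * cmod (h w) * p\<^sup>2"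
        using \<kappa> by simp
      also have "\<dots> \<le> \<kappa> * (cmod (h z))\<^sup>2 + K2 * p\<^sup>2"
        unfolding K2_def using D r y by (simp add: algebra_simps)
      finally show ?thesis unfolding p2 .
    qed
  qed
  have hm: "(\<lambda>x. h (Complex x t)) \<in> borel_measurable borel" if "t > 0" for t
    by (rule hardy2_measurable_line[OF hol that])
  have zero: "(\<integral>t. \<phi> (Complex t \<epsilon>) \<partial>lborel) = 0"
  proof (rule halfplane_integral_zero[OF \<phi>hol])
    fix t assume t: "a < t"
    then have t0: "t > 0" using a by simp
    have [measurable]: "(\<lambda>x. h (Complex x t)) \<in> borel_measurable borel" by (rule hm[OF t0])
    have "(\<integral>\<^sup>+x. ennreal (cmod (\<phi> (Complex x t))) \<partial>lborel)
      \<le> (\<integral>\<^sup>+x. ennreal \<kappa> * ennreal ((cmod (h (Complex x t)))\<^sup>2) + ennreal K2 * ennreal (1 / (cmod (Complex x t - w'))\<^sup>2) \<partial>lborel)"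
    proof (intro nn_integral_mono)
      fix u
      have "cmod (\<phi> (Complex u t)) \<le> \<kappa> * (cmod (h (Complex u t)))\<^sup>2 + K2 * (1 / (cmod (Complex u t - w'))\<^sup>2)"
        by (rule bound) (use t in auto)
      then have "ennreal (cmod (\<phi> (Complex u t))) \<le> ennreal (\<kappa> * (cmod (h (Complex u t)))\<^sup>2 + K2 * (1 / (cmod (Complex u t - w'))\<^sup>2))"
        by (rule ennreal_leI)
      then show "ennreal (cmod (\<phi> (Complex u t))) \<le> ennreal \<kappa> * ennreal ((cmod (h (Complex u t)))\<^sup>2) + ennreal K2 * ennreal (1 / (cmod (Complex u t - w'))\<^sup>2)"
        using \<kappa> K2 by (subst (asm) ennreal_linear_combination) auto
    qed
    also have "\<dots> = ennreal \<kappa> * (\<integral>\<^sup>+x. ennreal ((cmod (h (Complex x t)))\<^sup>2) \<partial>lborel)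
        + ennreal K2 * (\<integral>\<^sup>+x. ennreal (1 / (cmod (Complex x t - w'))\<^sup>2) \<partial>lborel)"
      by (subst nn_integral_add) (auto simp: nn_integral_cmult)
    also have "\<dots> \<le> ennreal \<kappa> * ennreal C + ennreal K2 * ennreal (pi / d)"
      using C(2)[OF t0] nn_integral_kernel_le[of w' a t] a t
      by (intro add_mono mult_left_mono) (auto simp: w'_def d_def)
    also have "\<dots> = ennreal (\<kappa> * C + K2 * (pi / d))"
      using \<kappa> K2 C d by (subst ennreal_linear_combination) auto
    finally show "(\<integral>\<^sup>+x. ennreal (cmod (\<phi> (Complex x t))) \<partial>lborel) \<le> ennreal (\<kappa> * C + K2 * (pi / d))" .
  qed (use a in auto)
  have \<phi>line: "\<phi> (Complex t \<epsilon>) = complex_of_real (1 / ((t - x)\<^sup>2 + y\<^sup>2)) * h (Complex t \<epsilon>) - complex_of_real (1 / ((t - x)\<^sup>2 + y\<^sup>2)) * h w" for t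
  proof -
    have "Complex t \<epsilon> \<noteq> w" using y by (simp add: w_def)
    then have "\<phi> (Complex t \<epsilon>) = (h (Complex t \<epsilon>) - h w) / ((Complex t \<epsilon> - w) * (Complex t \<epsilon> - w'))"
      by (simp add: \<phi>_def Q_def)
    also have "(Complex t \<epsilon> - w) * (Complex t \<epsilon> - w') = complex_of_real ((t - x)\<^sup>2 + y\<^sup>2)"
      by (simp add: w_def w'_def complex_eq_iff power2_eq_square)
    finally show ?thesis
      by (simp only: of_real_divide of_real_1 diff_divide_distrib times_divide_eq_left mult_1_left)
  qed
  have [measurable]: "(\<lambda>x. h (Complex x \<epsilon>)) \<in> borel_measurable borel" by (rule hm[OF e])
  have int1: "integrable lborel (\<lambda>t. complex_of_real (1 / ((t - x)\<^sup>2 + y\<^sup>2)) * h (Complex t \<epsilon>))"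
    by (intro integrable_inverse_square_mult y hardy2_square_integrable h e) measurable
  have int2: "integrable lborel (\<lambda>t. complex_of_real (1 / ((t - x)\<^sup>2 + y\<^sup>2)))"
    by (rule integrable_of_real[OF integral_inverse_square(1)[OF y]])
  have int2': "integrable lborel (\<lambda>t. complex_of_real (1 / ((t - x)\<^sup>2 + y\<^sup>2)) * h w)"
    by (rule integrable_mult_left[OF int2])
  have "(\<integral>t. complex_of_real (1 / ((t - x)\<^sup>2 + y\<^sup>2)) * h (Complex t \<epsilon>) \<partial>lborel)
      = (\<integral>t. complex_of_real (1 / ((t - x)\<^sup>2 + y\<^sup>2)) * h w \<partial>lborel)"
    using zero unfolding \<phi>line Bochner_Integration.integral_diff[OF int1 int2'] by simp
  also have "\<dots> = (\<integral>t. complex_of_real (1 / ((t - x)\<^sup>2 + y\<^sup>2)) \<partial>lborel) * h w"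
    by (rule integral_mult_left_zero)
  also have "\<dots> = complex_of_real (pi / y) * h w"
    by (simp only: integral_complex_of_real integral_inverse_square(2)[OF y])
  finally have "complex_of_real (y / pi) * (\<integral>t. complex_of_real (1 / ((t - x)\<^sup>2 + y\<^sup>2)) * h (Complex t \<epsilon>) \<partial>lborel) = h w"
    using y by simp
  moreover have "complex_of_real (y / pi) * (\<integral>t. complex_of_real (1 / ((t - x)\<^sup>2 + y\<^sup>2)) * h (Complex t \<epsilon>) \<partial>lborel)
    = (\<integral>t. complex_of_real (poisson y (t - x)) * h (Complex t \<epsilon>) \<partial>lborel)"
    unfolding integral_mult_right_zero[symmetric]
    by (intro Bochner_Integration.integral_cong) (auto simp: poisson_def)
  ultimately show ?thesis by (simp add: w_def)
qed

section \<open>Boundary values\<close>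

definition line_energy :: "(complex \<Rightarrow> complex) \<Rightarrow> real \<Rightarrow> real" where
  "line_energy h y = (\<integral>x. (cmod (h (Complex x y)))\<^sup>2 \<partial>lborel)"

lemma line_energy_bounded:
  assumes "h \<in> hardy2"
  obtains C where "\<And>y. y > 0 \<Longrightarrow> line_energy h y \<le> C"
proof -
  obtain C where C: "C \<ge> 0" "\<And>y. y > 0 \<Longrightarrow> (\<integral>\<^sup>+ x. ennreal ((cmod (h (Complex x y)))\<^sup>2) \<partial>lborel) \<le> ennreal C"
    using hardy2_bound[OF assms] by metis
  have "line_energy h y \<le> C" if y: "y > 0" for y
  proof -
    have "ennreal (line_energy h y) = (\<integral>\<^sup>+ x. ennreal ((cmod (h (Complex x y)))\<^sup>2) \<partial>lborel)"
      unfolding line_energy_def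
      by (rule nn_integral_eq_integral[symmetric]) (auto intro: hardy2_square_integrable assms y)
    then have "ennreal (line_energy h y) \<le> ennreal C" using C(2)[OF y] by simp
    then show ?thesis using C(1) by (simp add: ennreal_le_iff)
  qed
  then show ?thesis using that by blast
qed

text \<open>The function \<open>cnj (h (cnj z + \<i> s))\<close> is holomorphic in \<open>z\<close>,
  and its product with \<open>h z\<close> correlates the lines at heights \<open>y\<close> and
  \<open>s - y\<close>. Moving the line inside the strip shows that the correlation depends only on
  the sum \<open>s\<close>. This makes the energy midpoint convex and identifies the distance of two
  lines.\<close>

lemma line_energy_mixed:
  assumes h: "h \<in> hardy2" and e: "\<epsilon> > 0" and d: "\<epsilon> \<le> \<delta>"
  shows "(\<integral>x. h (Complex x \<epsilon>) * cnj (h (Complex x \<delta>)) \<partial>lborel) = of_real (line_energy h ((\<epsilon> + \<delta>) / 2))"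
proof -
  obtain A where A: "A \<ge> 0" "\<And>y. y > 0 \<Longrightarrow> (\<integral>\<^sup>+ x. ennreal ((cmod (h (Complex x y)))\<^sup>2) \<partial>lborel) \<le> ennreal A"
    using hardy2_bound[OF h] by metis
  define s where "s = \<epsilon> + \<delta>"
  define \<phi> where "\<phi> = (\<lambda>z. h z * (cnj \<circ> (\<lambda>u. h (u + \<i> * of_real s)) \<circ> cnj) z)"
  have \<phi>: "\<phi> (Complex x y) = h (Complex x y) * cnj (h (Complex x (s - y)))" for x y
  proof -
    have "cnj (Complex x y) + \<i> * of_real s = Complex x (s - y)" by (simp add: complex_eq_iff)
    then show ?thesis by (simp add: \<phi>_def)
  qed
  have S_eq: "{z. 0 < Im z \<and> Im z < s} = {z. Im z > 0} \<inter> {z. Im z < s}" by auto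
  have "(cnj \<circ> (\<lambda>u. h (u + \<i> * of_real s)) \<circ> cnj) holomorphic_on {z. 0 < Im z \<and> Im z < s}"
  proof (rule holomorphic_on_compose_cnj_cnj)
    show "open {z. 0 < Im z \<and> Im z < s}"
      unfolding S_eq by (intro open_Int open_halfspace_Im_gt open_halfspace_Im_lt)
    show "(\<lambda>u. h (u + \<i> * of_real s)) holomorphic_on cnj ` {z. 0 < Im z \<and> Im z < s}"
      using hardy2_holomorphic[OF h]
      by (rule holomorphic_on_compose_gen[of "\<lambda>u. u + \<i> * of_real s" _ h upper_half, unfolded o_def, rotated])
        (auto intro!: holomorphic_intros simp: upper_half_iff)
  qed
  moreover have "h holomorphic_on {z. 0 < Im z \<and> Im z < s}"
    by (rule holomorphic_on_subset[OF hardy2_holomorphic[OF h]]) (auto simp: upper_half_iff)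
  ultimately have hol: "\<phi> holomorphic_on {z. 0 < Im z \<and> Im z < s}"
    unfolding \<phi>_def by (intro holomorphic_intros)
  have bd: "(\<integral>\<^sup>+x. ennreal (cmod (\<phi> (Complex x y))) \<partial>lborel) \<le> ennreal (2 * A)" if y: "0 < y" "y < s" for y
  proof -
    have [measurable]: "(\<lambda>x. h (Complex x y)) \<in> borel_measurable borel" "(\<lambda>x. h (Complex x (s - y))) \<in> borel_measurable borel"
      using h y by (auto intro!: hardy2_measurable_line hardy2_holomorphic)
    have "(\<integral>\<^sup>+ x. ennreal (cmod (\<phi> (Complex x y))) \<partial>lborel)
       \<le> (\<integral>\<^sup>+ x. ennreal ((cmod (h (Complex x y)))\<^sup>2) + ennreal ((cmod (h (Complex x (s - y))))\<^sup>2) \<partial>lborel)"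
    proof (intro nn_integral_mono)
      fix x
      have "2 * cmod (h (Complex x y)) * cmod (h (Complex x (s-y))) \<le> (cmod (h (Complex x y)))\<^sup>2 + (cmod (h (Complex x (s-y))))\<^sup>2"
        by (rule sum_squares_bound)
      moreover have "0 \<le> cmod (h (Complex x y)) * cmod (h (Complex x (s-y)))" by simp
      ultimately have "cmod (\<phi> (Complex x y)) \<le> (cmod (h (Complex x y)))\<^sup>2 + (cmod (h (Complex x (s-y))))\<^sup>2"
        unfolding \<phi> norm_mult complex_mod_cnj by linarith
      then show "ennreal (cmod (\<phi> (Complex x y))) \<le> ennreal ((cmod (h (Complex x y)))\<^sup>2) + ennreal ((cmod (h (Complex x (s-y))))\<^sup>2)"
        by (metis ennreal_leI ennreal_plus zero_le_power2)
    qed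
    also have "\<dots> = (\<integral>\<^sup>+ x. ennreal ((cmod (h (Complex x y)))\<^sup>2) \<partial>lborel) + (\<integral>\<^sup>+ x. ennreal ((cmod (h (Complex x (s-y))))\<^sup>2) \<partial>lborel)"
      by (intro nn_integral_add) measurable
    also have "\<dots> \<le> ennreal A + ennreal A" using y by (intro add_mono A) auto
    also have "\<dots> = ennreal (2 * A)" using A by (simp add: ennreal_plus[symmetric] del: ennreal_plus)
    finally show ?thesis .
  qed
  have "(\<integral>x. \<phi> (Complex x \<epsilon>) \<partial>lborel) = (\<integral>x. \<phi> (Complex x (s / 2)) \<partial>lborel)"
    by (rule strip_integral_const[OF hol bd]) (use e d in \<open>auto simp: s_def\<close>)
  also have "\<dots> = (\<integral>x. of_real ((cmod (h (Complex x (s / 2))))\<^sup>2) \<partial>lborel)"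
    by (intro Bochner_Integration.integral_cong) (simp_all add: \<phi> complex_norm_square del: of_real_power)
  also have "\<dots> = of_real (line_energy h (s / 2))"
    by (simp only: integral_complex_of_real line_energy_def)
  finally show ?thesis by (simp add: \<phi> s_def)
qed

lemma cmod_diff_squared: "(cmod (a - b))\<^sup>2 = (cmod a)\<^sup>2 + (cmod b)\<^sup>2 - 2 * Re (a * cnj b)"
  unfolding cmod_power2 by (simp add: power2_eq_square algebra_simps)

lemma cnj_measurable [measurable]: "cnj \<in> borel_measurable borel"
  by (intro borel_measurable_continuous_onI continuous_intros)

lemma integrable_line_product:
  assumes h: "h \<in> hardy2" and e: "\<epsilon> > 0" and d: "\<delta> > 0"
  shows "integrable lborel (\<lambda>x. h (Complex x \<epsilon>) * cnj (h (Complex x \<delta>)))"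
proof -
  have [measurable]: "(\<lambda>x. h (Complex x \<epsilon>)) \<in> borel_measurable borel" "(\<lambda>x. h (Complex x \<delta>)) \<in> borel_measurable borel"
    using h e d by (auto intro!: hardy2_measurable_line hardy2_holomorphic)
  show ?thesis
    by (rule integrable_mult_L2) (auto intro!: hardy2_square_integrable h e d)
qed

lemma line_diff_energy:
  assumes h: "h \<in> hardy2" and e: "\<epsilon> > 0" and d: "\<epsilon> \<le> \<delta>"
  shows "integrable lborel (\<lambda>x. (cmod (h (Complex x \<epsilon>) - h (Complex x \<delta>)))\<^sup>2)"
    and "(\<integral>x. (cmod (h (Complex x \<epsilon>) - h (Complex x \<delta>)))\<^sup>2 \<partial>lborel)
       = line_energy h \<epsilon> + line_energy h \<delta> - 2 * line_energy h ((\<epsilon> + \<delta>) / 2)"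
proof -
  have d0: "\<delta> > 0" using e d by simp
  note i1 = hardy2_square_integrable[OF h e] and i2 = hardy2_square_integrable[OF h d0]
  note i3 = integrable_line_product[OF h e d0]
  have i3': "integrable lborel (\<lambda>x. 2 * Re (h (Complex x \<epsilon>) * cnj (h (Complex x \<delta>))))"
    using i3 by (intro integrable_mult_right integrable_Re)
  show "integrable lborel (\<lambda>x. (cmod (h (Complex x \<epsilon>) - h (Complex x \<delta>)))\<^sup>2)"
    unfolding cmod_diff_squared by (intro Bochner_Integration.integrable_diff Bochner_Integration.integrable_add i1 i2 i3')
  have "(\<integral>x. (cmod (h (Complex x \<epsilon>) - h (Complex x \<delta>)))\<^sup>2 \<partial>lborel)
      = (\<integral>x. (cmod (h (Complex x \<epsilon>)))\<^sup>2 \<partial>lborel) + (\<integral>x. (cmod (h (Complex x \<delta>)))\<^sup>2 \<partial>lborel)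
      - (\<integral>x. 2 * Re (h (Complex x \<epsilon>) * cnj (h (Complex x \<delta>))) \<partial>lborel)"
    unfolding cmod_diff_squared
    by (subst Bochner_Integration.integral_diff[OF Bochner_Integration.integrable_add[OF i1 i2] i3'],
        subst Bochner_Integration.integral_add[OF i1 i2]) simp
  also have "(\<integral>x. 2 * Re (h (Complex x \<epsilon>) * cnj (h (Complex x \<delta>))) \<partial>lborel) = 2 * line_energy h ((\<epsilon> + \<delta>) / 2)"
    by (simp only: integral_mult_right_zero integral_Re[OF i3] line_energy_mixed[OF h e d] Re_complex_of_real)
  finally show "(\<integral>x. (cmod (h (Complex x \<epsilon>) - h (Complex x \<delta>)))\<^sup>2 \<partial>lborel)
       = line_energy h \<epsilon> + line_energy h \<delta> - 2 * line_energy h ((\<epsilon> + \<delta>) / 2)"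
    by (simp only: line_energy_def)
qed

text \<open>Midpoint convexity passes any increase over one step on to the next step of the same
  length, so an increase would grow linearly and break the bound.\<close>

lemma bounded_midconvex_antimono:
  fixes f :: "real \<Rightarrow> real"
  assumes mid: "\<And>a b. 0 < a \<Longrightarrow> a \<le> b \<Longrightarrow> 2 * f ((a + b) / 2) \<le> f a + f b"
    and bd: "\<And>x. x > 0 \<Longrightarrow> f x \<le> C"
    and ab: "0 < a" "a \<le> b"
  shows "f b \<le> f a"
proof (rule ccontr)
  assume "\<not> f b \<le> f a"
  then have k: "f b - f a > 0" by simp
  define d where "d = b - a"
  have d: "d \<ge> 0" using ab by (simp add: d_def)
  have step: "f (a + real (Suc n) * d) - f (a + real n * d) \<ge> f b - f a" for n
  proof (induction n)
    case 0 then show ?case by (simp add: d_def)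
  next
    case (Suc n)
    have "2 * f ((a + real n * d + (a + real (Suc (Suc n)) * d)) / 2) \<le> f (a + real n * d) + f (a + real (Suc (Suc n)) * d)"
      using ab d by (intro mid) (auto intro!: mult_right_mono add_pos_nonneg)
    moreover have "(a + real n * d + (a + real (Suc (Suc n)) * d)) / 2 = a + real (Suc n) * d"
      by (simp add: field_simps)
    ultimately have "2 * f (a + real (Suc n) * d) \<le> f (a + real n * d) + f (a + real (Suc (Suc n)) * d)"
      by (simp only:)
    then show ?case using Suc.IH by linarith
  qed
  have lin: "f (a + real n * d) \<ge> f a + real n * (f b - f a)" for n
  proof (induction n)
    case (Suc n)
    then show ?case using step[of n] by (simp add: algebra_simps)
  qed simp
  obtain n where "real n * (f b - f a) > C - f a"
    using reals_Archimedean3[OF k] by metis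
  moreover have "f (a + real n * d) \<le> C" using ab d by (intro bd) (auto intro: add_pos_nonneg)
  ultimately show False using lin[of n] by linarith
qed

lemma line_energy_antimono:
  assumes h: "h \<in> hardy2" and ab: "0 < a" "a \<le> b"
  shows "line_energy h b \<le> line_energy h a"
proof -
  obtain C where "\<And>y. y > 0 \<Longrightarrow> line_energy h y \<le> C" using line_energy_bounded[OF h] by metis
  moreover have "2 * line_energy h ((a + b) / 2) \<le> line_energy h a + line_energy h b" if "0 < a" "a \<le> b" for a b
  proof -
    have "0 \<le> (\<integral>x. (cmod (h (Complex x a) - h (Complex x b)))\<^sup>2 \<partial>lborel)" by simp
    then show ?thesis unfolding line_diff_energy(2)[OF h that] by simp
  qed
  ultimately show ?thesis using bounded_midconvex_antimono[of "line_energy h" C a b] ab by blast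
qed

text \<open>The midpoint energy is at least the energy of the upper line, so the distance is
  controlled by the energy drop alone; convergence of the energies then makes the lines Cauchy in
  L^2.\<close>

lemma line_diff_energy_le:
  assumes h: "h \<in> hardy2" and e: "\<epsilon> > 0" and d: "\<epsilon> \<le> \<delta>"
  shows "(\<integral>\<^sup>+x. ennreal ((cmod (h (Complex x \<epsilon>) - h (Complex x \<delta>)))\<^sup>2) \<partial>lborel)
       \<le> ennreal (line_energy h \<epsilon> - line_energy h \<delta>)"
proof -
  have "(\<integral>\<^sup>+x. ennreal ((cmod (h (Complex x \<epsilon>) - h (Complex x \<delta>)))\<^sup>2) \<partial>lborel)
     = ennreal (line_energy h \<epsilon> + line_energy h \<delta> - 2 * line_energy h ((\<epsilon> + \<delta>) / 2))"
    unfolding line_diff_energy(2)[OF h e d, symmetric]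
    by (rule nn_integral_eq_integral) (auto intro: line_diff_energy(1)[OF h e d])
  also have "\<dots> \<le> ennreal (line_energy h \<epsilon> - line_energy h \<delta>)"
    using line_energy_antimono[OF h, of "(\<epsilon> + \<delta>) / 2" \<delta>] e d by (intro ennreal_leI) auto
  finally show ?thesis .
qed

lemma line_energy_limit:
  assumes h: "h \<in> hardy2"
  obtains L where "(line_energy h \<longlongrightarrow> L) (at_right 0)" "\<And>y. y > 0 \<Longrightarrow> line_energy h y \<le> L"
proof -
  obtain C where C: "\<And>y. y > 0 \<Longrightarrow> line_energy h y \<le> C" using line_energy_bounded[OF h] by metis
  define L where "L = Sup (line_energy h ` {0<..})"
  have bdd: "bdd_above (line_energy h ` {0<..})" using C by (auto intro!: bdd_aboveI2)
  have le: "line_energy h y \<le> L" if "y > 0" for y unfolding L_def using that bdd by (intro cSup_upper) auto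
  have "(line_energy h \<longlongrightarrow> L) (at_right 0)"
  proof (rule order_tendstoI)
    fix a assume "a < L"
    then obtain y where y: "y > 0" "a < line_energy h y"
      unfolding L_def by (subst (asm) less_cSup_iff) (use bdd in auto)
    have "eventually (\<lambda>x. x \<in> {0<..<y}) (at_right 0)" using y by (intro eventually_at_right_real)
    then show "\<forall>\<^sub>F x in at_right 0. a < line_energy h x"
      by eventually_elim (use y line_energy_antimono[OF h] in \<open>force intro: less_le_trans\<close>)
  next
    fix a assume La: "L < a"
    show "\<forall>\<^sub>F x in at_right 0. line_energy h x < a"
      using eventually_at_right_less[of "0::real"] by eventually_elim (use le La in \<open>force intro: le_less_trans\<close>)
  qed
  then show ?thesis using that le by blast
qed

section \<open>A weak-type maximal inequality for Poisson averages\<close>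

lemma pred_cball_measurable [measurable]: "Measurable.pred borel (\<lambda>x. x \<in> cball (a::real) r)"
  by (rule pred_sets2[where N=borel]) auto

text \<open>Vitali covering: disjoint intervals around points of \<open>S\<close>, each carrying
  more than \<open>a\<close> times its length of the mass of \<open>U\<close>, cover
  \<open>S\<close> after fivefold enlargement. Their radii are bounded because the total mass is
  finite.\<close>

lemma weak_maximal_inequality:
  fixes U :: "real \<Rightarrow> ennreal"
  assumes U[measurable]: "U \<in> borel_measurable borel" and S[measurable]: "S \<in> sets borel" and a: "a > 0"
    and sub: "\<And>x. x \<in> S \<Longrightarrow> \<exists>r>0. (\<integral>\<^sup>+t. U t * indicator (cball x r) t \<partial>lborel) > ennreal (2 * r * a)"
  shows "ennreal a * emeasure lborel S \<le> 5 * (\<integral>\<^sup>+t. U t \<partial>lborel)"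
proof (cases "(\<integral>\<^sup>+t. U t \<partial>lborel) = \<infinity>")
  case True then show ?thesis by simp
next
  case False
  then obtain T where T: "T \<ge> 0" "(\<integral>\<^sup>+t. U t \<partial>lborel) = ennreal T"
    by (metis ennreal_cases infinity_ennreal_def)
  obtain r where r: "\<And>x. x \<in> S \<Longrightarrow> r x > 0"
      "\<And>x. x \<in> S \<Longrightarrow> (\<integral>\<^sup>+t. U t * indicator (cball x (r x)) t \<partial>lborel) > ennreal (2 * r x * a)"
    using sub by metis
  have rB: "r x \<le> T / (2 * a)" if "x \<in> S" for x
  proof -
    have "ennreal (2 * r x * a) \<le> (\<integral>\<^sup>+t. U t * indicator (cball x (r x)) t \<partial>lborel)"
      using r(2)[OF that] by simp
    also have "\<dots> \<le> (\<integral>\<^sup>+t. U t \<partial>lborel)" by (intro nn_integral_mono) (auto simp: indicator_def)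
    finally have "2 * r x * a \<le> T" using T by (simp add: ennreal_le_iff)
    then show ?thesis using a by (simp add: field_simps)
  qed
  obtain C where C: "countable C" "C \<subseteq> S"
      "pairwise (\<lambda>i j. disjnt (cball (id i) (r i)) (cball (id j) (r j))) C"
      "S \<subseteq> (\<Union>i\<in>C. cball (id i) (5 * r i))"
  proof (rule Vitali_covering_lemma_cballs[where S=S and K=S and a=id and r=r and B="T / (2 * a)"])
    show "S \<subseteq> (\<Union>i\<in>S. cball (id i) (r i))" using r by (force simp: less_imp_le)
  qed (use r rB in auto)
  \<comment> \<open>Sums over the countable family are written as integrals over
    \<open>count_space C\<close>; disjointness is then a bound on this overlap function, and sums
    interchange with integrals.\<close>
  have disj: "(\<integral>\<^sup>+i. indicator (cball i (r i)) t \<partial>count_space C) \<le> (1::ennreal)" for t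
  proof (cases "\<exists>i\<in>C. t \<in> cball i (r i)")
    case True
    then obtain i where i: "i \<in> C" "t \<in> cball i (r i)" by auto
    have "(\<integral>\<^sup>+j. indicator (cball j (r j)) t \<partial>count_space C) = (\<integral>\<^sup>+j. indicator {i} j \<partial>count_space C)"
    proof (intro nn_integral_cong)
      fix j assume "j \<in> space (count_space C)"
      then have j: "j \<in> C" by simp
      show "indicator (cball j (r j)) t = (indicator {i} j :: ennreal)"
      proof (cases "j = i")
        case False
        then have "disjnt (cball i (r i)) (cball j (r j))"
          using C(3) i(1) j by (auto simp: pairwise_def)
        then show ?thesis using i(2) False by (auto simp: disjnt_iff indicator_def)
      qed (use i in auto)
    qed
    also have "\<dots> = 1" using i(1) by (simp add: nn_integral_indicator)
    finally show ?thesis by simp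
  next
    case False
    then have "(\<integral>\<^sup>+i. indicator (cball i (r i)) t \<partial>count_space C) = (\<integral>\<^sup>+i. 0 \<partial>count_space C)"
      by (intro nn_integral_cong) (auto simp: indicator_def)
    then show ?thesis by simp
  qed
  have "ennreal a * emeasure lborel S = (\<integral>\<^sup>+t. ennreal a * indicator S t \<partial>lborel)"
    by (simp add: nn_integral_cmult_indicator)
  also have "\<dots> \<le> (\<integral>\<^sup>+t. (\<integral>\<^sup>+i. ennreal a * indicator (cball i (5 * r i)) t \<partial>count_space C) \<partial>lborel)"
  proof (intro nn_integral_mono)
    fix t
    show "ennreal a * indicator S t \<le> (\<integral>\<^sup>+i. ennreal a * indicator (cball i (5 * r i)) t \<partial>count_space C)"
    proof (cases "t \<in> S")
      case True
      then obtain i where i: "i \<in> C" "t \<in> cball i (5 * r i)" using C(4) by auto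
      have "ennreal a * indicator S t = (\<integral>\<^sup>+j. ennreal a * indicator {i} j \<partial>count_space C)"
        using i(1) True by (subst nn_integral_cmult_indicator) auto
      also have "\<dots> \<le> (\<integral>\<^sup>+j. ennreal a * indicator (cball j (5 * r j)) t \<partial>count_space C)"
        using i by (intro nn_integral_mono) (auto simp: indicator_def)
      finally show ?thesis .
    qed simp
  qed
  also have "\<dots> = (\<integral>\<^sup>+i. (\<integral>\<^sup>+t. ennreal a * indicator (cball i (5 * r i)) t \<partial>lborel) \<partial>count_space C)"
    by (rule nn_integral_count_space_nn_integral[OF C(1)]) measurable
  also have "\<dots> \<le> (\<integral>\<^sup>+i. (\<integral>\<^sup>+t. 5 * (U t * indicator (cball i (r i)) t) \<partial>lborel) \<partial>count_space C)"
  proof (rule nn_integral_mono)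
    fix i assume "i \<in> space (count_space C)"
    then have i: "i \<in> S" using C by auto
    have "(\<integral>\<^sup>+t. ennreal a * indicator (cball i (5 * r i)) t \<partial>lborel) = ennreal a * ennreal (10 * r i)"
      using r(1)[OF i] by (subst nn_integral_cmult_indicator) (auto simp: cball_eq_atLeastAtMost algebra_simps)
    also have "\<dots> = 5 * ennreal (2 * r i * a)"
      using a r(1)[OF i] by (simp add: ennreal_mult'[symmetric] ennreal_numeral[symmetric] algebra_simps del: ennreal_numeral)
    also have "\<dots> \<le> 5 * (\<integral>\<^sup>+t. U t * indicator (cball i (r i)) t \<partial>lborel)"
      using r(2)[OF i] by (intro mult_left_mono) auto
    also have "\<dots> = (\<integral>\<^sup>+t. 5 * (U t * indicator (cball i (r i)) t) \<partial>lborel)"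
      by (intro nn_integral_cmult[symmetric]) measurable
    finally show "(\<integral>\<^sup>+t. ennreal a * indicator (cball i (5 * r i)) t \<partial>lborel) \<le> (\<integral>\<^sup>+t. 5 * (U t * indicator (cball i (r i)) t) \<partial>lborel)" .
  qed
  also have "\<dots> = (\<integral>\<^sup>+t. (\<integral>\<^sup>+i. 5 * (U t * indicator (cball i (r i)) t) \<partial>count_space C) \<partial>lborel)"
    by (rule nn_integral_count_space_nn_integral[OF C(1), symmetric]) measurable
  also have "\<dots> = (\<integral>\<^sup>+t. 5 * U t * (\<integral>\<^sup>+i. indicator (cball i (r i)) t \<partial>count_space C) \<partial>lborel)"
    by (intro nn_integral_cong) (simp add: nn_integral_cmult mult.assoc[symmetric])
  also have "\<dots> \<le> (\<integral>\<^sup>+t. 5 * U t * 1 \<partial>lborel)"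
    by (intro nn_integral_mono mult_left_mono disj) simp
  also have "\<dots> = 5 * (\<integral>\<^sup>+t. U t \<partial>lborel)" by (simp add: nn_integral_cmult)
  finally show ?thesis .
qed

lemma ennreal_le_suminf: "f k \<le> (\<Sum>i. f i :: ennreal)"
  using sum_le_suminf[OF summableI, of "{k}" f] by simp

lemma poisson_nonneg: "y \<ge> 0 \<Longrightarrow> poisson y t \<ge> 0"
  by (auto simp: poisson_def)

text \<open>On the shell \<open>2^(k-1) y < |t - x| \<le> 2^k y\<close> the kernel is at most
  \<open>4 / (\<pi> y) * 4^(-k)\<close>; the least \<open>k\<close> with
  \<open>|t - x| \<le> 2^k y\<close> thus supplies one summand that already dominates.\<close>

lemma poisson_le_dyadic:
  assumes y: "y > 0"
  shows "ennreal (poisson y (t - x)) \<le> (\<Sum>k. ennreal (4 / (pi * y) * (1/4)^k) * indicator (cball x (2^k * y)) t)"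
proof -
  define s where "s = \<bar>t - x\<bar>"
  obtain n where n: "s < real n * y" using reals_Archimedean3[OF y] by metis
  have "real n * y \<le> 2 ^ n * y" using y of_nat_less_two_power[of n, where 'a=real] by (intro mult_right_mono) auto
  then have ex: "s \<le> 2 ^ n * y" using n by linarith
  define k where "k = (LEAST k. s \<le> 2 ^ k * y)"
  have k: "s \<le> 2 ^ k * y" unfolding k_def by (rule LeastI[of "\<lambda>k. s \<le> 2 ^ k * y", OF ex])
  have kmin: "j < k \<Longrightarrow> s > 2 ^ j * y" for j unfolding k_def using not_less_Least[of j "\<lambda>k. s \<le> 2 ^ k * y"] by auto
  have "poisson y (t - x) \<le> 4 / (pi * y) * (1/4)^k"
  proof (cases k)
    case 0
    have "poisson y (t - x) \<le> y / (pi * y\<^sup>2)" unfolding poisson_def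
      using y by (intro divide_left_mono mult_left_mono) (auto intro!: mult_pos_pos add_nonneg_pos)
    also have "\<dots> \<le> 4 / (pi * y)" using y by (simp add: power2_eq_square field_simps)
    finally show ?thesis using 0 by simp
  next
    case (Suc j)
    then have "2 ^ j * y < s" using kmin by auto
    then have "(2 ^ j * y)\<^sup>2 \<le> s\<^sup>2" using y by (intro power_mono) auto
    then have j: "(2 ^ j * y)\<^sup>2 \<le> (t - x)\<^sup>2" by (simp add: s_def)
    have "poisson y (t - x) \<le> y / (pi * (2 ^ j * y)\<^sup>2)" unfolding poisson_def
      using y by (intro divide_left_mono mult_left_mono order.trans[OF j]) (auto intro!: mult_pos_pos add_nonneg_pos)
    also have "(2 ^ j * y)\<^sup>2 = 4 ^ j * y\<^sup>2"
      by (simp add: power_mult_distrib power2_eq_square[of "2^j"] power_mult_distrib[symmetric])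
    also have "y / (pi * (4 ^ j * y\<^sup>2)) = 4 / (pi * y) * (1/4)^k"
      unfolding Suc using y by (simp add: power2_eq_square field_simps power_divide)
    finally show ?thesis .
  qed
  then have "ennreal (poisson y (t - x)) \<le> ennreal (4 / (pi * y) * (1/4)^k) * indicator (cball x (2^k * y)) t"
    using k by (auto simp: indicator_def s_def dist_real_def abs_minus_commute intro!: ennreal_leI)
  also have "\<dots> \<le> (\<Sum>k. ennreal (4 / (pi * y) * (1/4)^k) * indicator (cball x (2^k * y)) t)"
    by (rule ennreal_le_suminf)
  finally show ?thesis .
qed

text \<open>The average over an interval of radius \<open>2^k y\<close> is at most \<open>a\<close>,
  so the dyadic majorant contributes \<open>8 a / \<pi> * 2^(-k)\<close>, and the geometric series
  sums to \<open>16 a / \<pi>\<close>.\<close>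

lemma poisson_integral_le:
  fixes U :: "real \<Rightarrow> ennreal"
  assumes U[measurable]: "U \<in> borel_measurable borel" and y: "y > 0" and a: "a \<ge> 0"
    and avg: "\<And>r. r > 0 \<Longrightarrow> (\<integral>\<^sup>+t. U t * indicator (cball x r) t \<partial>lborel) \<le> ennreal (2 * r * a)"
  shows "(\<integral>\<^sup>+t. ennreal (poisson y (t - x)) * U t \<partial>lborel) \<le> ennreal (16 * a / pi)"
proof -
  define c where "c = (\<lambda>k. 4 / (pi * y) * (1/4::real)^k)"
  have c0: "c k \<ge> 0" for k using y by (simp add: c_def)
  have "(\<integral>\<^sup>+t. ennreal (poisson y (t - x)) * U t \<partial>lborel)
    \<le> (\<integral>\<^sup>+t. (\<Sum>k. ennreal (c k) * (U t * indicator (cball x (2^k * y)) t)) \<partial>lborel)"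
  proof (intro nn_integral_mono)
    fix t
    have "ennreal (poisson y (t - x)) * U t \<le> (\<Sum>k. ennreal (c k) * indicator (cball x (2^k * y)) t) * U t"
      using poisson_le_dyadic[OF y, of t x] by (intro mult_right_mono) (auto simp: c_def)
    also have "\<dots> = (\<Sum>k. ennreal (c k) * (U t * indicator (cball x (2^k * y)) t))"
      by (subst ennreal_suminf_multc[symmetric]) (simp add: mult_ac)
    finally show "ennreal (poisson y (t - x)) * U t \<le> (\<Sum>k. ennreal (c k) * (U t * indicator (cball x (2^k * y)) t))" .
  qed
  also have "\<dots> = (\<Sum>k. \<integral>\<^sup>+t. ennreal (c k) * (U t * indicator (cball x (2^k * y)) t) \<partial>lborel)"
    by (intro nn_integral_suminf) measurable
  also have "\<dots> = (\<Sum>k. ennreal (c k) * (\<integral>\<^sup>+t. U t * indicator (cball x (2^k * y)) t \<partial>lborel))"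
    by (subst nn_integral_cmult) auto
  also have "\<dots> \<le> (\<Sum>k. ennreal (c k) * ennreal (2 * (2^k * y) * a))"
    using y by (intro suminf_le mult_left_mono avg) auto
  also have "\<dots> = (\<Sum>k. ennreal ((8 * a / pi) * (1/2)^k))"
  proof (intro suminf_cong)
    fix k :: nat
    have 4: "(4::real) ^ k = 2 ^ k * 2 ^ k" by (simp add: power_mult_distrib[symmetric])
    have "c k * (2 * (2^k * y) * a) = (8 * a / pi) * (1/2)^k"
      unfolding c_def using y by (simp add: power_divide 4 field_simps)
    then show "ennreal (c k) * ennreal (2 * (2^k * y) * a) = ennreal ((8 * a / pi) * (1/2)^k)"
      using c0[of k] by (simp add: ennreal_mult''[symmetric] y a less_imp_le ennreal_mult'[symmetric] del: times_divide_eq_left)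
  qed
  also have "\<dots> = ennreal (16 * a / pi)"
  proof (rule suminf_ennreal_eq)
    have "(\<lambda>k. (1/2::real)^k) sums (1 / (1 - 1/2))" by (rule geometric_sums) simp
    from sums_mult[OF this, of "8 * a / pi"] show "(\<lambda>k. (8 * a / pi) * (1/2)^k) sums (16 * a / pi)" by simp
  qed (use a in auto)
  finally show ?thesis .
qed

lemma poisson_maximal_inequality:
  fixes U :: "real \<Rightarrow> ennreal"
  assumes U[measurable]: "U \<in> borel_measurable borel" and S[measurable]: "S \<in> sets borel" and l: "l > 0"
    and sub: "\<And>x. x \<in> S \<Longrightarrow> \<exists>y>0. (\<integral>\<^sup>+t. ennreal (poisson y (t - x)) * U t \<partial>lborel) > ennreal l"
  shows "ennreal l * emeasure lborel S \<le> 30 * (\<integral>\<^sup>+t. U t \<partial>lborel)"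
proof -
  \<comment> \<open>Chosen so that \<open>poisson_integral_le\<close> returns exactly
    \<open>l\<close>. The resulting constant \<open>5 * 16 / \<pi>\<close> is rounded up to
    30.\<close>
  define a where "a = l * pi / 16"
  have a: "a > 0" using l by (simp add: a_def)
  have "ennreal a * emeasure lborel S \<le> 5 * (\<integral>\<^sup>+t. U t \<partial>lborel)"
  proof (rule weak_maximal_inequality[OF U S a], rule ccontr)
    fix x assume x: "x \<in> S"
    assume "\<not> (\<exists>r>0. ennreal (2 * r * a) < (\<integral>\<^sup>+t. U t * indicator (cball x r) t \<partial>lborel))"
    then have "\<And>r. r > 0 \<Longrightarrow> (\<integral>\<^sup>+t. U t * indicator (cball x r) t \<partial>lborel) \<le> ennreal (2 * r * a)"
      by (meson not_less)
    then have "(\<integral>\<^sup>+t. ennreal (poisson y (t - x)) * U t \<partial>lborel) \<le> ennreal l" if "y > 0" for y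
      using poisson_integral_le[OF U that, of a x] a by (simp add: a_def)
    then show False using sub[OF x] by (auto simp: not_less[symmetric])
  qed
  then have "ennreal (16 / pi) * (ennreal a * emeasure lborel S) \<le> ennreal (16 / pi) * (5 * (\<integral>\<^sup>+t. U t \<partial>lborel))"
    by (intro mult_left_mono) auto
  also have "ennreal (16 / pi) * (ennreal a * emeasure lborel S) = ennreal l * emeasure lborel S"
    using a by (simp add: mult.assoc[symmetric] ennreal_mult''[symmetric]) (simp add: a_def)
  also have "ennreal (16 / pi) * (5 * (\<integral>\<^sup>+t. U t \<partial>lborel)) = ennreal (16 / pi * 5) * (\<integral>\<^sup>+t. U t \<partial>lborel)"
    by (simp add: mult.assoc[symmetric] ennreal_mult'' del: times_divide_eq_left)
  also have "\<dots> \<le> ennreal 30 * (\<integral>\<^sup>+t. U t \<partial>lborel)"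
    using pi_gt3 by (intro mult_right_mono ennreal_leI) (auto simp: field_simps)
  finally show ?thesis by simp
qed

section \<open>Vertical limits exist almost everywhere\<close>

lemma poisson_integral: 
  assumes "y > 0" shows "(\<integral>\<^sup>+t. ennreal (poisson y (t - x)) \<partial>lborel) = 1"
proof -
  have "(\<integral>\<^sup>+t. ennreal (poisson y (t - x)) \<partial>lborel) = (\<integral>\<^sup>+t. ennreal (y / pi) * ennreal (1 / ((t - x)\<^sup>2 + y\<^sup>2)) \<partial>lborel)"
    using assms by (intro nn_integral_cong) (auto simp: poisson_def ennreal_mult[symmetric] simp del: times_divide_eq_left)
  also have "\<dots> = ennreal (y / pi) * (\<integral>\<^sup>+t. ennreal (1 / ((t - x)\<^sup>2 + y\<^sup>2)) \<partial>lborel)"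
    by (intro nn_integral_cmult) measurable
  also have "\<dots> = 1"
    unfolding nn_integral_inverse_square[OF assms] using assms by (simp add: ennreal_mult''[symmetric])
  finally show ?thesis .
qed

text \<open>The difference between the two heights is the Poisson integral of the difference
  \<open>u\<close> of the lines at \<open>\<delta>\<close> and \<open>\<delta> + \<eta>\<close>. A
  large oscillation somewhere above \<open>x\<close> therefore puts \<open>x\<close> into the set
  handled by the maximal inequality for \<open>|u|^2\<close>, whose integral is at most the energy
  drop.\<close>

lemma vertical_oscillation_measure:
  assumes h: "h \<in> hardy2" and d: "\<delta> > 0" and e: "\<eta> > 0" and l: "l > 0"
  defines "S \<equiv> {x. \<exists>y>0. cmod (h (Complex x (\<delta> + y)) - h (Complex x (\<delta> + \<eta> + y))) > l}"
  shows "S \<in> sets borel"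
    and "ennreal (l\<^sup>2) * emeasure lborel S \<le> ennreal (30 * (line_energy h \<delta> - line_energy h (\<delta> + \<eta>)))"
proof -
  note hol = hardy2_holomorphic[OF h]
  \<comment> \<open>The union over \<open>y\<close> is uncountable, but each member is open, so the
    union is Borel.\<close>
  have S_eq: "S = (\<Union>y\<in>{0<..}. {x. cmod (h (Complex x (\<delta> + y)) - h (Complex x (\<delta> + \<eta> + y))) > l})"
    by (auto simp: S_def)
  have "open S" unfolding S_eq
  proof (intro open_UN ballI open_Collect_less)
    fix y :: real assume "y \<in> {0<..}"
    then show "continuous_on UNIV (\<lambda>x. cmod (h (Complex x (\<delta> + y)) - h (Complex x (\<delta> + \<eta> + y))))"
      using d e by (intro continuous_intros hardy2_continuous_line[OF hol]) auto
  qed auto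
  then show S[measurable]: "S \<in> sets borel" by simp
  have de: "\<delta> + \<eta> > 0" using d e by simp
  have [measurable]: "(\<lambda>x. h (Complex x \<delta>)) \<in> borel_measurable borel" "(\<lambda>x. h (Complex x (\<delta> + \<eta>))) \<in> borel_measurable borel"
    using hardy2_measurable_line[OF hol] d de by auto
  define u where "u = (\<lambda>t. h (Complex t \<delta>) - h (Complex t (\<delta> + \<eta>)))"
  have um[measurable]: "u \<in> borel_measurable borel" unfolding u_def by measurable
  have pint: "integrable lborel (\<lambda>t. complex_of_real (poisson y (t - x)) * h (Complex t a))" if "y > 0" "a > 0" for x y a
  proof -
    have [measurable]: "(\<lambda>x. h (Complex x a)) \<in> borel_measurable borel" using hardy2_measurable_line[OF hol that(2)] .
    have "integrable lborel (\<lambda>t. complex_of_real (y / pi) * (complex_of_real (1 / ((t - x)\<^sup>2 + y\<^sup>2)) * h (Complex t a)))"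
      by (intro integrable_mult_right integrable_inverse_square_mult that hardy2_square_integrable h) measurable
    then show ?thesis by (simp add: poisson_def)
  qed
  have "ennreal (l\<^sup>2) * emeasure lborel S \<le> 30 * (\<integral>\<^sup>+t. ennreal ((cmod (u t))\<^sup>2) \<partial>lborel)"
  proof (rule poisson_maximal_inequality[OF _ S])
    fix x assume "x \<in> S"
    then obtain y where y: "y > 0" "cmod (h (Complex x (\<delta> + y)) - h (Complex x (\<delta> + \<eta> + y))) > l"
      by (auto simp: S_def)
    have "h (Complex x (\<delta> + y)) - h (Complex x (\<delta> + \<eta> + y)) = (\<integral>t. complex_of_real (poisson y (t - x)) * u t \<partial>lborel)"
      unfolding hardy2_poisson[OF h d y(1)] hardy2_poisson[OF h de y(1)] u_def right_diff_distrib
      by (rule Bochner_Integration.integral_diff[symmetric]) (auto intro!: pint y d de)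
    then have "ennreal (cmod (h (Complex x (\<delta> + y)) - h (Complex x (\<delta> + \<eta> + y))))
       \<le> (\<integral>\<^sup>+t. ennreal (cmod (complex_of_real (poisson y (t - x)) * u t)) \<partial>lborel)"
      by (simp only: norm_integral_le_nn_integral)
    \<comment> \<open>The bound \<open>|u| \<le> l/2 + |u|^2 / (2 l)\<close> turns a Poisson average
      of \<open>|u|\<close> above \<open>l\<close> into an average of \<open>|u|^2\<close> above
      \<open>l^2\<close>.\<close>
    also have "\<dots> \<le> (\<integral>\<^sup>+t. ennreal (l / 2) * ennreal (poisson y (t - x)) + ennreal (1 / (2 * l)) * (ennreal (poisson y (t - x)) * ennreal ((cmod (u t))\<^sup>2)) \<partial>lborel)"
    proof (intro nn_integral_mono)
      fix t
      have p: "poisson y (t - x) \<ge> 0" using y by (intro poisson_nonneg) auto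
      have "0 \<le> (cmod (u t) - l)\<^sup>2" by simp
      then have "2 * l * cmod (u t) \<le> l\<^sup>2 + (cmod (u t))\<^sup>2" by (simp add: power2_diff algebra_simps)
      then have "cmod (u t) \<le> l / 2 + 1 / (2 * l) * (cmod (u t))\<^sup>2" using l by (simp add: field_simps power2_eq_square)
      then have "poisson y (t - x) * cmod (u t) \<le> poisson y (t - x) * (l / 2 + 1 / (2 * l) * (cmod (u t))\<^sup>2)"
        using p by (rule mult_left_mono)
      also have "\<dots> = l / 2 * poisson y (t - x) + 1 / (2 * l) * (poisson y (t - x) * (cmod (u t))\<^sup>2)"
        by (simp add: algebra_simps)
      finally have "ennreal (cmod (complex_of_real (poisson y (t - x)) * u t)) \<le> ennreal (l / 2 * poisson y (t - x) + 1 / (2 * l) * (poisson y (t - x) * (cmod (u t))\<^sup>2))"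
        using p by (intro ennreal_leI) (simp add: norm_mult)
      also have "\<dots> = ennreal (l / 2) * ennreal (poisson y (t - x)) + ennreal (1 / (2 * l)) * (ennreal (poisson y (t - x)) * ennreal ((cmod (u t))\<^sup>2))"
        using l p by (subst ennreal_linear_combination) (auto simp: ennreal_mult)
      finally show "ennreal (cmod (complex_of_real (poisson y (t - x)) * u t)) \<le> \<dots>" .
    qed
    also have "\<dots> = ennreal (l / 2) * (\<integral>\<^sup>+t. ennreal (poisson y (t - x)) \<partial>lborel)
        + ennreal (1 / (2 * l)) * (\<integral>\<^sup>+t. (ennreal (poisson y (t - x)) * ennreal ((cmod (u t))\<^sup>2)) \<partial>lborel)"
      by (subst nn_integral_add) (auto simp: nn_integral_cmult)
    also have "\<dots> = ennreal (l / 2) + ennreal (1 / (2 * l)) * (\<integral>\<^sup>+t. (ennreal (poisson y (t - x)) * ennreal ((cmod (u t))\<^sup>2)) \<partial>lborel)"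
      using poisson_integral[OF y(1), of x] by simp
    finally have le: "ennreal (cmod (h (Complex x (\<delta> + y)) - h (Complex x (\<delta> + \<eta> + y)))) \<le> \<dots>" .
    have "(\<integral>\<^sup>+t. (ennreal (poisson y (t - x)) * ennreal ((cmod (u t))\<^sup>2)) \<partial>lborel) > ennreal (l\<^sup>2)"
    proof (rule ccontr)
      assume "\<not> ?thesis"
      then have "ennreal (cmod (h (Complex x (\<delta> + y)) - h (Complex x (\<delta> + \<eta> + y)))) \<le> ennreal (l / 2) + ennreal (1 / (2 * l)) * ennreal (l\<^sup>2)"
        by (intro order.trans[OF le] add_left_mono mult_left_mono) (auto simp: not_less)
      also have "\<dots> = ennreal (l / 2 + 1 / (2 * l) * l\<^sup>2)"
        using l by (simp add: ennreal_mult''[symmetric] ennreal_plus[symmetric] del: ennreal_plus)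
      also have "l / 2 + 1 / (2 * l) * l\<^sup>2 = l" using l by (simp add: power2_eq_square field_simps)
      finally show False using y(2) l by (simp add: ennreal_le_iff)
    qed
    then show "\<exists>y>0. (\<integral>\<^sup>+t. (ennreal (poisson y (t - x)) * ennreal ((cmod (u t))\<^sup>2)) \<partial>lborel) > ennreal (l\<^sup>2)"
      using y by auto
  qed (use l in auto)
  also have "\<dots> \<le> 30 * ennreal (line_energy h \<delta> - line_energy h (\<delta> + \<eta>))"
    unfolding u_def using d e by (intro mult_left_mono line_diff_energy_le[OF h]) auto
  also have "\<dots> = ennreal (30 * (line_energy h \<delta> - line_energy h (\<delta> + \<eta>)))"
    using line_energy_antimono[OF h d, of "\<delta> + \<eta>"] e by (simp add: ennreal_mult del: right_diff_distrib_numeral)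
  finally show "ennreal (l\<^sup>2) * emeasure lborel S \<le> ennreal (30 * (line_energy h \<delta> - line_energy h (\<delta> + \<eta>)))" .
qed

text \<open>The lower line tends to the real axis along \<open>\<eta> / (n + 1)\<close>; the
  exceptional sets increase with \<open>n\<close>, since a lower starting height only allows more
  values of \<open>y\<close>. As \<open>\<delta> n + \<eta> \<le> 2 \<eta>\<close> and the energy
  decreases with the height, one bound with \<open>2 \<eta>\<close> serves all
  \<open>n\<close>.\<close>

lemma vertical_oscillation_measure_0:
  assumes h: "h \<in> hardy2" and e: "\<eta> > 0" and l: "l > 0"
    and L: "\<And>y. y > 0 \<Longrightarrow> line_energy h y \<le> L"
  defines "A \<equiv> {x. \<exists>y>0. cmod (h (Complex x y) - h (Complex x (\<eta> + y))) > l}"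
  shows "A \<in> sets borel"
    and "ennreal (l\<^sup>2) * emeasure lborel A \<le> ennreal (30 * (L - line_energy h (2 * \<eta>)))"
proof -
  define \<delta> where "\<delta> = (\<lambda>n. \<eta> / real (Suc n))"
  have d: "\<delta> n > 0" "\<delta> n \<le> \<eta>" for n using e by (auto simp: \<delta>_def field_simps)
  define S where "S = (\<lambda>n. {x. \<exists>y>0. cmod (h (Complex x (\<delta> n + y)) - h (Complex x (\<delta> n + \<eta> + y))) > l})"
  have S[measurable]: "S n \<in> sets borel" for n
    unfolding S_def by (rule vertical_oscillation_measure(1)[OF h d(1) e l])
  have SA: "A = (\<Union>n. S n)"
  proof (intro equalityI subsetI)
    fix x assume "x \<in> A"
    then obtain y where y: "y > 0" "cmod (h (Complex x y) - h (Complex x (\<eta> + y))) > l" by (auto simp: A_def)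
    have "\<delta> \<longlonglongrightarrow> 0" unfolding \<delta>_def by (rule LIMSEQ_Suc[OF lim_const_over_n])
    then have "\<forall>\<^sub>F n in sequentially. \<delta> n < y" using y(1) by (rule order_tendstoD)
    then obtain n where n: "\<delta> n < y" using eventually_happens'[OF sequentially_bot] by blast
    then have "\<delta> n + (y - \<delta> n) = y" "\<delta> n + \<eta> + (y - \<delta> n) = \<eta> + y" "y - \<delta> n > 0" by auto
    then have "x \<in> S n" using y(2) unfolding S_def mem_Collect_eq by metis
    then show "x \<in> (\<Union>n. S n)" by auto
  next
    fix x assume "x \<in> (\<Union>n. S n)"
    then obtain n y where y: "y > 0" "cmod (h (Complex x (\<delta> n + y)) - h (Complex x (\<delta> n + \<eta> + y))) > l"
      by (auto simp: S_def)
    have "\<delta> n + \<eta> + y = \<eta> + (\<delta> n + y)" "\<delta> n + y > 0" using y(1) d[of n] by auto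
    then show "x \<in> A" unfolding A_def mem_Collect_eq using y(2) by metis
  qed
  show "A \<in> sets borel" unfolding SA by measurable
  have inc: "incseq S"
  proof (intro monoI subsetI)
    fix m n :: nat and x assume mn: "m \<le> n" and "x \<in> S m"
    then obtain y where y: "y > 0" "cmod (h (Complex x (\<delta> m + y)) - h (Complex x (\<delta> m + \<eta> + y))) > l"
      by (auto simp: S_def)
    have "\<delta> n \<le> \<delta> m" using mn e unfolding \<delta>_def by (intro divide_left_mono) auto
    then have "\<delta> n + (\<delta> m - \<delta> n + y) = \<delta> m + y" "\<delta> n + \<eta> + (\<delta> m - \<delta> n + y) = \<delta> m + \<eta> + y" "\<delta> m - \<delta> n + y > 0"
      using y(1) by auto
    then show "x \<in> S n" using y(2) unfolding S_def mem_Collect_eq by metis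
  qed
  have "emeasure lborel A = (SUP n. emeasure lborel (S n))"
    unfolding SA by (rule SUP_emeasure_incseq[symmetric]) (use inc in auto)
  then have "ennreal (l\<^sup>2) * emeasure lborel A = (SUP n. ennreal (l\<^sup>2) * emeasure lborel (S n))"
    by (simp add: SUP_mult_left_ennreal)
  also have "\<dots> \<le> ennreal (30 * (L - line_energy h (2 * \<eta>)))"
  proof (rule SUP_least)
    fix n
    have "ennreal (l\<^sup>2) * emeasure lborel (S n) \<le> ennreal (30 * (line_energy h (\<delta> n) - line_energy h (\<delta> n + \<eta>)))"
      unfolding S_def by (rule vertical_oscillation_measure(2)[OF h d(1) e l])
    also have "\<dots> \<le> ennreal (30 * (L - line_energy h (2 * \<eta>)))"
    proof (intro ennreal_leI mult_left_mono diff_mono)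
      show "line_energy h (\<delta> n) \<le> L" by (rule L[OF d(1)])
      show "line_energy h (2 * \<eta>) \<le> line_energy h (\<delta> n + \<eta>)"
        using d[of n] e by (intro line_energy_antimono h) auto
    qed auto
    finally show "ennreal (l\<^sup>2) * emeasure lborel (S n) \<le> ennreal (30 * (L - line_energy h (2 * \<eta>)))" .
  qed
  finally show "ennreal (l\<^sup>2) * emeasure lborel A \<le> ennreal (30 * (L - line_energy h (2 * \<eta>)))" .
qed

text \<open>The thresholds run through \<open>1 / (n + 1)\<close> and the inequality is weak, so
  that the set of good \<open>x\<close> is a countable intersection of countable unions of closed
  sets and hence Borel.\<close>

definition vertically_Cauchy :: "(complex \<Rightarrow> complex) \<Rightarrow> real \<Rightarrow> bool" where
  "vertically_Cauchy h x \<longleftrightarrow> (\<forall>m. \<exists>j. \<forall>y\<in>{0<..<1 / real (Suc j)}. \<forall>y'\<in>{0<..<1 / real (Suc j)}.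
     cmod (h (Complex x y) - h (Complex x y')) \<le> 1 / real (Suc m))"

lemma vertically_CauchyD:
  assumes "vertically_Cauchy h x" "e > 0"
  obtains d where "d > 0" "\<And>y y'. 0 < y \<Longrightarrow> y < d \<Longrightarrow> 0 < y' \<Longrightarrow> y' < d \<Longrightarrow> cmod (h (Complex x y) - h (Complex x y')) < e"
proof -
  obtain m where m: "1 / real (Suc m) < e" using assms(2) by (meson nat_approx_posE)
  obtain j where j: "\<forall>y\<in>{0<..<1 / real (Suc j)}. \<forall>y'\<in>{0<..<1 / real (Suc j)}. cmod (h (Complex x y) - h (Complex x y')) \<le> 1 / real (Suc m)"
    using assms(1) unfolding vertically_Cauchy_def by blast
  show ?thesis
  proof (rule that[of "1 / real (Suc j)"])
    fix y y' assume y: "0 < y" "y < 1 / real (Suc j)" "0 < y'" "y' < 1 / real (Suc j)"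
    then have "cmod (h (Complex x y) - h (Complex x y')) \<le> 1 / real (Suc m)"
      using j by (metis greaterThanLessThan_iff)
    then show "cmod (h (Complex x y) - h (Complex x y')) < e" using m by linarith
  qed simp
qed

lemma vertically_Cauchy_tendsto:
  assumes "vertically_Cauchy h x"
  shows "((\<lambda>y. h (Complex x y)) \<longlongrightarrow> lim (\<lambda>n. h (Complex x (1 / real (Suc n))))) (at_right 0)"
proof -
  have "Cauchy (\<lambda>n. h (Complex x (1 / real (Suc n))))"
  proof (rule metric_CauchyI)
    fix e :: real assume "e > 0"
    then obtain d where d: "d > 0" "\<And>y y'. 0 < y \<Longrightarrow> y < d \<Longrightarrow> 0 < y' \<Longrightarrow> y' < d \<Longrightarrow> cmod (h (Complex x y) - h (Complex x y')) < e"
      using vertically_CauchyD[OF assms] by metis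
    obtain M where M: "1 / real (Suc M) < d" using d(1) by (meson nat_approx_posE)
    have "1 / real (Suc n) < d" if "n \<ge> M" for n
      by (rule le_less_trans[OF _ M]) (use that in \<open>auto intro!: divide_left_mono\<close>)
    then show "\<exists>M. \<forall>m\<ge>M. \<forall>n\<ge>M. dist (h (Complex x (1 / real (Suc m)))) (h (Complex x (1 / real (Suc n)))) < e"
      using d(2) by (intro exI[of _ M]) (auto simp: dist_norm)
  qed
  then have lim: "(\<lambda>n. h (Complex x (1 / real (Suc n)))) \<longlonglongrightarrow> lim (\<lambda>n. h (Complex x (1 / real (Suc n))))"
    by (rule convergent_LIMSEQ_iff[THEN iffD1, OF Cauchy_convergent])
  show ?thesis
  proof (rule tendstoI)
    fix e :: real assume "e > 0"
    then have e2: "e / 2 > 0" by simp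
    then obtain d where d: "d > 0" "\<And>y y'. 0 < y \<Longrightarrow> y < d \<Longrightarrow> 0 < y' \<Longrightarrow> y' < d \<Longrightarrow> cmod (h (Complex x y) - h (Complex x y')) < e / 2"
      using vertically_CauchyD[OF assms] by metis
    have "(\<lambda>n. 1 / real (Suc n)) \<longlonglongrightarrow> 0" by (rule LIMSEQ_Suc[OF lim_1_over_n])
    then have "\<forall>\<^sub>F n in sequentially. 1 / real (Suc n) < d" using d(1) by (rule order_tendstoD)
    moreover have "\<forall>\<^sub>F n in sequentially. dist (h (Complex x (1 / real (Suc n)))) (lim (\<lambda>n. h (Complex x (1 / real (Suc n))))) < e / 2"
      using lim e2 by (rule tendstoD)
    ultimately have "\<forall>\<^sub>F n in sequentially. 1 / real (Suc n) < d \<and> dist (h (Complex x (1 / real (Suc n)))) (lim (\<lambda>n. h (Complex x (1 / real (Suc n))))) < e / 2"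
      by (rule eventually_conj)
    then obtain n where n: "1 / real (Suc n) < d" "dist (h (Complex x (1 / real (Suc n)))) (lim (\<lambda>n. h (Complex x (1 / real (Suc n))))) < e / 2"
      using eventually_happens'[OF sequentially_bot] by blast
    have "eventually (\<lambda>y. y \<in> {0<..<d}) (at_right 0)" using d(1) by (rule eventually_at_right_real)
    then show "\<forall>\<^sub>F y in at_right 0. dist (h (Complex x y)) (lim (\<lambda>n. h (Complex x (1 / real (Suc n))))) < e"
    proof eventually_elim
      case (elim y)
      have "dist (h (Complex x y)) (h (Complex x (1 / real (Suc n)))) < e / 2"
        unfolding dist_norm using elim n by (intro d) auto
      then show ?case
        using n(2) dist_triangle[of "h (Complex x y)" "lim (\<lambda>n. h (Complex x (1 / real (Suc n))))" "h (Complex x (1 / real (Suc n)))"]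
        by linarith
    qed
  qed
qed

lemma tendsto_vertically_Cauchy:
  assumes "((\<lambda>y. h (Complex x y)) \<longlongrightarrow> l) (at_right 0)"
  shows "vertically_Cauchy h x"
  unfolding vertically_Cauchy_def
proof
  fix m
  have "\<forall>\<^sub>F y in at_right 0. dist (h (Complex x y)) l < 1 / real (Suc m) / 2"
    using assms by (rule tendstoD) simp
  then obtain b where b: "b > 0" "\<And>y. 0 < y \<Longrightarrow> y < b \<Longrightarrow> dist (h (Complex x y)) l < 1 / real (Suc m) / 2"
    unfolding eventually_at_right_field by auto
  obtain j where j: "1 / real (Suc j) < b" using b(1) by (meson nat_approx_posE)
  have "cmod (h (Complex x y) - h (Complex x y')) \<le> 1 / real (Suc m)"
    if "y \<in> {0<..<1 / real (Suc j)}" "y' \<in> {0<..<1 / real (Suc j)}" for y y'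
  proof -
    have "dist (h (Complex x y)) (h (Complex x y')) < 1 / real (Suc m)"
      using that j by (intro dist_triangle_half_l[OF b(2) b(2)]) auto
    then show ?thesis by (simp add: dist_norm)
  qed
  then show "\<exists>j. \<forall>y\<in>{0<..<1 / real (Suc j)}. \<forall>y'\<in>{0<..<1 / real (Suc j)}. cmod (h (Complex x y) - h (Complex x y')) \<le> 1 / real (Suc m)"
    by blast
qed

lemma hardy_bv_eqI:
  "((\<lambda>y. f (Complex x y)) \<longlongrightarrow> l) (at_right 0) \<Longrightarrow> hardy_bv f x = l"
  unfolding hardy_bv_def by (rule tendsto_Lim) auto

lemma hardy_bv_measurable [measurable]:
  assumes hol: "h holomorphic_on upper_half"
  shows "hardy_bv h \<in> borel_measurable borel"
proof -
  \<comment> \<open>Where the limit fails to exist, \<open>Lim\<close> takes the default value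
    \<open>THE l. False\<close>, the same for all such \<open>x\<close>; so
    \<open>hardy_bv h\<close> is Borel on the whole line and not merely up to a null set.\<close>
  have eq: "hardy_bv h x = (if vertically_Cauchy h x then lim (\<lambda>n. h (Complex x (1 / real (Suc n)))) else (THE l. False))" for x
  proof (cases "vertically_Cauchy h x")
    case True
    then show ?thesis using hardy_bv_eqI[OF vertically_Cauchy_tendsto[OF True]] by simp
  next
    case False
    then have "\<And>l. ((\<lambda>y. h (Complex x y)) \<longlongrightarrow> l) (at_right 0) \<longleftrightarrow> False"
      using tendsto_vertically_Cauchy by blast
    then show ?thesis using False by (simp add: hardy_bv_def Topological_Spaces.Lim_def)
  qed
  have set: "{x. vertically_Cauchy h x} = (\<Inter>m. \<Union>j. \<Inter>y\<in>{0<..<1 / real (Suc j)}. \<Inter>y'\<in>{0<..<1 / real (Suc j)}.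
     {x. cmod (h (Complex x y) - h (Complex x y')) \<le> 1 / real (Suc m)})"
    by (auto simp: vertically_Cauchy_def)
  have "closed {x. cmod (h (Complex x y) - h (Complex x y')) \<le> 1 / real (Suc m)}" if "y > 0" "y' > 0" for y y' m
    by (intro closed_Collect_le continuous_intros hardy2_continuous_line[OF hol] that)
  then have "closed (\<Inter>y\<in>{0<..<1 / real (Suc j)}. \<Inter>y'\<in>{0<..<1 / real (Suc j)}.
     {x. cmod (h (Complex x y) - h (Complex x y')) \<le> 1 / real (Suc m)})" for j m
    by (intro closed_INT ballI) auto
  then have [measurable]: "{x. vertically_Cauchy h x} \<in> sets borel"
    unfolding set by (intro sets.countable_INT'' sets.countable_UN) (auto intro: borel_closed)
  have [measurable]: "Measurable.pred borel (vertically_Cauchy h)"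
    by (rule pred_def[THEN iffD2]) simp
  have [measurable]: "(\<lambda>x. h (Complex x (1 / real (Suc n)))) \<in> borel_measurable borel" for n
    by (rule hardy2_measurable_line[OF hol]) simp
  show ?thesis unfolding eq[abs_def] by measurable
qed

text \<open>If \<open>x\<close> escapes \<open>A m' j\<close>, then \<open>h\<close> on the vertical
  line through \<open>x\<close> stays within \<open>1 / (m' + 1)\<close> of its upward shift by
  \<open>1 / (j + 1)\<close>, and the shifted function is continuous down to the axis. The points
  lying in \<open>A m j\<close> for every \<open>j\<close> form a null set, since the energy at
  height \<open>2 / (j + 1)\<close> tends to its upper bound \<open>L\<close>.\<close>

lemma hardy2_vertically_Cauchy_AE:
  assumes h: "h \<in> hardy2"
  shows "AE x in lborel. vertically_Cauchy h x"
proof -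
  obtain L where L: "(line_energy h \<longlongrightarrow> L) (at_right 0)" "\<And>y. y > 0 \<Longrightarrow> line_energy h y \<le> L"
    using line_energy_limit[OF h] by metis
  define A where "A = (\<lambda>m j. {x. \<exists>y>0. cmod (h (Complex x y) - h (Complex x (1 / real (Suc j) + y))) > 1 / real (Suc m)})"
  have Am: "A m j \<in> sets borel" for m j unfolding A_def
    by (rule vertical_oscillation_measure_0(1)[OF h _ _ L(2)]) auto
  have Ab: "ennreal ((1 / real (Suc m))\<^sup>2) * emeasure lborel (A m j) \<le> ennreal (30 * (L - line_energy h (2 * (1 / real (Suc j)))))" for m j
    unfolding A_def by (rule vertical_oscillation_measure_0(2)[OF h _ _ L(2)]) auto
  have null: "(\<Inter>j. A m j) \<in> null_sets lborel" for m
  proof -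
    have mb: "(\<Inter>j. A m j) \<in> sets borel" by (intro sets.countable_INT'') (auto intro: Am)
    have "filterlim (\<lambda>j. 2 * (1 / real (Suc j))) (at_right 0) sequentially"
      unfolding filterlim_at using tendsto_mult_right_zero[OF LIMSEQ_Suc[OF lim_1_over_n], of 2] by auto
    from filterlim_compose[OF L(1) this]
    have "(\<lambda>j. ennreal (30 * (L - line_energy h (2 * (1 / real (Suc j)))))) \<longlonglongrightarrow> ennreal (30 * (L - L))"
      by (intro tendsto_intros)
    moreover have "ennreal ((1 / real (Suc m))\<^sup>2) * emeasure lborel (\<Inter>j. A m j) \<le> ennreal (30 * (L - line_energy h (2 * (1 / real (Suc j)))))" for j
      by (rule order.trans[OF _ Ab]) (auto intro!: mult_left_mono emeasure_mono Am)
    ultimately have "ennreal ((1 / real (Suc m))\<^sup>2) * emeasure lborel (\<Inter>j. A m j) \<le> ennreal (30 * (L - L))"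
      by (intro tendsto_lowerbound[of _ _ sequentially]) auto
    then have "emeasure lborel (\<Inter>j. A m j) = 0" by simp
    then show ?thesis using mb by auto
  qed
  then have "(\<Union>m. \<Inter>j. A m j) \<in> null_sets lborel" by (rule null_sets_UN)
  then show ?thesis
  proof (rule AE_I')
    show "{x \<in> space lborel. \<not> vertically_Cauchy h x} \<subseteq> (\<Union>m. \<Inter>j. A m j)"
    proof (rule ccontr)
      assume "\<not> ?thesis"
      then obtain x where x: "\<not> vertically_Cauchy h x" "x \<notin> (\<Union>m. \<Inter>j. A m j)" by blast
      have "vertically_Cauchy h x" unfolding vertically_Cauchy_def
      proof
        fix m
        \<comment> \<open>Each of the two points is compared with \<open>h\<close> at height
          \<open>1 / (j + 1)\<close> at a cost of \<open>2 / (m' + 1)\<close>, so four errors have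
          to fit into \<open>1 / (m + 1)\<close>.\<close>
        define m' where "m' = 4 * Suc m"
        obtain j where "x \<notin> A m' j" using x(2) by auto
        then have j: "cmod (h (Complex x y) - h (Complex x (1 / real (Suc j) + y))) \<le> 1 / real (Suc m')" if "y > 0" for y
          using that unfolding A_def mem_Collect_eq by (meson not_less)
        have "isCont h (Complex x (1 / real (Suc j)))"
          using hardy2_holomorphic[OF h] open_upper_half
          by (intro continuous_on_interior[OF holomorphic_on_imp_continuous_on]) (auto simp: interior_open upper_half_iff)
        have "((\<lambda>y. Complex x (1 / real (Suc j) + y)) \<longlongrightarrow> Complex x (1 / real (Suc j) + 0)) (at_right 0)"
          by (intro tendsto_intros)
        then have "((\<lambda>y. h (Complex x (1 / real (Suc j) + y))) \<longlongrightarrow> h (Complex x (1 / real (Suc j)))) (at_right 0)"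
          using \<open>isCont h (Complex x (1 / real (Suc j)))\<close> by (intro isCont_tendsto_compose[of _ h]) auto
        then have "\<forall>\<^sub>F y in at_right 0. dist (h (Complex x (1 / real (Suc j) + y))) (h (Complex x (1 / real (Suc j)))) < 1 / real (Suc m')"
          by (rule tendstoD) simp
        then obtain b where b: "b > 0" "\<And>y. 0 < y \<Longrightarrow> y < b \<Longrightarrow> dist (h (Complex x (1 / real (Suc j) + y))) (h (Complex x (1 / real (Suc j)))) < 1 / real (Suc m')"
          unfolding eventually_at_right_field by auto
        obtain k where k: "1 / real (Suc k) < b" using b(1) by (meson nat_approx_posE)
        have "cmod (h (Complex x y) - h (Complex x y')) \<le> 1 / real (Suc m)"
          if y: "y \<in> {0<..<1 / real (Suc k)}" "y' \<in> {0<..<1 / real (Suc k)}" for y y'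
        proof -
          let ?c = "h (Complex x (1 / real (Suc j)))"
          have "dist (h (Complex x y)) ?c \<le> 2 * (1 / real (Suc m'))" if "y \<in> {0<..<1 / real (Suc k)}" for y
            using dist_triangle[of "h (Complex x y)" ?c "h (Complex x (1 / real (Suc j) + y))"] j[of y] b(2)[of y] that k
            by (auto simp: dist_norm)
          from this[OF y(1)] this[OF y(2)] have "dist (h (Complex x y)) (h (Complex x y')) \<le> 4 * (1 / real (Suc m'))"
            using dist_triangle2[of "h (Complex x y)" "h (Complex x y')" ?c] by linarith
          also have "\<dots> \<le> 1 / real (Suc m)" by (simp add: m'_def field_simps)
          finally show ?thesis by (simp add: dist_norm)
        qed
        then show "\<exists>j. \<forall>y\<in>{0<..<1 / real (Suc j)}. \<forall>y'\<in>{0<..<1 / real (Suc j)}. cmod (h (Complex x y) - h (Complex x y')) \<le> 1 / real (Suc m)"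
          by blast
      qed
      then show False using x(1) by simp
    qed
  qed
qed

lemma hardy_bv_tendsto_AE:
  assumes h: "h \<in> hardy2"
  shows "AE x in lborel. ((\<lambda>y. h (Complex x y)) \<longlongrightarrow> hardy_bv h x) (at_right 0)"
  using hardy2_vertically_Cauchy_AE[OF h]
proof eventually_elim
  case (elim x)
  show ?case using vertically_Cauchy_tendsto[OF elim] hardy_bv_eqI[OF vertically_Cauchy_tendsto[OF elim]] by simp
qed

section \<open>Convergence in L^2 and the Cauchy formula for boundary values\<close>

lemma at_right_0_inverse_Suc: "filterlim (\<lambda>j. 1 / real (Suc j)) (at_right 0) sequentially"
  unfolding filterlim_at using LIMSEQ_Suc[OF lim_1_over_n[where 'a=real]] by auto

text \<open>Fatou's lemma, applied to the distances from the lines at height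
  \<open>1 / (n + 1)\<close>, each of which is at most an energy drop.\<close>

lemma hardy_bv_L2_distance:
  assumes h: "h \<in> hardy2" and e: "\<epsilon> > 0" and L: "\<And>y. y > 0 \<Longrightarrow> line_energy h y \<le> L"
  shows "(\<integral>\<^sup>+x. ennreal ((cmod (h (Complex x \<epsilon>) - hardy_bv h x))\<^sup>2) \<partial>lborel) \<le> ennreal (L - line_energy h \<epsilon>)"
proof -
  note hol = hardy2_holomorphic[OF h]
  have [measurable]: "(\<lambda>x. h (Complex x \<epsilon>)) \<in> borel_measurable borel" by (rule hardy2_measurable_line[OF hol e])
  have [measurable]: "(\<lambda>x. h (Complex x (1 / real (Suc n)))) \<in> borel_measurable borel" for n
    by (rule hardy2_measurable_line[OF hol]) simp
  define u where "u = (\<lambda>n x. ennreal ((cmod (h (Complex x \<epsilon>) - h (Complex x (1 / real (Suc n)))))\<^sup>2))"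
  have um: "u n \<in> borel_measurable lborel" for n unfolding u_def by measurable
  have "(\<integral>\<^sup>+x. ennreal ((cmod (h (Complex x \<epsilon>) - hardy_bv h x))\<^sup>2) \<partial>lborel) = (\<integral>\<^sup>+x. liminf (\<lambda>n. u n x) \<partial>lborel)"
  proof (rule nn_integral_cong_AE)
    show "AE x in lborel. ennreal ((cmod (h (Complex x \<epsilon>) - hardy_bv h x))\<^sup>2) = liminf (\<lambda>n. u n x)"
      using hardy_bv_tendsto_AE[OF h]
    proof eventually_elim
      case (elim x)
      have "(\<lambda>n. h (Complex x (1 / real (Suc n)))) \<longlonglongrightarrow> hardy_bv h x"
        by (rule filterlim_compose[OF elim at_right_0_inverse_Suc])
      then have "(\<lambda>n. u n x) \<longlonglongrightarrow> ennreal ((cmod (h (Complex x \<epsilon>) - hardy_bv h x))\<^sup>2)"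
        unfolding u_def by (intro tendsto_intros)
      then show ?case by (simp add: lim_imp_Liminf)
    qed
  qed
  also have "\<dots> \<le> liminf (\<lambda>n. \<integral>\<^sup>+x. u n x \<partial>lborel)"
    by (rule nn_integral_liminf) (rule um)
  also have "\<dots> \<le> ennreal (L - line_energy h \<epsilon>)"
  proof -
    have "\<forall>\<^sub>F n in sequentially. (\<integral>\<^sup>+x. u n x \<partial>lborel) \<le> ennreal (L - line_energy h \<epsilon>)"
    proof -
      have "\<forall>\<^sub>F n in sequentially. 1 / real (Suc n) < \<epsilon>"
        using LIMSEQ_Suc[OF lim_1_over_n] e by (rule order_tendstoD)
      then show ?thesis
      proof eventually_elim
        case (elim n)
        have "(\<integral>\<^sup>+x. u n x \<partial>lborel) \<le> ennreal (line_energy h (1 / real (Suc n)) - line_energy h \<epsilon>)"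
          using line_diff_energy_le[OF h, of "1 / real (Suc n)" \<epsilon>] elim by (simp add: u_def norm_minus_commute)
        also have "\<dots> \<le> ennreal (L - line_energy h \<epsilon>)" using L[of "1 / real (Suc n)"] by (intro ennreal_leI) auto
        finally show ?case .
      qed
    qed
    from Liminf_mono[OF this] show ?thesis by (simp add: Liminf_const)
  qed
  finally show ?thesis .
qed

lemma cmod_integral_mult_le:
  fixes p q :: "real \<Rightarrow> complex"
  assumes [measurable]: "p \<in> borel_measurable lborel" "q \<in> borel_measurable lborel"
    and P: "(\<integral>\<^sup>+x. ennreal ((cmod (p x))\<^sup>2) \<partial>lborel) \<le> ennreal P" "P \<ge> 0"
    and Q: "(\<integral>\<^sup>+x. ennreal ((cmod (q x))\<^sup>2) \<partial>lborel) \<le> ennreal Q" "Q \<ge> 0"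
  shows "cmod (\<integral>x. p x * q x \<partial>lborel) \<le> sqrt (P * Q)"
proof -
  have "ennreal (cmod (\<integral>x. p x * q x \<partial>lborel)) \<le> (\<integral>\<^sup>+x. ennreal (cmod (p x)) * ennreal (cmod (q x)) \<partial>lborel)"
    using norm_integral_le_nn_integral[of lborel "\<lambda>x. p x * q x"] by (simp add: norm_mult ennreal_mult)
  then have "(ennreal (cmod (\<integral>x. p x * q x \<partial>lborel)))\<^sup>2 \<le> (\<integral>\<^sup>+x. ennreal (cmod (p x)) * ennreal (cmod (q x)) \<partial>lborel)\<^sup>2"
    by (intro power_mono) auto
  also have "\<dots> \<le> (\<integral>\<^sup>+x. (ennreal (cmod (p x)))\<^sup>2 \<partial>lborel) * (\<integral>\<^sup>+x. (ennreal (cmod (q x)))\<^sup>2 \<partial>lborel)"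
    by (rule Cauchy_Schwarz_nn_integral) measurable
  also have "\<dots> \<le> ennreal P * ennreal Q"
    using P Q by (intro mult_mono) (auto simp: ennreal_power)
  finally have "ennreal ((cmod (\<integral>x. p x * q x \<partial>lborel))\<^sup>2) \<le> ennreal (P * Q)"
    using P Q by (simp add: ennreal_power ennreal_mult)
  then have "(cmod (\<integral>x. p x * q x \<partial>lborel))\<^sup>2 \<le> P * Q"
    using P Q by (simp add: ennreal_le_iff)
  then show ?thesis by (rule real_le_rsqrt)
qed

lemma sum_L2_nn_bound:
  fixes a b :: "real \<Rightarrow> complex"
  assumes [measurable]: "a \<in> borel_measurable lborel" "b \<in> borel_measurable lborel"
    and A: "(\<integral>\<^sup>+x. ennreal ((cmod (a x))\<^sup>2) \<partial>lborel) \<le> ennreal A" "A \<ge> 0"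
    and B: "(\<integral>\<^sup>+x. ennreal ((cmod (b x))\<^sup>2) \<partial>lborel) \<le> ennreal B" "B \<ge> 0"
  shows "(\<integral>\<^sup>+x. ennreal ((cmod (a x - b x))\<^sup>2) \<partial>lborel) \<le> ennreal (2 * A + 2 * B)"
proof -
  have "(\<integral>\<^sup>+x. ennreal ((cmod (a x - b x))\<^sup>2) \<partial>lborel)
    \<le> (\<integral>\<^sup>+x. ennreal 2 * ennreal ((cmod (a x))\<^sup>2) + ennreal 2 * ennreal ((cmod (b x))\<^sup>2) \<partial>lborel)"
  proof (rule nn_integral_mono)
    fix x
    have "(cmod (a x - b x))\<^sup>2 \<le> (cmod (a x) + cmod (b x))\<^sup>2"
      by (intro power_mono norm_triangle_ineq4) auto
    also have "\<dots> \<le> 2 * (cmod (a x))\<^sup>2 + 2 * (cmod (b x))\<^sup>2"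
      using sum_squares_bound[of "cmod (a x)" "cmod (b x)"] by (simp add: power2_sum)
    finally have "ennreal ((cmod (a x - b x))\<^sup>2) \<le> ennreal (2 * (cmod (a x))\<^sup>2 + 2 * (cmod (b x))\<^sup>2)"
      by (rule ennreal_leI)
    then show "ennreal ((cmod (a x - b x))\<^sup>2) \<le> ennreal 2 * ennreal ((cmod (a x))\<^sup>2) + ennreal 2 * ennreal ((cmod (b x))\<^sup>2)"
      by (subst (asm) ennreal_linear_combination) auto
  qed
  also have "\<dots> = ennreal 2 * (\<integral>\<^sup>+x. ennreal ((cmod (a x))\<^sup>2) \<partial>lborel) + ennreal 2 * (\<integral>\<^sup>+x. ennreal ((cmod (b x))\<^sup>2) \<partial>lborel)"
    by (subst nn_integral_add) (auto simp: nn_integral_cmult simp del: ennreal_numeral)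
  also have "\<dots> \<le> ennreal 2 * ennreal A + ennreal 2 * ennreal B"
    by (intro add_mono mult_left_mono A B) auto
  also have "\<dots> = ennreal (2 * A + 2 * B)" using A B by (subst ennreal_linear_combination) auto
  finally show ?thesis .
qed

lemma hardy_bv_L2:
  assumes h: "h \<in> hardy2"
  obtains C where "C \<ge> 0" "(\<integral>\<^sup>+x. ennreal ((cmod (hardy_bv h x))\<^sup>2) \<partial>lborel) \<le> ennreal C"
proof -
  obtain A where A: "A \<ge> 0" "\<And>y. y > 0 \<Longrightarrow> (\<integral>\<^sup>+ x. ennreal ((cmod (h (Complex x y)))\<^sup>2) \<partial>lborel) \<le> ennreal A"
    using hardy2_bound[OF h] by metis
  obtain L where L: "\<And>y. y > 0 \<Longrightarrow> line_energy h y \<le> L" using line_energy_limit[OF h] by metis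
  note hol = hardy2_holomorphic[OF h]
  have [measurable]: "(\<lambda>x. h (Complex x 1)) \<in> borel_measurable borel" by (rule hardy2_measurable_line[OF hol]) simp
  have [measurable]: "hardy_bv h \<in> borel_measurable borel" by (rule hardy_bv_measurable[OF hol])
  have "(\<integral>\<^sup>+x. ennreal ((cmod (h (Complex x 1) - (h (Complex x 1) - hardy_bv h x)))\<^sup>2) \<partial>lborel) \<le> ennreal (2 * A + 2 * (L - line_energy h 1))"
    by (rule sum_L2_nn_bound) (use A hardy_bv_L2_distance[OF h _ L, of 1] L[of 1] in auto)
  then have "(\<integral>\<^sup>+x. ennreal ((cmod (hardy_bv h x))\<^sup>2) \<partial>lborel) \<le> ennreal (2 * A + 2 * (L - line_energy h 1))" by simp
  then show ?thesis using that[of "2 * A + 2 * (L - line_energy h 1)"] A L[of 1] by auto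
qed

lemma integrable_cmod_squared:
  fixes u :: "real \<Rightarrow> complex"
  assumes "u \<in> borel_measurable borel" "(\<integral>\<^sup>+x. ennreal ((cmod (u x))\<^sup>2) \<partial>lborel) \<le> ennreal C"
  shows "integrable lborel (\<lambda>x. (cmod (u x))\<^sup>2)"
  using assms by (intro integrableI_bounded) (auto intro: le_less_trans)

lemma hardy_bv_square_integrable:
  assumes "h \<in> hardy2"
  shows "integrable lborel (\<lambda>x. (cmod (hardy_bv h x))\<^sup>2)"
proof -
  obtain C where "(\<integral>\<^sup>+x. ennreal ((cmod (hardy_bv h x))\<^sup>2) \<partial>lborel) \<le> ennreal C"
    using hardy_bv_L2[OF assms] by metis
  then show ?thesis by (intro integrable_cmod_squared hardy_bv_measurable hardy2_holomorphic assms)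
qed

lemma L2_product_tendsto:
  fixes u v :: "nat \<Rightarrow> real \<Rightarrow> complex" and u0 v0 :: "real \<Rightarrow> complex"
  assumes [measurable]: "\<And>n. u n \<in> borel_measurable borel" "\<And>n. v n \<in> borel_measurable borel"
      "u0 \<in> borel_measurable borel" "v0 \<in> borel_measurable borel"
    and u: "\<And>n. (\<integral>\<^sup>+x. ennreal ((cmod (u n x - u0 x))\<^sup>2) \<partial>lborel) \<le> ennreal (a n)" "a \<longlonglongrightarrow> 0" "\<And>n. a n \<ge> 0"
    and v: "\<And>n. (\<integral>\<^sup>+x. ennreal ((cmod (v n x - v0 x))\<^sup>2) \<partial>lborel) \<le> ennreal (b n)" "b \<longlonglongrightarrow> 0" "\<And>n. b n \<ge> 0"
    and un: "\<And>n. (\<integral>\<^sup>+x. ennreal ((cmod (u n x))\<^sup>2) \<partial>lborel) \<le> ennreal C" and C: "C \<ge> 0"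
    and v0: "(\<integral>\<^sup>+x. ennreal ((cmod (v0 x))\<^sup>2) \<partial>lborel) \<le> ennreal D" and D: "D \<ge> 0"
  shows "(\<lambda>n. \<integral>x. u n x * v n x \<partial>lborel) \<longlonglongrightarrow> (\<integral>x. u0 x * v0 x \<partial>lborel)"
proof -
  have i: "integrable lborel (\<lambda>x. (cmod (u n x))\<^sup>2)" for n by (rule integrable_cmod_squared[OF _ un]) measurable
  have iv0: "integrable lborel (\<lambda>x. (cmod (v0 x))\<^sup>2)" by (rule integrable_cmod_squared[OF _ v0]) measurable
  have iu: "integrable lborel (\<lambda>x. (cmod (u n x - u0 x))\<^sup>2)" for n by (rule integrable_cmod_squared[OF _ u(1)]) measurable
  have iv: "integrable lborel (\<lambda>x. (cmod (v n x - v0 x))\<^sup>2)" for n by (rule integrable_cmod_squared[OF _ v(1)]) measurable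
  have i1: "integrable lborel (\<lambda>x. u n x * (v n x - v0 x))" for n by (rule integrable_mult_L2) (use i iv in auto)
  have i2: "integrable lborel (\<lambda>x. u n x * v0 x)" for n by (rule integrable_mult_L2) (use i iv0 in auto)
  have i3: "integrable lborel (\<lambda>x. (u n x - u0 x) * v0 x)" for n by (rule integrable_mult_L2) (use iu iv0 in auto)
  have dec: "(\<integral>x. u n x * v n x \<partial>lborel) - (\<integral>x. u0 x * v0 x \<partial>lborel)
      = (\<integral>x. u n x * (v n x - v0 x) \<partial>lborel) + (\<integral>x. (u n x - u0 x) * v0 x \<partial>lborel)" for n
  proof -
    have i4: "integrable lborel (\<lambda>x. u n x * v n x)"
      using Bochner_Integration.integrable_add[OF i1[of n] i2[of n]] by (simp add: algebra_simps)
    have i5: "integrable lborel (\<lambda>x. u0 x * v0 x)"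
      using Bochner_Integration.integrable_diff[OF i2[of n] i3[of n]] by (simp add: algebra_simps)
    show ?thesis
      unfolding Bochner_Integration.integral_diff[OF i4 i5, symmetric] Bochner_Integration.integral_add[OF i1 i3, symmetric]
      by (intro Bochner_Integration.integral_cong) (auto simp: algebra_simps)
  qed
  have "(\<lambda>n. (\<integral>x. u n x * v n x \<partial>lborel) - (\<integral>x. u0 x * v0 x \<partial>lborel)) \<longlonglongrightarrow> 0"
  proof (rule Lim_null_comparison)
    show "\<forall>\<^sub>F n in sequentially. norm ((\<integral>x. u n x * v n x \<partial>lborel) - (\<integral>x. u0 x * v0 x \<partial>lborel)) \<le> sqrt (C * b n) + sqrt (a n * D)"
    proof (rule always_eventually, rule allI)
      fix n
      have "cmod (\<integral>x. u n x * (v n x - v0 x) \<partial>lborel) \<le> sqrt (C * b n)"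
        by (rule cmod_integral_mult_le) (use un v C in auto)
      moreover have "cmod (\<integral>x. (u n x - u0 x) * v0 x \<partial>lborel) \<le> sqrt (a n * D)"
        by (rule cmod_integral_mult_le) (use u v0 D in auto)
      ultimately show "norm ((\<integral>x. u n x * v n x \<partial>lborel) - (\<integral>x. u0 x * v0 x \<partial>lborel)) \<le> sqrt (C * b n) + sqrt (a n * D)"
        unfolding dec by (intro order.trans[OF norm_triangle_ineq] add_mono)
    qed
    have "(\<lambda>n. sqrt (C * b n) + sqrt (a n * D)) \<longlonglongrightarrow> sqrt (C * 0) + sqrt (0 * D)"
      by (intro tendsto_intros u v)
    then show "(\<lambda>n. sqrt (C * b n) + sqrt (a n * D)) \<longlonglongrightarrow> 0" by simp
  qed
  then show ?thesis by (simp add: LIM_zero_iff)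
qed

lemma hardy_bv_L2_tendsto:
  assumes h: "h \<in> hardy2"
  obtains a where "\<And>n. (\<integral>\<^sup>+x. ennreal ((cmod (h (Complex x (1 / real (Suc n))) - hardy_bv h x))\<^sup>2) \<partial>lborel) \<le> ennreal (a n)"
    "a \<longlonglongrightarrow> 0" "\<And>n. a n \<ge> (0::real)"
proof -
  obtain L where L: "(line_energy h \<longlongrightarrow> L) (at_right 0)" "\<And>y. y > 0 \<Longrightarrow> line_energy h y \<le> L"
    using line_energy_limit[OF h] by metis
  show ?thesis
  proof (rule that[of "\<lambda>n. L - line_energy h (1 / real (Suc n))"])
    show "(\<integral>\<^sup>+x. ennreal ((cmod (h (Complex x (1 / real (Suc n))) - hardy_bv h x))\<^sup>2) \<partial>lborel) \<le> ennreal (L - line_energy h (1 / real (Suc n)))" for n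
      by (rule hardy_bv_L2_distance[OF h _ L(2)]) auto
    have "(\<lambda>n. L - line_energy h (1 / real (Suc n))) \<longlonglongrightarrow> L - L"
      by (intro tendsto_intros filterlim_compose[OF L(1) at_right_0_inverse_Suc])
    then show "(\<lambda>n. L - line_energy h (1 / real (Suc n))) \<longlonglongrightarrow> 0" by simp
    show "L - line_energy h (1 / real (Suc n)) \<ge> 0" for n using L(2)[of "1 / real (Suc n)"] by simp
  qed
qed

text \<open>The source of the vanishing integrals below: paired with \<open>1 / (z - w)\<close> for
  \<open>Im w < 0\<close> it removes one of the two kernels in the Cauchy formula, and paired with a
  Blaschke multiple it puts reciprocals of entire functions into the model space.\<close>

lemma hardy_bv_mult_integral_zero:
  assumes f: "f \<in> hardy2" and g: "g \<in> hardy2"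
  shows "(\<integral>x. hardy_bv f x * hardy_bv g x \<partial>lborel) = 0"
proof -
  obtain a where a: "\<And>n. (\<integral>\<^sup>+x. ennreal ((cmod (f (Complex x (1 / real (Suc n))) - hardy_bv f x))\<^sup>2) \<partial>lborel) \<le> ennreal (a n)"
    "a \<longlonglongrightarrow> 0" "\<And>n. a n \<ge> (0::real)" using hardy_bv_L2_tendsto[OF f] by metis
  obtain b where b: "\<And>n. (\<integral>\<^sup>+x. ennreal ((cmod (g (Complex x (1 / real (Suc n))) - hardy_bv g x))\<^sup>2) \<partial>lborel) \<le> ennreal (b n)"
    "b \<longlonglongrightarrow> 0" "\<And>n. b n \<ge> (0::real)" using hardy_bv_L2_tendsto[OF g] by metis
  obtain C where C: "C \<ge> 0" "\<And>y. y > 0 \<Longrightarrow> (\<integral>\<^sup>+ x. ennreal ((cmod (f (Complex x y)))\<^sup>2) \<partial>lborel) \<le> ennreal C"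
    using hardy2_bound[OF f] by metis
  obtain D where D: "D \<ge> 0" "(\<integral>\<^sup>+x. ennreal ((cmod (hardy_bv g x))\<^sup>2) \<partial>lborel) \<le> ennreal D"
    using hardy_bv_L2[OF g] by metis
  have "(\<lambda>n. \<integral>x. f (Complex x (1 / real (Suc n))) * g (Complex x (1 / real (Suc n))) \<partial>lborel) \<longlonglongrightarrow> (\<integral>x. hardy_bv f x * hardy_bv g x \<partial>lborel)"
    by (rule L2_product_tendsto[OF _ _ _ _ a b C(2) C(1) D(2) D(1)])
      (auto intro!: hardy2_measurable_line hardy_bv_measurable hardy2_holomorphic f g)
  moreover have "(\<lambda>n. \<integral>x. f (Complex x (1 / real (Suc n))) * g (Complex x (1 / real (Suc n))) \<partial>lborel) = (\<lambda>n. 0)"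
    by (intro ext hardy2_mult_integral_zero f g) simp
  ultimately show ?thesis by (metis LIMSEQ_unique tendsto_const)
qed

lemma hardy_bv_kernel:
  assumes "Im w < 0"
  shows "hardy_bv (\<lambda>z. 1 / (z - w)) x = 1 / (complex_of_real x - w)"
proof (rule hardy_bv_eqI)
  have "((\<lambda>y. Complex x y) \<longlongrightarrow> Complex x 0) (at_right 0)" by (intro tendsto_intros)
  then have "((\<lambda>y. Complex x y) \<longlongrightarrow> of_real x) (at_right 0)" by (simp add: complex_of_real_def)
  then show "((\<lambda>y. 1 / (Complex x y - w)) \<longlongrightarrow> 1 / (complex_of_real x - w)) (at_right 0)"
    by (intro tendsto_intros) (use assms in \<open>auto simp: complex_eq_iff\<close>)
qed

lemma hardy_bv_lower_kernel_integral:
  assumes h: "h \<in> hardy2" and w: "Im w < 0"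
  shows "(\<integral>t. hardy_bv h t / (of_real t - w) \<partial>lborel) = 0"
  using hardy_bv_mult_integral_zero[OF h kernel_hardy2[OF w]] by (simp add: hardy_bv_kernel[OF w])

lemma kernel_square_integral:
  assumes "Im w \<noteq> 0"
  shows "(\<integral>\<^sup>+t. ennreal ((cmod (1 / (of_real t - w)))\<^sup>2) \<partial>lborel) = ennreal (pi / \<bar>Im w\<bar>)"
proof -
  have "(cmod (1 / (of_real t - w)))\<^sup>2 = 1 / ((t - Re w)\<^sup>2 + \<bar>Im w\<bar>\<^sup>2)" for t
    by (simp add: norm_divide power_divide cmod_power2)
  then show ?thesis using nn_integral_inverse_square[of "\<bar>Im w\<bar>" "Re w"] assms by simp
qed

lemma integrable_kernel_mult:
  assumes [measurable]: "F \<in> borel_measurable borel" and F: "integrable lborel (\<lambda>x. (cmod (F x))\<^sup>2)"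
    and w: "Im w \<noteq> 0"
  shows "integrable lborel (\<lambda>t. F t / (of_real t - w))"
proof -
  have "integrable lborel (\<lambda>t. F t * (1 / (of_real t - w)))"
    by (rule integrable_mult_L2) (use F integrable_cmod_squared[OF _ eq_refl[OF kernel_square_integral[OF w]]] in auto)
  then show ?thesis by simp
qed

lemma hardy_bv_poisson:
  assumes h: "h \<in> hardy2" and y: "y > 0"
  shows "h (Complex x y) = (\<integral>t. complex_of_real (poisson y (t - x)) * hardy_bv h t \<partial>lborel)"
proof -
  note hol = hardy2_holomorphic[OF h]
  obtain b where b: "\<And>n. (\<integral>\<^sup>+x. ennreal ((cmod (h (Complex x (1 / real (Suc n))) - hardy_bv h x))\<^sup>2) \<partial>lborel) \<le> ennreal (b n)"
    "b \<longlonglongrightarrow> 0" "\<And>n. b n \<ge> (0::real)" using hardy_bv_L2_tendsto[OF h] by metis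
  obtain D where D: "D \<ge> 0" "(\<integral>\<^sup>+x. ennreal ((cmod (hardy_bv h x))\<^sup>2) \<partial>lborel) \<le> ennreal D"
    using hardy_bv_L2[OF h] by metis
  define C where "C = 1 / (pi * y)"
  have P: "(\<integral>\<^sup>+t. ennreal ((cmod (complex_of_real (poisson y (t - x))))\<^sup>2) \<partial>lborel) \<le> ennreal C"
  proof -
    have "(\<integral>\<^sup>+t. ennreal ((cmod (complex_of_real (poisson y (t - x))))\<^sup>2) \<partial>lborel) \<le> (\<integral>\<^sup>+t. ennreal C * ennreal (poisson y (t - x)) \<partial>lborel)"
    proof (rule nn_integral_mono)
      fix t
      have p: "0 \<le> poisson y (t - x)" using y by (intro poisson_nonneg) auto
      have "poisson y (t - x) \<le> y / (pi * y\<^sup>2)" unfolding poisson_def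
        using y by (intro divide_left_mono mult_left_mono) (auto intro!: mult_pos_pos add_nonneg_pos)
      also have "\<dots> = C" using y by (simp add: C_def power2_eq_square)
      finally have "(poisson y (t - x))\<^sup>2 \<le> C * poisson y (t - x)"
        unfolding power2_eq_square using p by (rule mult_right_mono)
      then show "ennreal ((cmod (complex_of_real (poisson y (t - x))))\<^sup>2) \<le> ennreal C * ennreal (poisson y (t - x))"
        using y p by (simp add: ennreal_mult[symmetric] C_def)
    qed
    also have "\<dots> = ennreal C" using poisson_integral[OF y, of x] by (simp add: nn_integral_cmult)
    finally show ?thesis .
  qed
  have "(\<lambda>n. \<integral>t. complex_of_real (poisson y (t - x)) * h (Complex t (1 / real (Suc n))) \<partial>lborel)
    \<longlonglongrightarrow> (\<integral>t. complex_of_real (poisson y (t - x)) * hardy_bv h t \<partial>lborel)"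
    by (rule L2_product_tendsto[OF _ _ _ _ _ _ _ b P _ D(2) D(1), where a="\<lambda>_. 0"])
      (use y in \<open>auto intro!: hardy2_measurable_line hardy_bv_measurable hol simp: C_def\<close>)
  moreover have "(\<lambda>n. \<integral>t. complex_of_real (poisson y (t - x)) * h (Complex t (1 / real (Suc n))) \<partial>lborel) = (\<lambda>n. h (Complex x (1 / real (Suc n) + y)))"
    by (intro ext hardy2_poisson[symmetric] h y) simp
  moreover have "(\<lambda>n. h (Complex x (1 / real (Suc n) + y))) \<longlonglongrightarrow> h (Complex x (0 + y))"
  proof (rule isCont_tendsto_compose[of _ h])
    show "isCont h (Complex x (0 + y))"
      using hol open_upper_half y
      by (intro continuous_on_interior[OF holomorphic_on_imp_continuous_on]) (auto simp: interior_open upper_half_iff)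
    show "(\<lambda>n. Complex x (1 / real (Suc n) + y)) \<longlonglongrightarrow> Complex x (0 + y)"
      by (intro tendsto_intros LIMSEQ_Suc[OF lim_1_over_n])
  qed
  ultimately show ?thesis using LIMSEQ_unique by fastforce
qed

text \<open>The Poisson kernel is, up to a constant, the difference of the Cauchy kernels at
  \<open>w\<close> and \<open>cnj w\<close>, and the second integrates to 0 against a Hardy
  function.\<close>

lemma hardy_bv_cauchy:
  assumes h: "h \<in> hardy2" and w: "w \<in> upper_half"
  shows "h w = 1 / (2 * of_real pi * \<i>) * (\<integral>t. hardy_bv h t / (of_real t - w) \<partial>lborel)"
proof -
  have y: "Im w > 0" using w by (simp add: upper_half_iff)
  note F = hardy_bv_measurable[OF hardy2_holomorphic[OF h]] hardy_bv_square_integrable[OF h]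
  have i1: "integrable lborel (\<lambda>t. hardy_bv h t / (of_real t - w))" by (rule integrable_kernel_mult[OF F]) (use y in auto)
  have i2: "integrable lborel (\<lambda>t. hardy_bv h t / (of_real t - cnj w))" by (rule integrable_kernel_mult[OF F]) (use y in auto)
  have eq: "complex_of_real (poisson (Im w) (t - Re w)) * hardy_bv h t
     = 1 / (2 * of_real pi * \<i>) * (hardy_bv h t / (of_real t - w) - hardy_bv h t / (of_real t - cnj w))" for t
  proof -
    have 1: "of_real t - w \<noteq> 0" "of_real t - cnj w \<noteq> 0" using y by (auto simp: complex_eq_iff)
    have 2: "(of_real t - w) * (of_real t - cnj w) = complex_of_real ((t - Re w)\<^sup>2 + (Im w)\<^sup>2)"
      by (simp add: complex_eq_iff power2_eq_square algebra_simps)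
    have 3: "w - cnj w = 2 * \<i> * of_real (Im w)" by (simp add: complex_eq_iff)
    have "hardy_bv h t / (of_real t - w) - hardy_bv h t / (of_real t - cnj w) = hardy_bv h t * (w - cnj w) / ((of_real t - w) * (of_real t - cnj w))"
      using 1 by (simp add: field_simps)
    then have "1 / (2 * of_real pi * \<i>) * (hardy_bv h t / (of_real t - w) - hardy_bv h t / (of_real t - cnj w))
      = hardy_bv h t * of_real (Im w) / (of_real pi * complex_of_real ((t - Re w)\<^sup>2 + (Im w)\<^sup>2))"
      unfolding 2 3 by simp
    then show ?thesis by (simp add: poisson_def)
  qed
  have "h w = h (Complex (Re w) (Im w))" by simp
  also have "\<dots> = (\<integral>t. complex_of_real (poisson (Im w) (t - Re w)) * hardy_bv h t \<partial>lborel)"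
    by (rule hardy_bv_poisson[OF h y])
  also have "\<dots> = 1 / (2 * of_real pi * \<i>) * ((\<integral>t. hardy_bv h t / (of_real t - w) \<partial>lborel) - (\<integral>t. hardy_bv h t / (of_real t - cnj w) \<partial>lborel))"
    unfolding eq integral_mult_right_zero Bochner_Integration.integral_diff[OF i1 i2] by simp
  also have "(\<integral>t. hardy_bv h t / (of_real t - cnj w) \<partial>lborel) = 0"
    by (rule hardy_bv_lower_kernel_integral[OF h]) (use y in simp)
  finally show ?thesis by simp
qed

section \<open>Blaschke products with unit-spaced zeros\<close>

text \<open>Index \<open>n\<close> carries the zero with real part \<open>n + 1\<close>, the shift
  used in \<open>B1\<close>. Unit spacing and a common bound on the imaginary parts drive the
  product and residue estimates.\<close>

locale unit_spaced_zeros =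
  fixes a :: "nat \<Rightarrow> complex" and Y :: real
  assumes Re_a: "Re (a n) = real (Suc n)" and Im_pos: "Im (a n) > 0" and Im_le: "Im (a n) \<le> Y"
begin

lemma Y_pos: "Y > 0"
  using Im_pos[of 0] Im_le[of 0] by linarith

lemma a_nonzero: "a n \<noteq> 0"
  using Im_pos[of n] by (auto simp: complex_eq_iff)

lemma cmod_a_ge: "cmod (a n) \<ge> real (Suc n)"
  using complex_Re_le_cmod[of "a n"] Re_a[of n] by simp

lemma off_pole: "Im z \<ge> 0 \<Longrightarrow> z \<noteq> cnj (a n)"
  using Im_pos[of n] by auto

lemma a_square_plus_1_nonzero: "(a n)\<^sup>2 + 1 \<noteq> 0"
proof -
  have "(a n)\<^sup>2 + 1 = (a n - \<i>) * (a n + \<i>)" by (simp add: algebra_simps power2_eq_square)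
  moreover have "a n - \<i> \<noteq> 0" "a n + \<i> \<noteq> 0" using Re_a[of n] by (auto simp: complex_eq_iff)
  ultimately show ?thesis by simp
qed

lemma unimodular_const:
  "cmod (complex_of_real (cmod ((a n)\<^sup>2 + 1)) / ((a n)\<^sup>2 + 1)) = 1"
  using a_square_plus_1_nonzero[of n] by (simp add: norm_divide)

lemma cmod_blaschke_factor:
  "cmod (blaschke_factor (a n) z) = cmod (z - a n) / cmod (z - cnj (a n))"
  unfolding blaschke_factor_def norm_mult unimodular_const by (simp add: norm_divide)

lemma cmod_blaschke_factor_le: "Im z \<ge> 0 \<Longrightarrow> cmod (blaschke_factor (a n) z) \<le> 1"
proof -
  assume z: "Im z \<ge> 0"
  have "0 \<le> Im z * Im (a n)" using z Im_pos[of n] by simp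
  then have "cmod (z - a n) \<le> cmod (z - cnj (a n))"
    unfolding cmod_def by (intro real_sqrt_le_mono) (simp add: power2_eq_square algebra_simps)
  then show ?thesis unfolding cmod_blaschke_factor by (simp add: divide_le_eq_1)
qed

text \<open>The factors are normalised to be positive at the imaginary unit, so the comparison with 1 goes
  through the value there; without the unimodular constant the deviation would only be of order 1/n.\<close>

lemma blaschke_factor_minus_1:
  assumes z: "2 * cmod z \<le> real (Suc n)"
  shows "cmod (blaschke_factor (a n) z - 1) \<le> 4 * Y * (2 + cmod z) / (real (Suc n))\<^sup>2"
proof -
  define A where "A = a n"
  define u where "u = complex_of_real (cmod (A\<^sup>2 + 1)) / (A\<^sup>2 + 1)"
  define N where "N = real (Suc n)"
  have N: "N > 0" by (simp add: N_def)
  have Re: "Re A = N" and Im: "Im A > 0" "Im A \<le> Y" using Re_a Im_pos Im_le by (auto simp: A_def N_def)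
  have u1: "cmod u = 1" unfolding u_def A_def by (rule unimodular_const)
  have b: "blaschke_factor A z = u * ((z - A) / (z - cnj A))" for z by (simp add: blaschke_factor_def u_def)
  have Ni: "cmod (A + \<i>) \<ge> N" "cmod (\<i> - cnj A) \<ge> N"
    using abs_Re_le_cmod[of "A + \<i>"] abs_Re_le_cmod[of "\<i> - cnj A"] Re N by auto
  have Nz: "cmod (z - cnj A) \<ge> N / 2"
    using norm_triangle_ineq2[of "cnj A" z] complex_Re_le_cmod[of A] z Re
    by (simp add: norm_minus_commute N_def)
  have "cmod (z - cnj A) > 0" "cmod (\<i> - cnj A) > 0" "cmod (A + \<i>) > 0" using Nz Ni N by linarith+
  moreover have "A - \<i> \<noteq> 0" using Re N by (auto simp: complex_eq_iff)
  ultimately have nz: "z - cnj A \<noteq> 0" "\<i> - cnj A \<noteq> 0" "A - \<i> \<noteq> 0" "A + \<i> \<noteq> 0" by auto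
  have "blaschke_factor A \<i> = complex_of_real (cmod (A - \<i>) / cmod (A + \<i>))"
  proof -
    have 1: "A\<^sup>2 + 1 = (A - \<i>) * (A + \<i>)" by (simp add: algebra_simps power2_eq_square)
    have "(\<i> - A) / (\<i> - cnj A) = (A - \<i>) / cnj (A + \<i>)"
    proof -
      have "\<i> - A = - (A - \<i>)" "\<i> - cnj A = - cnj (A + \<i>)" by simp_all
      then show ?thesis by (simp only: divide_minus_left divide_minus_right minus_minus)
    qed
    also have "\<dots> = (A - \<i>) * (A + \<i>) / complex_of_real ((cmod (A + \<i>))\<^sup>2)"
      using nz by (simp add: complex_norm_square del: of_real_power)
    finally have "blaschke_factor A \<i> = complex_of_real (cmod (A - \<i>) * cmod (A + \<i>)) / ((A - \<i>) * (A + \<i>)) * ((A - \<i>) * (A + \<i>) / complex_of_real ((cmod (A + \<i>))\<^sup>2))"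
      unfolding b u_def 1 norm_mult by simp
    also have "\<dots> = complex_of_real (cmod (A - \<i>) * cmod (A + \<i>)) / complex_of_real ((cmod (A + \<i>))\<^sup>2)"
      using nz by simp
    also have "\<dots> = complex_of_real (cmod (A - \<i>) / cmod (A + \<i>))"
      using nz by (simp add: power2_eq_square)
    finally show ?thesis .
  qed
  \<comment> \<open>Since \<open>|A + \<i>|^2 - |A - \<i>|^2 = 4 Im A\<close>, the positive value at
    the imaginary unit misses 1 only by order \<open>Y / N^2\<close>.\<close>
  moreover have "cmod (complex_of_real (cmod (A - \<i>) / cmod (A + \<i>)) - 1) \<le> 4 * Y / N\<^sup>2"
  proof -
    define r where "r = cmod (A - \<i>) / cmod (A + \<i>)"
    have "(cmod (A - \<i>))\<^sup>2 = (cmod (A + \<i>))\<^sup>2 - 4 * Im A"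
      unfolding cmod_power2 by (simp add: power2_eq_square algebra_simps)
    then have r2: "r\<^sup>2 = ((cmod (A + \<i>))\<^sup>2 - 4 * Im A) / (cmod (A + \<i>))\<^sup>2"
      by (simp only: r_def power_divide)
    then have r2': "1 - r\<^sup>2 = 4 * Im A / (cmod (A + \<i>))\<^sup>2" using nz by (simp add: field_simps)
    have r0: "r \<ge> 0" by (simp add: r_def)
    have "r\<^sup>2 \<le> 1" using r2' Im by (smt (verit) divide_nonneg_nonneg zero_le_power2)
    then have r1: "r \<le> 1" using power2_le_imp_le[of r 1] by simp
    have "cmod (complex_of_real r - 1) = \<bar>r - 1\<bar>"
      by (metis norm_of_real of_real_1 of_real_diff)
    also have "\<dots> = 1 - r" using r1 by simp
    also have "\<dots> \<le> 1 - r\<^sup>2" using r0 r1 by (simp add: power2_eq_square mult_left_le)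
    also have "\<dots> \<le> 4 * Y / N\<^sup>2" unfolding r2'
      using Im Ni N by (intro frac_le power_mono) auto
    finally show ?thesis by (simp add: r_def)
  qed
  moreover have "cmod (blaschke_factor A z - blaschke_factor A \<i>) \<le> 4 * Y * (1 + cmod z) / N\<^sup>2"
  proof -
    have "(z - A) / (z - cnj A) - (\<i> - A) / (\<i> - cnj A) = (A - cnj A) * (z - \<i>) / ((\<i> - cnj A) * (z - cnj A))"
      using nz by (simp add: field_simps)
    then have "blaschke_factor A z - blaschke_factor A \<i> = u * ((A - cnj A) * (z - \<i>) / ((\<i> - cnj A) * (z - cnj A)))"
      unfolding b by (simp only: right_diff_distrib[symmetric])
    then have "cmod (blaschke_factor A z - blaschke_factor A \<i>) = cmod (A - cnj A) * cmod (z - \<i>) / (cmod (\<i> - cnj A) * cmod (z - cnj A))"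
      by (simp add: norm_mult norm_divide u1)
    also have "cmod (A - cnj A) = 2 * Im A"
      using Im by (simp add: complex_diff_cnj norm_mult)
    also have "2 * Im A * cmod (z - \<i>) / (cmod (\<i> - cnj A) * cmod (z - cnj A)) \<le> 2 * Y * (1 + cmod z) / (N * (N / 2))"
      using Im Ni Nz N norm_triangle_ineq4[of z \<i>]
      by (intro frac_le mult_mono) auto
    also have "\<dots> = 4 * Y * (1 + cmod z) / N\<^sup>2" using N by (simp add: power2_eq_square)
    finally show ?thesis .
  qed
  ultimately have "cmod (blaschke_factor A z - 1) \<le> 4 * Y * (1 + cmod z) / N\<^sup>2 + 4 * Y / N\<^sup>2"
    using norm_triangle_ineq[of "blaschke_factor A z - blaschke_factor A \<i>" "blaschke_factor A \<i> - 1"] by simp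
  also have "\<dots> = 4 * Y * (2 + cmod z) / N\<^sup>2" by (simp add: add_divide_distrib[symmetric] algebra_simps)
  finally show ?thesis by (simp add: A_def N_def)
qed

lemma summable_inverse_Suc_square: "summable (\<lambda>n. C / (real (Suc n))\<^sup>2)"
  using summable_mult[OF inverse_power_summable[of 2, where 'a=real], of C]
  by (subst summable_Suc_iff) (simp add: field_simps)

text \<open>Factors outside \<open>S\<close> are replaced by 1 instead of being reindexed, so the
  products over \<open>S\<close> and \<open>- S\<close> multiply term by term to the full product,
  and one convergence proof serves every \<open>S\<close>.\<close>

definition sub_factor :: "nat set \<Rightarrow> nat \<Rightarrow> complex \<Rightarrow> complex" where
  "sub_factor S n z = (if n \<in> S then blaschke_factor (a n) z else 1)"

definition sub_blaschke :: "nat set \<Rightarrow> complex \<Rightarrow> complex" where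
  "sub_blaschke S z = (\<Prod>n. sub_factor S n z)"

lemma sub_blaschke_UNIV: "sub_blaschke UNIV = blaschke a"
  by (rule ext) (simp add: sub_blaschke_def sub_factor_def blaschke_def)

lemma sub_factor_minus_1:
  assumes "cmod z \<le> \<rho>"
  shows "\<forall>\<^sub>F n in sequentially. cmod (sub_factor S n z - 1) \<le> 4 * Y * (2 + \<rho>) / (real (Suc n))\<^sup>2"
proof -
  have "\<forall>\<^sub>F n in sequentially. n \<ge> nat \<lceil>2 * \<rho>\<rceil>" by (rule eventually_ge_at_top)
  then show ?thesis
  proof eventually_elim
    case (elim n)
    then have "2 * \<rho> \<le> real (Suc n)" by linarith
    then have "2 * cmod z \<le> real (Suc n)" using assms by linarith
    from blaschke_factor_minus_1[OF this]
    have "cmod (blaschke_factor (a n) z - 1) \<le> 4 * Y * (2 + \<rho>) / (real (Suc n))\<^sup>2"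
      by (rule order.trans) (use assms Y_pos in \<open>auto intro!: divide_right_mono mult_left_mono\<close>)
    moreover have "0 \<le> 4 * Y * (2 + \<rho>) / (real (Suc n))\<^sup>2"
      using Y_pos order.trans[OF norm_ge_zero assms] by (intro divide_nonneg_nonneg mult_nonneg_nonneg) auto
    ultimately show ?case unfolding sub_factor_def by (simp split: if_splits)
  qed
qed

lemma summable_sub_factor: "summable (\<lambda>n. cmod (sub_factor S n z - 1))"
  by (rule summable_comparison_test_ev[OF _ summable_inverse_Suc_square])
    (use sub_factor_minus_1[of z "cmod z" S] in simp)

lemma convergent_prod_sub_factor: "convergent_prod (\<lambda>n. sub_factor S n z)"
  using summable_imp_abs_convergent_prod[OF summable_sub_factor] by (rule abs_convergent_prod_imp_convergent_prod)

lemma sub_blaschke_LIMSEQ: "(\<lambda>N. \<Prod>n<N. sub_factor S n z) \<longlonglongrightarrow> sub_blaschke S z"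
  using convergent_prod_LIMSEQ[OF convergent_prod_sub_factor[of S z]]
  unfolding sub_blaschke_def LIMSEQ_lessThan_iff_atMost .

lemma sub_blaschke_split: "sub_blaschke S z * sub_blaschke (- S) z = blaschke a z"
  unfolding sub_blaschke_UNIV[symmetric] sub_blaschke_def
    prodinf_mult[OF convergent_prod_sub_factor convergent_prod_sub_factor]
  by (intro arg_cong[where f=prodinf] ext) (auto simp: sub_factor_def)

lemma continuous_on_sub_factor: "continuous_on {z. Im z \<ge> 0} (sub_factor S n)"
proof (cases "n \<in> S")
  case True
  then have "sub_factor S n = (\<lambda>z. blaschke_factor (a n) z)" by (auto simp: sub_factor_def)
  then show ?thesis unfolding blaschke_factor_def
    using a_square_plus_1_nonzero[of n] by (auto intro!: continuous_intros simp: off_pole)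
next
  case False
  then have "sub_factor S n = (\<lambda>z. 1)" by (auto simp: sub_factor_def)
  then show ?thesis by simp
qed

text \<open>The compact sets include a piece of the real line, where no factor has a pole. This
  makes every subproduct continuous up to the boundary, so that its vertical limits are its values
  there.\<close>

lemma sub_blaschke_uniform_limit:
  "uniform_limit ({z. Im z \<ge> 0} \<inter> cball 0 \<rho>) (\<lambda>N z. \<Prod>n<N. sub_factor S n z) (sub_blaschke S) sequentially"
proof -
  define K where "K = {z. Im z \<ge> 0} \<inter> cball (0::complex) \<rho>"
  have cK: "compact K" unfolding K_def by (intro closed_Int_compact closed_halfspace_Im_ge compact_cball)
  have "uniformly_convergent_on K (\<lambda>N z. \<Prod>n<N. sub_factor S n z)"
  proof (rule uniformly_convergent_on_prod'[OF _ cK])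
    show "continuous_on K (sub_factor S n)" for n
      by (rule continuous_on_subset[OF continuous_on_sub_factor]) (auto simp: K_def)
    have "\<forall>\<^sub>F n in sequentially. \<forall>z\<in>K. norm (cmod (sub_factor S n z - 1)) \<le> 4 * Y * (2 + \<rho>) / (real (Suc n))\<^sup>2"
    proof (cases "\<rho> < 0")
      case True then show ?thesis by (simp add: K_def)
    next
      case False
      have "\<forall>\<^sub>F n in sequentially. n \<ge> nat \<lceil>2 * \<rho>\<rceil>" by (rule eventually_ge_at_top)
      then show ?thesis
      proof eventually_elim
        case (elim n)
        show ?case
        proof
          fix z assume "z \<in> K"
          then have z: "cmod z \<le> \<rho>" by (simp add: K_def)
          have "2 * cmod z \<le> real (Suc n)" using elim z by linarith
          from blaschke_factor_minus_1[OF this]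
          have "cmod (blaschke_factor (a n) z - 1) \<le> 4 * Y * (2 + \<rho>) / (real (Suc n))\<^sup>2"
            by (rule order.trans) (use z Y_pos in \<open>auto intro!: divide_right_mono mult_left_mono\<close>)
          moreover have "0 \<le> 4 * Y * (2 + \<rho>) / (real (Suc n))\<^sup>2"
            using Y_pos False by (intro divide_nonneg_nonneg mult_nonneg_nonneg) auto
          ultimately show "norm (cmod (sub_factor S n z - 1)) \<le> 4 * Y * (2 + \<rho>) / (real (Suc n))\<^sup>2"
            unfolding sub_factor_def by (simp split: if_splits)
        qed
      qed
    qed
    from Weierstrass_m_test_ev[OF this summable_inverse_Suc_square]
    show "uniformly_convergent_on K (\<lambda>N z. \<Sum>n<N. norm (sub_factor S n z - 1))"
      by (rule uniformly_convergentI)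
  qed
  then obtain l where l: "uniform_limit K (\<lambda>N z. \<Prod>n<N. sub_factor S n z) l sequentially"
    by (auto simp: uniformly_convergent_on_def)
  have eq: "l z = sub_blaschke S z" if "z \<in> K" for z
    using tendsto_uniform_limitI[OF l that] sub_blaschke_LIMSEQ by (rule LIMSEQ_unique)
  show ?thesis using l unfolding K_def[symmetric] uniform_limit_sequentially_iff by (simp add: eq)
qed

lemma holomorphic_sub_factor: "sub_factor S n holomorphic_on upper_half"
proof (cases "n \<in> S")
  case True
  then have "sub_factor S n = (\<lambda>z. blaschke_factor (a n) z)" by (auto simp: sub_factor_def)
  then show ?thesis unfolding blaschke_factor_def
    using off_pole a_square_plus_1_nonzero[of n] by (auto intro!: holomorphic_intros simp: upper_half_iff less_imp_le)
next
  case False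
  then have "sub_factor S n = (\<lambda>z. 1)" by (auto simp: sub_factor_def)
  then show ?thesis by simp
qed

lemma holomorphic_sub_blaschke: "sub_blaschke S holomorphic_on upper_half"
proof (rule holomorphic_uniform_sequence[OF open_upper_half, of "\<lambda>N z. \<Prod>n<N. sub_factor S n z"])
  show "(\<lambda>z. \<Prod>n<N. sub_factor S n z) holomorphic_on upper_half" for N
    by (intro holomorphic_intros holomorphic_sub_factor)
  fix z assume z: "z \<in> upper_half"
  obtain d where d: "d > 0" "cball z d \<subseteq> upper_half"
    using open_contains_cball[THEN iffD1, OF open_upper_half] z by auto
  have sub: "cball z d \<subseteq> {z. Im z \<ge> 0} \<inter> cball 0 (cmod z + d)"
  proof
    fix w assume w: "w \<in> cball z d"
    then have "Im w > 0" using d by (auto simp: upper_half_iff)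
    moreover have "cmod w \<le> cmod z + d" using w norm_triangle_sub[of w z] by (simp add: dist_norm norm_minus_commute)
    ultimately show "w \<in> {z. Im z \<ge> 0} \<inter> cball 0 (cmod z + d)" by simp
  qed
  show "\<exists>d>0. cball z d \<subseteq> upper_half \<and> uniform_limit (cball z d) (\<lambda>N z. \<Prod>n<N. sub_factor S n z) (sub_blaschke S) sequentially"
    using d uniform_limit_on_subset[OF sub_blaschke_uniform_limit sub] by blast
qed

lemma sub_blaschke_vertical_limit:
  "((\<lambda>y. sub_blaschke S (Complex x y)) \<longlongrightarrow> sub_blaschke S (of_real x)) (at_right 0)"
proof -
  define K where "K = {z. Im z \<ge> 0} \<inter> cball (0::complex) (\<bar>x\<bar> + 1)"
  have c: "continuous_on K (\<lambda>z. \<Prod>n<N. sub_factor S n z)" for N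
  proof (intro continuous_intros)
    fix n
    show "continuous_on K (sub_factor S n)"
      by (rule continuous_on_subset[OF continuous_on_sub_factor]) (auto simp: K_def)
  qed
  have "continuous_on K (sub_blaschke S)"
    by (rule uniform_limit_theorem[OF always_eventually sub_blaschke_uniform_limit[where \<rho>="\<bar>x\<bar> + 1" and S=S, folded K_def]]) (use c in auto)
  moreover have "((\<lambda>y. Complex x y) \<longlongrightarrow> of_real x) (at_right 0)"
  proof -
    have "((\<lambda>y. Complex x y) \<longlongrightarrow> Complex x 0) (at_right 0)" by (intro tendsto_intros)
    then show ?thesis by (simp add: complex_of_real_def)
  qed
  moreover have "\<forall>\<^sub>F y in at_right 0. Complex x y \<in> K"
  proof -
    have "eventually (\<lambda>y. y \<in> {0<..<1}) (at_right (0::real))" by (rule eventually_at_right_real) simp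
    then show ?thesis
    proof eventually_elim
      case (elim y)
      have "cmod (Complex x y) \<le> \<bar>x\<bar> + \<bar>y\<bar>" using cmod_le[of "Complex x y"] by simp
      then show ?case using elim by (auto simp: K_def)
    qed
  qed
  ultimately show ?thesis
    by (intro continuous_on_tendsto_compose[of K "sub_blaschke S"]) (auto simp: K_def)
qed

lemma cmod_sub_blaschke_le: "Im z \<ge> 0 \<Longrightarrow> cmod (sub_blaschke S z) \<le> 1"
proof -
  assume z: "Im z \<ge> 0"
  have "(\<lambda>N. cmod (\<Prod>n<N. sub_factor S n z)) \<longlonglongrightarrow> cmod (sub_blaschke S z)"
    by (intro tendsto_norm sub_blaschke_LIMSEQ)
  moreover have "cmod (\<Prod>n<N. sub_factor S n z) \<le> 1" for N
    unfolding prod_norm[symmetric]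
    by (intro prod_le_1) (auto simp: sub_factor_def cmod_blaschke_factor_le z)
  ultimately show ?thesis by (intro LIMSEQ_le_const2) auto
qed

lemma sub_blaschke_mult_hardy2:
  assumes h: "h \<in> hardy2"
  shows "(\<lambda>z. sub_blaschke S z * h z) \<in> hardy2"
proof -
  obtain C where C: "\<And>y. y > 0 \<Longrightarrow> (\<integral>\<^sup>+ x. ennreal ((cmod (h (Complex x y)))\<^sup>2) \<partial>lborel) \<le> ennreal C"
    using hardy2_bound[OF h] by metis
  have "(\<integral>\<^sup>+ x. ennreal ((cmod (sub_blaschke S (Complex x y) * h (Complex x y)))\<^sup>2) \<partial>lborel) \<le> ennreal C" if y: "y > 0" for y
  proof -
    have "(\<integral>\<^sup>+ x. ennreal ((cmod (sub_blaschke S (Complex x y) * h (Complex x y)))\<^sup>2) \<partial>lborel)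
      \<le> (\<integral>\<^sup>+ x. ennreal ((cmod (h (Complex x y)))\<^sup>2) \<partial>lborel)"
      by (intro nn_integral_mono ennreal_leI power_mono)
        (use cmod_sub_blaschke_le[of "Complex _ y" S] y in \<open>auto simp: norm_mult intro!: mult_left_le_one_le\<close>)
    also note C[OF y]
    finally show ?thesis .
  qed
  moreover have "(\<lambda>z. sub_blaschke S z * h z) holomorphic_on upper_half"
    by (intro holomorphic_intros holomorphic_sub_blaschke hardy2_holomorphic h)
  ultimately show ?thesis unfolding hardy2_def by blast
qed

lemma hardy_bv_sub_blaschke_mult:
  assumes "((\<lambda>y. h (Complex x y)) \<longlongrightarrow> hardy_bv h x) (at_right 0)"
  shows "hardy_bv (\<lambda>z. sub_blaschke S z * h z) x = sub_blaschke S (of_real x) * hardy_bv h x"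
  by (rule hardy_bv_eqI) (intro tendsto_intros sub_blaschke_vertical_limit assms)

end

section \<open>Admissibility from sparse zeros\<close>

text \<open>Sparseness gives \<open>|a (m k)| \<ge> (k + 1)^2\<close>, which makes the canonical
  product of genus 0 converge.\<close>

locale sparse_subsequence = unit_spaced_zeros +
  fixes m :: "nat \<Rightarrow> nat"
  assumes m_mono: "strict_mono m" and m_sparse: "(real (Suc k))\<^sup>2 \<le> real (Suc (m k))"
begin

text \<open>The zero is the reflected point \<open>cnj (a (m k))\<close> below the axis: the
  reciprocal of the product is holomorphic in the upper half-plane, and on the real line the
  quotient of the conjugate factor by the factor is a Blaschke factor up to a constant.\<close>

definition denom_factor :: "nat \<Rightarrow> complex \<Rightarrow> complex" where
  "denom_factor k z = 1 - z / cnj (a (m k))"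

definition denom :: "complex \<Rightarrow> complex" where
  "denom z = (\<Prod>k. denom_factor k z)"

lemma cmod_denom_factor_minus_1: "cmod (denom_factor k z - 1) \<le> cmod z / (real (Suc k))\<^sup>2"
proof -
  have "cmod (denom_factor k z - 1) = cmod z / cmod (a (m k))"
    by (simp add: denom_factor_def norm_divide)
  also have "\<dots> \<le> cmod z / (real (Suc k))\<^sup>2"
    using order.trans[OF m_sparse[of k] cmod_a_ge[of "m k"]]
    by (intro divide_left_mono mult_pos_pos) (auto simp: a_nonzero)
  finally show ?thesis .
qed

lemma summable_denom_factor: "summable (\<lambda>k. cmod (denom_factor k z - 1))"
  by (rule summable_comparison_test[OF _ summable_inverse_Suc_square[of "cmod z"]])
    (use cmod_denom_factor_minus_1 in auto)

lemma convergent_prod_denom_factor: "convergent_prod (\<lambda>k. denom_factor k z)"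
  using summable_imp_abs_convergent_prod[OF summable_denom_factor] by (rule abs_convergent_prod_imp_convergent_prod)

lemma denom_LIMSEQ: "(\<lambda>N. \<Prod>k<N. denom_factor k z) \<longlonglongrightarrow> denom z"
  using convergent_prod_LIMSEQ[OF convergent_prod_denom_factor[of z]]
  unfolding denom_def LIMSEQ_lessThan_iff_atMost .

lemma denom_uniform_limit:
  "uniform_limit (cball 0 \<rho>) (\<lambda>N z. \<Prod>k<N. denom_factor k z) denom sequentially"
proof -
  have "uniformly_convergent_on (cball 0 \<rho>) (\<lambda>N z. \<Prod>k<N. denom_factor k z)"
  proof (rule uniformly_convergent_on_prod')
    show "continuous_on (cball 0 \<rho>) (denom_factor k)" for k
      unfolding denom_factor_def by (intro continuous_intros) (auto simp: a_nonzero)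
    have "\<forall>\<^sub>F n in sequentially. \<forall>z\<in>cball 0 \<rho>. norm (cmod (denom_factor n z - 1)) \<le> \<rho> / (real (Suc n))\<^sup>2"
      by (rule always_eventually)
        (auto intro!: order.trans[OF cmod_denom_factor_minus_1] divide_right_mono)
    from Weierstrass_m_test_ev[OF this summable_inverse_Suc_square]
    show "uniformly_convergent_on (cball 0 \<rho>) (\<lambda>N z. \<Sum>n<N. norm (denom_factor n z - 1))"
      by (rule uniformly_convergentI)
  qed auto
  then obtain l where l: "uniform_limit (cball 0 \<rho>) (\<lambda>N z. \<Prod>k<N. denom_factor k z) l sequentially"
    by (auto simp: uniformly_convergent_on_def)
  have eq: "l z = denom z" if "z \<in> cball 0 \<rho>" for z
    using tendsto_uniform_limitI[OF l that] denom_LIMSEQ by (rule LIMSEQ_unique)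
  show ?thesis using l unfolding uniform_limit_sequentially_iff by (simp add: eq)
qed

lemma holomorphic_denom: "denom holomorphic_on UNIV"
proof (rule holomorphic_uniform_sequence[of UNIV "\<lambda>N z. \<Prod>k<N. denom_factor k z"])
  show "(\<lambda>z. \<Prod>k<N. denom_factor k z) holomorphic_on UNIV" for N
    unfolding denom_factor_def by (intro holomorphic_intros) (auto simp: a_nonzero)
  fix z :: complex
  have sub: "cball z 1 \<subseteq> cball 0 (cmod z + 1)"
  proof
    fix w assume "w \<in> cball z 1"
    then show "w \<in> cball 0 (cmod z + 1)"
      using norm_triangle_sub[of w z] by (simp add: dist_norm norm_minus_commute)
  qed
  show "\<exists>d>0. cball z d \<subseteq> UNIV \<and> uniform_limit (cball z d) (\<lambda>N z. \<Prod>k<N. denom_factor k z) denom sequentially"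
    using uniform_limit_on_subset[OF denom_uniform_limit sub] by (intro exI[of _ 1]) auto
qed auto

lemma denom_nonzero:
  assumes "Im z \<ge> 0"
  shows "denom z \<noteq> 0"
  unfolding denom_def
proof (rule prodinf_nonzero[OF convergent_prod_denom_factor])
  fix k
  have "cnj (a (m k)) \<noteq> z" using off_pole[OF assms, of "m k"] by auto
  then show "denom_factor k z \<noteq> 0" by (auto simp: denom_factor_def a_nonzero)
qed

text \<open>All zeros lie below the real axis, so moving up a vertical line increases the distance
  to each of them. A growth estimate on the real line alone therefore bounds the reciprocal on every
  higher line.\<close>

lemma cmod_denom_mono:
  assumes "Im z \<ge> 0"
  shows "cmod (denom (of_real (Re z))) \<le> cmod (denom z)"
proof (rule LIMSEQ_le)
  show "(\<lambda>N. cmod (\<Prod>k<N. denom_factor k (of_real (Re z)))) \<longlonglongrightarrow> cmod (denom (of_real (Re z)))"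
    "(\<lambda>N. cmod (\<Prod>k<N. denom_factor k z)) \<longlonglongrightarrow> cmod (denom z)"
    by (intro tendsto_norm denom_LIMSEQ)+
  have "cmod (denom_factor k (of_real (Re z))) \<le> cmod (denom_factor k z)" for k
  proof -
    let ?p = "cnj (a (m k))"
    have f: "denom_factor k w = (?p - w) / ?p" for w using a_nonzero by (simp add: denom_factor_def field_simps)
    have "\<bar>Im (a (m k))\<bar> \<le> \<bar>Im (a (m k)) + Im z\<bar>" using assms Im_pos[of "m k"] by simp
    then have "(Im (a (m k)))\<^sup>2 \<le> (Im (a (m k)) + Im z)\<^sup>2" by (simp only: abs_le_square_iff)
    then have "cmod (?p - of_real (Re z)) \<le> cmod (?p - z)"
      unfolding cmod_def by (intro real_sqrt_le_mono) (simp add: power2_eq_square algebra_simps)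
    then show ?thesis unfolding f norm_divide by (rule divide_right_mono) simp
  qed
  then show "\<exists>N. \<forall>n\<ge>N. cmod (\<Prod>k<n. denom_factor k (of_real (Re z))) \<le> cmod (\<Prod>k<n. denom_factor k z)"
    by (intro exI[of _ 0] allI impI) (auto simp: prod_norm[symmetric] intro!: prod_mono)
qed

lemma blaschke_factor_real:
  "blaschke_factor (a (m k)) (of_real x) = blaschke_factor (a (m k)) 0 * (cnj (denom_factor k (of_real x)) / denom_factor k (of_real x))"
proof -
  define A where "A = a (m k)"
  have A: "A \<noteq> 0" "cnj A \<noteq> 0" using a_nonzero by (auto simp: A_def)
  have ne: "of_real x - cnj A \<noteq> 0" "cnj A - of_real x \<noteq> 0" using Im_pos[of "m k"] by (auto simp: A_def complex_eq_iff)
  have "(of_real x - A) / (of_real x - cnj A) = A / cnj A * ((1 - of_real x / A) / (1 - of_real x / cnj A))"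
  proof -
    have "1 - of_real x / A = (A - of_real x) / A" "1 - of_real x / cnj A = (cnj A - of_real x) / cnj A"
      using A by (simp_all add: diff_divide_distrib)
    moreover have "(of_real x - A) / (of_real x - cnj A) = (A - of_real x) / (cnj A - of_real x)"
      by (metis minus_diff_eq minus_divide_left minus_divide_right minus_minus)
    ultimately show ?thesis using A ne by simp
  qed
  then show ?thesis
    by (simp add: blaschke_factor_def denom_factor_def A_def[symmetric] mult.assoc)
qed

text \<open>Factor by factor this is \<open>blaschke_factor_real\<close>; it passes to the limit
  along the partial products of length \<open>m K\<close>, in which exactly the first
  \<open>K\<close> chosen zeros occur.\<close>

lemma sub_blaschke_range_real:
  "sub_blaschke (range m) (of_real x)
     = sub_blaschke (range m) 0 * (cnj (denom (of_real x)) / denom (of_real x))"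
proof -
  have sub: "(\<lambda>K. \<Prod>k<K. blaschke_factor (a (m k)) z) \<longlonglongrightarrow> sub_blaschke (range m) z" for z
  proof -
    have "(\<Prod>n<m K. sub_factor (range m) n z) = (\<Prod>k<K. blaschke_factor (a (m k)) z)" for K
    proof -
      have "(\<Prod>n<m K. sub_factor (range m) n z) = (\<Prod>n\<in>m ` {..<K}. sub_factor (range m) n z)"
      proof (rule prod.mono_neutral_right)
        show "m ` {..<K} \<subseteq> {..<m K}" using m_mono by (auto simp: strict_mono_less)
        show "\<forall>i\<in>{..<m K} - m ` {..<K}. sub_factor (range m) i z = 1"
          using m_mono by (auto simp: sub_factor_def strict_mono_less)
      qed simp
      also have "\<dots> = (\<Prod>k<K. sub_factor (range m) (m k) z)"
        using inj_on_subset[OF strict_mono_imp_inj_on[OF m_mono]] by (subst prod.reindex) auto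
      also have "\<dots> = (\<Prod>k<K. blaschke_factor (a (m k)) z)" by (simp add: sub_factor_def)
      finally show ?thesis .
    qed
    moreover have "(\<lambda>K. \<Prod>n<m K. sub_factor (range m) n z) \<longlonglongrightarrow> sub_blaschke (range m) z"
      using LIMSEQ_subseq_LIMSEQ[OF sub_blaschke_LIMSEQ m_mono] by (simp add: o_def)
    ultimately show ?thesis by simp
  qed
  have "(\<lambda>K. (\<Prod>k<K. blaschke_factor (a (m k)) 0) * (cnj (\<Prod>k<K. denom_factor k (of_real x)) / (\<Prod>k<K. denom_factor k (of_real x))))
     \<longlonglongrightarrow> sub_blaschke (range m) 0 * (cnj (denom (of_real x)) / denom (of_real x))"
    by (intro tendsto_intros sub[of 0] denom_LIMSEQ denom_nonzero) simp
  moreover have "(\<Prod>k<K. blaschke_factor (a (m k)) 0) * (cnj (\<Prod>k<K. denom_factor k (of_real x)) / (\<Prod>k<K. denom_factor k (of_real x)))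
     = (\<Prod>k<K. blaschke_factor (a (m k)) (of_real x))" for K
    by (simp add: blaschke_factor_real prod.distrib prod_dividef)
  ultimately show ?thesis using sub[of "of_real x"] LIMSEQ_unique by fastforce
qed

lemma denom_vertical_limit: "((\<lambda>y. denom (Complex x y)) \<longlongrightarrow> denom (of_real x)) (at_right 0)"
proof (rule isCont_tendsto_compose[of _ denom])
  show "isCont denom (of_real x)"
    using holomorphic_on_imp_continuous_on[OF holomorphic_denom] by (simp add: continuous_on_eq_continuous_at)
  have "((\<lambda>y. Complex x y) \<longlongrightarrow> Complex x 0) (at_right 0)" by (intro tendsto_intros)
  then show "((\<lambda>y. Complex x y) \<longlongrightarrow> of_real x) (at_right 0)" by (simp add: complex_of_real_def)
qed

text \<open>Write \<open>E\<close> for the product and \<open>B = \<kappa> (cnj E / E) B'\<close> on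
  the real line. Then \<open>(c / E) * cnj (B h)\<close> is the conjugate of
  \<open>\<kappa> (c / E) (B' h)\<close>, where \<open>c / E\<close> and \<open>B' h\<close> are
  boundary values of Hardy functions. The quadratic growth of \<open>E\<close> makes
  \<open>c / E\<close> square integrable.\<close>

lemma reciprocal_denom_admissible:
  assumes c: "c > 0" and quad: "\<And>x. c * (1 + x\<^sup>2) \<le> cmod (denom (of_real x))"
    and w: "\<And>x. c \<le> w x * cmod (denom (of_real x))"
  shows "w \<in> Adm (blaschke a)"
proof -
  define f where "f = (\<lambda>z. of_real c / denom z)"
  have f_hol: "f holomorphic_on upper_half" unfolding f_def
    by (intro holomorphic_intros holomorphic_on_subset[OF holomorphic_denom]) (auto simp: denom_nonzero upper_half_iff less_imp_le)
  have f_bd: "(cmod (f (Complex x y)))\<^sup>2 \<le> 1 / ((x - 0)\<^sup>2 + 1\<^sup>2)" if "y \<ge> 0" for x y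
  proof -
    have "c * (1 + x\<^sup>2) \<le> cmod (denom (Complex x y))"
      using quad[of x] cmod_denom_mono[of "Complex x y"] that by simp
    moreover have p: "1 + x\<^sup>2 > 0" by (simp add: add_pos_nonneg)
    ultimately have "cmod (f (Complex x y)) \<le> c / (c * (1 + x\<^sup>2))"
      unfolding f_def norm_divide using c by (intro frac_le) auto
    also have "\<dots> = 1 / (1 + x\<^sup>2)" using c by simp
    finally have "(cmod (f (Complex x y)))\<^sup>2 \<le> (1 / (1 + x\<^sup>2))\<^sup>2" by (intro power_mono) auto
    also have "\<dots> \<le> 1 / (1 + x\<^sup>2)"
      unfolding power2_eq_square[of "1 / (1 + x\<^sup>2)"] using p by (intro mult_left_le_one_le) auto
    finally show ?thesis by (simp add: add.commute)
  qed
  have f: "f \<in> hardy2"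
  proof -
    have "(\<integral>\<^sup>+ x. ennreal ((cmod (f (Complex x y)))\<^sup>2) \<partial>lborel) \<le> ennreal (pi / 1)" if "y > 0" for y
    proof -
      have "(\<integral>\<^sup>+ x. ennreal ((cmod (f (Complex x y)))\<^sup>2) \<partial>lborel) \<le> (\<integral>\<^sup>+ x. ennreal (1 / ((x - 0)\<^sup>2 + 1\<^sup>2)) \<partial>lborel)"
        using that by (intro nn_integral_mono ennreal_leI f_bd) auto
      also have "\<dots> = ennreal (pi / 1)" by (rule nn_integral_inverse_square) simp
      finally show ?thesis .
    qed
    then show ?thesis unfolding hardy2_def using f_hol by blast
  qed
  have f_bv: "hardy_bv f x = of_real c / denom (of_real x)" for x
    unfolding f_def by (rule hardy_bv_eqI) (intro tendsto_intros denom_vertical_limit denom_nonzero, simp)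
  have orth: "l2_inner (hardy_bv f) (hardy_bv (\<lambda>z. blaschke a z * h z)) = 0" if h: "h \<in> hardy2" for h
  proof -
    define \<kappa> where "\<kappa> = sub_blaschke (range m) 0"
    define g where "g = (\<lambda>z. sub_blaschke (- range m) z * h z)"
    have g: "g \<in> hardy2" unfolding g_def by (rule sub_blaschke_mult_hardy2[OF h])
    have bh: "(\<lambda>z. blaschke a z * h z) \<in> hardy2"
      using sub_blaschke_mult_hardy2[OF h, of UNIV] by (simp add: sub_blaschke_UNIV)
    have "l2_inner (hardy_bv f) (hardy_bv (\<lambda>z. blaschke a z * h z))
      = (\<integral>x. cnj (\<kappa> * (hardy_bv f x * hardy_bv g x)) \<partial>lborel)"
      unfolding l2_inner_def
    proof (rule integral_cong_AE)
      show "AE x in lborel. hardy_bv f x * cnj (hardy_bv (\<lambda>z. blaschke a z * h z) x) = cnj (\<kappa> * (hardy_bv f x * hardy_bv g x))"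
        using hardy_bv_tendsto_AE[OF h]
      proof eventually_elim
        case (elim x)
        have dn: "denom (of_real x) \<noteq> 0" by (rule denom_nonzero) simp
        have "hardy_bv (\<lambda>z. blaschke a z * h z) x = blaschke a (of_real x) * hardy_bv h x"
          using hardy_bv_sub_blaschke_mult[OF elim, of UNIV] by (simp add: sub_blaschke_UNIV)
        also have "blaschke a (of_real x) = \<kappa> * (cnj (denom (of_real x)) / denom (of_real x)) * sub_blaschke (- range m) (of_real x)"
          unfolding sub_blaschke_split[of "range m", symmetric] sub_blaschke_range_real[of x] \<kappa>_def ..
        finally have B: "hardy_bv (\<lambda>z. blaschke a z * h z) x = \<kappa> * (cnj (denom (of_real x)) / denom (of_real x)) * sub_blaschke (- range m) (of_real x) * hardy_bv h x" .
        have gx: "hardy_bv g x = sub_blaschke (- range m) (of_real x) * hardy_bv h x"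
          unfolding g_def by (rule hardy_bv_sub_blaschke_mult[OF elim])
        show ?case unfolding B f_bv gx using dn by simp
      qed
      have [measurable]: "hardy_bv f \<in> borel_measurable borel" "hardy_bv g \<in> borel_measurable borel"
        "hardy_bv (\<lambda>z. blaschke a z * h z) \<in> borel_measurable borel"
        using f g bh by (auto intro!: hardy_bv_measurable hardy2_holomorphic)
      show "(\<lambda>x. hardy_bv f x * cnj (hardy_bv (\<lambda>z. blaschke a z * h z) x)) \<in> borel_measurable lborel"
        "(\<lambda>x. cnj (\<kappa> * (hardy_bv f x * hardy_bv g x))) \<in> borel_measurable lborel"
        by measurable
    qed
    also have "\<dots> = cnj (\<kappa> * (\<integral>x. hardy_bv f x * hardy_bv g x \<partial>lborel))"
      by (simp only: Bochner_Integration.integral_cnj integral_mult_right_zero)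
    also have "\<dots> = 0" by (simp add: hardy_bv_mult_integral_zero[OF f g])
    finally show ?thesis .
  qed
  have "f \<in> model_space (blaschke a)" using f orth by (simp add: model_space_def)
  moreover have "\<exists>z\<in>upper_half. f z \<noteq> 0"
    using c by (intro bexI[of _ \<i>]) (auto simp: f_def denom_nonzero upper_half_iff)
  moreover have "AE x in lborel. cmod (hardy_bv f x) \<le> w x"
  proof (rule AE_I2)
    fix x
    have "cmod (denom (of_real x)) > 0" using denom_nonzero[of "of_real x"] by simp
    then show "cmod (hardy_bv f x) \<le> w x" unfolding f_bv norm_divide using w[of x] c
      by (simp add: pos_divide_le_eq)
  qed
  ultimately show ?thesis unfolding Adm_def by blast
qed

end

section \<open>Choosing the sparse zeros\<close>

lemma sum_consecutive_blocks:
  fixes f :: "nat \<Rightarrow> real"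
  assumes "mono g"
  shows "(\<Sum>j<J. \<Sum>n\<in>{g j..<g (Suc j)}. f n) = (\<Sum>n\<in>{g 0..<g J}. f n)"
proof (induction J)
  case (Suc J)
  have "g 0 \<le> g J" "g J \<le> g (Suc J)" using assms by (auto simp: mono_def)
  then show ?case using Suc by (simp add: sum.atLeastLessThan_concat)
qed simp

text \<open>Between \<open>q (j + 1)^2\<close> and \<open>q (j + 2)^2\<close> there are
  \<open>q (2 j + 3)\<close> integers, each of weight at least \<open>(q (j + 2)^2)^(-3/2)\<close>;
  the block is thus worth at least a constant times \<open>L(q (j + 1)^2) / (j + 1)^2\<close>. Here
  the exponent 3/2 meets the square spacing of the zeros.\<close>

lemma square_condensation:
  fixes L :: "nat \<Rightarrow> real" and q :: nat
  assumes q: "q \<ge> 1" and L0: "\<And>n. L n \<ge> 0" and Lmono: "\<And>m n. 1 \<le> m \<Longrightarrow> m \<le> n \<Longrightarrow> L m \<le> L n"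
    and sm: "summable (\<lambda>k. real (Suc k) powr (-3/2) * L (Suc k))"
  shows "summable (\<lambda>j. L (q * (Suc j)\<^sup>2) / (real (Suc j))\<^sup>2)"
proof -
  define f where "f = (\<lambda>n. real n powr (-3/2) * L n)"
  have f0: "f n \<ge> 0" for n by (simp add: f_def L0)
  have sf: "summable f" using sm unfolding f_def by (subst summable_Suc_iff[symmetric])
  define g where "g = (\<lambda>j. q * (Suc j)\<^sup>2)"
  have g: "mono g" unfolding g_def mono_def by (auto intro!: mult_left_mono power_mono)
  have blk: "L (g j) / (real (Suc j))\<^sup>2 \<le> 4 * sqrt q * (\<Sum>n\<in>{g j..<g (Suc j)}. f n)" for j
  proof -
    have gj: "1 \<le> g j" unfolding g_def using q by simp
    have qp: "real q > 0" using q by simp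
    have card: "real (card {g j..<g (Suc j)}) = real q * (2 * real j + 3)"
    proof -
      have "g (Suc j) = g j + q * (2 * j + 3)" unfolding g_def by (simp add: power2_eq_square algebra_simps)
      then show ?thesis by simp
    qed
    have pw: "real (g (Suc j)) powr (-3/2) = 1 / (real q * sqrt q * (real j + 2) ^ 3)"
    proof -
      have j2: "real j + 2 > 0" by simp
      have "real (g (Suc j)) = real q * (real j + 2)\<^sup>2" by (simp add: g_def)
      then have "real (g (Suc j)) powr (-3/2) = real q powr (-3/2) * ((real j + 2)\<^sup>2) powr (-3/2)"
        by (simp add: powr_mult)
      also have "((real j + 2)\<^sup>2) powr (-3/2) = (real j + 2) powr (-3)"
        using j2 by (simp add: powr_powr flip: powr_numeral)
      also have "\<dots> = 1 / (real j + 2) ^ 3" using j2 by (simp add: powr_minus_divide)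
      also have "real q powr (-3/2) = 1 / (real q * sqrt q)"
      proof -
        have "real q powr (-3/2) = 1 / real q powr (1 + 1/2)" by (simp add: powr_minus_divide)
        also have "real q powr (1 + 1/2) = real q * sqrt q"
          using qp unfolding powr_add by (simp add: powr_half_sqrt)
        finally show ?thesis .
      qed
      finally show ?thesis by simp
    qed
    have "real (card {g j..<g (Suc j)}) * (real (g (Suc j)) powr (-3/2) * L (g j)) \<le> (\<Sum>n\<in>{g j..<g (Suc j)}. f n)"
    proof (rule sum_bounded_below)
      fix n assume n: "n \<in> {g j..<g (Suc j)}"
      then have n1: "1 \<le> n" using gj by auto
      show "real (g (Suc j)) powr (-3/2) * L (g j) \<le> f n" unfolding f_def
        using n n1 gj by (intro mult_mono powr_mono2' Lmono L0) auto
    qed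
    moreover have "L (g j) / (real (Suc j))\<^sup>2 \<le> 4 * sqrt q * (real (card {g j..<g (Suc j)}) * (real (g (Suc j)) powr (-3/2) * L (g j)))"
    proof -
      have "4 * sqrt q * (real (card {g j..<g (Suc j)}) * (real (g (Suc j)) powr (-3/2) * L (g j)))
        = L (g j) * (4 * (2 * real j + 3) / (real j + 2) ^ 3)"
        unfolding card pw using qp by (simp add: field_simps)
      also have "\<dots> \<ge> L (g j) * (1 / (real (Suc j))\<^sup>2)"
      proof (intro mult_left_mono L0)
        have "(real j + 2) ^ 3 \<le> (4 * (2 * real j + 3)) * (real (Suc j))\<^sup>2"
          by (simp add: power2_eq_square power3_eq_cube algebra_simps)
        then show "1 / (real (Suc j))\<^sup>2 \<le> 4 * (2 * real j + 3) / (real j + 2) ^ 3"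
          by (simp add: field_simps)
      qed
      finally show ?thesis by simp
    qed
    moreover have "sqrt q \<ge> 0" by simp
    ultimately show ?thesis by (smt (verit) mult_left_mono)
  qed
  show ?thesis
  proof (rule summableI_nonneg_bounded)
    fix J
    have "(\<Sum>j<J. L (q * (Suc j)\<^sup>2) / (real (Suc j))\<^sup>2) \<le> (\<Sum>j<J. 4 * sqrt q * (\<Sum>n\<in>{g j..<g (Suc j)}. f n))"
      by (intro sum_mono) (use blk in \<open>simp add: g_def\<close>)
    also have "\<dots> = 4 * sqrt q * (\<Sum>n\<in>{g 0..<g J}. f n)"
      by (simp only: sum_distrib_left[symmetric] sum_consecutive_blocks[OF g])
    also have "\<dots> \<le> 4 * sqrt q * suminf f"
      by (intro mult_left_mono sum_le_suminf sf) (auto simp: f0)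
    finally show "(\<Sum>j<J. L (q * (Suc j)\<^sup>2) / (real (Suc j))\<^sup>2) \<le> 4 * sqrt q * suminf f" .
  qed (simp add: L0)
qed

text \<open>The zeros will be \<open>l k = q\<^sub>k (k + 1)\<^sup>2\<close> with \<open>q\<^sub>k\<close> nondecreasing and bounded. Compared with the
  zeros of a cosine of a square root, every step of \<open>ln q\<^sub>k\<close> is a gain for all larger points.\<close>

lemma sparse_zero_sequence:
  fixes L :: "nat \<Rightarrow> real"
  assumes L0: "\<And>n. L n \<ge> 0" and Lmono: "\<And>m n. 1 \<le> m \<Longrightarrow> m \<le> n \<Longrightarrow> L m \<le> L n"
    and sm: "summable (\<lambda>k. real (Suc k) powr (-3/2) * L (Suc k))"
  obtains l :: "nat \<Rightarrow> nat" and C :: real where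
    "l 0 = 1" "\<And>k. (Suc k)\<^sup>2 \<le> l k" "\<And>k. l k \<le> 4 * (Suc k)\<^sup>2" 
    "\<And>k. l k + 2 \<le> l (Suc k)"
    "\<And>k j. k \<le> j \<Longrightarrow> real (l k) / (real (Suc k))\<^sup>2 \<le> real (l j) / (real (Suc j))\<^sup>2"
    "\<And>K. L (4 * (K + 2)\<^sup>2) - C \<le> (\<Sum>k<K. ln ((real (l K) / (real (Suc K))\<^sup>2) / (real (l k) / (real (Suc k))\<^sup>2)))"
proof -
  \<comment> \<open>The constants are read backwards from the gain: for
    \<open>j \<ge> K div 2\<close> one has \<open>K + 2 \<le> 4 (j + 1)\<close>, so
    \<open>64 (j + 1)^2\<close> dominates \<open>4 (K + 2)^2\<close>; the factor 4 makes up for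
    using only half of the steps and half of the zeros.\<close>
  define d where "d = (\<lambda>j. 4 * (L (64 * (Suc j)\<^sup>2) / (real (Suc j))\<^sup>2))"
  have d0: "d j \<ge> 0" for j by (simp add: d_def L0)
  have sd: "summable d" unfolding d_def
    by (intro summable_mult square_condensation L0 Lmono sm) auto
  obtain J where "\<forall>n\<ge>J. norm (\<Sum>j. d (j + n)) < ln 2"
    using suminf_exist_split[OF _ sd, of "ln 2"] by auto
  then have "norm (\<Sum>j. d (j + J)) < ln 2" by blast
  then have J: "(\<Sum>j. d (j + J)) < ln 2" by simp
  \<comment> \<open>Dropping the first \<open>J\<close> increments keeps their total at most
    \<open>ln 2\<close>; what is lost for small \<open>K\<close> is absorbed in the constant
    \<open>C\<close>.\<close>
  define e where "e = (\<lambda>j. if j < J then 0 else d j)"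
  have e0: "e j \<ge> 0" for j by (simp add: e_def d0)
  have sum_e: "(\<Sum>j<k. e j) \<le> ln 2" for k
  proof -
    have "(\<Sum>j<k. e j) \<le> (\<Sum>j<k + J. e j)" by (rule sum_mono2) (auto simp: e0)
    also have "\<dots> = (\<Sum>j\<in>{J..<k + J}. d j)"
      by (rule sum.mono_neutral_cong_right) (auto simp: e_def)
    also have "\<dots> = (\<Sum>j<k. d (j + J))"
      using sum.shift_bounds_nat_ivl[of d 0 J k] by (simp add: atLeast0LessThan add.commute)
    also have "\<dots> \<le> (\<Sum>j. d (j + J))"
      by (rule sum_le_suminf) (use sd d0 in \<open>auto simp: summable_iff_shift\<close>)
    finally show ?thesis using J by simp
  qed
  \<comment> \<open>Rounding up keeps the positions integral. It preserves the growth of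
    \<open>q\<close> by \<open>exp (e k)\<close> and adds at most \<open>1 / (k + 2)^2\<close>;
    these errors telescope, so that \<open>q\<close> stays below
    \<open>exp (ln 2) * 2 = 4\<close>.\<close>
  define l where "l = rec_nat (1::nat) (\<lambda>k lk. nat \<lceil>real lk * (real (k + 2) / real (k + 1))\<^sup>2 * exp (e k)\<rceil>)"
  define q where "q = (\<lambda>k. real (l k) / (real (Suc k))\<^sup>2)"
  have l_0: "l 0 = 1" by (simp add: l_def)
  have l_Suc: "l (Suc k) = nat \<lceil>real (l k) * (real (k + 2) / real (k + 1))\<^sup>2 * exp (e k)\<rceil>" for k
    by (simp add: l_def)
  have l_pos: "l k \<ge> 1" for k
  proof (induction k)
    case (Suc k)
    have "0 < real (l k) * (real (k + 2) / real (k + 1))\<^sup>2 * exp (e k)"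
      using Suc by (intro mult_pos_pos) auto
    then show ?case unfolding l_Suc by linarith
  qed (simp add: l_0)
  have q_eq: "q k = real (l k) / (real (Suc k))\<^sup>2" for k by (simp add: q_def)
  have q_pos: "q k > 0" for k unfolding q_def using l_pos[of k] by simp
  have lq: "real (l k) * (real (k + 2) / real (k + 1))\<^sup>2 * exp (e k) = q k * exp (e k) * (real (Suc (Suc k)))\<^sup>2" for k
    by (simp add: q_def power_divide)
  have step_ge: "q (Suc k) \<ge> q k * exp (e k)" for k
  proof -
    have "real (l (Suc k)) \<ge> q k * exp (e k) * (real (Suc (Suc k)))\<^sup>2"
      unfolding l_Suc lq by linarith
    then show ?thesis unfolding q_eq[of "Suc k"] by (simp add: pos_le_divide_eq)
  qed
  have step_le: "q (Suc k) \<le> q k * exp (e k) + 1 / (real (Suc (Suc k)))\<^sup>2" for k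
  proof -
    have "0 \<le> q k * exp (e k) * (real (Suc (Suc k)))\<^sup>2" using q_pos[of k] by simp
    then have "real (l (Suc k)) \<le> q k * exp (e k) * (real (Suc (Suc k)))\<^sup>2 + 1"
      unfolding l_Suc lq by linarith
    then have "q (Suc k) \<le> (q k * exp (e k) * (real (Suc (Suc k)))\<^sup>2 + 1) / (real (Suc (Suc k)))\<^sup>2"
      unfolding q_eq[of "Suc k"] by (rule divide_right_mono) simp
    then show ?thesis by (simp add: add_divide_distrib)
  qed
  have q_bound: "q k \<le> exp (\<Sum>j<k. e j) * (2 - 1 / real (Suc k))" for k
  proof (induction k)
    case 0 then show ?case by (simp add: q_def l_0)
  next
    case (Suc k)
    have E1: "exp (\<Sum>j<Suc k. e j) \<ge> 1" by (simp add: sum_nonneg e0)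
    have "1 / (real (Suc (Suc k)))\<^sup>2 \<le> 1 / real (Suc k) - 1 / real (Suc (Suc k))"
    proof -
      have "1 / real (Suc k) - 1 / real (Suc (Suc k)) = 1 / (real (Suc k) * real (Suc (Suc k)))"
        by (simp add: field_simps)
      also have "\<dots> \<ge> 1 / (real (Suc (Suc k)))\<^sup>2"
        unfolding power2_eq_square by (intro divide_left_mono mult_right_mono mult_pos_pos) auto
      finally show ?thesis .
    qed
    moreover have "0 \<le> 1 / (real (Suc (Suc k)))\<^sup>2" by simp
    ultimately have "1 / (real (Suc (Suc k)))\<^sup>2 \<le> exp (\<Sum>j<Suc k. e j) * (1 / real (Suc k) - 1 / real (Suc (Suc k)))"
      using mult_mono[OF E1, of "1 / (real (Suc (Suc k)))\<^sup>2" "1 / real (Suc k) - 1 / real (Suc (Suc k))"] by simp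
    moreover have "q k * exp (e k) \<le> exp (\<Sum>j<Suc k. e j) * (2 - 1 / real (Suc k))"
      using mult_right_mono[OF Suc, of "exp (e k)"] by (simp add: exp_add mult_ac)
    ultimately show ?case using step_le[of k] by (simp add: algebra_simps)
  qed
  have q4: "q k \<le> 4" for k
  proof -
    have "q k \<le> exp (\<Sum>j<k. e j) * (2 - 1 / real (Suc k))" by (rule q_bound)
    also have "\<dots> \<le> 2 * 2"
    proof (rule mult_mono)
      have "exp (\<Sum>j<k. e j) \<le> exp (ln 2)" using sum_e by (simp only: exp_le_cancel_iff)
      then show "exp (\<Sum>j<k. e j) \<le> 2" by simp
    qed (auto simp: divide_le_eq)
    finally show ?thesis by simp
  qed
  have q_ratio: "q j \<ge> q k * exp (\<Sum>i\<in>{k..<j}. e i)" if "k \<le> j" for k j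
    using that
  proof (induction j rule: dec_induct)
    case (step j)
    have "q k * exp (\<Sum>i\<in>{k..<Suc j}. e i) = (q k * exp (\<Sum>i\<in>{k..<j}. e i)) * exp (e j)"
      using step by (simp add: exp_add)
    also have "\<dots> \<le> q j * exp (e j)" using step by (intro mult_right_mono) auto
    also have "\<dots> \<le> q (Suc j)" by (rule step_ge)
    finally show ?case .
  qed simp
  have q_mono: "q k \<le> q j" if "k \<le> j" for k j
  proof -
    have "q k * 1 \<le> q k * exp (\<Sum>i\<in>{k..<j}. e i)"
      using q_pos[of k] by (intro mult_left_mono) (auto simp: sum_nonneg e0)
    then show ?thesis using q_ratio[OF that] by simp
  qed
  have l_eq: "real (l k) = q k * (real (Suc k))\<^sup>2" for k by (simp add: q_def)
  have q1: "q k \<ge> 1" for k using q_mono[of 0 k] by (simp add: q_def l_0)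
  have l_ge: "(Suc k)\<^sup>2 \<le> l k" for k
  proof -
    have "real ((Suc k)\<^sup>2) \<le> real (l k)" unfolding l_eq using mult_right_mono[OF q1, of "(real (Suc k))\<^sup>2" k] by simp
    then show ?thesis by (simp only: of_nat_le_iff)
  qed
  have l_le: "l k \<le> 4 * (Suc k)\<^sup>2" for k
  proof -
    have "real (l k) \<le> real (4 * (Suc k)\<^sup>2)" unfolding l_eq using mult_right_mono[OF q4, of "(real (Suc k))\<^sup>2" k] by simp
    then show ?thesis by (simp only: of_nat_le_iff)
  qed
  have gap: "l k + 2 \<le> l (Suc k)" for k
  proof -
    have "real (l k) + 2 \<le> q k * (real (Suc k))\<^sup>2 + q k * (2 * real k + 3)"
      unfolding l_eq using mult_mono[OF q1[of k], of 2 "2 * real k + 3"] q1[of k] by simp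
    also have "\<dots> = q k * (real (Suc (Suc k)))\<^sup>2" by (simp add: power2_eq_square algebra_simps)
    also have "\<dots> \<le> real (l (Suc k))" unfolding l_eq by (intro mult_right_mono q_mono) auto
    finally have "real (l k + 2) \<le> real (l (Suc k))" by simp
    then show ?thesis by (simp only: of_nat_le_iff)
  qed
  define C where "C = L (4 * (2 * J + 3)\<^sup>2)"
  \<comment> \<open>Each of the roughly \<open>K/2\<close> increments with index from
    \<open>K div 2\<close> up to \<open>K\<close> raises \<open>q K / q k\<close> for all
    \<open>k \<le> K div 2\<close>. The sum of logarithms therefore gains about
    \<open>(K/2)^2\<close> times the increment size \<open>v\<close>, which is
    \<open>L (4 (K + 2)^2)\<close>.\<close>
  have gain: "L (4 * (K + 2)\<^sup>2) - C \<le> (\<Sum>k<K. ln (q K / q k))" for K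
  proof (cases "K < 2 * J + 1")
    case True
    have "L (4 * (K + 2)\<^sup>2) \<le> C" unfolding C_def
      by (rule Lmono) (use True in \<open>auto intro!: power_mono\<close>)
    moreover have "(\<Sum>k<K. ln (q K / q k)) \<ge> 0"
      by (intro sum_nonneg ln_ge_zero) (use q_mono q_pos in \<open>auto simp: le_divide_eq_1_pos\<close>)
    ultimately show ?thesis by simp
  next
    case False
    define h where "h = K div 2"
    have h: "h \<ge> J" "h < K" "2 * (h + 1) \<ge> K + 1" "2 * h \<le> K" using False by (auto simp: h_def)
    have K0: "real K > 0" using False by simp
    define v where "v = 4 * L (4 * (K + 2)\<^sup>2) / (real K)\<^sup>2"
    have v0: "v \<ge> 0" by (simp add: v_def L0)
    have ej: "e j \<ge> v" if j: "j \<in> {h..<K}" for j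
    proof -
      have "K + 2 \<le> 4 * Suc j" using j h by auto
      then have "(K + 2)\<^sup>2 \<le> (4 * Suc j)\<^sup>2" by (rule power_mono) simp
      moreover have "(4 * Suc j)\<^sup>2 = 16 * (Suc j)\<^sup>2" by (simp only: power_mult_distrib) simp
      ultimately have "4 * (K + 2)\<^sup>2 \<le> 64 * (Suc j)\<^sup>2" by linarith
      then have "L (4 * (K + 2)\<^sup>2) \<le> L (64 * (Suc j)\<^sup>2)" by (intro Lmono) auto
      moreover have "(real (Suc j))\<^sup>2 \<le> (real K)\<^sup>2" using j by (intro power_mono) auto
      ultimately have "L (4 * (K + 2)\<^sup>2) / (real K)\<^sup>2 \<le> L (64 * (Suc j)\<^sup>2) / (real (Suc j))\<^sup>2"
        by (intro frac_le L0) auto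
      then show ?thesis using j h unfolding e_def d_def v_def by auto
    qed
    have gain_at: "ln (q K / q k) \<ge> (real K / 2) * v" if k: "k \<in> {..h}" for k
    proof -
      have kK: "k \<le> K" using k h by simp
      have "(real K / 2) * v \<le> real (card {h..<K}) * v" using h v0 by (intro mult_right_mono) auto
      also have "\<dots> \<le> (\<Sum>i\<in>{h..<K}. e i)" by (rule sum_bounded_below) (use ej in auto)
      also have "\<dots> \<le> (\<Sum>i\<in>{k..<K}. e i)" by (rule sum_mono2) (use k e0 in auto)
      also have "\<dots> \<le> ln (q K / q k)"
      proof -
        have "exp (\<Sum>i\<in>{k..<K}. e i) \<le> q K / q k"
          using q_ratio[OF kK] q_pos[of k] by (simp add: pos_le_divide_eq mult.commute)
        then show ?thesis using q_pos by (subst ln_ge_iff) auto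
      qed
      finally show ?thesis .
    qed
    have "L (4 * (K + 2)\<^sup>2) - C \<le> (real K / 2) * ((real K / 2) * v)"
      using K0 L0[of "4 * (2 * J + 3)\<^sup>2"] by (simp add: v_def C_def power2_eq_square)
    also have "\<dots> \<le> real (card {..h}) * ((real K / 2) * v)"
      using h v0 K0 by (intro mult_right_mono) auto
    also have "\<dots> \<le> (\<Sum>k\<in>{..h}. ln (q K / q k))" by (rule sum_bounded_below) (use gain_at in auto)
    also have "\<dots> \<le> (\<Sum>k<K. ln (q K / q k))"
      using h q_mono q_pos by (intro sum_mono2) (auto simp: le_divide_eq_1_pos intro!: ln_ge_zero)
    finally show ?thesis .
  qed
  show ?thesis
    by (rule that[of l C]) (use l_0 l_ge l_le gap q_mono gain in \<open>auto simp: q_def\<close>)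
qed

section \<open>Comparison products over squares in closed form\<close>

lemma square_minus_product:
  assumes "j < M"
  shows "(\<Prod>k<j. (real M)\<^sup>2 / (real (Suc k))\<^sup>2 - 1) = fact (M + j) / (real M * fact (M - 1 - j) * (fact j)\<^sup>2)"
  using assms
proof (induction j)
  case 0
  then obtain M' where "M = Suc M'" by (cases M) auto
  then show ?case by simp
next
  case (Suc j)
  then obtain r where r: "M = Suc (Suc (j + r))"
    by (metis add_Suc_right less_imp_Suc_add add.commute)
  have "(real M)\<^sup>2 / (real (Suc j))\<^sup>2 - 1 = (real r + 1) * (real M + real j + 1) / (real (Suc j))\<^sup>2"
  proof -
    have "(real M)\<^sup>2 / (real (Suc j))\<^sup>2 - 1 = ((real M)\<^sup>2 - (real (Suc j))\<^sup>2) / (real (Suc j))\<^sup>2"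
      by (simp add: diff_divide_distrib)
    also have "(real M)\<^sup>2 - (real (Suc j))\<^sup>2 = (real r + 1) * (real M + real j + 1)"
      unfolding r by (simp add: power2_eq_square algebra_simps)
    finally show ?thesis .
  qed
  then have "(\<Prod>k<Suc j. (real M)\<^sup>2 / (real (Suc k))\<^sup>2 - 1)
     = fact (M + j) / (real M * fact (Suc r) * (fact j)\<^sup>2) * ((real r + 1) * (real M + real j + 1) / (real (Suc j))\<^sup>2)"
    using Suc r by simp
  also have "\<dots> = fact (M + Suc j) / (real M * fact r * (fact (Suc j))\<^sup>2)"
  proof -
    have "real M \<noteq> 0" using r by simp
    have f1: "fact (M + Suc j) = (real M + real j + 1) * (fact (M + j) :: real)" by (simp add: algebra_simps)
    have f2: "fact (Suc r) = (real r + 1) * (fact r :: real)" by (simp add: algebra_simps)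
    have f3: "fact (Suc j) = real (Suc j) * (fact j :: real)" by (simp add: algebra_simps)
    have "real r + 1 \<noteq> 0" by linarith
    then show ?thesis unfolding f1 f2 f3 power_mult_distrib using \<open>real M \<noteq> 0\<close> by (simp add: mult_ac)
  qed
  finally show ?case using r by simp
qed

lemma fact_log_convex: "(fact (i + p) :: real)\<^sup>2 \<le> fact i * fact (i + 2 * p)"
proof (induction p)
  case (Suc p)
  have "fact (i + Suc p) = real (i + p + 1) * (fact (i + p) :: real)" by (simp add: algebra_simps)
  then have "(fact (i + Suc p) :: real)\<^sup>2 = (real (i + p + 1))\<^sup>2 * (fact (i + p))\<^sup>2"
    by (simp only: power_mult_distrib)
  also have "\<dots> \<le> (real (i + 2 * p + 2) * real (i + 2 * p + 1)) * (fact i * fact (i + 2 * p))"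
    unfolding power2_eq_square[of "real (i + p + 1)"] using Suc by (intro mult_mono) auto
  also have "\<dots> = fact i * fact (i + 2 * Suc p)" by (simp add: algebra_simps)
  finally show ?case .
qed (simp add: power2_eq_square)

text \<open>The finite product equals the left side times
  \<open>n! (2 M + n)! / ((M + n)!)^2\<close>, which is at least 1 by log-convexity of the
  factorial.\<close>

lemma tail_product_ge:
  assumes M: "M \<ge> 1"
  shows "(fact M)\<^sup>2 / fact (2 * M) \<le> (\<Prod>i<n. 1 - (real M)\<^sup>2 / (real (M + Suc i))\<^sup>2)"
proof -
  have "(\<Prod>i<n. 1 - (real M)\<^sup>2 / (real (M + Suc i))\<^sup>2) = fact n * fact (2 * M + n) / fact (2 * M) * (fact M)\<^sup>2 / (fact (M + n))\<^sup>2"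
  proof (induction n)
    case (Suc n)
    have p: "real (M + Suc n) \<noteq> 0" by simp
    have "1 - (real M)\<^sup>2 / (real (M + Suc n))\<^sup>2 = real (Suc n) * real (2 * M + Suc n) / (real (M + Suc n))\<^sup>2"
      using p by (simp add: divide_simps) (simp add: power2_eq_square algebra_simps)
    then have "(\<Prod>i<Suc n. 1 - (real M)\<^sup>2 / (real (M + Suc i))\<^sup>2)
      = fact n * fact (2 * M + n) / fact (2 * M) * (fact M)\<^sup>2 / (fact (M + n))\<^sup>2 * (real (Suc n) * real (2 * M + Suc n) / (real (M + Suc n))\<^sup>2)"
      using Suc by simp
    also have "\<dots> = (real (Suc n) * fact n) * (real (2 * M + Suc n) * fact (2 * M + n)) / fact (2 * M) * (fact M)\<^sup>2 / (real (M + Suc n) * fact (M + n))\<^sup>2"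
      by (simp add: power_mult_distrib mult_ac)
    also have "real (Suc n) * fact n = fact (Suc n)" by simp
    also have "real (2 * M + Suc n) * fact (2 * M + n) = fact (2 * M + Suc n)" by simp
    also have "real (M + Suc n) * fact (M + n) = fact (M + Suc n)" by simp
    finally show ?case .
  qed simp
  moreover have "(fact M)\<^sup>2 / fact (2 * M) * 1 \<le> (fact M)\<^sup>2 / fact (2 * M) * (fact n * fact (n + 2 * M) / (fact (n + M))\<^sup>2 :: real)"
    using fact_log_convex[of n M] by (intro mult_left_mono) (auto simp: le_divide_eq)
  ultimately show ?thesis by (simp add: add.commute mult_ac)
qed

text \<open>The head grows like a central binomial coefficient, while the tail, with
  \<open>M + 1\<close> in place of \<open>M\<close>, decays like the inverse of one. With
  \<open>p = M - 1\<close> the factorials cancel to \<open>(p + 2) / (4 (2 p + 3))\<close>, which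
  decreases to \<open>1/8\<close>.\<close>

lemma binomial_quotient_ge:
  assumes M: "M \<ge> 1"
  shows "1 / 8 \<le> (\<Prod>k<M - 1. (real M)\<^sup>2 / (real (Suc k))\<^sup>2 - 1) * ((fact (M + 1))\<^sup>2 / fact (2 * (M + 1)))"
proof -
  obtain p where p: "M = Suc p" using M by (cases M) auto
  have "(\<Prod>k<p. (real (Suc p))\<^sup>2 / (real (Suc k))\<^sup>2 - 1) = fact (Suc p + p) / (real (Suc p) * fact (Suc p - 1 - p) * (fact p)\<^sup>2)"
    by (rule square_minus_product) simp
  moreover have "Suc p + p = 2 * p + 1" "Suc p - 1 - p = 0" "real (Suc p) = real (p + 1)" by simp_all
  ultimately have "(\<Prod>k<p. (real (p + 1))\<^sup>2 / (real (Suc k))\<^sup>2 - 1) = fact (2 * p + 1) / (real (p + 1) * (fact p)\<^sup>2)"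
    by (simp only: fact_0 mult_1_right)
  moreover have "M - 1 = p" "real M = real (p + 1)" using p by simp_all
  ultimately have 1: "(\<Prod>k<M - 1. (real M)\<^sup>2 / (real (Suc k))\<^sup>2 - 1) = fact (2 * p + 1) / (real (p + 1) * (fact p)\<^sup>2)"
    by (simp only:)
  have "M + 1 = Suc (Suc p)" using p by simp
  then have 2: "fact (M + 1) = real (p + 2) * real (p + 1) * (fact p :: real)"
    by (simp only: fact_Suc) simp
  have "2 * (M + 1) = Suc (Suc (Suc (2 * p + 1)))" using p by simp
  then have 3: "fact (2 * (M + 1)) = real (2 * p + 4) * real (2 * p + 3) * real (2 * p + 2) * (fact (2 * p + 1) :: real)"
    by (simp only: fact_Suc[of "Suc (Suc (2 * p + 1))"] fact_Suc[of "Suc (2 * p + 1)"] fact_Suc[of "2 * p + 1"]) (simp add: algebra_simps)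
  have "(\<Prod>k<M - 1. (real M)\<^sup>2 / (real (Suc k))\<^sup>2 - 1) * ((fact (M + 1))\<^sup>2 / fact (2 * (M + 1)))
     = fact (2 * p + 1) / (real (p + 1) * (fact p)\<^sup>2) * ((real (p + 2) * real (p + 1) * fact p)\<^sup>2 / (real (2 * p + 4) * real (2 * p + 3) * real (2 * p + 2) * fact (2 * p + 1)))"
    unfolding 1 2 3 ..
  also have "\<dots> = real (p + 2) ^ 2 * real (p + 1) / (real (2 * p + 4) * real (2 * p + 3) * real (2 * p + 2))"
  proof -
    have cancel: "F / (B * f\<^sup>2) * ((A * B * f)\<^sup>2 / (X * F)) = A\<^sup>2 * B / X" if "F \<noteq> 0" "f \<noteq> 0" "B \<noteq> 0" for F f A B X :: real
      using that by (simp add: power_mult_distrib power2_eq_square)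
    show ?thesis by (rule cancel) auto
  qed
  also have "\<dots> = real (p + 2) / (4 * real (2 * p + 3))"
  proof -
    have cancel: "A\<^sup>2 * B / ((2 * A) * X * (2 * B)) = A / (4 * X)" if "A \<noteq> 0" "B \<noteq> 0" for A B X :: real
      using that by (simp add: power2_eq_square)
    have "real (2 * p + 4) = 2 * real (p + 2)" "real (2 * p + 2) = 2 * real (p + 1)" by simp_all
    then show ?thesis by (simp only:) (rule cancel, auto)
  qed
  also have "\<dots> \<ge> 1 / 8" by (simp add: field_simps)
  finally show ?thesis .
qed

lemma prod_lessThan_add:
  fixes f :: "nat \<Rightarrow> real"
  shows "(\<Prod>k<i + n. f k) = (\<Prod>k<i. f k) * (\<Prod>k<n. f (i + k))"
  by (induction n) (auto simp: mult_ac)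

lemma sum_inverse_squares_le: "(\<Sum>k<n. 1 / (real (Suc k))\<^sup>2) \<le> 2"
proof (cases n)
  case (Suc n')
  have "(\<Sum>k<Suc j. 1 / (real (Suc k))\<^sup>2) \<le> 2 - 1 / real (Suc j)" for j
  proof (induction j)
    case (Suc j)
    have "1 / real (Suc j) - 1 / real (Suc (Suc j)) = 1 / (real (Suc j) * real (Suc (Suc j)))"
      by (simp add: field_simps)
    also have "\<dots> \<ge> 1 / (real (Suc (Suc j)))\<^sup>2"
      unfolding power2_eq_square by (intro divide_left_mono mult_right_mono mult_pos_pos) auto
    finally show ?case using Suc by simp
  qed simp
  from this[of n'] have "(\<Sum>k<n. 1 / (real (Suc k))\<^sup>2) \<le> 2 - 1 / real n" using Suc by simp
  also have "\<dots> \<le> 2" by simp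
  finally show ?thesis .
qed simp

section \<open>Lower bounds for the denominator on the real line\<close>

context sparse_subsequence
begin

lemma cmod_denom_factor:
  "cmod (denom_factor k (of_real x)) = cmod (a (m k) - of_real x) / cmod (a (m k))"
proof -
  have "denom_factor k (of_real x) = cnj (a (m k) - of_real x) / cnj (a (m k))"
    using a_nonzero[of "m k"] by (simp add: denom_factor_def diff_divide_distrib)
  then show ?thesis by (simp only: norm_divide complex_mod_cnj)
qed

text \<open>The imaginary part of a zero can only enlarge the numerator; in the denominator it costs
  at most \<open>exp (Y^2 / l^2)\<close> with \<open>l \<ge> k + 1\<close>, and the product of these
  costs is bounded.\<close>

lemma cmod_denom_factor_ge:
  "cmod (denom_factor k (of_real x)) \<ge> exp (- (Y\<^sup>2 / (real (Suc k))\<^sup>2)) * \<bar>1 - x / real (Suc (m k))\<bar>"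
proof -
  define l where "l = real (Suc (m k))"
  have l: "l > 0" by (simp add: l_def)
  have lk: "real (Suc k) \<le> l"
  proof -
    have "real (Suc k) * 1 \<le> real (Suc k) * real (Suc k)" by (intro mult_left_mono) auto
    also have "\<dots> \<le> l" using m_sparse[of k] by (simp only: l_def power2_eq_square)
    finally show ?thesis by (simp only: mult_1_right)
  qed
  have Re: "Re (a (m k)) = l" by (simp add: Re_a l_def)
  have I: "0 < Im (a (m k))" "Im (a (m k)) \<le> Y" by (rule Im_pos Im_le)+
  have "(cmod (a (m k)))\<^sup>2 = l\<^sup>2 + (Im (a (m k)))\<^sup>2" by (simp add: cmod_power2 Re)
  also have "\<dots> \<le> l\<^sup>2 + Y\<^sup>2" using I by (intro add_left_mono power_mono) auto
  also have "\<dots> = l\<^sup>2 * (1 + Y\<^sup>2 / l\<^sup>2)" using l by (simp add: field_simps)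
  also have "\<dots> \<le> l\<^sup>2 * (exp (Y\<^sup>2 / l\<^sup>2))\<^sup>2"
  proof (intro mult_left_mono)
    have "1 + Y\<^sup>2 / l\<^sup>2 \<le> exp (Y\<^sup>2 / l\<^sup>2)" by (rule exp_ge_add_one_self)
    also have "\<dots> \<le> exp (Y\<^sup>2 / l\<^sup>2) * exp (Y\<^sup>2 / l\<^sup>2)" by simp
    finally show "1 + Y\<^sup>2 / l\<^sup>2 \<le> (exp (Y\<^sup>2 / l\<^sup>2))\<^sup>2" by (simp add: power2_eq_square)
  qed simp
  finally have "(cmod (a (m k)))\<^sup>2 \<le> (l * exp (Y\<^sup>2 / l\<^sup>2))\<^sup>2" by (simp add: power_mult_distrib)
  then have "cmod (a (m k)) \<le> l * exp (Y\<^sup>2 / l\<^sup>2)" using l by (intro power2_le_imp_le[of "cmod (a (m k))"]) auto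
  also have "\<dots> \<le> l * exp (Y\<^sup>2 / (real (Suc k))\<^sup>2)"
    using l lk by (intro mult_left_mono) (auto intro!: divide_left_mono power_mono)
  finally have ub: "cmod (a (m k)) \<le> l * exp (Y\<^sup>2 / (real (Suc k))\<^sup>2)" .
  have "\<bar>l - x\<bar> \<le> cmod (a (m k) - of_real x)" using abs_Re_le_cmod[of "a (m k) - of_real x"] Re by simp
  then have "\<bar>l - x\<bar> / (l * exp (Y\<^sup>2 / (real (Suc k))\<^sup>2)) \<le> cmod (a (m k) - of_real x) / cmod (a (m k))"
    using ub l a_nonzero[of "m k"] by (intro frac_le) auto
  moreover have "\<bar>l - x\<bar> / (l * exp (Y\<^sup>2 / (real (Suc k))\<^sup>2)) = exp (- (Y\<^sup>2 / (real (Suc k))\<^sup>2)) * \<bar>1 - x / l\<bar>"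
  proof -
    have "1 - x / l = (l - x) / l" using l by (simp add: diff_divide_distrib)
    then have "\<bar>1 - x / l\<bar> = \<bar>l - x\<bar> / l" using l by (simp add: abs_divide)
    then show ?thesis by (simp add: exp_minus field_simps)
  qed
  ultimately show ?thesis unfolding cmod_denom_factor l_def by simp
qed

lemma prod_damping_ge: "exp (- (2 * Y\<^sup>2)) \<le> (\<Prod>k<n. exp (- (Y\<^sup>2 / (real (Suc k))\<^sup>2)))"
proof -
  have "(\<Sum>k<n. Y\<^sup>2 / (real (Suc k))\<^sup>2) = Y\<^sup>2 * (\<Sum>k<n. 1 / (real (Suc k))\<^sup>2)"
    by (simp add: sum_distrib_left)
  also have "\<dots> \<le> Y\<^sup>2 * 2"
    using sum_inverse_squares_le[of n] by (intro mult_left_mono) auto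
  finally show ?thesis by (simp add: exp_sum[symmetric] sum_negf)
qed

text \<open>As the two positions are at least 2 apart, \<open>x\<close> has horizontal distance at
  least 1 from one of them; the other zero is still at least its imaginary part away. This is where
  the size of the imaginary parts enters.\<close>

lemma two_middle_factors:
  assumes gap: "Suc (m K) + 2 \<le> Suc (m (Suc K))" and up: "\<And>k. Suc (m k) \<le> 4 * (Suc k)\<^sup>2"
    and Im_mono: "Im (a (m (Suc K))) \<le> Im (a (m K))"
  shows "Im (a (m (Suc K))) / ((4 + Y)\<^sup>2 * real (K + 2) ^ 4)
     \<le> cmod (denom_factor K (of_real x)) * cmod (denom_factor (Suc K) (of_real x))"
proof -
  have size: "cmod (a (m k)) \<le> (4 + Y) * (real (K + 2))\<^sup>2" if "k \<le> Suc K" for k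
  proof -
    have "cmod (a (m k)) \<le> real (Suc (m k)) + Y"
      using cmod_le[of "a (m k)"] Re_a[of "m k"] Im_pos[of "m k"] Im_le[of "m k"] by simp
    also have "real (Suc (m k)) \<le> real (4 * (Suc k)\<^sup>2)" using up[of k] by (simp only: of_nat_le_iff)
    also have "\<dots> \<le> 4 * (real (K + 2))\<^sup>2" using that by (simp add: power_mono)
    also have "Y \<le> Y * (real (K + 2))\<^sup>2" using Y_pos by (simp add: mult_le_cancel_left1)
    finally show ?thesis by (simp add: algebra_simps)
  qed
  have Re_dist: "\<bar>real (Suc (m k)) - x\<bar> \<le> cmod (a (m k) - of_real x)" for k
    using abs_Re_le_cmod[of "a (m k) - of_real x"] Re_a[of "m k"] by simp
  have Im_dist: "Im (a (m k)) \<le> cmod (a (m k) - of_real x)" for k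
    using abs_Im_le_cmod[of "a (m k) - of_real x"] Im_pos[of "m k"] by simp
  have "Im (a (m (Suc K))) \<le> cmod (a (m K) - of_real x) * cmod (a (m (Suc K)) - of_real x)"
  proof (cases "\<bar>real (Suc (m K)) - x\<bar> \<ge> 1")
    case True
    then have "1 * Im (a (m (Suc K))) \<le> cmod (a (m K) - of_real x) * cmod (a (m (Suc K)) - of_real x)"
      using Re_dist[of K] Im_dist[of "Suc K"] Im_pos[of "m (Suc K)"] by (intro mult_mono) auto
    then show ?thesis by simp
  next
    case False
    then have "\<bar>real (Suc (m (Suc K))) - x\<bar> \<ge> 1" using gap by (simp add: abs_if split: if_splits)
    then have "Im (a (m (Suc K))) * 1 \<le> cmod (a (m K) - of_real x) * cmod (a (m (Suc K)) - of_real x)"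
      using Re_dist[of "Suc K"] Im_dist[of K] Im_mono Im_pos[of "m (Suc K)"] by (intro mult_mono) auto
    then show ?thesis by simp
  qed
  moreover have "cmod (a (m K)) * cmod (a (m (Suc K))) \<le> (4 + Y)\<^sup>2 * real (K + 2) ^ 4"
  proof -
    have "cmod (a (m K)) * cmod (a (m (Suc K))) \<le> ((4 + Y) * (real (K + 2))\<^sup>2) * ((4 + Y) * (real (K + 2))\<^sup>2)"
      using Y_pos by (intro mult_mono size) auto
    also have "\<dots> = (4 + Y)\<^sup>2 * real (K + 2) ^ 4"
      by (simp only: power2_eq_square power4_eq_xxxx mult_ac)
    finally show ?thesis .
  qed
  ultimately have "Im (a (m (Suc K))) / ((4 + Y)\<^sup>2 * real (K + 2) ^ 4)
    \<le> (cmod (a (m K) - of_real x) * cmod (a (m (Suc K)) - of_real x)) / (cmod (a (m K)) * cmod (a (m (Suc K))))"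
    using a_nonzero by (intro frac_le) auto
  then show ?thesis by (simp add: cmod_denom_factor)
qed

text \<open>The product is split at the two zeros around \<open>x\<close>. Before them,
  \<open>x\<close> beyond the \<open>K\<close>-th zero yields the comparison factor times the gain
  \<open>q K / q k\<close>; after them, monotonicity of \<open>q\<close> yields the comparison
  factor itself. The two comparison products together cost only the constant
  \<open>1/8\<close>.\<close>

lemma denom_lower_bound:
  assumes ratio: "\<And>k j. k \<le> j \<Longrightarrow> real (Suc (m k)) / (real (Suc k))\<^sup>2 \<le> real (Suc (m j)) / (real (Suc j))\<^sup>2"
    and gap: "Suc (m K) + 2 \<le> Suc (m (Suc K))" and up: "\<And>k. Suc (m k) \<le> 4 * (Suc k)\<^sup>2"
    and Im_mono: "Im (a (m (Suc K))) \<le> Im (a (m K))"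
    and x: "real (Suc (m K)) \<le> x" "x \<le> real (Suc (m (Suc K)))"
  shows "exp (- (4 * Y\<^sup>2)) / 8
      * exp (\<Sum>k<K. ln ((real (Suc (m K)) / (real (Suc K))\<^sup>2) / (real (Suc (m k)) / (real (Suc k))\<^sup>2)))
      * (Im (a (m (Suc K))) / ((4 + Y)\<^sup>2 * real (K + 2) ^ 4)) \<le> cmod (denom (of_real x))"
proof -
  define q where "q = (\<lambda>k. real (Suc (m k)) / (real (Suc k))\<^sup>2)"
  define s where "s = (\<lambda>k. cmod (denom_factor k (of_real x)))"
  define G where "G = exp (\<Sum>k<K. ln (q K / q k))"
  define H where "H = Im (a (m (Suc K))) / ((4 + Y)\<^sup>2 * real (K + 2) ^ 4)"
  have q0: "q k > 0" for k by (simp add: q_def)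
  have qm: "q k \<le> q j" if "k \<le> j" for k j using ratio[OF that] by (simp add: q_def)
  have lq: "real (Suc (m k)) = q k * (real (Suc k))\<^sup>2" for k by (simp add: q_def)
  have H0: "H \<ge> 0" using Im_pos[of "m (Suc K)"] Y_pos by (simp add: H_def)
  have G_prod: "G = (\<Prod>k<K. q K / q k)" unfolding G_def
    by (simp add: exp_sum q0)
  define M where "M = Suc K"
  have head: "exp (- (2 * Y\<^sup>2)) * (G * (\<Prod>k<M - 1. (real M)\<^sup>2 / (real (Suc k))\<^sup>2 - 1)) \<le> (\<Prod>k<K. s k)"
  proof -
    have sk: "exp (- (Y\<^sup>2 / (real (Suc k))\<^sup>2)) * ((q K / q k) * ((real M)\<^sup>2 / (real (Suc k))\<^sup>2 - 1)) \<le> s k" if k: "k < K" for k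
    proof -
      define r where "r = q K / q k"
      define u where "u = (real M)\<^sup>2 / (real (Suc k))\<^sup>2"
      have r: "r \<ge> 1" using qm[of k K] q0[of k] k by (simp add: r_def)
      have "real (Suc (m K)) / real (Suc (m k)) = r * u" unfolding lq r_def u_def M_def by simp
      moreover have "real (Suc (m K)) / real (Suc (m k)) \<le> x / real (Suc (m k))"
        using x by (intro divide_right_mono) auto
      ultimately have "r * u \<le> x / real (Suc (m k))" by simp
      \<comment> \<open>Since \<open>r \<ge> 1\<close>, the gain can be pulled out in front of the
        factor \<open>u - 1\<close> that belongs to pure squares.\<close>
      moreover have "r * (u - 1) \<le> r * u - 1" using r by (simp add: algebra_simps)
      ultimately have "r * (u - 1) \<le> \<bar>1 - x / real (Suc (m k))\<bar>" by linarith
      then have "exp (- (Y\<^sup>2 / (real (Suc k))\<^sup>2)) * (r * (u - 1)) \<le> exp (- (Y\<^sup>2 / (real (Suc k))\<^sup>2)) * \<bar>1 - x / real (Suc (m k))\<bar>"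
        by (intro mult_left_mono) auto
      also have "\<dots> \<le> s k" unfolding s_def by (rule cmod_denom_factor_ge)
      finally show ?thesis by (simp add: r_def u_def)
    qed
    have pos: "0 \<le> (real M)\<^sup>2 / (real (Suc k))\<^sup>2 - 1" if "k < K" for k
      using that unfolding M_def by (simp add: le_divide_eq power_mono)
    have "exp (- (2 * Y\<^sup>2)) * (G * (\<Prod>k<M - 1. (real M)\<^sup>2 / (real (Suc k))\<^sup>2 - 1))
      \<le> (\<Prod>k<K. exp (- (Y\<^sup>2 / (real (Suc k))\<^sup>2))) * (G * (\<Prod>k<M - 1. (real M)\<^sup>2 / (real (Suc k))\<^sup>2 - 1))"
      using pos by (intro mult_right_mono prod_damping_ge mult_nonneg_nonneg prod_nonneg) (auto simp: G_def M_def)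
    also have "\<dots> = (\<Prod>k<K. exp (- (Y\<^sup>2 / (real (Suc k))\<^sup>2)) * ((q K / q k) * ((real M)\<^sup>2 / (real (Suc k))\<^sup>2 - 1)))"
      unfolding G_prod prod.distrib by (simp add: M_def)
    also have "\<dots> \<le> (\<Prod>k<K. s k)"
      by (rule prod_mono) (use sk pos q0 in \<open>auto intro!: mult_nonneg_nonneg divide_nonneg_nonneg less_imp_le[OF q0]\<close>)
    finally show ?thesis .
  qed
  have tail: "exp (- (2 * Y\<^sup>2)) * ((fact (M + 1))\<^sup>2 / fact (2 * (M + 1))) \<le> (\<Prod>i<n. s (K + 2 + i))" for n
  proof -
    have si: "exp (- (Y\<^sup>2 / (real (Suc i))\<^sup>2)) * (1 - (real (M + 1))\<^sup>2 / (real (M + 1 + Suc i))\<^sup>2) \<le> s (K + 2 + i)" for i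
    proof -
      define k where "k = K + 2 + i"
      have k1: "real (Suc k) = real (M + 1 + Suc i)" by (simp add: k_def M_def)
      have "x / real (Suc (m k)) \<le> real (Suc (m (Suc K))) / real (Suc (m k))"
        using x by (intro divide_right_mono) auto
      also have "\<dots> = (q (Suc K) / q k) * ((real (M + 1))\<^sup>2 / (real (Suc k))\<^sup>2)"
        unfolding lq M_def by simp
      also have "\<dots> \<le> 1 * ((real (M + 1))\<^sup>2 / (real (Suc k))\<^sup>2)"
        using qm[of "Suc K" k] q0[of k] by (intro mult_right_mono) (auto simp: k_def)
      finally have le: "1 - (real (M + 1))\<^sup>2 / (real (Suc k))\<^sup>2 \<le> \<bar>1 - x / real (Suc (m k))\<bar>" by linarith
      have "(real (M + 1))\<^sup>2 / (real (Suc k))\<^sup>2 \<le> 1"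
        unfolding k1 by (simp add: power_mono)
      then have "exp (- (Y\<^sup>2 / (real (Suc i))\<^sup>2)) * (1 - (real (M + 1))\<^sup>2 / (real (Suc k))\<^sup>2)
        \<le> exp (- (Y\<^sup>2 / (real (Suc k))\<^sup>2)) * \<bar>1 - x / real (Suc (m k))\<bar>"
        using le by (intro mult_mono) (auto simp: k_def intro!: divide_left_mono power_mono)
      also have "\<dots> \<le> s k" unfolding s_def by (rule cmod_denom_factor_ge)
      finally show ?thesis unfolding k1 unfolding k_def .
    qed
    have pos: "0 \<le> 1 - (real (M + 1))\<^sup>2 / (real (M + 1 + Suc i))\<^sup>2" for i
      by (simp add: power_mono)
    have "exp (- (2 * Y\<^sup>2)) * ((fact (M + 1))\<^sup>2 / fact (2 * (M + 1)))
      \<le> (\<Prod>i<n. exp (- (Y\<^sup>2 / (real (Suc i))\<^sup>2))) * (\<Prod>i<n. 1 - (real (M + 1))\<^sup>2 / (real (M + 1 + Suc i))\<^sup>2)"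
      by (intro mult_mono prod_damping_ge tail_product_ge prod_nonneg) auto
    also have "\<dots> = (\<Prod>i<n. exp (- (Y\<^sup>2 / (real (Suc i))\<^sup>2)) * (1 - (real (M + 1))\<^sup>2 / (real (M + 1 + Suc i))\<^sup>2))"
      by (simp only: prod.distrib)
    also have "\<dots> \<le> (\<Prod>i<n. s (K + 2 + i))"
      by (rule prod_mono) (use si pos in \<open>auto intro!: mult_nonneg_nonneg\<close>)
    finally show ?thesis .
  qed
  define A where "A = (\<Prod>k<M - 1. (real M)\<^sup>2 / (real (Suc k))\<^sup>2 - 1)"
  define B where "B = ((fact (M + 1))\<^sup>2 / fact (2 * (M + 1)) :: real)"
  have AB: "1 / 8 \<le> A * B" unfolding A_def B_def by (rule binomial_quotient_ge) (simp add: M_def)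
  have B0: "B > 0" by (simp add: B_def)
  have A0: "A \<ge> 0" using AB B0 by (smt (verit) mult_neg_pos divide_pos_pos)
  have fin: "exp (- (4 * Y\<^sup>2)) / 8 * G * H \<le> (\<Prod>k<K + 2 + n. s k)" for n
  proof -
    have mid: "H \<le> s K * s (Suc K)" unfolding H_def s_def by (rule two_middle_factors[OF gap up Im_mono])
    have "exp (- (4 * Y\<^sup>2)) = exp (- (2 * Y\<^sup>2)) * exp (- (2 * Y\<^sup>2))" by (simp flip: exp_add)
    then have "exp (- (4 * Y\<^sup>2)) / 8 * G * H = (exp (- (2 * Y\<^sup>2)) * exp (- (2 * Y\<^sup>2)) * G * H) * (1 / 8)" by simp
    also have "\<dots> \<le> (exp (- (2 * Y\<^sup>2)) * exp (- (2 * Y\<^sup>2)) * G * H) * (A * B)"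
      using H0 by (intro mult_left_mono AB) (auto simp: G_def)
    also have "\<dots> = (exp (- (2 * Y\<^sup>2)) * (G * A)) * H * (exp (- (2 * Y\<^sup>2)) * B)" by (simp add: mult_ac)
    also have "\<dots> \<le> (\<Prod>k<K. s k) * (s K * s (Suc K)) * (\<Prod>i<n. s (K + 2 + i))"
      using head tail[of n] mid A0 B0 H0 unfolding A_def[symmetric] B_def[symmetric]
      by (intro mult_mono mult_nonneg_nonneg prod_nonneg) (auto simp: G_def s_def)
    also have "\<dots> = (\<Prod>k<K + 2 + n. s k)" unfolding prod_lessThan_add by (simp add: numeral_2_eq_2 mult_ac)
    finally show ?thesis .
  qed
  have "(\<lambda>N. \<Prod>k<N. s k) \<longlonglongrightarrow> cmod (denom (of_real x))"
    unfolding s_def prod_norm by (intro tendsto_norm denom_LIMSEQ)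
  then have "(\<lambda>n. \<Prod>k<n + (K + 2). s k) \<longlonglongrightarrow> cmod (denom (of_real x))" by (rule LIMSEQ_ignore_initial_segment)
  then have "exp (- (4 * Y\<^sup>2)) / 8 * G * H \<le> cmod (denom (of_real x))"
    by (rule LIMSEQ_le_const) (use fin in \<open>auto simp: add.commute\<close>)
  then show ?thesis by (simp add: G_def H_def q_def)
qed

text \<open>The point may sit at the first zero, whose factor is bounded below through its imaginary
  part; the remaining comparison factors \<open>1 - 1 / (k + 2)^2\<close> telescope to a product
  above \<open>1/2\<close>.\<close>

lemma denom_lower_bound_initial:
  assumes x: "0 \<le> x" "x \<le> 1"
  shows "exp (- (2 * Y\<^sup>2)) / 2 * (Im (a (m 0)) / cmod (a (m 0))) \<le> cmod (denom (of_real x))"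
proof -
  define s where "s = (\<lambda>k. cmod (denom_factor k (of_real x)))"
  define h where "h = Im (a (m 0)) / cmod (a (m 0))"
  have h0: "h > 0" using Im_pos[of "m 0"] a_nonzero[of "m 0"] by (simp add: h_def)
  have s0: "h \<le> s 0"
    using abs_Im_le_cmod[of "a (m 0) - of_real x"] Im_pos[of "m 0"]
    unfolding s_def cmod_denom_factor h_def by (intro divide_right_mono) auto
  have sk: "exp (- (Y\<^sup>2 / (real (Suc k))\<^sup>2)) * (1 - 1 / (real (Suc (Suc k)))\<^sup>2) \<le> s (Suc k)" for k
  proof -
    have "x / real (Suc (m (Suc k))) \<le> 1 / (real (Suc (Suc k)))\<^sup>2"
      using m_sparse[of "Suc k"] x by (intro frac_le) auto
    moreover have "1 / (real (Suc (Suc k)))\<^sup>2 \<le> 1" by simp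
    ultimately have "exp (- (Y\<^sup>2 / (real (Suc k))\<^sup>2)) * (1 - 1 / (real (Suc (Suc k)))\<^sup>2)
      \<le> exp (- (Y\<^sup>2 / (real (Suc (Suc k)))\<^sup>2)) * \<bar>1 - x / real (Suc (m (Suc k)))\<bar>"
      by (intro mult_mono) (auto intro!: divide_left_mono power_mono)
    also have "\<dots> \<le> s (Suc k)" unfolding s_def by (rule cmod_denom_factor_ge)
    finally show ?thesis .
  qed
  have half: "(\<Prod>k<n. 1 - 1 / (real (Suc (Suc k)))\<^sup>2) = (real n + 2) / (2 * (real n + 1))" for n
  proof (induction n)
    case (Suc n)
    have "real n + 1 \<noteq> 0" "real n + 2 \<noteq> 0" by linarith+
    moreover have "1 - 1 / (real (Suc (Suc n)))\<^sup>2 = (real n + 1) * (real n + 3) / (real n + 2)\<^sup>2"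
      using \<open>real n + 2 \<noteq> 0\<close> by (simp add: divide_simps) (simp add: power2_eq_square algebra_simps)
    moreover have cancel: "A / (2 * B) * (B * C / A\<^sup>2) = C / (2 * A)" if "A \<noteq> 0" "B \<noteq> 0" for A B C :: real
      using that by (simp add: power2_eq_square)
    ultimately have "(\<Prod>k<Suc n. 1 - 1 / (real (Suc (Suc k)))\<^sup>2) = (real n + 3) / (2 * (real n + 2))"
      using Suc by (simp only: prod.lessThan_Suc)
    then show ?case by (simp add: add_ac)
  qed simp
  have fin: "exp (- (2 * Y\<^sup>2)) / 2 * h \<le> (\<Prod>k<Suc n. s k)" for n
  proof -
    have "1 / 2 \<le> (\<Prod>k<n. 1 - 1 / (real (Suc (Suc k)))\<^sup>2)" unfolding half by (simp add: field_simps)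
    then have "h * (exp (- (2 * Y\<^sup>2)) * (1 / 2)) \<le> h * ((\<Prod>k<n. exp (- (Y\<^sup>2 / (real (Suc k))\<^sup>2))) * (\<Prod>k<n. 1 - 1 / (real (Suc (Suc k)))\<^sup>2))"
      using h0 by (intro mult_left_mono mult_mono prod_damping_ge) (auto intro!: prod_nonneg)
    also have "\<dots> \<le> s 0 * (\<Prod>k<n. s (Suc k))"
      unfolding prod.distrib[symmetric]
      by (intro mult_mono prod_mono s0) (use sk h0 in \<open>auto intro!: mult_nonneg_nonneg prod_nonneg simp: s_def\<close>)
    also have "\<dots> = (\<Prod>k<Suc n. s k)" by (rule prod.lessThan_Suc_shift[symmetric])
    finally show ?thesis by (simp add: mult_ac)
  qed
  have "(\<lambda>N. \<Prod>k<N. s k) \<longlonglongrightarrow> cmod (denom (of_real x))"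
    unfolding s_def prod_norm by (intro tendsto_norm denom_LIMSEQ)
  then have "(\<lambda>n. \<Prod>k<Suc n. s k) \<longlonglongrightarrow> cmod (denom (of_real x))" by (rule LIMSEQ_Suc)
  then show ?thesis unfolding h_def[symmetric] by (rule LIMSEQ_le_const) (use fin in auto)
qed

text \<open>The zeros have positive real parts, so \<open>-x\<close> is at least as far from each of
  them as \<open>x\<close>. With \<open>w\<close> even, estimates on the positive half-axis
  suffice.\<close>

lemma denom_negative_axis:
  assumes "x \<ge> 0"
  shows "cmod (denom (of_real x)) \<le> cmod (denom (of_real (- x)))"
proof (rule LIMSEQ_le)
  show "(\<lambda>N. cmod (\<Prod>k<N. denom_factor k (of_real x))) \<longlonglongrightarrow> cmod (denom (of_real x))"
    "(\<lambda>N. cmod (\<Prod>k<N. denom_factor k (of_real (- x)))) \<longlonglongrightarrow> cmod (denom (of_real (- x)))"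
    by (intro tendsto_norm denom_LIMSEQ)+
  have "cmod (denom_factor k (of_real x)) \<le> cmod (denom_factor k (of_real (- x)))" for k
  proof -
    have "\<bar>Re (a (m k)) - x\<bar> \<le> \<bar>Re (a (m k)) + x\<bar>" using assms Re_a[of "m k"] by simp
    then have "(Re (a (m k)) - x)\<^sup>2 \<le> (Re (a (m k)) + x)\<^sup>2" by (simp only: abs_le_square_iff)
    then have "cmod (a (m k) - of_real x) \<le> cmod (a (m k) - of_real (- x))"
      unfolding cmod_def by (intro real_sqrt_le_mono) simp
    then show ?thesis unfolding cmod_denom_factor by (rule divide_right_mono) simp
  qed
  then show "\<exists>N. \<forall>n\<ge>N. cmod (\<Prod>k<n. denom_factor k (of_real x)) \<le> cmod (\<Prod>k<n. denom_factor k (of_real (- x)))"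
    by (intro exI[of _ 0] allI impI) (auto simp: prod_norm[symmetric] simp del: of_real_minus intro!: prod_mono)
qed

end

section \<open>From convergent logarithmic sums to admissibility\<close>

lemma summable_powr_ln: "summable (\<lambda>k. real (Suc k) powr (-3/2) * ln (real (Suc k)))"
proof (rule summable_comparison_test)
  have "summable (\<lambda>n. real n powr (-5/4))" by (subst summable_real_powr_iff) simp
  then show "summable (\<lambda>k. 4 * real (Suc k) powr (-5/4))"
    by (intro summable_mult) (subst summable_Suc_iff)
  have "norm (real (Suc k) powr (-3/2) * ln (real (Suc k))) \<le> 4 * real (Suc k) powr (-5/4)" for k
  proof -
    have "ln (real (Suc k)) \<le> real (Suc k) powr (1/4) / (1/4)" by (rule ln_powr_bound) auto
    then have "real (Suc k) powr (-3/2) * ln (real (Suc k)) \<le> real (Suc k) powr (-3/2) * (4 * real (Suc k) powr (1/4))"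
      by (intro mult_left_mono) auto
    also have "\<dots> = 4 * (real (Suc k) powr (-3/2) * real (Suc k) powr (1/4))" by simp
    also have "real (Suc k) powr (-3/2) * real (Suc k) powr (1/4) = real (Suc k) powr (-5/4)"
      by (simp flip: powr_add)
    finally show ?thesis by (simp add: abs_mult)
  qed
  then show "\<exists>N. \<forall>n\<ge>N. norm (real (Suc n) powr (-3/2) * ln (real (Suc n))) \<le> 4 * real (Suc n) powr (-5/4)" by blast
qed

lemma summable_positive_part:
  fixes u :: "nat \<Rightarrow> real"
  assumes s: "summable (\<lambda>k. real (Suc k) powr (-3/2) * u (Suc k))" and b: "\<And>n. n \<ge> 1 \<Longrightarrow> - b \<le> u n"
  shows "summable (\<lambda>k. real (Suc k) powr (-3/2) * max 0 (u (Suc k)))"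
proof (rule summable_comparison_test)
  have "summable (\<lambda>n. real n powr (-3/2))" by (subst summable_real_powr_iff) simp
  then have "summable (\<lambda>k. \<bar>b\<bar> * real (Suc k) powr (-3/2))"
    by (intro summable_mult) (subst summable_Suc_iff)
  from summable_add[OF s this]
  show "summable (\<lambda>k. real (Suc k) powr (-3/2) * u (Suc k) + \<bar>b\<bar> * real (Suc k) powr (-3/2))" .
  have "norm (real (Suc k) powr (-3/2) * max 0 (u (Suc k))) \<le> real (Suc k) powr (-3/2) * u (Suc k) + \<bar>b\<bar> * real (Suc k) powr (-3/2)" for k
  proof -
    have "max 0 (u (Suc k)) \<le> u (Suc k) + \<bar>b\<bar>" using b[of "Suc k"] by auto
    then have "real (Suc k) powr (-3/2) * max 0 (u (Suc k)) \<le> real (Suc k) powr (-3/2) * (u (Suc k) + \<bar>b\<bar>)"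
      by (intro mult_left_mono) auto
    then show ?thesis by (simp add: abs_mult algebra_simps)
  qed
  then show "\<exists>N. \<forall>n\<ge>N. norm (real (Suc n) powr (-3/2) * max 0 (u (Suc n))) \<le> real (Suc n) powr (-3/2) * u (Suc n) + \<bar>b\<bar> * real (Suc n) powr (-3/2)" by blast
qed

lemma summable_of_log_integral:
  fixes w :: "real \<Rightarrow> real"
  assumes wpos: "\<And>t. w t > 0" and wmono: "\<And>s t. 0 \<le> s \<Longrightarrow> s \<le> t \<Longrightarrow> w t \<le> w s"
    and wint: "set_integrable lborel {1..} (\<lambda>t. t powr (-3/2) * ln (1 / w t))"
  shows "summable (\<lambda>k. real (Suc k) powr (-3/2) * max 0 (ln (1 / w (real (Suc k)))))"
proof -
  define \<phi> where "\<phi> = (\<lambda>t. max 0 (ln (1 / w t)))"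
  define g where "g = (\<lambda>t. indicator {1..} t *\<^sub>R (t powr (-3/2) * ln (1 / w t)))"
  have gi: "integrable lborel g" using wint by (simp add: set_integrable_def g_def)
  have \<phi>_mono: "\<phi> s \<le> \<phi> t" if "0 \<le> s" "s \<le> t" for s t
  proof -
    have "ln (1 / w s) \<le> ln (1 / w t)"
      using wmono[OF that] wpos[of s] wpos[of t] by (intro ln_mono divide_left_mono) auto
    then show ?thesis unfolding \<phi>_def by (intro max.mono) auto
  qed
  \<comment> \<open>The power is taken at the right end and \<open>\<phi>\<close> at the left end of
    the interval from \<open>n + 1\<close> to \<open>n + 2\<close>: one decreases and the other
    increases, so both are lower bounds there.\<close>
  define c where "c = (\<lambda>n. real (Suc (Suc n)) powr (-3/2) * \<phi> (real (Suc n)))"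
  have c0: "c n \<ge> 0" for n by (simp add: c_def \<phi>_def)
  have pw: "c n * indicator {real (Suc n)..<real (Suc (Suc n))} t \<le> \<bar>g t\<bar>" for n t
  proof (cases "t \<in> {real (Suc n)..<real (Suc (Suc n))}")
    case True
    then have t: "1 \<le> t" "real (Suc n) \<le> t" "t \<le> real (Suc (Suc n))" by auto
    have "c n \<le> t powr (-3/2) * \<phi> t" unfolding c_def
      using t by (intro mult_mono powr_mono2' \<phi>_mono) (auto simp: \<phi>_def)
    also have "\<dots> \<le> \<bar>g t\<bar>" using t by (auto simp: g_def \<phi>_def abs_mult intro!: mult_left_mono)
    finally show ?thesis using True by simp
  qed simp
  have "summable c"
  proof (rule summableI_nonneg_bounded[OF c0])
    fix N
    define S where "S = (\<lambda>t. \<Sum>n<N. c n * indicator {real (Suc n)..<real (Suc (Suc n))} t)"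
    have S_le: "S t \<le> \<bar>g t\<bar>" for t
    proof (cases "\<exists>n<N. t \<in> {real (Suc n)..<real (Suc (Suc n))}")
      case True
      then obtain n where n: "n < N" "t \<in> {real (Suc n)..<real (Suc (Suc n))}" by auto
      have "S t = (\<Sum>k\<in>{n}. c k * indicator {real (Suc k)..<real (Suc (Suc k))} t)" unfolding S_def
      proof (rule sum.mono_neutral_right)
        show "\<forall>i\<in>{..<N} - {n}. c i * indicator {real (Suc i)..<real (Suc (Suc i))} t = 0"
        proof
          fix i assume i: "i \<in> {..<N} - {n}"
          have "t \<notin> {real (Suc i)..<real (Suc (Suc i))}"
          proof
            assume "t \<in> {real (Suc i)..<real (Suc (Suc i))}"
            then have "real i < real n + 1" "real n < real i + 1" using n by auto
            then have "i = n" by linarith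
            then show False using i by simp
          qed
          then show "c i * indicator {real (Suc i)..<real (Suc (Suc i))} t = 0" by simp
        qed
      qed (use n in auto)
      also have "\<dots> = c n * indicator {real (Suc n)..<real (Suc (Suc n))} t"
        by (simp only: sum.insert finite.emptyI sum.empty empty_iff not_False_eq_True add_0_right)
      finally show ?thesis using pw[of n t] by simp
    next
      case False
      then have "S t = 0" unfolding S_def by (intro sum.neutral) (auto simp: indicator_def)
      then show ?thesis by simp
    qed
    have ii: "integrable lborel (\<lambda>t. c n * indicator {real (Suc n)..<real (Suc (Suc n))} t)" for n
      by (intro integrable_mult_right integrable_real_indicator) auto
    have "(\<Sum>n<N. c n) = (\<Sum>n<N. \<integral>t. c n * indicator {real (Suc n)..<real (Suc (Suc n))} t \<partial>lborel)"
      by simp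
    also have "\<dots> = (\<integral>t. S t \<partial>lborel)" unfolding S_def
      by (rule Bochner_Integration.integral_sum[symmetric]) (rule ii)
    also have "\<dots> \<le> (\<integral>t. \<bar>g t\<bar> \<partial>lborel)"
    proof (rule integral_mono)
      show "integrable lborel S" unfolding S_def by (intro Bochner_Integration.integrable_sum ii)
    qed (auto intro: S_le gi)
    finally show "(\<Sum>n<N. c n) \<le> (\<integral>t. \<bar>g t\<bar> \<partial>lborel)" .
  qed
  show ?thesis
  proof (rule summable_comparison_test)
    show "summable (\<lambda>k. 2 powr (3/2) * c k)" using \<open>summable c\<close> by (rule summable_mult)
    have "norm (real (Suc k) powr (-3/2) * max 0 (ln (1 / w (real (Suc k))))) \<le> 2 powr (3/2) * c k" for k
    proof -
      \<comment> \<open>As \<open>k + 2 \<le> 2 (k + 1)\<close>, moving the power back to the left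
        end costs only \<open>2 powr (3/2)\<close>.\<close>
      have "real (Suc k) powr (-3/2) = 2 powr (3/2) * (2 * real (Suc k)) powr (-3/2)"
      proof -
        have "(2 * real (Suc k)) powr (-3/2) = 2 powr (-3/2) * real (Suc k) powr (-3/2)" by (rule powr_mult)
        moreover have "2 powr (3/2) * 2 powr (-3/2) = (1::real)" by (simp flip: powr_add)
        ultimately show ?thesis by (simp only: mult.assoc[symmetric] mult_1_left)
      qed
      also have "\<dots> \<le> 2 powr (3/2) * real (Suc (Suc k)) powr (-3/2)"
        by (intro mult_left_mono powr_mono2') auto
      finally have "real (Suc k) powr (-3/2) * \<phi> (real (Suc k)) \<le> (2 powr (3/2) * real (Suc (Suc k)) powr (-3/2)) * \<phi> (real (Suc k))"
        by (rule mult_right_mono) (simp add: \<phi>_def)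
      then show ?thesis by (simp add: c_def \<phi>_def abs_mult mult.assoc)
    qed
    then show "\<exists>N. \<forall>n\<ge>N. norm (real (Suc n) powr (-3/2) * max 0 (ln (1 / w (real (Suc n))))) \<le> 2 powr (3/2) * c n" by blast
  qed
qed

lemma antitone_from_Suc:
  fixes y :: "nat \<Rightarrow> real"
  assumes ydec: "\<And>n. n \<ge> 1 \<Longrightarrow> y (Suc n) \<le> y n" and mn: "1 \<le> m" "m \<le> n"
  shows "y n \<le> y m"
  using mn(2)
proof (induction n rule: dec_induct)
  case (step n)
  then show ?case using ydec[of n] mn(1) by linarith
qed simp

lemma unit_spaced_zeros_B1:
  fixes y :: "nat \<Rightarrow> real"
  assumes ypos: "\<And>n. n \<ge> 1 \<Longrightarrow> y n > 0" and ydec: "\<And>n. n \<ge> 1 \<Longrightarrow> y (Suc n) \<le> y n"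
  shows "unit_spaced_zeros (\<lambda>k. Complex (real (Suc k)) (y (Suc k))) (y 1)"
  by unfold_locales (use ypos antitone_from_Suc[of y 1] ydec in auto)

lemma admissible_of_summable:
  fixes y :: "nat \<Rightarrow> real" and w :: "real \<Rightarrow> real"
  assumes ypos: "\<And>n. n \<ge> 1 \<Longrightarrow> y n > 0" and ydec: "\<And>n. n \<ge> 1 \<Longrightarrow> y (Suc n) \<le> y n"
    and sy: "summable (\<lambda>k. real (Suc k) powr (-3/2) * ln (1 / y (Suc k)))"
    and wpos: "\<And>t. w t > 0" and weven: "\<And>t. w (- t) = w t"
    and wmono: "\<And>s t. 0 \<le> s \<Longrightarrow> s \<le> t \<Longrightarrow> w t \<le> w s"
    and wint: "set_integrable lborel {1..} (\<lambda>t. t powr (-3/2) * ln (1 / w t))"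
  shows "w \<in> Adm (B1 y)"
proof -
  have yanti: "y n \<le> y m" if "1 \<le> m" "m \<le> n" for m n
    using antitone_from_Suc[of y m n] ydec that by blast
  \<comment> \<open>The three costs that the gain must cover: the majorant, the imaginary part from
    the middle factors, and a fourth power of \<open>n\<close> for the polynomial denominators
    together with the quadratic growth.\<close>
  define L where "L = (\<lambda>n. max 0 (ln (1 / w (real n))) + max 0 (ln (1 / y n)) + 4 * ln (real n))"
  have L0: "L n \<ge> 0" for n unfolding L_def by (cases n) auto
  have Lmono: "L m \<le> L n" if mn: "1 \<le> m" "m \<le> n" for m n
    unfolding L_def
  proof (intro add_mono max.mono order.refl mult_left_mono)
    show "ln (1 / w (real m)) \<le> ln (1 / w (real n))"
      using wmono[of "real m" "real n"] wpos[of "real m"] wpos[of "real n"] mn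
      by (intro ln_mono divide_left_mono) auto
    show "ln (1 / y m) \<le> ln (1 / y n)"
      using yanti[OF mn] ypos[of m] ypos[of n] mn by (intro ln_mono divide_left_mono) auto
    show "ln (real m) \<le> ln (real n)" using mn by (intro ln_mono) auto
  qed simp
  have smL: "summable (\<lambda>k. real (Suc k) powr (-3/2) * L (Suc k))"
  proof -
    have "- ln (y 1) \<le> ln (1 / y n)" if "n \<ge> 1" for n
    proof -
      have "1 / y 1 \<le> 1 / y n" using yanti[of 1 n] ypos[of 1] ypos[of n] that by (intro divide_left_mono) auto
      then have "ln (1 / y 1) \<le> ln (1 / y n)" using ypos[of 1] by (intro ln_mono) auto
      then show ?thesis using ypos[of 1] by (simp add: ln_div)
    qed
    then have 1: "summable (\<lambda>k. real (Suc k) powr (-3/2) * max 0 (ln (1 / y (Suc k))))"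
      by (intro summable_positive_part[of "\<lambda>n. ln (1 / y n)" "ln (y 1)"] sy) auto
    have 2: "summable (\<lambda>k. 4 * (real (Suc k) powr (-3/2) * ln (real (Suc k))))"
      by (intro summable_mult summable_powr_ln)
    from summable_add[OF summable_add[OF summable_of_log_integral[OF wpos wmono wint] 1] 2]
    show ?thesis by (simp add: L_def algebra_simps)
  qed
  obtain l :: "nat \<Rightarrow> nat" and C :: real where l:
    "l 0 = 1" "\<And>k. (Suc k)\<^sup>2 \<le> l k" "\<And>k. l k \<le> 4 * (Suc k)\<^sup>2" 
    "\<And>k. l k + 2 \<le> l (Suc k)"
    "\<And>k j. k \<le> j \<Longrightarrow> real (l k) / (real (Suc k))\<^sup>2 \<le> real (l j) / (real (Suc j))\<^sup>2"
    "\<And>K. L (4 * (K + 2)\<^sup>2) - C \<le> (\<Sum>k<K. ln ((real (l K) / (real (Suc K))\<^sup>2) / (real (l k) / (real (Suc k))\<^sup>2)))"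
  proof (rule sparse_zero_sequence[of L], goal_cases)
    case 1 show ?case by (rule L0)
  next
    case (2 m n) show ?case by (rule Lmono) (fact 2)+
  next
    case 3 show ?case by (rule smL)
  next
    case (4 l C)
    show ?case by (rule that) (fact 4)+
  qed
  \<comment> \<open>Index \<open>n\<close> stands for the zero with real part \<open>n + 1\<close>,
    hence the shift by one.\<close>
  define m where "m = (\<lambda>k. l k - 1)"
  have l1: "l k \<ge> 1" for k using l(2)[of k] by (simp add: power2_eq_square)
  have Sm: "Suc (m k) = l k" for k using l1[of k] by (simp add: m_def)
  define a where "a = (\<lambda>k. Complex (real (Suc k)) (y (Suc k)))"
  have Ima: "Im (a (m k)) = y (l k)" for k by (simp add: a_def Sm)
  interpret unit_spaced_zeros a "y 1" unfolding a_def by (rule unit_spaced_zeros_B1) (fact ypos ydec)+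
  interpret sparse_subsequence a "y 1" m
  proof
    have "m k < m (Suc k)" for k using l(4)[of k] l1[of k] unfolding m_def by linarith
    then show "strict_mono m" by (simp add: strict_mono_Suc_iff)
    show "(real (Suc k))\<^sup>2 \<le> real (Suc (m k))" for k
    proof -
      have "real ((Suc k)\<^sup>2) \<le> real (l k)" using l(2)[of k] by (simp only: of_nat_le_iff)
      then show ?thesis unfolding Sm by (simp only: of_nat_power)
    qed
  qed
  define \<beta> where "\<beta> = exp (- (4 * (y 1)\<^sup>2)) / 8 * exp (- C) / (4 + y 1)\<^sup>2"
  have y1: "y 1 > 0" using ypos by simp
  have \<beta>: "\<beta> > 0" using y1 by (simp add: \<beta>_def)
  have far: "\<beta> * (1 + x\<^sup>2) \<le> 2 * cmod (denom (of_real x)) \<and> \<beta> \<le> w x * cmod (denom (of_real x))" if x: "x \<ge> 1" for x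
  proof -
    obtain N :: nat where N: "x < real N" using reals_Archimedean2 by blast
    have "\<exists>K. real (l K) \<le> x \<and> x \<le> real (l (Suc K))"
    proof -
      define K1 where "K1 = (LEAST k. x \<le> real (l k))"
      have "N \<le> (Suc N)\<^sup>2" by (simp add: power2_eq_square)
      then have "x \<le> real (l N)" using N l(2)[of N] by linarith
      then have K1: "x \<le> real (l K1)" unfolding K1_def by (rule LeastI)
      show ?thesis
      proof (cases K1)
        case 0
        then have "x = 1" using K1 x l(1) by simp
        then show ?thesis using l(1) l1[of 1] by (intro exI[of _ 0]) simp
      next
        case (Suc K)
        then have "\<not> x \<le> real (l K)" unfolding K1_def by (intro not_less_Least) simp
        then show ?thesis using K1 Suc by (intro exI[of _ K]) auto
      qed
    qed
    then obtain K where K: "real (l K) \<le> x" "x \<le> real (l (Suc K))" by blast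
    \<comment> \<open>This bounds \<open>l (K + 1)\<close> and therefore \<open>x\<close>, so by
      monotonicity \<open>w\<close> and \<open>y\<close> can be estimated through their values at
      \<open>n\<close>.\<close>
    define n where "n = 4 * (K + 2)\<^sup>2"
    have n1: "n \<ge> 1" by (simp add: n_def)
    have ln: "l (Suc K) \<le> n" using l(3)[of "Suc K"] by (simp add: n_def)
    have xn: "x \<le> real n" using K ln by linarith
    have yl: "y (l (Suc K)) > 0" using ypos l1 by simp
    have yln: "y n \<le> y (l (Suc K))" using yanti[OF l1 ln] .
    have lb: "exp (- (4 * (y 1)\<^sup>2)) / 8
      * exp (\<Sum>k<K. ln ((real (Suc (m K)) / (real (Suc K))\<^sup>2) / (real (Suc (m k)) / (real (Suc k))\<^sup>2)))
      * (Im (a (m (Suc K))) / ((4 + y 1)\<^sup>2 * real (K + 2) ^ 4)) \<le> cmod (denom (of_real x))"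
    proof (rule denom_lower_bound)
      show "Im (a (m (Suc K))) \<le> Im (a (m K))" unfolding Ima using l(4)[of K] by (intro yanti l1) simp
    qed (use l K in \<open>simp_all add: Sm\<close>)
    have eL: "exp (L n - C) \<le> exp (\<Sum>k<K. ln ((real (Suc (m K)) / (real (Suc K))\<^sup>2) / (real (Suc (m k)) / (real (Suc k))\<^sup>2)))"
      unfolding Sm exp_le_cancel_iff n_def by (rule l(6))
    define W where "W = max 1 (1 / w (real n))"
    have eLn: "exp (L n) \<ge> W * (1 / y n) * real n ^ 4"
    proof -
      have "exp (max 0 (ln (1 / w (real n)))) = W" unfolding W_def using wpos[of "real n"] by (simp add: max_def)
      moreover have "exp (max 0 (ln (1 / y n))) \<ge> 1 / y n" 
      proof -
        have "exp (ln (1 / y n)) \<le> exp (max 0 (ln (1 / y n)))" by simp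
        then show ?thesis using ypos[OF n1] by simp
      qed
      moreover have "exp (4 * ln (real n)) = real n ^ 4" using n1
        by (metis exp_ln exp_of_nat_mult of_nat_0_less_iff of_nat_numeral zero_less_one order_less_le_trans)
      moreover have "W \<ge> 1" by (simp add: W_def)
      ultimately show ?thesis unfolding L_def exp_add by (intro mult_mono) (auto simp: ypos[OF n1] less_imp_le)
    qed
    have W1: "W \<ge> 1" by (simp add: W_def)
    have nK: "real n = 4 * (real (K + 2))\<^sup>2" by (simp add: n_def)
    have main: "\<beta> * (W * (real n)\<^sup>2) \<le> cmod (denom (of_real x))"
    proof -
      define \<gamma> where "\<gamma> = exp (- (4 * (y 1)\<^sup>2)) / 8"
      define D where "D = (4 + y 1)\<^sup>2"
      have D: "D > 0" using y1 by (simp add: D_def)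
      have g: "\<gamma> > 0" by (simp add: \<gamma>_def)
      \<comment> \<open>As \<open>n = 4 (K + 2)^2\<close>, half of the fourth power pays for
        \<open>(K + 2)^4\<close> and \<open>n^2\<close> is left for the quadratic growth.\<close>
      have "(real n)\<^sup>2 * real (K + 2) ^ 4 \<le> real n ^ 4"
      proof -
        have "real (K + 2) ^ 4 = ((real (K + 2))\<^sup>2)\<^sup>2" by simp
        also have "\<dots> \<le> (real n)\<^sup>2" unfolding nK by (intro power_mono) auto
        finally have "(real n)\<^sup>2 * real (K + 2) ^ 4 \<le> (real n)\<^sup>2 * (real n)\<^sup>2" by (intro mult_left_mono) auto
        then show ?thesis by (simp flip: power_add)
      qed
      then have "(real n)\<^sup>2 \<le> real n ^ 4 / real (K + 2) ^ 4" by (simp add: pos_le_divide_eq)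
      then have "\<beta> * (W * (real n)\<^sup>2) \<le> \<beta> * (W * (real n ^ 4 / real (K + 2) ^ 4))"
        using \<beta> W1 by (intro mult_left_mono) auto
      also have "\<dots> \<le> \<beta> * (W * (real n ^ 4 / real (K + 2) ^ 4)) * (y (l (Suc K)) / y n)"
      proof -
        have "0 \<le> \<beta> * (W * (real n ^ 4 / real (K + 2) ^ 4))"
          using \<beta> W1 by (intro mult_nonneg_nonneg divide_nonneg_nonneg) auto
        moreover have "1 \<le> y (l (Suc K)) / y n" using yln ypos[OF n1] by (simp add: le_divide_eq)
        ultimately have "\<beta> * (W * (real n ^ 4 / real (K + 2) ^ 4)) * 1 \<le> \<beta> * (W * (real n ^ 4 / real (K + 2) ^ 4)) * (y (l (Suc K)) / y n)"
          by (rule mult_left_mono[rotated])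
        then show ?thesis by (simp only: mult_1_right)
      qed
      also have "\<dots> = \<gamma> * (exp (- C) * (W * (1 / y n) * real n ^ 4)) * (y (l (Suc K)) / (D * real (K + 2) ^ 4))"
        unfolding \<beta>_def \<gamma>_def[symmetric] D_def[symmetric] by (simp add: mult_ac)
      also have "\<dots> \<le> \<gamma> * (exp (- C) * exp (L n)) * (y (l (Suc K)) / (D * real (K + 2) ^ 4))"
        using g D yl by (intro mult_right_mono mult_left_mono eLn) auto
      also have "exp (- C) * exp (L n) = exp (L n - C)" by (simp flip: exp_add)
      also have "\<gamma> * exp (L n - C) * (y (l (Suc K)) / (D * real (K + 2) ^ 4))
         \<le> \<gamma> * exp (\<Sum>k<K. ln ((real (Suc (m K)) / (real (Suc K))\<^sup>2) / (real (Suc (m k)) / (real (Suc k))\<^sup>2))) * (y (l (Suc K)) / (D * real (K + 2) ^ 4))"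
        using g D yl by (intro mult_right_mono mult_left_mono eL) auto
      also have "\<dots> \<le> cmod (denom (of_real x))" using lb unfolding \<gamma>_def D_def Ima .
      finally show ?thesis .
    qed
    have "x\<^sup>2 \<le> (real n)\<^sup>2" using x xn by (intro power_mono) auto
    moreover have "1 \<le> (real n)\<^sup>2" using n1 by simp
    ultimately have "1 + x\<^sup>2 \<le> 2 * (1 * (real n)\<^sup>2)" by linarith
    also have "\<dots> \<le> 2 * (W * (real n)\<^sup>2)" using W1 by (intro mult_left_mono mult_right_mono) auto
    finally have "\<beta> * (1 + x\<^sup>2) \<le> \<beta> * (2 * (W * (real n)\<^sup>2))" using \<beta> by (intro mult_left_mono) auto
    then have A: "\<beta> * (1 + x\<^sup>2) \<le> 2 * cmod (denom (of_real x))" using main by simp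
    have "1 \<le> w x * W"
    proof -
      have "1 = w (real n) * (1 / w (real n))" using wpos[of "real n"] by simp
      also have "\<dots> \<le> w x * W" using wmono[of x "real n"] x xn wpos W1
        by (intro mult_mono) (auto simp: W_def less_imp_le)
      finally show ?thesis .
    qed
    then have "\<beta> * 1 * 1 \<le> \<beta> * (w x * W) * (real n)\<^sup>2"
      using \<beta> n1 by (intro mult_mono) auto
    also have "\<dots> = w x * (\<beta> * (W * (real n)\<^sup>2))" by simp
    also have "\<dots> \<le> w x * cmod (denom (of_real x))" using main wpos[of x] by (intro mult_left_mono) auto
    finally show ?thesis using A by simp
  qed
  define \<alpha> where "\<alpha> = exp (- (2 * (y 1)\<^sup>2)) / 2 * (Im (a (m 0)) / cmod (a (m 0)))"
  have \<alpha>: "\<alpha> > 0" using Im_pos[of "m 0"] a_nonzero[of "m 0"] by (simp add: \<alpha>_def)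
  \<comment> \<open>The first entry serves \<open>x \<ge> 1\<close>; the other two serve the unit
    interval, where \<open>1 + x^2 \<le> 2\<close> and \<open>w x \<ge> w 1\<close>.\<close>
  define c where "c = min (\<beta> / 2) (min (\<alpha> / 2) (\<alpha> * w 1))"
  have c: "c > 0" using \<beta> \<alpha> wpos[of 1] by (simp add: c_def)
  have pos: "c * (1 + x\<^sup>2) \<le> cmod (denom (of_real x)) \<and> c \<le> w x * cmod (denom (of_real x))" if x: "x \<ge> 0" for x
  proof (cases "x \<ge> 1")
    case True
    have cb: "c \<le> \<beta> / 2" by (simp add: c_def)
    have "c * (1 + x\<^sup>2) \<le> \<beta> / 2 * (1 + x\<^sup>2)" by (intro mult_right_mono cb) (simp add: add_nonneg_nonneg)
    then show ?thesis using far[OF True] cb \<beta> by auto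
  next
    case False
    have d: "\<alpha> \<le> cmod (denom (of_real x))" unfolding \<alpha>_def using x False by (intro denom_lower_bound_initial) auto
    have "c * (1 + x\<^sup>2) \<le> \<alpha> / 2 * 2"
      using x False c \<alpha> by (intro mult_mono) (auto simp: c_def power_le_one)
    moreover have "c \<le> w x * cmod (denom (of_real x))"
    proof -
      have "c \<le> w 1 * \<alpha>" by (simp add: c_def mult.commute)
      also have "\<dots> \<le> w x * cmod (denom (of_real x))"
        using wmono[of x 1] x False wpos[of x] \<alpha> d by (intro mult_mono) auto
      finally show ?thesis .
    qed
    ultimately show ?thesis using d by auto
  qed
  have all: "c * (1 + x\<^sup>2) \<le> cmod (denom (of_real x)) \<and> c \<le> w x * cmod (denom (of_real x))" for x
  proof (cases "x \<ge> 0")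
    case False
    then have nx: "- x \<ge> 0" by simp
    have "cmod (denom (of_real (- x))) \<le> cmod (denom (of_real x))" using denom_negative_axis[OF nx] by simp
    moreover have "w (- x) * cmod (denom (of_real (- x))) \<le> w x * cmod (denom (of_real x))"
      unfolding weven using calculation wpos[of x] by (intro mult_left_mono) auto
    ultimately show ?thesis using pos[OF nx] by auto
  qed (use pos in auto)
  have "w \<in> Adm (blaschke a)"
    by (rule reciprocal_denom_admissible[OF c]) (use all in auto)
  then show ?thesis by (simp add: B1_def a_def)
qed

section \<open>Pole expansions in the model space\<close>

context unit_spaced_zeros
begin

definition unimod :: "nat \<Rightarrow> complex" where
  "unimod n = complex_of_real (cmod ((a n)\<^sup>2 + 1)) / ((a n)\<^sup>2 + 1)"

definition finite_blaschke :: "nat \<Rightarrow> complex \<Rightarrow> complex" where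
  "finite_blaschke N z = (\<Prod>n<N. blaschke_factor (a n) z)"

text \<open>For \<open>n < N\<close> this is the residue of \<open>finite_blaschke N\<close> at
  \<open>cnj (a n)\<close>; the index set \<open>- {n}\<close> drops the factor with that
  pole.\<close>

definition finite_residue :: "nat \<Rightarrow> nat \<Rightarrow> complex" where
  "finite_residue N n = unimod n * (cnj (a n) - a n) * (\<Prod>k<N. sub_factor (- {n}) k (cnj (a n)))"

lemma cmod_unimod: "cmod (unimod n) = 1"
  unfolding unimod_def by (rule unimodular_const)

lemma pole_inj: "cnj (a m) = cnj (a n) \<longleftrightarrow> m = n"
  using Re_a[of m] Re_a[of n] by (metis complex_cnj_cancel_iff of_nat_eq_iff Suc_inject)

lemma blaschke_factor_split:
  assumes "z \<noteq> cnj (a n)"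
  shows "blaschke_factor (a n) z = unimod n + unimod n * (cnj (a n) - a n) / (z - cnj (a n))"
proof -
  have ne: "z - cnj (a n) \<noteq> 0" using assms by simp
  have "(z - a n) / (z - cnj (a n)) = 1 + (cnj (a n) - a n) / (z - cnj (a n))"
    using ne by (simp add: field_simps)
  then show ?thesis unfolding blaschke_factor_def unimod_def[symmetric]
    by (simp add: distrib_left)
qed

text \<open>Induction: a new factor has the form \<open>u + \<tau> / (w - p)\<close>, and the
  products of simple fractions are resolved by subtracting the value of the old product at the new
  pole \<open>p\<close>. The constant \<open>\<kappa>\<close> cancels in the differences formed
  later.\<close>

lemma finite_blaschke_partial_fractions:
  "\<exists>\<kappa>. \<forall>w. (\<forall>n<N. w \<noteq> cnj (a n)) \<longrightarrow>
     finite_blaschke N w = \<kappa> + (\<Sum>n<N. finite_residue N n / (w - cnj (a n)))"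
proof (induction N)
  case 0
  show ?case by (rule exI[of _ 1]) (simp add: finite_blaschke_def)
next
  case (Suc N)
  then obtain \<kappa> where \<kappa>: "\<And>w. (\<forall>n<N. w \<noteq> cnj (a n)) \<Longrightarrow>
     finite_blaschke N w = \<kappa> + (\<Sum>n<N. finite_residue N n / (w - cnj (a n)))" by blast
  define p where "p = cnj (a N)"
  define u where "u = unimod N"
  define \<tau> where "\<tau> = u * (cnj (a N) - a N)"
  have pn: "p \<noteq> cnj (a n)" if "n < N" for n using that pole_inj[of N n] by (auto simp: p_def)
  have resN: "finite_residue (Suc N) N = \<tau> * finite_blaschke N p"
  proof -
    have "(\<Prod>k<Suc N. sub_factor (- {N}) k p) = (\<Prod>k<N. blaschke_factor (a k) p)"
      by (simp add: sub_factor_def)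
    then show ?thesis by (simp add: finite_residue_def finite_blaschke_def p_def \<tau>_def u_def)
  qed
  have resn: "finite_residue (Suc N) n = finite_residue N n * (u - \<tau> / (p - cnj (a n)))" if n: "n < N" for n
  proof -
    have "sub_factor (- {n}) N (cnj (a n)) = u + \<tau> / (cnj (a n) - p)"
      using n pn[OF n] unfolding sub_factor_def u_def \<tau>_def p_def by (subst blaschke_factor_split) auto
    also have "\<tau> / (cnj (a n) - p) = - (\<tau> / (p - cnj (a n)))"
      by (metis minus_diff_eq minus_divide_right)
    finally show ?thesis by (simp add: finite_residue_def mult.assoc)
  qed
  show ?case
  proof (intro exI[of _ "\<kappa> * u"] allI impI)
    fix w assume w: "\<forall>n<Suc N. w \<noteq> cnj (a n)"
    then have wp: "w - p \<noteq> 0" and wn: "\<And>n. n < N \<Longrightarrow> w - cnj (a n) \<noteq> 0" by (auto simp: p_def)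
    have "finite_blaschke (Suc N) w = finite_blaschke N w * (u + \<tau> / (w - p))"
      using w blaschke_factor_split[of w N] by (simp add: finite_blaschke_def u_def \<tau>_def p_def)
    \<comment> \<open>The middle term has a removable singularity at \<open>p\<close>; the last one
      is the new simple fraction.\<close>
    also have "\<dots> = finite_blaschke N w * u + (finite_blaschke N w - finite_blaschke N p) * \<tau> / (w - p) + finite_blaschke N p * \<tau> / (w - p)"
      by (simp add: algebra_simps add_divide_distrib diff_divide_distrib)
    also have "finite_blaschke N w - finite_blaschke N p = (\<Sum>n<N. finite_residue N n / (w - cnj (a n)) - finite_residue N n / (p - cnj (a n)))"
      using w pn by (simp add: \<kappa> sum_subtractf)
    also have "\<dots> * \<tau> / (w - p) = (\<Sum>n<N. - (finite_residue N n / (w - cnj (a n)) * (\<tau> / (p - cnj (a n)))))"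
      unfolding sum_distrib_right sum_divide_distrib
    proof (rule sum.cong)
      fix n assume "n \<in> {..<N}"
      then have n: "n < N" by simp
      have pne: "p - cnj (a n) \<noteq> 0" using pn[OF n] by simp
      have "r / A - r / B = - (r * (A - B) / (A * B))" if "A \<noteq> 0" "B \<noteq> 0" for r A B :: complex
        using that by (simp add: divide_simps) (simp add: algebra_simps)
      from this[OF wn[OF n] pne, of "finite_residue N n"]
      have "finite_residue N n / (w - cnj (a n)) - finite_residue N n / (p - cnj (a n))
         = - (finite_residue N n * (w - cnj (a n) - (p - cnj (a n))) / ((w - cnj (a n)) * (p - cnj (a n))))" .
      moreover have "w - cnj (a n) - (p - cnj (a n)) = w - p" by simp
      ultimately have "finite_residue N n / (w - cnj (a n)) - finite_residue N n / (p - cnj (a n))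
         = - (finite_residue N n * (w - p) / ((w - cnj (a n)) * (p - cnj (a n))))" by (simp only:)
      then show "(finite_residue N n / (w - cnj (a n)) - finite_residue N n / (p - cnj (a n))) * \<tau> / (w - p)
         = - (finite_residue N n / (w - cnj (a n)) * (\<tau> / (p - cnj (a n))))"
        using wp by simp
    qed simp
    also have "finite_blaschke N w * u + \<dots> + finite_blaschke N p * \<tau> / (w - p)
       = \<kappa> * u + (\<Sum>n<N. finite_residue (Suc N) n / (w - cnj (a n))) + finite_residue (Suc N) N / (w - p)"
    proof -
      have "finite_blaschke N w * u = \<kappa> * u + (\<Sum>n<N. finite_residue N n / (w - cnj (a n)) * u)"
        using w by (simp add: \<kappa> distrib_right sum_distrib_right)
      moreover have "(\<Sum>n<N. finite_residue (Suc N) n / (w - cnj (a n)))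
         = (\<Sum>n<N. finite_residue N n / (w - cnj (a n)) * u) + (\<Sum>n<N. - (finite_residue N n / (w - cnj (a n)) * (\<tau> / (p - cnj (a n)))))"
      proof -
        have "(r * (u - t)) / A = r / A * u + - (r / A * t)" for r t A :: complex
          by (simp add: right_diff_distrib diff_divide_distrib)
        then show ?thesis unfolding sum.distrib[symmetric]
          by (intro sum.cong refl) (simp only: resn lessThan_iff)
      qed
      ultimately show ?thesis by (simp add: resN mult.commute)
    qed
    finally show "finite_blaschke (Suc N) w = \<kappa> * u + (\<Sum>n<Suc N. finite_residue (Suc N) n / (w - cnj (a n)))"
      by (simp add: p_def add.assoc)
  qed
qed

text \<open>The squared modulus is \<open>1 + 4 s t / (d + (s - t)^2)\<close>, where
  \<open>d\<close> is the squared horizontal distance of the two zeros. Unit spacing bounds the sum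
  of \<open>1 / d\<close>, so the product over the other zeros is bounded uniformly in
  \<open>N\<close> and \<open>n\<close>.\<close>

lemma cmod_factor_at_pole:
  assumes "m \<noteq> n"
  shows "cmod (blaschke_factor (a m) (cnj (a n))) \<le> exp (2 * Y\<^sup>2 / (real m - real n)\<^sup>2)"
proof -
  define d where "d = (real m - real n)\<^sup>2"
  have d: "d > 0" using assms by (simp add: d_def)
  define s where "s = Im (a n)"
  define t where "t = Im (a m)"
  have st: "0 < s" "s \<le> Y" "0 < t" "t \<le> Y" by (auto simp: s_def t_def Im_pos Im_le)
  have "(cmod (blaschke_factor (a m) (cnj (a n))))\<^sup>2 = (d + (s + t)\<^sup>2) / (d + (s - t)\<^sup>2)"
    unfolding cmod_blaschke_factor power_divide cmod_power2
    by (simp add: Re_a d_def s_def t_def power2_eq_square algebra_simps)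
  also have "\<dots> \<le> 1 + 4 * Y\<^sup>2 / d"
  proof -
    have "(d + (s + t)\<^sup>2) / (d + (s - t)\<^sup>2) = 1 + 4 * s * t / (d + (s - t)\<^sup>2)"
    proof -
      define e where "e = d + (s - t)\<^sup>2"
      have "e > 0" using d by (simp add: e_def add_pos_nonneg)
      moreover have "d + (s + t)\<^sup>2 = e + 4 * s * t" by (simp add: e_def power2_eq_square algebra_simps)
      ultimately show ?thesis unfolding e_def[symmetric] by (simp add: add_divide_distrib)
    qed
    also have "4 * s * t / (d + (s - t)\<^sup>2) \<le> 4 * (Y * Y) / d"
      using st d by (intro frac_le) (auto intro!: mult_mono simp: mult.assoc)
    finally show ?thesis by (simp add: power2_eq_square)
  qed
  also have "\<dots> \<le> exp (4 * Y\<^sup>2 / d)" by (rule exp_ge_add_one_self)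
  also have "\<dots> = (exp (2 * Y\<^sup>2 / d))\<^sup>2" by (simp add: power2_eq_square flip: exp_add)
  finally show ?thesis unfolding d_def by (rule power2_le_imp_le) simp
qed

lemma sum_inverse_square_distances: "(\<Sum>k\<in>{..<N} - {n}. 1 / (real k - real n)\<^sup>2) \<le> 4"
proof -
  have "(\<Sum>k\<in>{..<N} - {n}. 1 / (real k - real n)\<^sup>2) \<le> (\<Sum>k\<in>{..<n} \<union> {Suc n..<Suc n + N}. 1 / (real k - real n)\<^sup>2)"
    by (rule sum_mono2) auto
  also have "\<dots> = (\<Sum>k<n. 1 / (real k - real n)\<^sup>2) + (\<Sum>k\<in>{Suc n..<Suc n + N}. 1 / (real k - real n)\<^sup>2)"
    by (rule sum.union_disjoint) auto
  also have "(\<Sum>k<n. 1 / (real k - real n)\<^sup>2) = (\<Sum>k<n. 1 / (real (Suc k))\<^sup>2)"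
  proof -
    have "(\<Sum>k<n. 1 / (real k - real n)\<^sup>2) = (\<Sum>k<n. 1 / (real (n - Suc k) - real n)\<^sup>2)"
      by (rule sum.nat_diff_reindex[symmetric])
    also have "\<dots> = (\<Sum>k<n. 1 / (real (Suc k))\<^sup>2)"
    proof (rule sum.cong)
      fix k assume "k \<in> {..<n}"
      then have "real (n - Suc k) - real n = - real (Suc k)" by simp
      then show "1 / (real (n - Suc k) - real n)\<^sup>2 = 1 / (real (Suc k))\<^sup>2" by (simp only: power2_minus)
    qed simp
    finally show ?thesis .
  qed
  also have "(\<Sum>k\<in>{Suc n..<Suc n + N}. 1 / (real k - real n)\<^sup>2) = (\<Sum>k<N. 1 / (real (Suc k))\<^sup>2)"
    using sum.shift_bounds_nat_ivl[of "\<lambda>k. 1 / (real k - real n)\<^sup>2" 0 "Suc n" N]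
    by (simp add: atLeast0LessThan add.commute)
  finally show ?thesis using sum_inverse_squares_le[of n] sum_inverse_squares_le[of N] by linarith
qed

lemma cmod_finite_residue: "cmod (finite_residue N n) \<le> 2 * exp (8 * Y\<^sup>2) * Im (a n)"
proof -
  have "cmod (\<Prod>k<N. sub_factor (- {n}) k (cnj (a n))) = (\<Prod>k\<in>{..<N} - {n}. cmod (blaschke_factor (a k) (cnj (a n))))"
    unfolding prod_norm[symmetric]
    by (rule prod.mono_neutral_cong_right) (auto simp: sub_factor_def)
  also have "\<dots> \<le> (\<Prod>k\<in>{..<N} - {n}. exp (2 * Y\<^sup>2 / (real k - real n)\<^sup>2))"
    by (intro prod_mono) (auto intro!: cmod_factor_at_pole)
  also have "\<dots> = exp (2 * Y\<^sup>2 * (\<Sum>k\<in>{..<N} - {n}. 1 / (real k - real n)\<^sup>2))"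
    by (simp add: exp_sum[symmetric] sum_distrib_left)
  also have "\<dots> \<le> exp (2 * Y\<^sup>2 * 4)"
    unfolding exp_le_cancel_iff by (intro mult_left_mono sum_inverse_square_distances) simp
  finally have "cmod (\<Prod>k<N. sub_factor (- {n}) k (cnj (a n))) \<le> exp (8 * Y\<^sup>2)" by simp
  moreover have "cmod (cnj (a n) - a n) = 2 * Im (a n)"
  proof -
    have "cnj (a n) - a n = of_real (- 2 * Im (a n)) * \<i>" by (simp add: complex_eq_iff)
    then show ?thesis using Im_pos[of n] by (simp only: norm_mult norm_of_real norm_ii)
  qed
  ultimately show ?thesis unfolding finite_residue_def norm_mult cmod_unimod
    using Im_pos[of n] by (simp add: mult_ac mult_left_mono)
qed

lemma finite_blaschke_eq: "finite_blaschke N z = (\<Prod>n<N. sub_factor UNIV n z)"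
  by (simp add: finite_blaschke_def sub_factor_def)

lemma finite_blaschke_LIMSEQ: "(\<lambda>N. finite_blaschke N z) \<longlonglongrightarrow> blaschke a z"
  using sub_blaschke_LIMSEQ[of UNIV z] by (simp add: finite_blaschke_eq sub_blaschke_UNIV)

lemma cmod_finite_blaschke_real: "cmod (finite_blaschke N (of_real t)) = 1"
proof -
  have "cmod (blaschke_factor (a n) (of_real t)) = 1" for n
  proof -
    have "of_real t - cnj (a n) = cnj (of_real t - a n)" by simp
    then have "cmod (of_real t - cnj (a n)) = cmod (of_real t - a n)" by (simp only: complex_mod_cnj)
    moreover have "of_real t - a n \<noteq> 0" using Im_pos[of n] by (auto simp: complex_eq_iff)
    ultimately show ?thesis by (simp add: cmod_blaschke_factor)
  qed
  then show ?thesis by (simp add: finite_blaschke_def prod_norm[symmetric])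
qed

text \<open>Let \<open>B\<close> be the finite product. On the real line
  \<open>1 = B(t) cnj (B(t))\<close>, so the numerator is \<open>(B(t) - B(w)) cnj (B(t))\<close>,
  and the difference of the two partial fraction expansions contains \<open>t - w\<close> in every
  term. Up to a constant, the left side is the conjugate of the reproducing kernel of the finite
  model space.\<close>

lemma finite_kernel_decomposition:
  assumes w: "Im w > 0"
  shows "(1 - finite_blaschke N w * cnj (finite_blaschke N (of_real t))) / (of_real t - w)
     = (\<Sum>n<N. - finite_residue N n / (w - cnj (a n)) * (cnj (finite_blaschke N (of_real t)) / (of_real t - cnj (a n))))"
proof -
  define \<beta> where "\<beta> = finite_blaschke N (of_real t)"
  obtain \<kappa> where \<kappa>: "\<And>w. (\<forall>n<N. w \<noteq> cnj (a n)) \<Longrightarrow>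
     finite_blaschke N w = \<kappa> + (\<Sum>n<N. finite_residue N n / (w - cnj (a n)))"
    using finite_blaschke_partial_fractions[of N] by blast
  have tw: "of_real t - w \<noteq> 0" using w by (auto simp: complex_eq_iff)
  have tn: "of_real t - cnj (a n) \<noteq> 0" for n using off_pole[of "of_real t" n] by simp
  have wn: "w - cnj (a n) \<noteq> 0" for n using off_pole[of w n] w by simp
  have "\<beta> * cnj \<beta> = 1" using complex_norm_square[of \<beta>] by (simp add: \<beta>_def cmod_finite_blaschke_real)
  then have "1 - finite_blaschke N w * cnj \<beta> = (\<beta> - finite_blaschke N w) * cnj \<beta>" by (simp add: algebra_simps)
  also have "\<beta> - finite_blaschke N w = (\<Sum>n<N. finite_residue N n / (of_real t - cnj (a n)) - finite_residue N n / (w - cnj (a n)))"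
    unfolding \<beta>_def using tn wn by (subst \<kappa>, simp, subst \<kappa>, simp, simp add: sum_subtractf)
  also have "\<dots> = (\<Sum>n<N. (of_real t - w) * (- finite_residue N n / (w - cnj (a n)) * (1 / (of_real t - cnj (a n)))))"
  proof (rule sum.cong)
    fix n
    have "r / A - r / B = (A - B) * (- r / B * (1 / A))" if "A \<noteq> 0" "B \<noteq> 0" for r A B :: complex
      using that by (simp add: field_simps)
    from this[OF tn[of n] wn[of n], of "finite_residue N n"]
    show "finite_residue N n / (of_real t - cnj (a n)) - finite_residue N n / (w - cnj (a n))
      = (of_real t - w) * (- finite_residue N n / (w - cnj (a n)) * (1 / (of_real t - cnj (a n))))" by simp
  qed simp
  also have "\<dots> = (of_real t - w) * (\<Sum>n<N. - finite_residue N n / (w - cnj (a n)) * (1 / (of_real t - cnj (a n))))"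
    by (simp only: sum_distrib_left)
  finally have "(1 - finite_blaschke N w * cnj \<beta>) / (of_real t - w)
    = (\<Sum>n<N. - finite_residue N n / (w - cnj (a n)) * (1 / (of_real t - cnj (a n)))) * cnj \<beta>"
    using tw by simp
  also have "\<dots> = (\<Sum>n<N. - finite_residue N n / (w - cnj (a n)) * (cnj \<beta> / (of_real t - cnj (a n))))"
    by (simp add: sum_distrib_right)
  finally show ?thesis by (simp only: \<beta>_def)
qed

text \<open>The coefficient of \<open>1 / (w - cnj (a n))\<close> that arises when the kernel
  decomposition is integrated against the boundary values of \<open>f\<close>.\<close>

definition finite_coeff :: "(complex \<Rightarrow> complex) \<Rightarrow> nat \<Rightarrow> nat \<Rightarrow> complex" where
  "finite_coeff f N n = - finite_residue N n / (2 * of_real pi * \<i>)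
     * (\<integral>t. hardy_bv f t * cnj (finite_blaschke N (of_real t)) / (of_real t - cnj (a n)) \<partial>lborel)"

lemma finite_blaschke_measurable [measurable]: "(\<lambda>t. finite_blaschke N (of_real t)) \<in> borel_measurable borel"
proof -
  have "continuous_on UNIV (\<lambda>t. finite_blaschke N (complex_of_real t))"
    unfolding finite_blaschke_eq
  proof (intro continuous_intros)
    fix n
    show "continuous_on UNIV (\<lambda>t. sub_factor UNIV n (complex_of_real t))"
      by (rule continuous_on_compose2[OF continuous_on_sub_factor[of UNIV n]]) (auto intro!: continuous_intros)
  qed
  then show ?thesis by (rule borel_measurable_continuous_onI)
qed

lemma blaschke_measurable [measurable]: "(\<lambda>t. blaschke a (of_real t)) \<in> borel_measurable borel"
  by (rule borel_measurable_LIMSEQ_metric[of "\<lambda>N t. finite_blaschke N (of_real t)"])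
    (auto intro: finite_blaschke_LIMSEQ)

lemma integrable_bounded_mult:
  fixes F \<beta> :: "real \<Rightarrow> complex"
  assumes [measurable]: "F \<in> borel_measurable borel" "\<beta> \<in> borel_measurable borel"
    and F: "integrable lborel (\<lambda>x. (cmod (F x))\<^sup>2)" and \<beta>: "\<And>t. cmod (\<beta> t) \<le> 1" and w: "Im w \<noteq> 0"
  shows "integrable lborel (\<lambda>t. F t * \<beta> t / (of_real t - w))"
proof (rule Bochner_Integration.integrable_bound[OF integrable_kernel_mult[OF assms(1) F w]])
  show "AE t in lborel. norm (F t * \<beta> t / (of_real t - w)) \<le> norm (F t / (of_real t - w))"
    using \<beta> by (intro AE_I2) (auto simp: norm_divide norm_mult intro!: divide_right_mono mult_left_le)
qed measurable

text \<open>The residue contributes \<open>Im (a n)\<close> and the L^2 norm of the kernel its power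
  \<open>-1/2\<close>, both uniformly in \<open>N\<close>.\<close>

lemma finite_coeff_bound:
  assumes f: "f \<in> hardy2"
  obtains D where "D \<ge> 0" "\<And>N n. cmod (finite_coeff f N n) \<le> D * sqrt (Im (a n))"
proof -
  obtain C where C: "C \<ge> 0" "(\<integral>\<^sup>+x. ennreal ((cmod (hardy_bv f x))\<^sup>2) \<partial>lborel) \<le> ennreal C"
    using hardy_bv_L2[OF f] by metis
  have [measurable]: "hardy_bv f \<in> borel_measurable borel" by (rule hardy_bv_measurable[OF hardy2_holomorphic[OF f]])
  have "cmod (finite_coeff f N n) \<le> (exp (8 * Y\<^sup>2) * sqrt (C * pi) / pi) * sqrt (Im (a n))" for N n
  proof -
    define \<eta> where "\<eta> = Im (a n)"
    have \<eta>: "\<eta> > 0" by (simp add: \<eta>_def Im_pos)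
    have "(\<integral>t. hardy_bv f t * cnj (finite_blaschke N (of_real t)) / (of_real t - cnj (a n)) \<partial>lborel)
      = (\<integral>t. (hardy_bv f t * cnj (finite_blaschke N (of_real t))) * (1 / (of_real t - cnj (a n))) \<partial>lborel)" by simp
    also have "cmod \<dots> \<le> sqrt (C * (pi / \<eta>))"
    proof (rule cmod_integral_mult_le)
      show "(\<integral>\<^sup>+t. ennreal ((cmod (hardy_bv f t * cnj (finite_blaschke N (of_real t))))\<^sup>2) \<partial>lborel) \<le> ennreal C"
        using C by (simp add: norm_mult cmod_finite_blaschke_real)
      show "(\<integral>\<^sup>+t. ennreal ((cmod (1 / (of_real t - cnj (a n))))\<^sup>2) \<partial>lborel) \<le> ennreal (pi / \<eta>)"
        using kernel_square_integral[of "cnj (a n)"] \<eta> by (simp add: \<eta>_def)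
    qed (use C \<eta> in auto)
    finally have I: "cmod (\<integral>t. hardy_bv f t * cnj (finite_blaschke N (of_real t)) / (of_real t - cnj (a n)) \<partial>lborel) \<le> sqrt (C * (pi / \<eta>))" .
    have "cmod (finite_residue N n) / (2 * pi) \<le> (2 * exp (8 * Y\<^sup>2) * \<eta>) / (2 * pi)"
      using cmod_finite_residue[of N n] by (intro divide_right_mono) (auto simp: \<eta>_def)
    moreover have "cmod (finite_coeff f N n) = cmod (finite_residue N n) / (2 * pi)
        * cmod (\<integral>t. hardy_bv f t * cnj (finite_blaschke N (of_real t)) / (of_real t - cnj (a n)) \<partial>lborel)"
      unfolding finite_coeff_def by (simp only: norm_mult norm_divide norm_minus_cancel) simp
    ultimately have "cmod (finite_coeff f N n) \<le> (2 * exp (8 * Y\<^sup>2) * \<eta> / (2 * pi)) * sqrt (C * (pi / \<eta>))"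
      using I \<eta> by (simp only:) (intro mult_mono, auto)
    also have "sqrt (C * (pi / \<eta>)) = sqrt (C * pi) / sqrt \<eta>" by (simp add: real_sqrt_divide real_sqrt_mult)
    also have "(2 * exp (8 * Y\<^sup>2) * \<eta> / (2 * pi)) * (sqrt (C * pi) / sqrt \<eta>) = (exp (8 * Y\<^sup>2) * sqrt (C * pi) / pi) * (\<eta> / sqrt \<eta>)"
      by simp
    also have "\<eta> / sqrt \<eta> = sqrt \<eta>" using \<eta> by (simp add: real_div_sqrt)
    finally show ?thesis by (simp add: \<eta>_def)
  qed
  then show ?thesis using C by (intro that[of "exp (8 * Y\<^sup>2) * sqrt (C * pi) / pi"]) auto
qed

lemma finite_coeff_converges:
  assumes f: "f \<in> hardy2"
  obtains c where "\<And>n. (\<lambda>N. finite_coeff f N n) \<longlonglongrightarrow> c n"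
proof -
  have [measurable]: "hardy_bv f \<in> borel_measurable borel" by (rule hardy_bv_measurable[OF hardy2_holomorphic[OF f]])
  \<comment> \<open>The infinite product is taken at a point of the lower half-plane: the products
    converge at every point of the plane, and the factor with this pole is left out.\<close>
  define c where "c = (\<lambda>n. - (unimod n * (cnj (a n) - a n) * sub_blaschke (- {n}) (cnj (a n))) / (2 * of_real pi * \<i>)
     * (\<integral>t. hardy_bv f t * cnj (blaschke a (of_real t)) / (of_real t - cnj (a n)) \<partial>lborel))"
  have "(\<lambda>N. finite_coeff f N n) \<longlonglongrightarrow> c n" for n
  proof -
    have "(\<lambda>N. \<integral>t. hardy_bv f t * cnj (finite_blaschke N (of_real t)) / (of_real t - cnj (a n)) \<partial>lborel)
      \<longlonglongrightarrow> (\<integral>t. hardy_bv f t * cnj (blaschke a (of_real t)) / (of_real t - cnj (a n)) \<partial>lborel)"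
    proof (rule integral_dominated_convergence[where w="\<lambda>t. norm (hardy_bv f t / (of_real t - cnj (a n)))"])
      show "integrable lborel (\<lambda>t. norm (hardy_bv f t / (of_real t - cnj (a n))))"
        using Im_pos[of n] by (intro integrable_norm integrable_kernel_mult hardy_bv_square_integrable f) auto
      show "AE t in lborel. (\<lambda>N. hardy_bv f t * cnj (finite_blaschke N (of_real t)) / (of_real t - cnj (a n)))
        \<longlonglongrightarrow> hardy_bv f t * cnj (blaschke a (of_real t)) / (of_real t - cnj (a n))"
        using off_pole[of "of_real _" n] by (intro AE_I2 tendsto_intros finite_blaschke_LIMSEQ) auto
      show "AE t in lborel. norm (hardy_bv f t * cnj (finite_blaschke N (of_real t)) / (of_real t - cnj (a n)))
        \<le> norm (hardy_bv f t / (of_real t - cnj (a n)))" for N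
        by (intro AE_I2) (simp add: norm_divide norm_mult cmod_finite_blaschke_real)
    qed measurable
    then show ?thesis unfolding finite_coeff_def c_def finite_residue_def
      by (intro tendsto_intros sub_blaschke_LIMSEQ) auto
  qed
  then show ?thesis by (rule that)
qed

text \<open>The Cauchy integral of \<open>f\<close>, minus the \<open>N\<close>-th finite product at
  \<open>w\<close> times the Cauchy integral of \<open>f\<close> against its conjugate, is a finite
  pole sum. Orthogonality to \<open>B / (z - cnj w)\<close> makes the second integral tend to 0, and
  the first one reproduces \<open>f w\<close>.\<close>

lemma model_space_kernel_formula:
  assumes f: "f \<in> model_space (blaschke a)" and w: "w \<in> upper_half"
  shows "(\<lambda>N. \<Sum>n<N. finite_coeff f N n / (w - cnj (a n))) \<longlonglongrightarrow> f w"
proof -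
  have fh: "f \<in> hardy2" using f by (simp add: model_space_def)
  have Imw: "Im w > 0" using w by (simp add: upper_half_iff)
  have Fm[measurable]: "hardy_bv f \<in> borel_measurable borel" by (rule hardy_bv_measurable[OF hardy2_holomorphic[OF fh]])
  note F2 = hardy_bv_square_integrable[OF fh]
  have orth: "(\<integral>t. hardy_bv f t * cnj (blaschke a (of_real t)) / (of_real t - w) \<partial>lborel) = 0"
  proof -
    have k: "(\<lambda>z. 1 / (z - cnj w)) \<in> hardy2" using Imw by (intro kernel_hardy2) simp
    have "\<forall>h\<in>hardy2. l2_inner (hardy_bv f) (hardy_bv (\<lambda>z. blaschke a z * h z)) = 0"
      using f by (simp add: model_space_def)
    from bspec[OF this k]
    have "l2_inner (hardy_bv f) (hardy_bv (\<lambda>z. blaschke a z * (1 / (z - cnj w)))) = 0" .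
    moreover have "hardy_bv (\<lambda>z. blaschke a z * (1 / (z - cnj w))) t = blaschke a (of_real t) * (1 / (of_real t - cnj w))" for t
    proof (rule hardy_bv_eqI)
      have "((\<lambda>y. Complex t y) \<longlongrightarrow> Complex t 0) (at_right 0)" by (intro tendsto_intros)
      then have "((\<lambda>y. Complex t y) \<longlongrightarrow> of_real t) (at_right 0)" by (simp add: complex_of_real_def)
      then show "((\<lambda>y. blaschke a (Complex t y) * (1 / (Complex t y - cnj w))) \<longlongrightarrow> blaschke a (of_real t) * (1 / (of_real t - cnj w))) (at_right 0)"
        using sub_blaschke_vertical_limit[of UNIV t] Imw unfolding sub_blaschke_UNIV
        by (intro tendsto_intros) (auto simp: complex_eq_iff)
    qed
    ultimately show ?thesis unfolding l2_inner_def by simp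
  qed
  define J where "J = (\<lambda>N. \<integral>t. hardy_bv f t * cnj (finite_blaschke N (of_real t)) / (of_real t - w) \<partial>lborel)"
  have i0: "integrable lborel (\<lambda>t. hardy_bv f t / (of_real t - w))"
    using Imw by (intro integrable_kernel_mult F2) auto
  have "J \<longlonglongrightarrow> (\<integral>t. hardy_bv f t * cnj (blaschke a (of_real t)) / (of_real t - w) \<partial>lborel)" unfolding J_def
  proof (rule integral_dominated_convergence[where w="\<lambda>t. norm (hardy_bv f t / (of_real t - w))"])
    show "AE t in lborel. (\<lambda>N. hardy_bv f t * cnj (finite_blaschke N (of_real t)) / (of_real t - w))
        \<longlonglongrightarrow> hardy_bv f t * cnj (blaschke a (of_real t)) / (of_real t - w)"
      using Imw by (intro AE_I2 tendsto_intros finite_blaschke_LIMSEQ) (auto simp: complex_eq_iff)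
    show "AE t in lborel. norm (hardy_bv f t * cnj (finite_blaschke N (of_real t)) / (of_real t - w))
        \<le> norm (hardy_bv f t / (of_real t - w))" for N
      by (intro AE_I2) (simp add: norm_divide norm_mult cmod_finite_blaschke_real)
  qed (use i0 in \<open>auto intro: integrable_norm\<close>)
  then have J0: "J \<longlonglongrightarrow> 0" by (simp add: orth)
  define I where "I = (\<integral>t. hardy_bv f t / (of_real t - w) \<partial>lborel)"
  have "(\<lambda>N. 1 / (2 * of_real pi * \<i>) * (I - finite_blaschke N w * J N)) \<longlonglongrightarrow> 1 / (2 * of_real pi * \<i>) * (I - blaschke a w * 0)"
    by (intro tendsto_intros finite_blaschke_LIMSEQ J0)
  then have "(\<lambda>N. 1 / (2 * of_real pi * \<i>) * (I - finite_blaschke N w * J N)) \<longlonglongrightarrow> f w"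
    using hardy_bv_cauchy[OF fh w] by (simp add: I_def)
  moreover have "1 / (2 * of_real pi * \<i>) * (I - finite_blaschke N w * J N) = (\<Sum>n<N. finite_coeff f N n / (w - cnj (a n)))" for N
  proof -
    have i1: "integrable lborel (\<lambda>t. hardy_bv f t * cnj (finite_blaschke N (of_real t)) / (of_real t - z))" if "Im z \<noteq> 0" for z
      by (rule integrable_bounded_mult[OF Fm _ F2 _ that]) (auto simp: cmod_finite_blaschke_real)
    have i2: "integrable lborel (\<lambda>t. finite_blaschke N w * (hardy_bv f t * cnj (finite_blaschke N (of_real t)) / (of_real t - w)))"
      using Imw by (intro integrable_mult_right i1) auto
    have "I - finite_blaschke N w * J N = (\<integral>t. hardy_bv f t / (of_real t - w) - finite_blaschke N w * (hardy_bv f t * cnj (finite_blaschke N (of_real t)) / (of_real t - w)) \<partial>lborel)"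
      unfolding I_def J_def Bochner_Integration.integral_diff[OF i0 i2] integral_mult_right_zero ..
    also have "\<dots> = (\<integral>t. (\<Sum>n<N. - finite_residue N n / (w - cnj (a n)) * (hardy_bv f t * cnj (finite_blaschke N (of_real t)) / (of_real t - cnj (a n)))) \<partial>lborel)"
    proof (rule Bochner_Integration.integral_cong[OF refl])
      fix t
      have "hardy_bv f t / (of_real t - w) - finite_blaschke N w * (hardy_bv f t * cnj (finite_blaschke N (of_real t)) / (of_real t - w))
        = hardy_bv f t * ((1 - finite_blaschke N w * cnj (finite_blaschke N (of_real t))) / (of_real t - w))"
        by (simp add: diff_divide_distrib right_diff_distrib mult_ac)
      also have "\<dots> = (\<Sum>n<N. - finite_residue N n / (w - cnj (a n)) * (hardy_bv f t * cnj (finite_blaschke N (of_real t)) / (of_real t - cnj (a n))))"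
        unfolding finite_kernel_decomposition[OF Imw] sum_distrib_left by (intro sum.cong) (simp_all add: mult_ac)
      finally show "hardy_bv f t / (of_real t - w) - finite_blaschke N w * (hardy_bv f t * cnj (finite_blaschke N (of_real t)) / (of_real t - w)) = \<dots>" .
    qed
    also have "\<dots> = (\<Sum>n<N. \<integral>t. - finite_residue N n / (w - cnj (a n)) * (hardy_bv f t * cnj (finite_blaschke N (of_real t)) / (of_real t - cnj (a n))) \<partial>lborel)"
    proof (rule Bochner_Integration.integral_sum)
      fix n
      have "Im (cnj (a n)) \<noteq> 0" using Im_pos[of n] by simp
      then show "integrable lborel (\<lambda>t. - finite_residue N n / (w - cnj (a n)) * (hardy_bv f t * cnj (finite_blaschke N (of_real t)) / (of_real t - cnj (a n))))"
        by (intro integrable_mult_right i1)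
    qed
    also have "\<dots> = (\<Sum>n<N. - finite_residue N n / (w - cnj (a n)) * (\<integral>t. hardy_bv f t * cnj (finite_blaschke N (of_real t)) / (of_real t - cnj (a n)) \<partial>lborel))"
      by (simp only: integral_mult_right_zero)
    finally have E: "I - finite_blaschke N w * J N = \<dots>" .
    show ?thesis unfolding E sum_distrib_left finite_coeff_def
      by (intro sum.cong refl) (simp add: mult_ac)
  qed
  ultimately show ?thesis by simp
qed

text \<open>The square root in the coefficient bound comes from a crude Cauchy-Schwarz estimate and is harmless.\<close>

lemma model_space_pole_expansion:
  assumes f: "f \<in> model_space (blaschke a)" and sm: "summable (\<lambda>n. sqrt (Im (a n)))"
  obtains c D where "D \<ge> 0" "\<And>n. cmod (c n) \<le> D * sqrt (Im (a n))"
    "\<And>w. w \<in> upper_half \<Longrightarrow> f w = (\<Sum>n. c n / (w - cnj (a n)))"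
proof -
  have fh: "f \<in> hardy2" using f by (simp add: model_space_def)
  obtain c where c: "\<And>n. (\<lambda>N. finite_coeff f N n) \<longlonglongrightarrow> c n" using finite_coeff_converges[OF fh] by blast
  obtain D where D: "D \<ge> 0" "\<And>N n. cmod (finite_coeff f N n) \<le> D * sqrt (Im (a n))"
    using finite_coeff_bound[OF fh] by blast
  have cD: "cmod (c n) \<le> D * sqrt (Im (a n))" for n
    by (rule LIMSEQ_le_const2[OF tendsto_norm[OF c]]) (use D in auto)
  have exp: "f w = (\<Sum>n. c n / (w - cnj (a n)))" if w: "w \<in> upper_half" for w
  proof -
    have Imw: "Im w > 0" using w by (simp add: upper_half_iff)
    \<comment> \<open>The coefficients of the partial sums depend on \<open>N\<close>; padding with
      zeros turns the sums into full series, to which dominated convergence for series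
      applies.\<close>
    define b where "b = (\<lambda>n N. if n < N then finite_coeff f N n / (w - cnj (a n)) else 0)"
    have ge: "Im w \<le> cmod (w - cnj (a n))" for n
      using abs_Im_le_cmod[of "w - cnj (a n)"] Imw Im_pos[of n] by simp
    have bb: "norm (b n N) \<le> D / Im w * sqrt (Im (a n))" for n N
    proof (cases "n < N")
      case True
      have "norm (b n N) = cmod (finite_coeff f N n) / cmod (w - cnj (a n))" using True by (simp add: b_def norm_divide)
      also have "\<dots> \<le> D * sqrt (Im (a n)) / Im w" using D ge Imw Im_pos[of n] by (intro frac_le) auto
      finally show ?thesis by simp
    next
      case False
      then show ?thesis using D Imw Im_pos[of n] by (simp add: b_def)
    qed
    have "eventually (\<lambda>N. summable (\<lambda>n. norm (b n N))) sequentially \<and> summable (\<lambda>n. norm (c n / (w - cnj (a n))))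
       \<and> ((\<lambda>N. suminf (\<lambda>n. b n N)) \<longlonglongrightarrow> (\<Sum>n. c n / (w - cnj (a n))))"
    proof (rule tannerys_theorem[where M="\<lambda>n. D / Im w * sqrt (Im (a n))"])
      fix n
      have "(\<lambda>N. finite_coeff f N n / (w - cnj (a n))) \<longlonglongrightarrow> c n / (w - cnj (a n))"
        using ge[of n] Imw by (intro tendsto_intros c) auto
      moreover have "\<forall>\<^sub>F N in sequentially. b n N = finite_coeff f N n / (w - cnj (a n))"
        using eventually_gt_at_top[of n] by eventually_elim (simp add: b_def)
      ultimately show "(\<lambda>N. b n N) \<longlonglongrightarrow> c n / (w - cnj (a n))" by (simp add: tendsto_cong)
    next
      show "\<forall>\<^sub>F (n, N) in sequentially \<times>\<^sub>F sequentially. norm (b n N) \<le> D / Im w * sqrt (Im (a n))"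
        using bb by (intro always_eventually) auto
    qed (use sm in \<open>auto intro: summable_mult\<close>)
    then have "(\<lambda>N. suminf (\<lambda>n. b n N)) \<longlonglongrightarrow> (\<Sum>n. c n / (w - cnj (a n)))" by blast
    moreover have "suminf (\<lambda>n. b n N) = (\<Sum>n<N. finite_coeff f N n / (w - cnj (a n)))" for N
    proof -
      have "suminf (\<lambda>n. b n N) = (\<Sum>n<N. b n N)" by (rule suminf_finite) (auto simp: b_def)
      then show ?thesis by (simp add: b_def)
    qed
    ultimately show ?thesis using model_space_kernel_formula[OF f w] LIMSEQ_unique by simp
  qed
  show ?thesis using that[OF D(1) cD exp] .
qed

end

section \<open>Vanishing moments and decay away from the poles\<close>

context unit_spaced_zeros
begin

lemma cmod_a_le: "cmod (a n) \<le> (1 + Y) * real (Suc n)"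
proof -
  have "cmod (a n) \<le> real (Suc n) + Y"
    using cmod_le[of "a n"] Re_a[of n] Im_pos[of n] Im_le[of n] by simp
  also have "Y \<le> Y * real (Suc n)" using Y_pos by simp
  finally show ?thesis by (simp add: algebra_simps)
qed

lemma pole_dist_left: "t \<le> 0 \<Longrightarrow> real (Suc n) - t \<le> cmod (of_real t - cnj (a n))"
  using abs_Re_le_cmod[of "of_real t - cnj (a n)"] Re_a[of n] by simp

text \<open>Let \<open>S k\<close> be the series with numerators \<open>c n * p n ^ k\<close> and
  \<open>\<mu> k\<close> their sum. By \<open>S (k + 1) = z S k - \<mu> k\<close>, vanishing of the
  first \<open>k\<close> moments gives \<open>S k = z^k S 0\<close>, while \<open>t S k (t)\<close>
  tends to \<open>\<mu> k\<close> at minus infinity. Decay faster than every power thus kills the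
  moments one by one, and then \<open>|z|^k |S 0|\<close> is at most the absolute series of
  \<open>S k\<close>.\<close>

lemma rapidly_decaying_pole_series:
  fixes c :: "nat \<Rightarrow> complex"
  assumes cD: "\<And>n. cmod (c n) \<le> D * sqrt (Im (a n))" and D: "D \<ge> 0"
    and sm: "\<And>k. summable (\<lambda>n. real (Suc n) ^ k * sqrt (Im (a n)))"
    and ae: "AE t in lborel. t < 0 \<longrightarrow> cmod (\<Sum>n. c n / (of_real t - cnj (a n))) \<le> w t"
    and small: "\<And>N::real. N > 0 \<Longrightarrow> w \<in> o[at_infinity](\<lambda>t. \<bar>t\<bar> powr (- N))"
    and z: "\<And>n. 1 \<le> cmod (z - cnj (a n))"
  shows "cmod z ^ k * cmod (\<Sum>n. c n / (z - cnj (a n)))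
    \<le> D * (1 + Y) ^ k * (\<Sum>n. real (Suc n) ^ k * sqrt (Im (a n)))"
proof -
  define p where "p = (\<lambda>n. cnj (a n))"
  define S where "S = (\<lambda>k z. \<Sum>n. c n * p n ^ k / (z - p n))"
  define \<mu> where "\<mu> = (\<lambda>k. \<Sum>n. c n * p n ^ k)"
  have term_le: "cmod (c n * p n ^ k) \<le> D * (1 + Y) ^ k * (real (Suc n) ^ k * sqrt (Im (a n)))" for n k
  proof -
    have "cmod (p n) ^ k \<le> ((1 + Y) * real (Suc n)) ^ k"
      unfolding p_def complex_mod_cnj by (intro power_mono cmod_a_le) simp
    then have "cmod (c n) * cmod (p n) ^ k \<le> (D * sqrt (Im (a n))) * ((1 + Y) * real (Suc n)) ^ k"
      using cD[of n] D Im_pos[of n] by (intro mult_mono) auto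
    then show ?thesis by (simp add: norm_mult norm_power power_mult_distrib mult_ac)
  qed
  have smM: "summable (\<lambda>n. D * (1 + Y) ^ k * (real (Suc n) ^ k * sqrt (Im (a n))))" for k
    by (intro summable_mult sm)
  have sm_abs: "summable (\<lambda>n. cmod (c n * p n ^ k))" for k
    by (rule summable_comparison_test[OF _ smM[of k]]) (use term_le in auto)
  have sm_c: "summable (\<lambda>n. c n * p n ^ k)" for k using sm_abs by (rule summable_norm_cancel)
  have quot_le: "cmod (c n * p n ^ k / (u - p n)) \<le> cmod (c n * p n ^ k)" if "\<And>n. 1 \<le> cmod (u - p n)" for u n k
  proof -
    have "cmod (c n * p n ^ k) / cmod (u - p n) \<le> cmod (c n * p n ^ k) / 1"
      using that[of n] by (intro divide_left_mono) (auto intro: mult_pos_pos)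
    then show ?thesis by (simp add: norm_divide)
  qed
  have sm_quot: "summable (\<lambda>n. cmod (c n * p n ^ k / (u - p n)))" if "\<And>n. 1 \<le> cmod (u - p n)" for u k
    by (rule summable_comparison_test[OF _ sm_abs[of k]]) (use quot_le[OF that] in auto)
  have S_rec: "S (Suc k) u = u * S k u - \<mu> k" if u: "\<And>n. 1 \<le> cmod (u - p n)" for u k
  proof -
    have "c n * p n ^ Suc k / (u - p n) = u * (c n * p n ^ k / (u - p n)) - c n * p n ^ k" for n
    proof -
      have "u - p n \<noteq> 0" using u[of n] by auto
      then have "q * P / (u - p n) = u * (q / (u - p n)) - q" if "P = p n" for q P
        using that by (simp add: field_simps)
      from this[of "p n" "c n * p n ^ k"] show ?thesis by (simp add: mult_ac)
    qed
    then have "S (Suc k) u = (\<Sum>n. u * (c n * p n ^ k / (u - p n)) - c n * p n ^ k)" by (simp only: S_def)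
    also have "\<dots> = (\<Sum>n. u * (c n * p n ^ k / (u - p n))) - (\<Sum>n. c n * p n ^ k)"
      using summable_norm_cancel[OF sm_quot[OF u]] by (intro suminf_diff[symmetric] summable_mult sm_c)
    also have "(\<Sum>n. u * (c n * p n ^ k / (u - p n))) = u * S k u"
      unfolding S_def by (rule suminf_mult) (rule summable_norm_cancel[OF sm_quot[OF u]])
    finally show ?thesis by (simp add: \<mu>_def)
  qed
  have S_pow: "S k u = u ^ k * S 0 u" if u: "\<And>n. 1 \<le> cmod (u - p n)" and "\<And>j. j < k \<Longrightarrow> \<mu> j = 0" for u k
    using that(2)
  proof (induction k)
    case (Suc k)
    then show ?case using S_rec[OF u, of k] by simp
  qed simp
  have left: "1 \<le> cmod (of_real t - p n)" if "t < 0" for t n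
    using pole_dist_left[of t n] that by (simp add: p_def)
  have moment: "\<mu> k = 0" for k
  proof (induction k rule: less_induct)
    case (less k)
    show ?case
    proof (rule ccontr)
      assume nz: "\<mu> k \<noteq> 0"
      define \<epsilon> where "\<epsilon> = cmod (\<mu> k) / 2"
      have \<epsilon>: "\<epsilon> > 0" using nz by (simp add: \<epsilon>_def)
      \<comment> \<open>Dominated convergence for series: for \<open>t < 0\<close> one has
        \<open>|t| \<le> |t - p n|\<close>, so each term is at most
        \<open>|c n * p n ^ k|\<close>.\<close>
      have "eventually (\<lambda>t. summable (\<lambda>n. norm (of_real t * (c n * p n ^ k / (of_real t - p n))))) at_bot
        \<and> summable (\<lambda>n. norm (c n * p n ^ k))
        \<and> ((\<lambda>t::real. \<Sum>n. of_real t * (c n * p n ^ k / (of_real t - p n))) \<longlongrightarrow> (\<Sum>n. c n * p n ^ k)) at_bot"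
      proof (rule tannerys_theorem[where M="\<lambda>n. cmod (c n * p n ^ k)"])
        fix n
        have "((\<lambda>t::real. 1 / t) \<longlongrightarrow> 0) at_bot"
          by (rule tendsto_divide_0[OF tendsto_const filterlim_at_bot_imp_at_infinity[OF filterlim_ident]])
        then have "((\<lambda>t. p n * of_real (1 / t)) \<longlongrightarrow> p n * of_real 0) at_bot"
          by (intro tendsto_intros)
        then have "((\<lambda>t. p n / of_real t) \<longlongrightarrow> 0) at_bot" by simp
        then have "((\<lambda>t. c n * p n ^ k / (1 - p n / of_real t)) \<longlongrightarrow> c n * p n ^ k / (1 - 0)) at_bot"
          by (intro tendsto_intros) auto
        moreover have "\<forall>\<^sub>F t in at_bot. of_real t * (c n * p n ^ k / (of_real t - p n)) = c n * p n ^ k / (1 - p n / of_real t)"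
          using eventually_gt_at_bot[of "0::real"]
        proof eventually_elim
          case (elim t)
          then have "complex_of_real t \<noteq> 0" by simp
          moreover have "of_real t - p n \<noteq> 0" using left[OF elim, of n] by auto
          ultimately show ?case by (simp add: field_simps)
        qed
        ultimately show "((\<lambda>t. of_real t * (c n * p n ^ k / (of_real t - p n))) \<longlongrightarrow> c n * p n ^ k) at_bot"
          by (simp add: tendsto_cong)
      next
        have ptw: "norm (of_real t * (c n * p n ^ k / (of_real t - p n))) \<le> cmod (c n * p n ^ k)" if t: "t < 0" for t n
        proof -
          have "\<bar>t\<bar> \<le> cmod (of_real t - p n)" using pole_dist_left[of t n] t by (simp add: p_def)
          then have "\<bar>t\<bar> / cmod (of_real t - p n) \<le> 1" using left[OF t, of n] by (simp add: divide_le_eq)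
          then have "(\<bar>t\<bar> / cmod (of_real t - p n)) * cmod (c n * p n ^ k) \<le> 1 * cmod (c n * p n ^ k)"
            by (intro mult_right_mono) auto
          then show ?thesis by (simp add: norm_mult norm_divide)
        qed
        have "\<forall>\<^sub>F t in at_bot. \<forall>n. norm (of_real t * (c n * p n ^ k / (of_real t - p n))) \<le> cmod (c n * p n ^ k)"
          using eventually_gt_at_bot[of "0::real"] by eventually_elim (use ptw in blast)
        then show "\<forall>\<^sub>F (n, t) in sequentially \<times>\<^sub>F at_bot. norm (of_real t * (c n * p n ^ k / (of_real t - p n))) \<le> cmod (c n * p n ^ k)"
          unfolding eventually_prod_filter
          by (intro exI[of _ "\<lambda>_. True"] exI[of _ "\<lambda>t. \<forall>n. norm (of_real t * (c n * p n ^ k / (of_real t - p n))) \<le> cmod (c n * p n ^ k)"]) simp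
      qed (use sm_abs in auto)
      then have lim: "((\<lambda>t::real. \<Sum>n. of_real t * (c n * p n ^ k / (of_real t - p n))) \<longlongrightarrow> \<mu> k) at_bot"
        by (simp add: \<mu>_def)
      have "((\<lambda>t::real. cmod (\<Sum>n. of_real t * (c n * p n ^ k / (of_real t - p n)))) \<longlongrightarrow> cmod (\<mu> k)) at_bot"
        using lim by (rule tendsto_norm)
      then have "\<forall>\<^sub>F t::real in at_bot. \<epsilon> < cmod (\<Sum>n. of_real t * (c n * p n ^ k / (of_real t - p n)))"
        using nz by (intro order_tendstoD) (auto simp: \<epsilon>_def)
      moreover have "\<forall>\<^sub>F t::real in at_bot. norm (w t) \<le> \<epsilon> * norm (\<bar>t\<bar> powr (- real (Suc k)))"
      proof -
        have "\<forall>\<^sub>F t in at_infinity. norm (w t) \<le> \<epsilon> * norm (\<bar>t\<bar> powr (- real (Suc k)))"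
          using landau_o.smallD[OF small[of "real (Suc k)"] \<epsilon>] by simp
        then show ?thesis unfolding at_infinity_eq_at_top_bot eventually_sup by blast
      qed
      ultimately have "\<forall>\<^sub>F t::real in at_bot. t < 0 \<and> \<epsilon> < cmod (\<Sum>n. of_real t * (c n * p n ^ k / (of_real t - p n)))
          \<and> norm (w t) \<le> \<epsilon> * norm (\<bar>t\<bar> powr (- real (Suc k)))"
        using eventually_gt_at_bot[of "0::real"] by eventually_elim auto
      then obtain T where T: "\<And>t. t \<le> T \<Longrightarrow> t < 0 \<and> \<epsilon> < cmod (\<Sum>n. of_real t * (c n * p n ^ k / (of_real t - p n)))
          \<and> norm (w t) \<le> \<epsilon> * norm (\<bar>t\<bar> powr (- real (Suc k)))"
        unfolding eventually_at_bot_linorder by blast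
      \<comment> \<open>The bound by \<open>w\<close> is only known almost everywhere, so a
        contradiction at single points would not do; the inequality fails on the whole half-line
        below \<open>T\<close>, which has positive measure.\<close>
      have neg: "\<not> (cmod (S 0 (of_real t)) \<le> w t)" if t: "t \<le> T" for t
      proof
        assume le: "cmod (S 0 (of_real t)) \<le> w t"
        have t0: "t < 0" using T[OF t] by simp
        have "(\<Sum>n. of_real t * (c n * p n ^ k / (of_real t - p n))) = of_real t * S k (of_real t)"
          unfolding S_def by (rule suminf_mult) (rule summable_norm_cancel[OF sm_quot[OF left[OF t0]]])
        also have "\<dots> = of_real t * (of_real t ^ k * S 0 (of_real t))"
          using S_pow[OF left[OF t0], of k] less by simp
        finally have eq: "(\<Sum>n. of_real t * (c n * p n ^ k / (of_real t - p n))) = of_real t * (of_real t ^ k * S 0 (of_real t))" .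
        have Tt: "\<epsilon> < cmod (\<Sum>n. of_real t * (c n * p n ^ k / (of_real t - p n)))"
            "norm (w t) \<le> \<epsilon> * norm (\<bar>t\<bar> powr (- real (Suc k)))"
          using T[OF t] by blast+
        then have "\<epsilon> < \<bar>t\<bar> ^ Suc k * cmod (S 0 (of_real t))"
          unfolding eq by (simp only: norm_mult norm_power norm_of_real power_Suc mult.assoc)
        also have "\<dots> \<le> \<bar>t\<bar> ^ Suc k * (\<epsilon> * \<bar>t\<bar> powr (- real (Suc k)))"
          using Tt(2) le by (intro mult_left_mono) auto
        also have "\<dots> = \<epsilon>"
        proof -
          have "\<bar>t\<bar> powr (- real (Suc k)) = 1 / \<bar>t\<bar> ^ Suc k"
            using t0 by (simp add: powr_minus_divide powr_realpow del: of_nat_Suc)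
          then show ?thesis using t0 by simp
        qed
        finally show False by simp
      qed
      have "AE t in lborel. \<not> t \<le> T"
        using ae
      proof eventually_elim
        case (elim t)
        show ?case using neg[of t] elim T[of t] by (auto simp: S_def p_def)
      qed
      then have "emeasure lborel {t. t \<le> T} = 0"
        by (subst (asm) AE_iff_measurable[of "{t. t \<le> T}"]) auto
      moreover have "emeasure lborel {T - 1..T} \<le> emeasure lborel {t. t \<le> T}"
        by (rule emeasure_mono) auto
      ultimately show False by simp
    qed
  qed
  have zp: "\<And>n. 1 \<le> cmod (z - p n)" using z by (simp add: p_def)
  have "cmod z ^ k * cmod (S 0 z) = cmod (S k z)"
    using S_pow[OF zp, of k] moment by (simp add: norm_mult norm_power)
  also have "\<dots> \<le> (\<Sum>n. cmod (c n * p n ^ k / (z - p n)))"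
    unfolding S_def by (rule summable_norm[OF sm_quot[OF zp]])
  also have "\<dots> \<le> (\<Sum>n. D * (1 + Y) ^ k * (real (Suc n) ^ k * sqrt (Im (a n))))"
    by (rule suminf_le[OF order.trans[OF quot_le[OF zp] term_le] sm_quot[OF zp] smM])
  also have "\<dots> = D * (1 + Y) ^ k * (\<Sum>n. real (Suc n) ^ k * sqrt (Im (a n)))"
    by (rule suminf_mult[OF sm])
  finally show ?thesis by (simp add: S_def p_def)
qed

lemma model_space_boundary_expansion:
  assumes f: "f \<in> model_space (blaschke a)" and sm: "summable (\<lambda>n. sqrt (Im (a n)))"
    and cD: "\<And>n. cmod (c n) \<le> D * sqrt (Im (a n))"
    and exp: "\<And>w. w \<in> upper_half \<Longrightarrow> f w = (\<Sum>n. c n / (w - cnj (a n)))"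
  shows "AE t in lborel. t < 0 \<longrightarrow> hardy_bv f t = (\<Sum>n. c n / (of_real t - cnj (a n)))"
proof (rule AE_I2, rule impI)
  fix t :: real assume t: "t < 0"
  have smc: "summable (\<lambda>n. cmod (c n))"
    by (rule summable_comparison_test[OF _ summable_mult[OF sm, of D]]) (use cD in auto)
  have ge: "1 \<le> cmod (Complex t y - cnj (a n))" for y n
    using abs_Re_le_cmod[of "Complex t y - cnj (a n)"] Re_a[of n] t by simp
  show "hardy_bv f t = (\<Sum>n. c n / (of_real t - cnj (a n)))"
  proof (rule hardy_bv_eqI)
    have "eventually (\<lambda>y. summable (\<lambda>n. norm (c n / (Complex t y - cnj (a n))))) (at_right 0)
      \<and> summable (\<lambda>n. norm (c n / (of_real t - cnj (a n))))
      \<and> ((\<lambda>y. \<Sum>n. c n / (Complex t y - cnj (a n))) \<longlongrightarrow> (\<Sum>n. c n / (of_real t - cnj (a n)))) (at_right 0)"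
    proof (rule tannerys_theorem[where M="\<lambda>n. cmod (c n)"])
      fix n
      have "((\<lambda>y. Complex t y) \<longlongrightarrow> Complex t 0) (at_right 0)" by (intro tendsto_intros)
      then have "((\<lambda>y. Complex t y) \<longlongrightarrow> of_real t) (at_right 0)" by (simp add: complex_of_real_def)
      moreover have "of_real t - cnj (a n) \<noteq> 0" using off_pole[of "of_real t" n] by simp
      ultimately show "((\<lambda>y. c n / (Complex t y - cnj (a n))) \<longlongrightarrow> c n / (of_real t - cnj (a n))) (at_right 0)"
        by (intro tendsto_intros)
    next
      have "norm (c n / (Complex t y - cnj (a n))) \<le> cmod (c n)" for n y
      proof -
        have "cmod (c n) / cmod (Complex t y - cnj (a n)) \<le> cmod (c n) / 1"
          using ge[of y n] by (intro divide_left_mono) (auto intro: mult_pos_pos)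
        then show ?thesis by (simp add: norm_divide)
      qed
      then show "\<forall>\<^sub>F (n, y) in sequentially \<times>\<^sub>F at_right 0. norm (c n / (Complex t y - cnj (a n))) \<le> cmod (c n)"
        by (intro always_eventually) auto
    qed (use smc in auto)
    moreover have "\<forall>\<^sub>F y in at_right 0. f (Complex t y) = (\<Sum>n. c n / (Complex t y - cnj (a n)))"
      using eventually_at_right_less[of "0::real"] by eventually_elim (simp add: exp upper_half_iff)
    ultimately show "((\<lambda>y. f (Complex t y)) \<longlongrightarrow> (\<Sum>n. c n / (of_real t - cnj (a n)))) (at_right 0)"
      by (simp add: tendsto_cong)
  qed
qed

end

section \<open>The logarithmic integral in a half-plane\<close>

lemma cmod_one_plus_scaled:
  assumes "Re \<zeta> \<ge> 0" "\<eta> \<ge> 0"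
  shows "1 \<le> cmod (1 + of_real \<eta> * \<zeta>)" "\<eta> * cmod \<zeta> \<le> cmod (1 + of_real \<eta> * \<zeta>)"
proof -
  have 1: "(cmod (1 + of_real \<eta> * \<zeta>))\<^sup>2 = 1 + 2 * \<eta> * Re \<zeta> + (\<eta> * cmod \<zeta>)\<^sup>2"
    unfolding power_mult_distrib cmod_power2 by (simp add: power2_eq_square algebra_simps)
  have "0 \<le> \<eta> * Re \<zeta>" using assms by simp
  then have "1\<^sup>2 \<le> (cmod (1 + of_real \<eta> * \<zeta>))\<^sup>2" "(\<eta> * cmod \<zeta>)\<^sup>2 \<le> (cmod (1 + of_real \<eta> * \<zeta>))\<^sup>2"
    unfolding 1 by (auto simp: add_nonneg_nonneg)
  then show "1 \<le> cmod (1 + of_real \<eta> * \<zeta>)" "\<eta> * cmod \<zeta> \<le> cmod (1 + of_real \<eta> * \<zeta>)"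
    using assms by (auto intro: power2_le_imp_le)
qed

text \<open>A Phragmen-Lindelof argument: division by \<open>1 + \<eta> \<zeta>\<close> makes the
  bounded function small on large arcs, the maximum principle applies on a half-disc, and then
  \<open>\<eta>\<close> tends to 0.\<close>

lemma bounded_halfplane_maximum:
  assumes hol: "G holomorphic_on {\<zeta>. Re \<zeta> > -1}" and C: "C > 0"
    and M: "\<And>\<zeta>. Re \<zeta> \<ge> 0 \<Longrightarrow> cmod (G \<zeta>) \<le> M"
    and bd: "\<And>s. cmod (G (\<i> * of_real s)) \<le> C" and \<zeta>: "Re \<zeta>0 > 0"
  shows "cmod (G \<zeta>0) \<le> C"
proof -
  have M0: "M \<ge> 0" using order.trans[OF norm_ge_zero M[of 0]] by simp
  have key: "cmod (G \<zeta>0) \<le> C * cmod (1 + of_real \<eta> * \<zeta>0)" if \<eta>: "\<eta> > 0" for \<eta>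
  proof -
    \<comment> \<open>Large enough that the arc of radius \<open>R\<close> contributes at most
      \<open>M / (\<eta> R) \<le> C\<close> and that \<open>\<zeta>0\<close> lies inside.\<close>
    define R where "R = max (cmod \<zeta>0 + 1) (M / (\<eta> * C))"
    have "cmod \<zeta>0 + 1 \<le> R" "M / (\<eta> * C) \<le> R" unfolding R_def by simp_all
    then have R: "R > cmod \<zeta>0" "R > 0" "M / (\<eta> * C) \<le> R" using norm_ge_zero[of \<zeta>0] by linarith+
    define S where "S = {\<zeta>. Re \<zeta> > 0} \<inter> ball 0 R"
    have oS: "open S" unfolding S_def by (intro open_Int open_halfspace_Re_gt open_ball)
    have cS: "closure S \<subseteq> {\<zeta>. Re \<zeta> \<ge> 0} \<inter> cball 0 R"
      by (rule closure_minimal) (auto simp: S_def intro!: closed_Int closed_halfspace_Re_ge)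
    define H where "H = (\<lambda>\<zeta>. G \<zeta> / (1 + of_real \<eta> * \<zeta>))"
    have ne: "1 + of_real \<eta> * \<zeta> \<noteq> 0" if "Re \<zeta> \<ge> 0" for \<zeta>
      using cmod_one_plus_scaled(1)[OF that, of \<eta>] \<eta> by auto
    have "G holomorphic_on {\<zeta>. Re \<zeta> \<ge> 0}" by (rule holomorphic_on_subset[OF hol]) auto
    then have H_hol: "H holomorphic_on {\<zeta>. Re \<zeta> \<ge> 0}" unfolding H_def by (intro holomorphic_intros) (auto simp: ne)
    have "cmod (H \<zeta>0) \<le> C"
    proof (rule maximum_modulus_frontier[of H S])
      show "H holomorphic_on interior S"
        by (rule holomorphic_on_subset[OF H_hol]) (use interior_subset[of S] in \<open>auto simp: S_def\<close>)
      show "continuous_on (closure S) H"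
        by (rule continuous_on_subset[OF holomorphic_on_imp_continuous_on[OF H_hol]]) (use cS in auto)
      show "bounded S" unfolding S_def by (intro bounded_Int) auto
      show "\<zeta>0 \<in> S" using \<zeta> R by (simp add: S_def)
      fix z assume "z \<in> frontier S"
      then have z: "z \<in> closure S" "z \<notin> S" using oS by (auto simp: frontier_def interior_open)
      then have zr: "Re z \<ge> 0" "cmod z \<le> R" using cS by auto
      have "Re z = 0 \<or> cmod z = R" using z zr by (auto simp: S_def)
      then show "norm (H z) \<le> C"
      proof
        assume "Re z = 0"
        then have "z = \<i> * of_real (Im z)" by (simp add: complex_eq_iff)
        then have "cmod (G z) \<le> C" using bd[of "Im z"] by simp
        moreover have "1 \<le> cmod (1 + of_real \<eta> * z)" using cmod_one_plus_scaled(1)[OF zr(1), of \<eta>] \<eta> by simp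
        ultimately have "cmod (G z) / cmod (1 + of_real \<eta> * z) \<le> C / 1" using C by (intro frac_le) auto
        then show ?thesis by (simp add: H_def norm_divide)
      next
        assume zR: "cmod z = R"
        have "\<eta> * R \<le> cmod (1 + of_real \<eta> * z)" using cmod_one_plus_scaled(2)[OF zr(1), of \<eta>] \<eta> zR by simp
        then have "cmod (G z) / cmod (1 + of_real \<eta> * z) \<le> M / (\<eta> * R)"
          using M[OF zr(1)] M0 \<eta> R by (intro frac_le) auto
        also have "\<dots> \<le> C" using R \<eta> C by (simp add: field_simps)
        finally show ?thesis by (simp add: H_def norm_divide)
      qed
    qed
    then show ?thesis using ne[of \<zeta>0] \<zeta> by (simp add: H_def norm_divide divide_le_eq)
  qed
  have "((\<lambda>\<eta>. C * cmod (1 + of_real \<eta> * \<zeta>0)) \<longlongrightarrow> C * cmod (1 + of_real 0 * \<zeta>0)) (at_right 0)"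
    by (intro tendsto_intros)
  moreover have "\<forall>\<^sub>F \<eta> in at_right 0. cmod (G \<zeta>0) \<le> C * cmod (1 + of_real \<eta> * \<zeta>0)"
    using eventually_at_right_less[of "0::real"] by eventually_elim (rule key)
  ultimately have "cmod (G \<zeta>0) \<le> C * cmod (1 + of_real 0 * \<zeta>0)"
    by (intro tendsto_lowerbound) auto
  then show ?thesis by simp
qed

text \<open>A rational substitute for the harmonic measure of the part \<open>\<bar>s\<bar> > 1/2\<close> of the imaginary axis: its
  real part on the axis is at most the indicator of that part, but it still grows linearly at 0.\<close>

definition barrier :: "complex \<Rightarrow> complex" where
  "barrier \<zeta> = (\<zeta>\<^sup>2 + of_real (3/8) * \<zeta>) / (1 + \<zeta>)\<^sup>2"

text \<open>The coefficient \<open>3/8\<close> in \<open>barrier\<close> is what produces the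
  numerator \<open>s^2 (s^2 - 1/4)\<close>, with its change of sign exactly at
  \<open>|s| = 1/2\<close>.\<close>

lemma Re_barrier_imag: "Re (barrier (\<i> * of_real s)) = s\<^sup>2 * (s\<^sup>2 - 1/4) / (1 + s\<^sup>2)\<^sup>2"
proof -
  define w where "w = 1 + \<i> * complex_of_real s"
  have w: "w * cnj w = of_real (1 + s\<^sup>2)" by (simp add: w_def complex_eq_iff power2_eq_square)
  have w0: "w \<noteq> 0" by (simp add: w_def complex_eq_iff)
  have "barrier (\<i> * of_real s) = ((\<i> * of_real s)\<^sup>2 + of_real (3/8) * (\<i> * of_real s)) * (cnj w)\<^sup>2 / (w * cnj w)\<^sup>2"
    unfolding barrier_def w_def[symmetric] power_mult_distrib using w0 by simp
  also have "\<dots> = ((\<i> * of_real s)\<^sup>2 + of_real (3/8) * (\<i> * of_real s)) * (cnj w)\<^sup>2 / of_real ((1 + s\<^sup>2)\<^sup>2)"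
    unfolding w by simp
  finally have "Re (barrier (\<i> * of_real s)) = Re (((\<i> * of_real s)\<^sup>2 + of_real (3/8) * (\<i> * of_real s)) * (cnj w)\<^sup>2) / (1 + s\<^sup>2)\<^sup>2"
    by (simp only: Re_divide_of_real)
  also have "Re (((\<i> * of_real s)\<^sup>2 + of_real (3/8) * (\<i> * of_real s)) * (cnj w)\<^sup>2) = s\<^sup>2 * (s\<^sup>2 - 1/4)"
    by (simp add: w_def power2_eq_square algebra_simps)
  finally show ?thesis .
qed

lemma Re_barrier_imag_le: "Re (barrier (\<i> * of_real s)) \<le> (if \<bar>s\<bar> > 1/2 then 1 else 0)"
proof (cases "\<bar>s\<bar> > 1/2")
  case True
  have "s\<^sup>2 * (s\<^sup>2 - 1/4) \<le> (1 + s\<^sup>2)\<^sup>2" by (simp add: power2_eq_square algebra_simps)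
  then have "s\<^sup>2 * (s\<^sup>2 - 1/4) / (1 + s\<^sup>2)\<^sup>2 \<le> 1" by (simp add: divide_le_eq)
  then show ?thesis using True by (simp add: Re_barrier_imag)
next
  case False
  then have "\<bar>s\<bar>\<^sup>2 \<le> (1/2)\<^sup>2" by (intro power_mono) auto
  then have "s\<^sup>2 - 1/4 \<le> 0" by (simp add: power2_eq_square)
  then have "s\<^sup>2 * (s\<^sup>2 - 1/4) / (1 + s\<^sup>2)\<^sup>2 \<le> 0"
    by (intro divide_nonpos_nonneg mult_nonneg_nonpos) auto
  then show ?thesis using False by (simp add: Re_barrier_imag)
qed

lemma cmod_barrier_le: "Re \<zeta> \<ge> 0 \<Longrightarrow> cmod (barrier \<zeta>) \<le> 2"
proof -
  assume z: "Re \<zeta> \<ge> 0"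
  have 1: "1 \<le> cmod (1 + \<zeta>)" "cmod \<zeta> \<le> cmod (1 + \<zeta>)" using cmod_one_plus_scaled[OF z, of 1] by auto
  have "cmod (\<zeta>\<^sup>2 + of_real (3/8) * \<zeta>) \<le> (cmod \<zeta>)\<^sup>2 + 3/8 * cmod \<zeta>"
    by (rule order.trans[OF norm_triangle_ineq]) (simp add: norm_power norm_mult)
  also have "\<dots> \<le> (cmod (1 + \<zeta>))\<^sup>2 + 1 * (cmod (1 + \<zeta>) * cmod (1 + \<zeta>))"
  proof (intro add_mono power_mono)
    have "3/8 * cmod \<zeta> \<le> 1 * (1 * cmod (1 + \<zeta>))" using 1 by (intro mult_mono) auto
    also have "\<dots> \<le> 1 * (cmod (1 + \<zeta>) * cmod (1 + \<zeta>))" using 1 by (intro mult_left_mono mult_right_mono) auto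
    finally show "3/8 * cmod \<zeta> \<le> 1 * (cmod (1 + \<zeta>) * cmod (1 + \<zeta>))" .
  qed (use 1 in auto)
  also have "\<dots> = 2 * (cmod (1 + \<zeta>))\<^sup>2" by (simp add: power2_eq_square)
  finally show ?thesis using 1 by (simp add: barrier_def norm_divide norm_power divide_le_eq)
qed

lemma barrier_real_ge:
  assumes "0 < x" "x \<le> 1"
  shows "Re (barrier (of_real x)) \<ge> 3/32 * x"
proof -
  have "barrier (of_real x) = of_real ((x\<^sup>2 + 3/8 * x) / (1 + x)\<^sup>2)" by (simp add: barrier_def)
  then have "Re (barrier (of_real x)) = (x\<^sup>2 + 3/8 * x) / (1 + x)\<^sup>2" by (simp only: Re_complex_of_real)
  also have "\<dots> \<ge> (3/8 * x) / 2\<^sup>2" using assms by (intro frac_le power_mono) auto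
  finally show ?thesis by simp
qed

lemma holomorphic_barrier: "barrier holomorphic_on {\<zeta>. Re \<zeta> > -1}"
proof -
  have "1 + \<zeta> \<noteq> 0" if "Re \<zeta> > -1" for \<zeta> using that by (auto simp: complex_eq_iff)
  then show ?thesis unfolding barrier_def by (intro holomorphic_intros) simp
qed

text \<open>The weight is broken into dyadic increments \<open>v k\<close>, each carried by a
  barrier scaled so that its threshold sits at \<open>2^k\<close>. Their sum \<open>\<Phi>\<close>
  has real part at most \<open>V |s|\<close> on the axis, so \<open>g exp \<Phi>\<close> is bounded
  by \<open>C\<close> there and hence at \<open>x\<close>. The linear growth of the barrier makes
  \<open>Re (\<Phi> x)\<close> at least a multiple of \<open>x \<Sum> V(2^k) / 2^k\<close>, which
  diverges and forces \<open>g x = 0\<close>.\<close>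

lemma halfplane_log_integral_uniqueness:
  fixes V :: "real \<Rightarrow> real"
  assumes hol: "g holomorphic_on {\<zeta>. Re \<zeta> > -1}" and M: "\<And>\<zeta>. Re \<zeta> \<ge> 0 \<Longrightarrow> cmod (g \<zeta>) \<le> M"
    and C: "C > 0" and bd: "\<And>s. cmod (g (\<i> * of_real s)) \<le> C * exp (- V \<bar>s\<bar>)"
    and V0: "\<And>s. s \<ge> 0 \<Longrightarrow> V s \<ge> 0" and Vmono: "\<And>s t. 0 \<le> s \<Longrightarrow> s \<le> t \<Longrightarrow> V s \<le> V t"
    and div: "\<not> summable (\<lambda>k. V (2 ^ k) / 2 ^ k)" and x: "0 < x" "x \<le> 1"
  shows "g (of_real x) = 0"
proof -
  define v where "v = (\<lambda>k. if k = 0 then V 1 else V (2 ^ k) - V (2 ^ (k - 1)))"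
  have v0: "v k \<ge> 0" for k
    by (cases k) (auto simp: v_def V0 intro!: Vmono)
  define \<Phi> where "\<Phi> = (\<lambda>K \<zeta>. \<Sum>k<K. of_real (v k) * barrier (\<zeta> / 2 ^ (k + 1)))"
  have \<Phi>_imag: "Re (\<Phi> K (\<i> * of_real s)) \<le> V \<bar>s\<bar>" for K s
  proof -
    \<comment> \<open>On the axis only the increments with \<open>2^k < |s|\<close> count, and they
      telescope to a value of \<open>V\<close> at a point not beyond \<open>|s|\<close>.\<close>
    define W where "W = (\<lambda>k. V (min (2 ^ k) \<bar>s\<bar>))"
    have W: "W k \<le> V \<bar>s\<bar>" for k unfolding W_def by (rule Vmono) auto
    have term0: "v k * Re (barrier (\<i> * of_real s / 2 ^ (k + 1))) \<le> v k * (if 2 ^ k < \<bar>s\<bar> then 1 else 0)" for k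
    proof -
      have "\<i> * of_real s / 2 ^ (k + 1) = \<i> * of_real (s / 2 ^ (k + 1))" by simp
      then have "Re (barrier (\<i> * of_real s / 2 ^ (k + 1))) \<le> (if \<bar>s / 2 ^ (k + 1)\<bar> > 1/2 then 1 else 0)"
        by (simp only: Re_barrier_imag_le)
      also have "(\<bar>s / 2 ^ (k + 1)\<bar> > 1/2) = (2 ^ k < \<bar>s\<bar>)"
      proof -
        have "\<bar>s / 2 ^ (k + 1)\<bar> = \<bar>s\<bar> / (2 * 2 ^ k)" by (simp add: abs_divide)
        moreover have "(1 / 2 < \<bar>s\<bar> / (2 * P)) = (P < \<bar>s\<bar>)" if "P > 0" for P :: real
          using that by (simp add: pos_less_divide_eq)
        ultimately show ?thesis by simp
      qed
      finally show ?thesis using v0 by (intro mult_left_mono) auto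
    qed
    have step: "v k * (if 2 ^ k < \<bar>s\<bar> then 1 else 0) \<le> W k - (if k = 0 then 0 else W (k - 1))" for k
    proof (cases "2 ^ k < \<bar>s\<bar>")
      case True
      show ?thesis
      proof (cases k)
        case 0 then show ?thesis using True by (simp add: v_def W_def)
      next
        case (Suc j)
        then have "(2::real) ^ j \<le> 2 ^ k" by (intro power_increasing) auto
        then have "(2::real) ^ j < \<bar>s\<bar>" using True by linarith
        then show ?thesis using True Suc by (simp add: v_def W_def)
      qed
    next
      case False
      have "W (k - 1) \<le> W k" unfolding W_def
        by (intro Vmono min.mono power_increasing) auto
      moreover have "0 \<le> W k" unfolding W_def by (rule V0) auto
      ultimately show ?thesis using False by auto
    qed
    have tel: "(\<Sum>k<K. W k - (if k = 0 then 0 else W (k - 1))) = (if K = 0 then 0 else W (K - 1))" for K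
      by (induction K) auto
    have "Re (\<Phi> K (\<i> * of_real s)) = (\<Sum>k<K. v k * Re (barrier (\<i> * of_real s / 2 ^ (k + 1))))"
      unfolding \<Phi>_def Re_sum by (intro sum.cong) (auto simp del: power_Suc)
    also have "\<dots> \<le> (\<Sum>k<K. W k - (if k = 0 then 0 else W (k - 1)))"
      by (intro sum_mono order.trans[OF term0 step])
    also have "\<dots> \<le> V \<bar>s\<bar>" unfolding tel using W V0[of "\<bar>s\<bar>"] by simp
    finally show ?thesis .
  qed
  have scale: "Re (\<zeta> / 2 ^ k) = Re \<zeta> / 2 ^ k" for \<zeta> k
  proof -
    have "\<zeta> / 2 ^ k = \<zeta> / of_real (2 ^ k)" by simp
    then show ?thesis by (simp only: Re_divide_of_real)
  qed
  have \<Phi>_bd: "cmod (\<Phi> K \<zeta>) \<le> (\<Sum>k<K. v k * 2)" if "Re \<zeta> \<ge> 0" for K \<zeta>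
    unfolding \<Phi>_def
  proof (rule order.trans[OF norm_sum sum_mono])
    fix k
    have "Re (\<zeta> / 2 ^ (k + 1)) \<ge> 0" unfolding scale using that by simp
    then have "cmod (barrier (\<zeta> / 2 ^ (k + 1))) \<le> 2" by (rule cmod_barrier_le)
    then show "cmod (of_real (v k) * barrier (\<zeta> / 2 ^ (k + 1))) \<le> v k * 2"
      using v0[of k] by (simp add: norm_mult mult_left_mono)
  qed
  have \<Phi>_hol: "\<Phi> K holomorphic_on {\<zeta>. Re \<zeta> > -1}" for K
  proof -
    have "(\<lambda>\<zeta>. barrier (\<zeta> / 2 ^ (k + 1))) holomorphic_on {\<zeta>. Re \<zeta> > -1}" for k
    proof (rule holomorphic_on_compose_gen[of "\<lambda>\<zeta>. \<zeta> / 2 ^ (k + 1)" _ barrier, unfolded o_def])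
      show "(\<lambda>\<zeta>. \<zeta> / 2 ^ (k + 1)) ` {\<zeta>. Re \<zeta> > -1} \<subseteq> {\<zeta>. Re \<zeta> > -1}"
      proof safe
        fix \<zeta> :: complex assume "Re \<zeta> > -1"
        moreover have "(1::real) \<le> 2 ^ (k + 1)" by (rule one_le_power) simp
        ultimately have "Re \<zeta> / 2 ^ (k + 1) > -1" by (simp add: pos_less_divide_eq)
        then show "Re (\<zeta> / 2 ^ (k + 1)) > -1" by (simp only: scale)
      qed
    qed (auto intro!: holomorphic_intros holomorphic_barrier)
    then show ?thesis unfolding \<Phi>_def by (intro holomorphic_intros)
  qed
  have main: "cmod (g (of_real x)) \<le> C * exp (- Re (\<Phi> K (of_real x)))" for K
  proof -
    define G where "G = (\<lambda>\<zeta>. g \<zeta> * exp (\<Phi> K \<zeta>))"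
    have "cmod (G (of_real x)) \<le> C"
    proof (rule bounded_halfplane_maximum[of G C "M * exp (\<Sum>k<K. v k * 2)"])
      show "G holomorphic_on {\<zeta>. Re \<zeta> > -1}" unfolding G_def by (intro holomorphic_intros hol \<Phi>_hol)
      show "cmod (G \<zeta>) \<le> M * exp (\<Sum>k<K. v k * 2)" if "Re \<zeta> \<ge> 0" for \<zeta>
      proof -
        have "Re (\<Phi> K \<zeta>) \<le> (\<Sum>k<K. v k * 2)" using complex_Re_le_cmod[of "\<Phi> K \<zeta>"] \<Phi>_bd[OF that, of K] by linarith
        then show ?thesis unfolding G_def norm_mult norm_exp_eq_Re
          using M[OF that] order.trans[OF norm_ge_zero M[OF that]] by (intro mult_mono) auto
      qed
      show "cmod (G (\<i> * of_real s)) \<le> C" for s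
      proof -
        have "cmod (G (\<i> * of_real s)) \<le> (C * exp (- V \<bar>s\<bar>)) * exp (V \<bar>s\<bar>)"
          unfolding G_def norm_mult norm_exp_eq_Re using C
          by (intro mult_mono bd[unfolded norm_mult]) (auto simp: \<Phi>_imag bd)
        also have "\<dots> = C" by (simp add: mult.assoc flip: exp_add)
        finally show ?thesis .
      qed
    qed (use C x in auto)
    then have "cmod (g (of_real x)) * exp (Re (\<Phi> K (of_real x))) \<le> C"
      by (simp add: G_def norm_mult norm_exp_eq_Re)
    then show ?thesis by (simp add: exp_minus field_simps)
  qed
  \<comment> \<open>Summation by parts: the increments weighted by \<open>2^(-k)\<close> amount to
    half of the weighted values plus a boundary term that is nonnegative.\<close>
  have abel: "(\<Sum>k<Suc K. v k / 2 ^ k) = (\<Sum>k<Suc K. V (2 ^ k) / 2 ^ k) / 2 + V (2 ^ K) / 2 ^ (Suc K)" for K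
  proof (induction K)
    case 0 then show ?case by (simp add: v_def)
  next
    case (Suc K)
    have "(\<Sum>k<Suc (Suc K). v k / 2 ^ k) = (\<Sum>k<Suc K. v k / 2 ^ k) + v (Suc K) / 2 ^ Suc K" by simp
    also have "\<dots> = (\<Sum>k<Suc K. V (2 ^ k) / 2 ^ k) / 2 + V (2 ^ Suc K) / 2 ^ Suc K"
      unfolding Suc by (simp add: v_def diff_divide_distrib)
    also have "\<dots> = (\<Sum>k<Suc (Suc K). V (2 ^ k) / 2 ^ k) / 2 + V (2 ^ Suc K) / 2 ^ Suc (Suc K)"
      by (simp add: add_divide_distrib)
    finally show ?case .
  qed
  have \<Phi>_ge: "Re (\<Phi> (Suc K) (of_real x)) \<ge> 3/128 * x * (\<Sum>k<Suc K. V (2 ^ k) / 2 ^ k)" for K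
  proof -
    have "3/128 * x * (\<Sum>k<Suc K. V (2 ^ k) / 2 ^ k) \<le> 3/64 * x * (\<Sum>k<Suc K. v k / 2 ^ k)"
    proof -
      have "0 \<le> V (2 ^ K) / 2 ^ (Suc K)" by (simp add: V0)
      then have "(\<Sum>k<Suc K. V (2 ^ k) / 2 ^ k) / 2 \<le> (\<Sum>k<Suc K. v k / 2 ^ k)" unfolding abel by linarith
      then have "3/64 * x * ((\<Sum>k<Suc K. V (2 ^ k) / 2 ^ k) / 2) \<le> 3/64 * x * (\<Sum>k<Suc K. v k / 2 ^ k)"
        using x by (intro mult_left_mono) auto
      then show ?thesis by simp
    qed
    also have "\<dots> = (\<Sum>k<Suc K. v k * (3/32 * (x / 2 ^ (k + 1))))"
      unfolding sum_distrib_left by (intro sum.cong) auto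
    also have "\<dots> \<le> (\<Sum>k<Suc K. v k * Re (barrier (of_real (x / 2 ^ (k + 1)))))"
    proof (intro sum_mono mult_left_mono barrier_real_ge v0)
      fix k
      have "(1::real) \<le> 2 ^ (k + 1)" by (rule one_le_power) simp
      then show "x / 2 ^ (k + 1) \<le> 1" "0 < x / 2 ^ (k + 1)" using x by (auto simp: divide_le_eq)
    qed
    also have "\<dots> = Re (\<Phi> (Suc K) (of_real x))"
      unfolding \<Phi>_def Re_sum by (intro sum.cong) (auto simp del: power_Suc)
    finally show ?thesis .
  qed
  show ?thesis
  proof (rule ccontr)
    assume "g (of_real x) \<noteq> 0"
    then have gp: "cmod (g (of_real x)) > 0" by simp
    define B where "B = ln (C / cmod (g (of_real x))) / (3/128 * x)"
    have "summable (\<lambda>k. V (2 ^ k) / 2 ^ k)"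
    proof (rule summableI_nonneg_bounded)
      show "0 \<le> V (2 ^ n) / 2 ^ n" for n by (simp add: V0)
      fix n
      have le: "(\<Sum>k<Suc n. V (2 ^ k) / 2 ^ k) \<le> B"
      proof -
        have "cmod (g (of_real x)) \<le> C * exp (- Re (\<Phi> (Suc n) (of_real x)))" by (rule main)
        then have "exp (Re (\<Phi> (Suc n) (of_real x))) \<le> C / cmod (g (of_real x))"
          using gp by (simp add: exp_minus field_simps)
        then have "Re (\<Phi> (Suc n) (of_real x)) \<le> ln (C / cmod (g (of_real x)))"
          using gp C by (simp add: ln_ge_iff)
        then have "3/128 * x * (\<Sum>k<Suc n. V (2 ^ k) / 2 ^ k) \<le> ln (C / cmod (g (of_real x)))"
          using \<Phi>_ge[of n] by linarith
        then show ?thesis using x unfolding B_def by (subst pos_le_divide_eq) (auto simp: mult_ac)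
      qed
      have "(\<Sum>k<n. V (2 ^ k) / 2 ^ k) \<le> (\<Sum>k<Suc n. V (2 ^ k) / 2 ^ k)" by (simp add: V0)
      then show "(\<Sum>k<n. V (2 ^ k) / 2 ^ k) \<le> B" using le by linarith
    qed
    then show False using div by simp
  qed
qed

section \<open>Divergent convex weights\<close>

locale convex_weight =
  fixes yf :: "real \<Rightarrow> real"
  assumes yf_pos: "t \<ge> 0 \<Longrightarrow> yf t > 0"
    and yf_anti: "0 \<le> s \<Longrightarrow> s \<le> t \<Longrightarrow> yf t \<le> yf s"
    and yf_convex: "convex_on UNIV (\<lambda>x. - ln (yf (exp x)))"
    and yf_divergent: "\<not> summable (\<lambda>k. real (Suc k) powr (-3/2) * ln (1 / yf (real (Suc k))))"
begin

definition \<psi> :: "real \<Rightarrow> real" where "\<psi> x = - ln (yf (exp x))"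

lemma yf_exp: "yf (exp x) = exp (- \<psi> x)"
  using yf_pos[of "exp x"] by (simp add: \<psi>_def)

lemma yf_eq: "r > 0 \<Longrightarrow> yf r = exp (- \<psi> (ln r))"
  using yf_exp[of "ln r"] by simp

lemma \<psi>_slope:
  assumes "0 < x0" "x0 \<le> x"
  shows "\<psi> x0 \<le> (1 - x0 / x) * \<psi> 0 + (x0 / x) * \<psi> x"
proof -
  have "\<psi> ((1 - x0 / x) *\<^sub>R 0 + (x0 / x) *\<^sub>R x) \<le> (1 - x0 / x) * \<psi> 0 + (x0 / x) * \<psi> x"
    unfolding \<psi>_def using assms by (intro convex_onD[OF yf_convex]) auto
  moreover have "(1 - x0 / x) *\<^sub>R 0 + (x0 / x) *\<^sub>R x = x0" using assms by simp
  ultimately show ?thesis by (simp only:)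
qed

text \<open>By convexity the alternative to superlinear growth is linear growth, which makes the series converge.\<close>

lemma \<psi>_superlinear: "\<exists>X>0. \<forall>x\<ge>X. S * x \<le> \<psi> x"
proof -
  \<comment> \<open>One point above the line of slope \<open>S\<close> through the value at 0 is
    enough: chords from 0 of a convex function have nondecreasing slope.\<close>
  have "\<exists>x0>0. \<psi> 0 + S * x0 < \<psi> x0" for S
  proof (rule ccontr)
    assume "\<not> ?thesis"
    then have le: "\<psi> x \<le> \<psi> 0 + S * x" if "x > 0" for x using that by (meson not_less)
    define B where "B = ln (yf 0)"
    have lower: "- B \<le> ln (1 / yf (real (Suc k)))" for k
    proof -
      have "ln (yf (real (Suc k))) \<le> ln (yf 0)" using yf_anti[of 0 "real (Suc k)"] yf_pos by (intro ln_mono) auto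
      then show ?thesis using yf_pos[of "real (Suc k)"] by (simp add: ln_div B_def)
    qed
    have eq: "ln (1 / yf (real (Suc k))) = \<psi> (ln (real (Suc k)))" for k
      using yf_pos[of "real (Suc k)"] by (simp add: \<psi>_def ln_div)
    have s1: "summable (\<lambda>k. real (Suc k) powr (-3/2))"
    proof -
      have "summable (\<lambda>n. real n powr (-3/2))" by (subst summable_real_powr_iff) simp
      then show ?thesis by (subst summable_Suc_iff)
    qed
    have "summable (\<lambda>k. real (Suc k) powr (-3/2) * ln (1 / yf (real (Suc k))))"
    proof (rule summable_comparison_test)
      show "summable (\<lambda>k. (\<bar>\<psi> 0\<bar> + \<bar>B\<bar>) * real (Suc k) powr (-3/2) + \<bar>S\<bar> * (real (Suc k) powr (-3/2) * ln (real (Suc k))))"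
        by (intro summable_add summable_mult s1 summable_powr_ln)
      have "norm (real (Suc k) powr (-3/2) * ln (1 / yf (real (Suc k))))
        \<le> (\<bar>\<psi> 0\<bar> + \<bar>B\<bar>) * real (Suc k) powr (-3/2) + \<bar>S\<bar> * (real (Suc k) powr (-3/2) * ln (real (Suc k)))" for k
      proof -
        define l where "l = ln (real (Suc k))"
        have l0: "l \<ge> 0" by (simp add: l_def)
        have "\<psi> l \<le> \<psi> 0 + S * l" using le[of l] l0 by (cases "l = 0") auto
        moreover have "S * l \<le> \<bar>S\<bar> * l" using l0 by (intro mult_right_mono) auto
        moreover have "- B \<le> \<psi> l" using lower[of k] unfolding eq l_def .
        moreover have "0 \<le> \<bar>S\<bar> * l" using l0 by simp
        ultimately have "\<bar>\<psi> l\<bar> \<le> \<bar>\<psi> 0\<bar> + \<bar>B\<bar> + \<bar>S\<bar> * l" by linarith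
        then have "real (Suc k) powr (-3/2) * \<bar>\<psi> l\<bar> \<le> real (Suc k) powr (-3/2) * (\<bar>\<psi> 0\<bar> + \<bar>B\<bar> + \<bar>S\<bar> * l)"
          by (intro mult_left_mono) auto
        also have "\<dots> = (\<bar>\<psi> 0\<bar> + \<bar>B\<bar>) * real (Suc k) powr (-3/2) + \<bar>S\<bar> * (real (Suc k) powr (-3/2) * l)"
          by (simp add: algebra_simps)
        finally show ?thesis unfolding eq l_def[symmetric] by (simp add: abs_mult)
      qed
      then show "\<exists>N. \<forall>k\<ge>N. norm (real (Suc k) powr (-3/2) * ln (1 / yf (real (Suc k))))
        \<le> (\<bar>\<psi> 0\<bar> + \<bar>B\<bar>) * real (Suc k) powr (-3/2) + \<bar>S\<bar> * (real (Suc k) powr (-3/2) * ln (real (Suc k)))" by blast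
    qed
    then show False using yf_divergent by simp
  qed
  \<comment> \<open>The surplus 1 in the slope absorbs the constant \<open>\<psi> 0\<close> once
    \<open>x \<ge> |\<psi> 0|\<close>.\<close>
  then obtain x0 where x0: "x0 > 0" "\<psi> 0 + (\<bar>S\<bar> + 1) * x0 < \<psi> x0" by blast
  have lin: "\<psi> 0 + (\<bar>S\<bar> + 1) * x \<le> \<psi> x" if "x \<ge> x0" for x
  proof -
    have x: "x > 0" using x0 that by simp
    have "\<psi> 0 + (\<bar>S\<bar> + 1) * x0 \<le> (1 - x0 / x) * \<psi> 0 + (x0 / x) * \<psi> x"
      using x0 \<psi>_slope[OF x0(1) that] by linarith
    then have "(\<bar>S\<bar> + 1) * x0 \<le> (x0 / x) * (\<psi> x - \<psi> 0)" by (simp add: algebra_simps)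
    then have "(\<bar>S\<bar> + 1) * x * x0 \<le> (\<psi> x - \<psi> 0) * x0" using x by (simp add: field_simps)
    then have "(\<bar>S\<bar> + 1) * x \<le> \<psi> x - \<psi> 0" using x0(1) by (simp only: mult_le_cancel_right_pos)
    then show ?thesis by simp
  qed
  show ?thesis
  proof (intro exI[of _ "max x0 \<bar>\<psi> 0\<bar>"] conjI allI impI)
    show "0 < max x0 \<bar>\<psi> 0\<bar>" using x0 by simp
    fix x assume x: "max x0 \<bar>\<psi> 0\<bar> \<le> x"
    have "S * x \<le> \<bar>S\<bar> * x" using x x0 by (intro mult_right_mono) auto
    moreover have "(\<bar>S\<bar> + 1) * x = \<bar>S\<bar> * x + x" by (simp add: algebra_simps)
    moreover have "x0 \<le> x" "\<bar>\<psi> 0\<bar> \<le> x" using x by simp_all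
    ultimately show "S * x \<le> \<psi> x" using lin[of x] by linarith
  qed
qed

text \<open>Growth of \<open>\<psi>\<close> beyond slope \<open>2 (k + 2)\<close> makes
  \<open>sqrt (yf m)\<close> at most \<open>m^(-k-2)\<close> for large \<open>m\<close>; the
  coefficients of the pole series thus have finite moments of every order.\<close>

lemma summable_power_sqrt: "summable (\<lambda>n. real (Suc n) ^ k * sqrt (yf (real (Suc n))))"
proof -
  obtain X where X: "X > 0" "\<And>x. x \<ge> X \<Longrightarrow> (2 * (real k + 2)) * x \<le> \<psi> x"
    using \<psi>_superlinear[of "2 * (real k + 2)"] by blast
  show ?thesis
  proof (rule summable_comparison_test)
    have "summable (\<lambda>n. 1 / (real (Suc n))\<^sup>2)"
      using inverse_power_summable[of 2, where 'a=real] by (subst summable_Suc_iff) (simp add: field_simps)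
    then show "summable (\<lambda>n. 1 / (real (Suc n))\<^sup>2)" .
    have "norm (real (Suc n) ^ k * sqrt (yf (real (Suc n)))) \<le> 1 / (real (Suc n))\<^sup>2" if n: "n \<ge> nat \<lceil>exp X\<rceil>" for n
    proof -
      define m where "m = real (Suc n)"
      have m: "m > 0" "exp X \<le> m" using n by (auto simp: m_def)
      have "exp X \<le> exp (ln m)" using m by simp
      then have "X \<le> ln m" by (simp only: exp_le_cancel_iff)
      then have "(real k + 2) * ln m \<le> \<psi> (ln m) / 2"
        using X(2)[OF \<open>X \<le> ln m\<close>] by (simp add: algebra_simps)
      have "sqrt (yf m) = exp (- \<psi> (ln m) / 2)"
      proof (rule real_sqrt_unique)
        show "(exp (- \<psi> (ln m) / 2))\<^sup>2 = yf m" using yf_eq[OF m(1)] by (simp add: power2_eq_square flip: exp_add)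
      qed simp
      also have "\<dots> \<le> exp (- (real (k + 2) * ln m))" using \<open>(real k + 2) * ln m \<le> \<psi> (ln m) / 2\<close> by (simp add: algebra_simps)
      also have "\<dots> = 1 / m ^ (k + 2)"
        using m(1) by (simp only: exp_minus exp_of_nat_mult exp_ln inverse_eq_divide)
      finally have "m ^ k * sqrt (yf m) \<le> m ^ k * (1 / m ^ (k + 2))" using m by (intro mult_left_mono) auto
      also have "\<dots> = 1 / m\<^sup>2" using m by (simp add: power_add power2_eq_square)
      finally have "\<bar>m ^ k * sqrt (yf m)\<bar> \<le> 1 / m\<^sup>2" using m yf_pos[of m] by simp
      then show ?thesis by (simp only: m_def real_norm_def)
    qed
    then show "\<exists>N. \<forall>n\<ge>N. norm (real (Suc n) ^ k * sqrt (yf (real (Suc n)))) \<le> 1 / (real (Suc n))\<^sup>2" by blast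
  qed
qed

text \<open>The moment bounds with the best exponent give back the weight: this is Legendre duality for the
  convex function \<open>\<psi>\<close>, up to rounding the exponent to an integer.\<close>

lemma legendre_duality:
  obtains R where "R \<ge> 1" "\<And>r. r \<ge> R \<Longrightarrow>
    \<exists>N::nat. (\<Sum>n. real (Suc n) ^ N * sqrt (yf (real (Suc n)))) \<le> 2 * r ^ N * (yf r) powr (1/4)"
proof -
  \<comment> \<open>Slope 12 pays for the rounding: an exponent lowered by at most 3 costs at most
    \<open>3 x \<le> \<psi> x / 4\<close>, so half of \<open>\<psi> x / 2\<close> survives, which is
    the power \<open>1/4\<close>. Slope \<open>4 + |\<psi> 0|\<close> forces the tangent slope
    \<open>p\<close> to be at least 2.\<close>
  obtain X where X: "X > 0" "\<And>x. x \<ge> X \<Longrightarrow> 12 * x \<le> \<psi> x" using \<psi>_superlinear[of 12] by blast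
  obtain X' where X': "X' > 0" "\<And>x. x \<ge> X' \<Longrightarrow> (4 + \<bar>\<psi> 0\<bar>) * x \<le> \<psi> x" using \<psi>_superlinear[of "4 + \<bar>\<psi> 0\<bar>"] by blast
  define R where "R = exp (max 1 (max X X'))"
  show ?thesis
  proof (rule that[of R])
    show "R \<ge> 1" by (simp add: R_def)
    fix r assume r: "r \<ge> R"
    define x where "x = ln r"
    have rp: "r > 0" using r by (simp add: R_def less_le_trans[OF exp_gt_zero])
    have "exp (max 1 (max X X')) \<le> exp (ln r)" using r rp by (simp add: R_def)
    then have x: "x \<ge> 1" "x \<ge> X" "x \<ge> X'" unfolding exp_le_cancel_iff x_def by auto
    \<comment> \<open>The right-hand slope of \<open>\<psi> / 2\<close> at \<open>x\<close> as an
      infimum of difference quotients; its supporting line bounds all terms of the moment series at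
      once.\<close>
    define p where "p = Inf ((\<lambda>t. (\<psi> x / 2 - \<psi> t / 2) / (x - t)) ` ({x<..} \<inter> UNIV))"
    have conv: "convex_on UNIV (\<lambda>x. \<psi> x / 2)"
    proof -
      have "convex_on UNIV (\<lambda>x. (1/2) * (- ln (yf (exp x))))" by (intro convex_on_cmul yf_convex) auto
      then show ?thesis by (simp add: \<psi>_def)
    qed
    have tangent: "\<psi> t / 2 \<ge> \<psi> x / 2 + p * (t - x)" for t
      unfolding p_def using convex_le_Inf_differential[OF conv, of x t] by simp
    have p2: "p \<ge> 2"
    proof -
      have "4 * x + \<bar>\<psi> 0\<bar> * 1 \<le> (4 + \<bar>\<psi> 0\<bar>) * x" using x(1) unfolding distrib_right
        by (intro add_mono mult_left_mono) auto
      then have "2 * x \<le> \<psi> x / 2 - \<psi> 0 / 2" using X'(2)[OF x(3)] by linarith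
      also have "\<dots> \<le> p * x" using tangent[of 0] by simp
      finally show ?thesis using x(1) by simp
    qed
    \<comment> \<open>Two less than the rounded slope: the spare exponent 2 becomes the summable
      factor \<open>1 / (n + 1)^2\<close>.\<close>
    define N where "N = nat (\<lfloor>p\<rfloor> - 2)"
    have Np: "real N \<le> p - 2" "p - 3 \<le> real N" using p2 unfolding N_def by linarith+
    have trm: "real (Suc n) ^ N * sqrt (yf (real (Suc n))) \<le> (r ^ N * (yf r) powr (1/4)) * (1 / (real (Suc n))\<^sup>2)" for n
    proof -
      define m where "m = real (Suc n)"
      have m: "m \<ge> 1" by (simp add: m_def)
      have lm: "ln m \<ge> 0" using m by simp
      have sq: "sqrt (yf m) = exp (- \<psi> (ln m) / 2)"
      proof (rule real_sqrt_unique)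
        show "(exp (- \<psi> (ln m) / 2))\<^sup>2 = yf m" using yf_eq[of m] m by (simp add: power2_eq_square flip: exp_add)
      qed simp
      have quarter: "(yf r) powr (1/4) = exp (- \<psi> x / 4)"
        using yf_eq[OF rp] by (simp add: x_def powr_def)
      have mN: "m ^ N = exp (real N * ln m)" using m by (simp add: exp_of_nat_mult)
      have rN: "r ^ N = exp (real N * x)" using rp by (simp add: exp_of_nat_mult x_def)
      have m2: "1 / m\<^sup>2 = exp (- (2 * ln m))"
      proof -
        have "exp (2 * ln m) = m\<^sup>2" using m exp_of_nat_mult[of 2 "ln m"] by simp
        then show ?thesis by (simp add: exp_minus inverse_eq_divide)
      qed
      have "real N * ln m - \<psi> (ln m) / 2 \<le> real N * x - \<psi> x / 4 - 2 * ln m"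
      proof -
        have "\<psi> (ln m) / 2 \<ge> \<psi> x / 2 + p * (ln m - x)" by (rule tangent)
        moreover have "(real N + 2) * ln m \<le> p * ln m" using Np lm by (intro mult_right_mono) auto
        moreover have "p * x \<le> (real N + 3) * x" using Np x by (intro mult_right_mono) auto
        moreover have "3 * x \<le> \<psi> x / 4" using X(2)[OF x(2)] by linarith
        ultimately show ?thesis by (simp add: algebra_simps)
      qed
      then have "exp (real N * ln m - \<psi> (ln m) / 2) \<le> exp (real N * x - \<psi> x / 4 - 2 * ln m)" by simp
      then show ?thesis unfolding m_def[symmetric] sq quarter mN rN m2
        by (simp flip: exp_add)
    qed
    have s2: "summable (\<lambda>n. 1 / (real (Suc n))\<^sup>2)"
      using inverse_power_summable[of 2, where 'a=real] by (subst summable_Suc_iff) (simp add: field_simps)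
    have "(\<Sum>n. real (Suc n) ^ N * sqrt (yf (real (Suc n)))) \<le> (\<Sum>n. (r ^ N * (yf r) powr (1/4)) * (1 / (real (Suc n))\<^sup>2))"
      by (rule suminf_le[OF trm summable_power_sqrt summable_mult[OF s2]])
    also have "\<dots> = (r ^ N * (yf r) powr (1/4)) * (\<Sum>n. 1 / (real (Suc n))\<^sup>2)"
      by (rule suminf_mult[OF s2])
    also have "\<dots> \<le> (r ^ N * (yf r) powr (1/4)) * 2"
      using rp by (intro mult_left_mono suminf_le_const[OF s2] sum_inverse_squares_le) auto
    finally show "\<exists>N::nat. (\<Sum>n. real (Suc n) ^ N * sqrt (yf (real (Suc n)))) \<le> 2 * r ^ N * (yf r) powr (1/4)"
      by (intro exI[of _ N]) simp
  qed
qed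

text \<open>The negative logarithm of \<open>yf powr (1/4)\<close> along the image of the imaginary
  axis, where \<open>|z|\<close> is comparable to \<open>s^2\<close> for large \<open>s\<close>.
  \<open>A\<close> is the rescaling of \<open>|z|\<close> in the moment bounds, and the constant
  normalises to \<open>V A 0 = 0\<close>.\<close>

definition V :: "real \<Rightarrow> real \<Rightarrow> real" where
  "V A s = (ln (yf 0) - ln (yf (s\<^sup>2 / A))) / 4"

lemma V_nonneg: "A > 0 \<Longrightarrow> V A s \<ge> 0"
  using yf_anti[of 0 "s\<^sup>2 / A"] yf_pos[of "s\<^sup>2 / A"] by (simp add: V_def ln_mono)

lemma V_mono: "A > 0 \<Longrightarrow> 0 \<le> s \<Longrightarrow> s \<le> t \<Longrightarrow> V A s \<le> V A t"
proof -
  assume A: "A > 0" and st: "0 \<le> s" "s \<le> t"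
  have "s\<^sup>2 / A \<le> t\<^sup>2 / A" using A st by (intro divide_right_mono power_mono) auto
  then have "yf (t\<^sup>2 / A) \<le> yf (s\<^sup>2 / A)" using A by (intro yf_anti) auto
  then have "ln (yf (t\<^sup>2 / A)) \<le> ln (yf (s\<^sup>2 / A))" using yf_pos[of "t\<^sup>2 / A"] A by (intro ln_mono) auto
  then show "V A s \<le> V A t" by (simp add: V_def)
qed

text \<open>The block from \<open>4^j\<close> to \<open>4^(j+1)\<close> has \<open>3 * 4^j\<close>
  members of weight at most \<open>8^(-j)\<close>, so the series over \<open>n\<close> is dominated
  by the dyadic one, shifted by \<open>e + 1\<close> places to absorb the scale
  \<open>A \<le> 4^e\<close>.\<close>

lemma V_divergent:
  assumes A: "A > 0"
  shows "\<not> summable (\<lambda>k. V A (2 ^ k) / 2 ^ k)"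
proof
  assume s: "summable (\<lambda>k. V A (2 ^ k) / 2 ^ k)"
  define u where "u = (\<lambda>n. ln (yf 0) - ln (yf (real n)))"
  have u0: "u n \<ge> 0" for n using yf_anti[of 0 "real n"] yf_pos[of "real n"] by (simp add: u_def ln_mono)
  obtain e :: nat where "A < 4 ^ e" using real_arch_pow[of 4 A] by auto
  then have e: "A \<le> 4 ^ e" by simp
  define f where "f = (\<lambda>n. real n powr (-3/2) * u n)"
  define W where "W = (\<lambda>k. V A (2 ^ (k + (e + 1))) / 2 ^ (k + (e + 1)))"
  have sW: "summable W" unfolding W_def using s by (subst summable_iff_shift)
  have W0: "W k \<ge> 0" for k unfolding W_def using V_nonneg[OF A] by simp
  have blk: "(\<Sum>n\<in>{4 ^ j..<4 ^ Suc j}. f n) \<le> 12 * 2 ^ (e + 1) * W j" for j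
  proof -
    have "(\<Sum>n\<in>{4 ^ j..<4 ^ Suc j}. f n) \<le> real (card {4 ^ j..<(4::nat) ^ Suc j}) * ((1 / 8 ^ j) * (4 * V A (2 ^ (j + (e + 1)))))"
    proof (rule sum_bounded_above)
      fix n :: nat assume n: "n \<in> {4 ^ j..<4 ^ Suc j}"
      then have "4 ^ j \<le> n" "n \<le> 4 ^ Suc j" by (simp_all only: atLeastLessThan_iff less_imp_le)
      then have "real (4 ^ j) \<le> real n" "real n \<le> real (4 ^ Suc j)" by (simp_all only: of_nat_le_iff)
      then have nr: "4 ^ j \<le> real n" "real n \<le> 4 ^ Suc j" by (simp_all only: of_nat_power of_nat_numeral)
      have "real n powr (-3/2) \<le> (4 ^ j) powr (-3/2)" using nr by (intro powr_mono2') auto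
      also have "(4::real) ^ j = (2 ^ j)\<^sup>2" by (simp add: power2_eq_square flip: power_mult_distrib)
      also have "((2 ^ j)\<^sup>2) powr (-3/2) = ((2::real) ^ j) powr (-3)" by (simp add: powr_powr flip: powr_numeral)
      also have "\<dots> = 1 / 8 ^ j"
        by (simp add: powr_minus_divide power3_eq_cube flip: power_mult_distrib)
      finally have 1: "real n powr (-3/2) \<le> 1 / 8 ^ j" .
      have "u n \<le> 4 * V A (2 ^ (j + (e + 1)))"
      proof -
        have "real n \<le> 4 ^ (j + (e + 1)) / A"
        proof -
          have "real n * A \<le> 4 ^ Suc j * 4 ^ e" using nr e A by (intro mult_mono) auto
          also have "\<dots> = 4 ^ (j + (e + 1))" by (simp add: power_add)
          finally show ?thesis using A by (simp add: pos_le_divide_eq)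
        qed
        also have "(4::real) ^ (j + (e + 1)) = (2 ^ (j + (e + 1)))\<^sup>2"
          by (simp add: power2_eq_square flip: power_mult_distrib)
        finally have le: "real n \<le> (2 ^ (j + (e + 1)))\<^sup>2 / A" .
        then have "yf ((2 ^ (j + (e + 1)))\<^sup>2 / A) \<le> yf (real n)" by (intro yf_anti) auto
        then have "ln (yf ((2 ^ (j + (e + 1)))\<^sup>2 / A)) \<le> ln (yf (real n))"
          using le yf_pos[of "(2 ^ (j + (e + 1)))\<^sup>2 / A"] by (intro ln_mono) auto
        then show ?thesis by (simp add: u_def V_def)
      qed
      with 1 show "f n \<le> (1 / 8 ^ j) * (4 * V A (2 ^ (j + (e + 1))))"
        unfolding f_def by (intro mult_mono u0) auto
    qed
    also have "real (card {4 ^ j..<(4::nat) ^ Suc j}) = 3 * 4 ^ j" by simp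
    also have "3 * 4 ^ j * (1 / 8 ^ j * (4 * V A (2 ^ (j + (e + 1))))) = 12 * 2 ^ (e + 1) * W j"
    proof -
      have "(8::real) ^ j = 4 ^ j * 2 ^ j" by (simp flip: power_mult_distrib)
      then show ?thesis by (simp add: W_def power_add)
    qed
    finally show ?thesis .
  qed
  have f0: "f n \<ge> 0" for n by (simp add: f_def u0)
  have "summable f"
  proof (rule summableI_nonneg_bounded[OF f0])
    fix n
    have n4: "n \<le> 4 ^ n" using less_exp[of n] power_mono[of 2 "4::nat" n] by simp
    have "sum f {..<n} \<le> sum f (insert 0 {4 ^ 0..<4 ^ n})"
    proof (rule sum_mono2)
      show "{..<n} \<subseteq> insert 0 {4 ^ 0..<4 ^ n}"
      proof
        fix x assume "x \<in> {..<n}"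
        then have "x < 4 ^ n" using less_le_trans[OF _ n4] by simp
        then show "x \<in> insert 0 {4 ^ 0..<4 ^ n}" by (cases "x = 0") simp_all
      qed
    qed (simp_all add: f0)
    also have "\<dots> = f 0 + sum f {4 ^ 0..<4 ^ n}" by simp
    also have "sum f {4 ^ 0..<4 ^ n} = (\<Sum>j<n. \<Sum>n\<in>{4 ^ j..<4 ^ Suc j}. f n)"
      using sum_consecutive_blocks[of "\<lambda>j. 4 ^ j" f n] by (simp add: mono_def power_increasing)
    also have "\<dots> \<le> (\<Sum>j<n. 12 * 2 ^ (e + 1) * W j)" by (intro sum_mono blk)
    also have "\<dots> = 12 * 2 ^ (e + 1) * (\<Sum>j<n. W j)" by (simp only: sum_distrib_left)
    also have "\<dots> \<le> 12 * 2 ^ (e + 1) * suminf W"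
      by (intro mult_left_mono sum_le_suminf sW) (auto simp: W0)
    finally show "sum f {..<n} \<le> f 0 + 12 * 2 ^ (e + 1) * suminf W" by simp
  qed
  then have "summable (\<lambda>k. f (Suc k))" by (subst summable_Suc_iff)
  moreover have "summable (\<lambda>k. ln (yf 0) * real (Suc k) powr (-3/2))"
  proof -
    have "summable (\<lambda>n. real n powr (-3/2))" by (subst summable_real_powr_iff) simp
    then show ?thesis by (intro summable_mult) (subst summable_Suc_iff)
  qed
  ultimately have "summable (\<lambda>k. f (Suc k) - ln (yf 0) * real (Suc k) powr (-3/2))" by (rule summable_diff)
  moreover have "f (Suc k) - ln (yf 0) * real (Suc k) powr (-3/2) = real (Suc k) powr (-3/2) * ln (1 / yf (real (Suc k)))" for k
    using yf_pos[of "real (Suc k)"] by (simp add: f_def u_def ln_div algebra_simps)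
  ultimately show False using yf_divergent by simp
qed

end

section \<open>The parabolic substitution and the second statement\<close>

context unit_spaced_zeros
begin

text \<open>The image of the half-plane is the outside of a parabola around the positive axis. For
  \<open>|v| \<le> u\<close> it has nonpositive real part, while the poles have real part at least
  1; otherwise its imaginary part has size at least \<open>1 + Y\<close>, while the poles lie at
  depth at most \<open>Y\<close> below the axis. The offset \<open>2 + Y\<close> gives
  \<open>u > 1 + Y\<close>, which the second case uses.\<close>

lemma parabola_dist:
  assumes "Re \<zeta> > -1"
  shows "1 \<le> cmod (- (of_real (2 + Y) + \<zeta>)\<^sup>2 - cnj (a n))"
proof -
  define u where "u = 2 + Y + Re \<zeta>"
  define v where "v = Im \<zeta>"
  have u: "u > 1 + Y" using assms by (simp add: u_def)
  have u0: "u > 0" using u Y_pos by simp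
  define z where "z = - (of_real (2 + Y) + \<zeta>)\<^sup>2"
  have Rez: "Re z = v\<^sup>2 - u\<^sup>2" and Imz: "Im z = - (2 * u * v)"
    by (simp_all add: z_def u_def v_def power2_eq_square algebra_simps)
  show ?thesis
  proof (cases "\<bar>v\<bar> \<le> u")
    case True
    then have "\<bar>v\<bar>\<^sup>2 \<le> u\<^sup>2" by (intro power_mono) auto
    then have "Re z \<le> 0" by (simp add: Rez)
    then have "1 \<le> \<bar>Re (z - cnj (a n))\<bar>" using Re_a[of n] by simp
    then show ?thesis using abs_Re_le_cmod[of "z - cnj (a n)"] by (simp add: z_def)
  next
    case False
    have "(1 + Y) * 1 \<le> u * u" using u Y_pos by (intro mult_mono) auto
    also have "\<dots> \<le> u * \<bar>v\<bar>" using False u0 by (intro mult_left_mono) auto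
    finally have "1 + Y \<le> u * \<bar>v\<bar>" by simp
    moreover have "\<bar>Im z\<bar> = 2 * (u * \<bar>v\<bar>)" using u0 by (simp add: Imz abs_mult)
    ultimately have "1 + Y \<le> \<bar>Im z\<bar>" using Y_pos by linarith
    then have "1 \<le> \<bar>Im (z - cnj (a n))\<bar>" using Im_pos[of n] Im_le[of n] by simp
    then show ?thesis using abs_Im_le_cmod[of "z - cnj (a n)"] by (simp add: z_def)
  qed
qed

lemma pole_series_parabola_holomorphic:
  assumes c: "summable (\<lambda>n. cmod (c n))"
  shows "(\<lambda>\<zeta>. \<Sum>n. c n / (- (of_real (2 + Y) + \<zeta>)\<^sup>2 - cnj (a n))) holomorphic_on {\<zeta>. Re \<zeta> > -1}"
proof (rule holomorphic_uniform_sequence[OF open_halfspace_Re_gt, of "\<lambda>N \<zeta>. \<Sum>n<N. c n / (- (of_real (2 + Y) + \<zeta>)\<^sup>2 - cnj (a n))"])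
  have ne: "- (of_real (2 + Y) + \<zeta>)\<^sup>2 - cnj (a n) \<noteq> 0" if "Re \<zeta> > -1" for \<zeta> n
    using parabola_dist[OF that, of n] by (metis norm_zero not_one_le_zero)
  show "(\<lambda>\<zeta>. \<Sum>n<N. c n / (- (of_real (2 + Y) + \<zeta>)\<^sup>2 - cnj (a n))) holomorphic_on {\<zeta>. -1 < Re \<zeta>}" for N
    by (intro holomorphic_intros) (use ne in auto)
  have unif: "uniform_limit {\<zeta>. Re \<zeta> > -1} (\<lambda>N \<zeta>. \<Sum>n<N. c n / (- (of_real (2 + Y) + \<zeta>)\<^sup>2 - cnj (a n)))
     (\<lambda>\<zeta>. \<Sum>n. c n / (- (of_real (2 + Y) + \<zeta>)\<^sup>2 - cnj (a n))) sequentially"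
  proof (rule Weierstrass_m_test[OF _ c])
    fix n \<zeta> assume "\<zeta> \<in> {\<zeta>. Re \<zeta> > -1}"
    then have "1 \<le> cmod (- (of_real (2 + Y) + \<zeta>)\<^sup>2 - cnj (a n))" by (intro parabola_dist) simp
    then have "cmod (c n) / cmod (- (of_real (2 + Y) + \<zeta>)\<^sup>2 - cnj (a n)) \<le> cmod (c n) / 1"
      by (intro divide_left_mono) (auto intro: mult_pos_pos)
    then show "norm (c n / (- (of_real (2 + Y) + \<zeta>)\<^sup>2 - cnj (a n))) \<le> cmod (c n)"
      unfolding norm_divide by (simp only: div_by_1)
  qed
  fix \<zeta> :: complex assume "\<zeta> \<in> {\<zeta>. -1 < Re \<zeta>}"
  then obtain d where d: "d > 0" "cball \<zeta> d \<subseteq> {\<zeta>. -1 < Re \<zeta>}"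
    using open_contains_cball[THEN iffD1, OF open_halfspace_Re_gt[of "-1"]] by auto
  show "\<exists>d>0. cball \<zeta> d \<subseteq> {\<zeta>. -1 < Re \<zeta>} \<and>
     uniform_limit (cball \<zeta> d) (\<lambda>N \<zeta>. \<Sum>n<N. c n / (- (of_real (2 + Y) + \<zeta>)\<^sup>2 - cnj (a n)))
     (\<lambda>\<zeta>. \<Sum>n. c n / (- (of_real (2 + Y) + \<zeta>)\<^sup>2 - cnj (a n))) sequentially"
    using d uniform_limit_on_subset[OF unif d(2)] by blast
qed

end

lemma not_admissible_of_divergent:
  fixes y :: "nat \<Rightarrow> real" and w yf :: "real \<Rightarrow> real"
  assumes ypos: "\<And>n. n \<ge> 1 \<Longrightarrow> y n > 0" and ydec: "\<And>n. n \<ge> 1 \<Longrightarrow> y (Suc n) \<le> y n"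
    and cw: "convex_weight yf" and yf: "\<And>n. n \<ge> 1 \<Longrightarrow> yf (real n) = y n"
    and small: "\<And>N::real. N > 0 \<Longrightarrow> w \<in> o[at_infinity](\<lambda>t. \<bar>t\<bar> powr (- N))"
  shows "w \<notin> Adm (B1 y)"
proof
  assume "w \<in> Adm (B1 y)"
  define a where "a = (\<lambda>k. Complex (real (Suc k)) (y (Suc k)))"
  define Y where "Y = y 1"
  have B: "B1 y = blaschke a" by (simp add: B1_def a_def)
  obtain f where f: "f \<in> model_space (blaschke a)" "\<exists>z\<in>upper_half. f z \<noteq> 0"
      "AE x in lborel. cmod (hardy_bv f x) \<le> w x"
    using \<open>w \<in> Adm (B1 y)\<close> unfolding B Adm_def mem_Collect_eq by blast
  have "unit_spaced_zeros a Y" unfolding a_def Y_def by (rule unit_spaced_zeros_B1) (fact ypos ydec)+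
  then interpret unit_spaced_zeros a Y .
  interpret convex_weight yf by (rule cw)
  have Ima: "Im (a n) = yf (real (Suc n))" for n using yf[of "Suc n"] by (simp add: a_def)
  have sm: "summable (\<lambda>n. real (Suc n) ^ k * sqrt (Im (a n)))" for k
    unfolding Ima by (rule summable_power_sqrt)
  have sm0: "summable (\<lambda>n. sqrt (Im (a n)))" using sm[of 0] by simp
  obtain c D where D: "D \<ge> 0" and cD: "\<And>n. cmod (c n) \<le> D * sqrt (Im (a n))"
    and fexp: "\<And>w. w \<in> upper_half \<Longrightarrow> f w = (\<Sum>n. c n / (w - cnj (a n)))"
    by (rule model_space_pole_expansion[OF f(1) sm0]) (rule that)
  have smc: "summable (\<lambda>n. cmod (c n))"
    by (rule summable_comparison_test[OF _ summable_mult[OF sm0, of D]]) (use cD in auto)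
  define g where "g = (\<lambda>z. \<Sum>n. c n / (z - cnj (a n)))"
  have be: "AE t in lborel. t < 0 \<longrightarrow> hardy_bv f t = (\<Sum>n. c n / (of_real t - cnj (a n)))"
    by (rule model_space_boundary_expansion[OF f(1) sm0 cD fexp])
  have ae: "AE t in lborel. t < 0 \<longrightarrow> cmod (\<Sum>n. c n / (of_real t - cnj (a n))) \<le> w t"
    using be f(3) by eventually_elim auto
  define A where "A = 1 + Y"
  have A: "A > 0" using Y_pos by (simp add: A_def)
  have bound: "cmod z ^ k * cmod (g z) \<le> D * A ^ k * (\<Sum>n. real (Suc n) ^ k * sqrt (Im (a n)))"
    if "\<And>n. 1 \<le> cmod (z - cnj (a n))" for z k
    unfolding g_def A_def by (rule rapidly_decaying_pole_series[OF cD D sm ae small that])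
  define M0 where "M0 = D * (\<Sum>n. sqrt (Im (a n)))"
  have g_M0: "cmod (g z) \<le> M0" if "\<And>n. 1 \<le> cmod (z - cnj (a n))" for z
    using bound[OF that, of 0] by (simp add: M0_def)
  obtain R where R: "R \<ge> 1" "\<And>r. r \<ge> R \<Longrightarrow>
    \<exists>N::nat. (\<Sum>n. real (Suc n) ^ N * sqrt (yf (real (Suc n)))) \<le> 2 * r ^ N * (yf r) powr (1/4)"
    by (rule legendre_duality) (rule that)
  have g_far: "cmod (g z) \<le> 2 * D * (yf r) powr (1/4)"
    if z: "\<And>n. 1 \<le> cmod (z - cnj (a n))" and r: "r \<ge> R" "cmod z = A * r" for z r
  proof -
    obtain N :: nat where N: "(\<Sum>n. real (Suc n) ^ N * sqrt (yf (real (Suc n)))) \<le> 2 * r ^ N * (yf r) powr (1/4)"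
      using R(2)[OF r(1)] by blast
    have Ar: "(A * r) ^ N > 0" using A r(1) R(1) by simp
    have "(A * r) ^ N * cmod (g z) \<le> D * A ^ N * (\<Sum>n. real (Suc n) ^ N * sqrt (Im (a n)))"
      using bound[OF z, of N] r(2) by simp
    also have "\<dots> \<le> D * A ^ N * (2 * r ^ N * (yf r) powr (1/4))"
      unfolding Ima using D A by (intro mult_left_mono N) auto
    also have "\<dots> = (A * r) ^ N * (2 * D * (yf r) powr (1/4))" by (simp add: power_mult_distrib)
    finally show ?thesis using Ar by (simp only: mult_le_cancel_left_pos)
  qed
  define Z where "Z = (\<lambda>\<zeta>. - (complex_of_real (2 + Y) + \<zeta>)\<^sup>2)"
  define G where "G = (\<lambda>\<zeta>. g (Z \<zeta>))"
  have Zd: "1 \<le> cmod (Z \<zeta> - cnj (a n))" if "Re \<zeta> > -1" for \<zeta> n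
    unfolding Z_def by (rule parabola_dist[OF that])
  have G_hol: "G holomorphic_on {\<zeta>. Re \<zeta> > -1}"
    unfolding G_def g_def Z_def by (rule pole_series_parabola_holomorphic[OF smc])
  have yp: "yf t powr (1/4) > 0" if "t \<ge> 0" for t using yf_pos[OF that] by simp
  \<comment> \<open>One constant for two ranges: \<open>2 D\<close> where the moment bound applies,
    and \<open>M0 / yf R powr (1/4)\<close> for \<open>r < R\<close>, where only the trivial bound
    \<open>M0\<close> is at hand.\<close>
  define q where "q = (2 * D + M0 / yf R powr (1/4) + 1)"
  have M0: "M0 \<ge> 0" unfolding M0_def using D Im_pos by (intro mult_nonneg_nonneg suminf_nonneg sm0) (auto simp: less_imp_le)
  have q: "q > 0" "2 * D \<le> q" "M0 / yf R powr (1/4) \<le> q" using D M0 by (auto simp: q_def add_nonneg_pos)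
  have G_axis: "cmod (G (\<i> * of_real s)) \<le> (q * yf 0 powr (1/4)) * exp (- V A \<bar>s\<bar>)" for s
  proof -
    define r where "r = ((2 + Y)\<^sup>2 + s\<^sup>2) / A"
    have "cmod (Z (\<i> * of_real s)) = (cmod (of_real (2 + Y) + \<i> * of_real s))\<^sup>2"
      by (simp add: Z_def norm_power)
    also have "\<dots> = (2 + Y)\<^sup>2 + s\<^sup>2" by (simp add: cmod_power2)
    finally have Zr: "cmod (Z (\<i> * of_real s)) = A * r" using A by (simp add: r_def)
    have dist: "\<And>n. 1 \<le> cmod (Z (\<i> * of_real s) - cnj (a n))" by (rule Zd) simp
    have sr: "0 \<le> s\<^sup>2 / A" "s\<^sup>2 / A \<le> r" using A unfolding r_def by (auto intro!: divide_right_mono)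
    have "cmod (G (\<i> * of_real s)) \<le> q * yf (s\<^sup>2 / A) powr (1/4)"
    proof (cases "r \<ge> R")
      case True
      have "cmod (G (\<i> * of_real s)) \<le> 2 * D * (yf r) powr (1/4)"
        unfolding G_def by (rule g_far[OF dist True Zr])
      also have "\<dots> \<le> q * yf (s\<^sup>2 / A) powr (1/4)"
        using q sr D yf_anti[OF sr] yf_pos[of r] by (intro mult_mono powr_mono2) auto
      finally show ?thesis .
    next
      case False
      have "cmod (G (\<i> * of_real s)) \<le> M0" unfolding G_def by (rule g_M0[OF dist])
      also have "\<dots> = (M0 / yf R powr (1/4)) * yf R powr (1/4)" using yp[of R] R(1) by simp
      also have "\<dots> \<le> q * yf (s\<^sup>2 / A) powr (1/4)"
        using q sr False yf_anti[of "s\<^sup>2 / A" R] yf_pos[of R] R(1) by (intro mult_mono powr_mono2) auto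
      finally show ?thesis .
    qed
    also have "yf (s\<^sup>2 / A) powr (1/4) = yf 0 powr (1/4) * exp (- V A \<bar>s\<bar>)"
      using yf_pos[of 0] yf_pos[OF sr(1)]
      by (simp add: V_def powr_def diff_divide_distrib flip: exp_add)
    finally show ?thesis by (simp add: mult.assoc)
  qed
  have G0: "G (of_real x) = 0" if "0 < x" "x \<le> 1" for x
  proof (rule halfplane_log_integral_uniqueness[OF G_hol _ _ G_axis _ _ V_divergent[OF A] that])
    show "cmod (G \<zeta>) \<le> M0" if "0 \<le> Re \<zeta>" for \<zeta>
      unfolding G_def by (rule g_M0) (rule Zd, use that in simp)
    show "0 < q * yf 0 powr (1/4)" using q yp[of 0] by simp
  qed (use A V_nonneg V_mono in auto)
  have G_zero: "G \<zeta> = 0" if "Re \<zeta> > -1" for \<zeta>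
  proof (rule analytic_continuation[OF G_hol open_halfspace_Re_gt, of "complex_of_real ` {1/2..1}" 1])
    show "connected {\<zeta>. -1 < Re \<zeta>}" by (intro convex_connected convex_halfspace_Re_gt)
    show "1 islimpt complex_of_real ` {1/2..1}"
    proof (rule connected_imp_perfect)
      show "connected (complex_of_real ` {1/2..1})"
        by (intro connected_continuous_image continuous_intros) auto
      show "1 \<in> complex_of_real ` {1/2..1}" by (rule image_eqI[of _ _ 1]) auto
      have "complex_of_real (1/2) \<in> complex_of_real ` {1/2..1}" "complex_of_real 1 \<in> complex_of_real ` {1/2..1}"
        by (auto simp only: intro!: imageI, auto)
      moreover have "complex_of_real (1/2) \<noteq> complex_of_real 1" by simp
      ultimately show "complex_of_real ` {1/2..1} \<noteq> {x}" for x by (metis singletonD)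
    qed
  qed (use that G0 in auto)
  \<comment> \<open>The image of the segment \<open>t - \<i>\<close>, on which the substitution
    lands in the upper half-plane, where the pole series equals \<open>f\<close>. Zeros along a
    nondegenerate path force \<open>f = 0\<close> there.\<close>
  define P where "P = (\<lambda>t. Z (complex_of_real t - \<i>))"
  have ReP: "Im (P t) = 2 * (2 + Y + t)" for t by (simp add: P_def Z_def power2_eq_square algebra_simps)
  have PU: "P t \<in> upper_half" if "t \<in> {0..1}" for t using that Y_pos by (simp add: upper_half_iff ReP)
  have fP: "f (P t) = 0" if "t \<in> {0..1}" for t
  proof -
    have "f (P t) = G (complex_of_real t - \<i>)" unfolding fexp[OF PU[OF that]] by (simp add: G_def g_def P_def)
    also have "\<dots> = 0" by (rule G_zero) (use that in simp)
    finally show ?thesis .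
  qed
  have "f z = 0" if "z \<in> upper_half" for z
  proof (rule analytic_continuation[of f upper_half "P ` {0..1}" "P 0"])
    show "f holomorphic_on upper_half" using f(1) by (simp add: model_space_def hardy2_holomorphic)
    show "connected upper_half" by (rule convex_connected[OF convex_upper_half])
    show "P 0 islimpt P ` {0..1}"
    proof (rule connected_imp_perfect)
      show "connected (P ` {0..1})" unfolding P_def Z_def
        by (intro connected_continuous_image continuous_intros) auto
      have "P 0 \<in> P ` {0..1}" "P 1 \<in> P ` {0..1}" by auto
      moreover have "P 0 \<noteq> P 1" using ReP[of 0] ReP[of 1] by auto
      ultimately show "P ` {0..1} \<noteq> {x}" for x by (metis singletonD)
    qed auto
  qed (use that fP PU open_upper_half in auto)
  then show False using f(2) by blast
qed

theorem theorem6p1: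
  fixes y :: "nat \<Rightarrow> real"
  assumes ypos: "\<And>n. n \<ge> 1 \<Longrightarrow> y n > 0"
    and ydec: "\<And>n. n \<ge> 1 \<Longrightarrow> y (Suc n) \<le> y n"
  shows
    "(summable (\<lambda>k. real (Suc k) powr (-3/2) * ln (1 / y (Suc k))) \<longrightarrow>
       (\<forall>w :: real \<Rightarrow> real.
          (\<forall>t. w t > 0) \<and> (\<forall>t. w (- t) = w t) \<and>
          (\<forall>s t. 0 \<le> s \<longrightarrow> s \<le> t \<longrightarrow> w t \<le> w s) \<and>
          set_integrable lborel {1..} (\<lambda>t. t powr (-3/2) * ln (1 / w t))
          \<longrightarrow> w \<in> Adm (B1 y)))
     \<and>
     (\<forall>yf :: real \<Rightarrow> real.
        (\<forall>t\<ge>0. yf t > 0) \<and>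
        (\<forall>s t. 0 \<le> s \<longrightarrow> s \<le> t \<longrightarrow> yf t \<le> yf s) \<and>
        (\<forall>n\<ge>1. yf (real n) = y n) \<and>
        convex_on UNIV (\<lambda>x. - ln (yf (exp x))) \<and>
        \<not> summable (\<lambda>k. real (Suc k) powr (-3/2) * ln (1 / y (Suc k)))
        \<longrightarrow> (\<forall>w :: real \<Rightarrow> real.
               (\<forall>t. w t \<ge> 0) \<and>
               (\<forall>N>0. w \<in> o[at_infinity](\<lambda>t. \<bar>t\<bar> powr (- N)))
               \<longrightarrow> w \<notin> Adm (B1 y)))"
proof (intro conjI impI allI)
  fix w :: "real \<Rightarrow> real"
  assume "summable (\<lambda>k. real (Suc k) powr (-3/2) * ln (1 / y (Suc k)))"
    and "(\<forall>t. w t > 0) \<and> (\<forall>t. w (- t) = w t) \<and>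
          (\<forall>s t. 0 \<le> s \<longrightarrow> s \<le> t \<longrightarrow> w t \<le> w s) \<and>
          set_integrable lborel {1..} (\<lambda>t. t powr (-3/2) * ln (1 / w t))"
  then show "w \<in> Adm (B1 y)"
    by (intro admissible_of_summable) (auto intro: ypos ydec)
next
  fix yf w :: "real \<Rightarrow> real"
  assume yf: "(\<forall>t\<ge>0. yf t > 0) \<and>
        (\<forall>s t. 0 \<le> s \<longrightarrow> s \<le> t \<longrightarrow> yf t \<le> yf s) \<and>
        (\<forall>n\<ge>1. yf (real n) = y n) \<and>
        convex_on UNIV (\<lambda>x. - ln (yf (exp x))) \<and>
        \<not> summable (\<lambda>k. real (Suc k) powr (-3/2) * ln (1 / y (Suc k)))"
    and w: "(\<forall>t. w t \<ge> 0) \<and> (\<forall>N>0. w \<in> o[at_infinity](\<lambda>t. \<bar>t\<bar> powr (- N)))"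
  have eq: "yf (real (Suc k)) = y (Suc k)" for k using yf by auto
  have "convex_weight yf"
    by unfold_locales (use yf in \<open>simp_all only: eq, auto\<close>)
  then show "w \<notin> Adm (B1 y)"
    by (rule not_admissible_of_divergent[rotated 2]) (use yf w ypos ydec in auto)
qed

end
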